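(* Let $M=M(N)$ be an integer function with $M=\mathrm{poly}(N)$ and $M=\omega(N^5)$, and let $x\in[0,1)$ be a constant (so that the overall circuit noise rate $1-x\in(0,1]$ is constant). Consider $M$-mode Fock-state Boson Sampling with $N$ single photons and a linear-optical circuit given by a Haar-random unitary $U\in U(M)$, subject to Gaussian circuit noise of rate $1-x$, and let $\tilde p(U,\cdot)$ be the resulting noisy output distribution on the collision-free outcomes together with the single lumped collision outcome $c$. Then there is a classical randomized algorithm which, for all sufficiently large $N$ and all $\epsilon,\delta\in(0,1)$, given $U$, $x$, $\epsilon$, $\delta$, runs in time $$N^{O(\log N+\log \epsilon^{-1}+\log\delta^{-1})}$$ (the implied constant may depend on the constant $x$ and on the choice of the function $M(\cdot)$) and such that, for a set of unitaries $U$ of Haar measure at least $1-\delta$, the output of the algorithm is distributed according to a probability distribution $q(U,\cdot)$ satisfying $$\|\tilde p(U,\cdot)-q(U,\cdot)\|_1\le\epsilon .$$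
   Context: Setting. $N$ single photons are injected in the first $N$ of $M$ modes of a linear-optical circuit described by an $M\times M$ unitary matrix $U$. A collision-free outcome is a vector $\bm z=(z_1,\dots,z_N)$ with $1\le z_1<z_2<\dots<z_N\le M$ (the output modes in which exactly one photon is detected); $cf$ denotes the set of all $\binom MN$ collision-free outcomes. For an $M\times M$ matrix $A$, $A_{N,\bm z}$ denotes the $N\times N$ submatrix formed by the first $N$ rows and the columns $z_1,\dots,z_N$. The noiseless probability of $\bm z\in cf$ is $p(U,\bm z)=|\mathrm{Per}(U_{N,\bm z})|^2$, where $\mathrm{Per}$ is the matrix permanent. Gaussian circuit noise of rate $1-x$, $x\in[0,1]$. The matrix $U$ is replaced by $\sqrt{x}\,U+\sqrt{1-x}\,Y$, where $Y$ is an $M\times M$ random matrix with i.i.d. circularly-symmetric complex Gaussian entries of mean $0$ and variance $\mathbb E|Y_{ij}|^2=1/M$, and one averages over $Y$. The noisy probabilities are $$\tilde p(U,\bm z)=\mathbb E_Y\Big[\big|\mathrm{Per}\big((\sqrt{x}\,U+\sqrt{1-x}\,Y)_{N,\bm z}\big)\big|^2\Big]\quad(\bm z\in cf).$$ All outcomes with collisions are identified with a single outcome $c$, with $\tilde p(U,c)=1-\sum_{\bm z\in cf}\tilde p(U,\bm z)$; for every unitary $U$ this quantity is nonnegative, so $\tilde p(U,\cdot)$ is a probability distribution on $cf\cup\{c\}$. Distance. The total variation distance is taken in the convention $\|p-q\|_1=\sum_{\bm z\in cf\cup\{c\}}|p(\bm z)-q(\bm z)|$ (no factor $1/2$). Running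 time. Running time counts elementary arithmetic operations (exact arithmetic on the entries of $U$) and elementary random choices (sampling from an explicitly given finite distribution). $M=\omega(N^5)$ means $M(N)/N^5\to\infty$ as $N\to\infty$. *)

theory Defs
  imports
    "HOL-Probability.Probability"
    "HOL-Library.Landau_Symbols"
    "Jordan_Normal_Form.Schur_Decomposition"
begin

section \<open>Haar measure on the unitary group\<close>

definition unitary_group :: "nat \<Rightarrow> complex mat set" where
  "unitary_group n =
     {U \<in> carrier_mat n n. U * mat_adjoint U = 1\<^sub>m n \<and> mat_adjoint U * U = 1\<^sub>m n}"

text \<open>The type of matrices carries no topology; the Borel sets of \<open>n \<times> m\<close> matrices are those
  generated by the entries.\<close>

definition borel_mat :: "nat \<Rightarrow> nat \<Rightarrow> complex mat measure" where
  "borel_mat n m =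
     vimage_algebra (carrier_mat n m) (\<lambda>A. \<lambda>ij\<in>{..<n} \<times> {..<m}. A $$ ij)
       (PiM ({..<n} \<times> {..<m}) (\<lambda>_. borel))"

text \<open>These conditions determine \<open>\<mu>\<close> uniquely: it is the normalised Haar measure of the compact
  group \<open>U(n)\<close>.\<close>

definition haar_measure :: "nat \<Rightarrow> complex mat measure \<Rightarrow> bool" where
  "haar_measure n \<mu> \<longleftrightarrow>
     prob_space \<mu> \<and>
     sets \<mu> = sets (restrict_space (borel_mat n n) (unitary_group n)) \<and>
     (\<forall>V\<in>unitary_group n. distr \<mu> \<mu> (\<lambda>U. V * U) = \<mu> \<and> distr \<mu> \<mu> (\<lambda>U. U * V) = \<mu>)"

section \<open>Noisy Fock-state Boson Sampling\<close>

definition permanent :: "'a mat \<Rightarrow> 'a :: comm_ring_1" where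
  "permanent A = (if dim_row A = dim_col A then
     (\<Sum>p\<in>{p. p permutes {0..<dim_row A}}. \<Prod>i = 0..<dim_row A. A $$ (i, p i)) else 0)"

text \<open>Circularly symmetric of mean 0, with \<open>v\<close> the expected squared modulus: the real and the
  imaginary part each have variance \<open>v / 2\<close>. The third argument below is a standard deviation.\<close>

definition complex_gaussian :: "real \<Rightarrow> complex measure" where
  "complex_gaussian v =
     (let g = density lborel (normal_density 0 (sqrt (v / 2)))
      in distr (g \<Otimes>\<^sub>M g) borel (\<lambda>(a, b). Complex a b))"

definition gaussian_entries :: "nat \<Rightarrow> (nat \<times> nat \<Rightarrow> complex) measure" where
  "gaussian_entries m = PiM ({..<m} \<times> {..<m}) (\<lambda>_. complex_gaussian (1 / real m))"

datatype outcome = Clicks "nat list" | Collision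

text \<open>Modes are numbered from 0, as are the rows and columns of \<^typ>\<open>complex mat\<close>.\<close>

definition collision_free :: "nat \<Rightarrow> nat \<Rightarrow> nat list set" where
  "collision_free n m = {z. length z = n \<and> sorted_wrt (<) z \<and> set z \<subseteq> {..<m}}"

definition outcomes :: "nat \<Rightarrow> nat \<Rightarrow> outcome set" where
  "outcomes n m = insert Collision (Clicks ` collision_free n m)"

definition output_submatrix :: "nat \<Rightarrow> 'a mat \<Rightarrow> nat list \<Rightarrow> 'a mat" where
  "output_submatrix n A z = mat n n (\<lambda>(i, j). A $$ (i, z ! j))"

definition noisy_matrix ::
  "nat \<Rightarrow> real \<Rightarrow> complex mat \<Rightarrow> (nat \<times> nat \<Rightarrow> complex) \<Rightarrow> complex mat" where
  "noisy_matrix m x U y =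
     complex_of_real (sqrt x) \<cdot>\<^sub>m U + complex_of_real (sqrt (1 - x)) \<cdot>\<^sub>m mat m m y"

definition noisy_click_prob :: "nat \<Rightarrow> nat \<Rightarrow> real \<Rightarrow> complex mat \<Rightarrow> nat list \<Rightarrow> real" where
  "noisy_click_prob n m x U z =
     (\<integral>y. (cmod (permanent (output_submatrix n (noisy_matrix m x U y) z)))\<^sup>2
       \<partial>gaussian_entries m)"

fun noisy_prob :: "nat \<Rightarrow> nat \<Rightarrow> real \<Rightarrow> complex mat \<Rightarrow> outcome \<Rightarrow> real" where
  "noisy_prob n m x U (Clicks z) = noisy_click_prob n m x U z"
| "noisy_prob n m x U Collision = 1 - (\<Sum>z\<in>collision_free n m. noisy_click_prob n m x U z)"

definition total_variation :: "'a set \<Rightarrow> ('a \<Rightarrow> real) \<Rightarrow> ('a \<Rightarrow> real) \<Rightarrow> real" where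
  "total_variation S p q = (\<Sum>z\<in>S. \<bar>p z - q z\<bar>)"

section \<open>Randomised algorithms over exact complex arithmetic\<close>

text \<open>A randomised algorithm is a finite while-program for a random access machine with two
  infinite register files: one of natural numbers (counters and addresses) and one of complex
  numbers, the latter handled by exact field operations. All operands are register numbers;
  \<open>Load\<close> and \<open>Store\<close> instructions address indirectly through a natural-number register. The input
  matrix is read-only. No literal is available other than natural numbers, and there is no
  conversion from complex to natural numbers, so comparisons and random choices are the only way
  in which complex values influence the control flow.\<close>

datatype nat_op = NPlus | NMonus | NTimes

datatype cpx_op = CPlus | CMinus | CTimes | CDivide

datatype cpx_unop = CRe | CIm

datatype test = NLess nat nat | CReLess nat nat

datatype com =
    NConst nat nat              \<comment> \<open>target, literal\<close>
  | NOp nat_op nat nat nat      \<comment> \<open>target, operands\<close>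
  | NLoad nat nat               \<comment> \<open>target, address\<close>
  | NStore nat nat              \<comment> \<open>address, source\<close>
  | COfNat nat nat              \<comment> \<open>complex target, natural-number source\<close>
  | COp cpx_op nat nat nat      \<comment> \<open>target, operands\<close>
  | CUnop cpx_unop nat nat      \<comment> \<open>target, operand\<close>
  | CLoad nat nat               \<comment> \<open>target, address\<close>
  | CStore nat nat              \<comment> \<open>address, source\<close>
  | Entry nat nat nat           \<comment> \<open>complex target, row, column\<close>
  | Sample nat nat nat          \<comment> \<open>natural-number target, address of first weight, number of weights\<close>
  | Seq com com
  | Branch test com com
  | While test com

record state =
  nreg :: "nat \<Rightarrow> nat"
  creg :: "nat \<Rightarrow> complex"

fun apply_nat_op :: "nat_op \<Rightarrow> nat \<Rightarrow> nat \<Rightarrow> nat" where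
  "apply_nat_op NPlus a b = a + b"
| "apply_nat_op NMonus a b = a - b"
| "apply_nat_op NTimes a b = a * b"

fun apply_cpx_op :: "cpx_op \<Rightarrow> complex \<Rightarrow> complex \<Rightarrow> complex" where
  "apply_cpx_op CPlus a b = a + b"
| "apply_cpx_op CMinus a b = a - b"
| "apply_cpx_op CTimes a b = a * b"
| "apply_cpx_op CDivide a b = a / b"

fun apply_cpx_unop :: "cpx_unop \<Rightarrow> complex \<Rightarrow> complex" where
  "apply_cpx_unop CRe a = complex_of_real (Re a)"
| "apply_cpx_unop CIm a = complex_of_real (Im a)"

fun holds :: "test \<Rightarrow> state \<Rightarrow> bool" where
  "holds (NLess a b) s \<longleftrightarrow> nreg s a < nreg s b"
| "holds (CReLess a b) s \<longleftrightarrow> Re (creg s a) < Re (creg s b)"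

definition set_nreg :: "nat \<Rightarrow> nat \<Rightarrow> state \<Rightarrow> state" where
  "set_nreg r v s = s\<lparr>nreg := (nreg s)(r := v)\<rparr>"

definition set_creg :: "nat \<Rightarrow> complex \<Rightarrow> state \<Rightarrow> state" where
  "set_creg r v s = s\<lparr>creg := (creg s)(r := v)\<rparr>"

text \<open>The index \<open>i < k\<close> is drawn with probability the weight in register \<open>a + i\<close>. Weights that do
  not form a probability distribution yield the index 0.\<close>

definition draw :: "(nat \<Rightarrow> complex) \<Rightarrow> nat \<Rightarrow> nat \<Rightarrow> nat pmf" where
  "draw w a k =
     (let ws = map (\<lambda>i. (i, Re (w (a + i)))) [0..<k]
      in if pmf_of_list_wf ws then pmf_of_list ws else return_pmf 0)"

text \<open>A configuration consists of the commands still to be executed and the current state; it is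
  final when no command is left. Every step performs at most one arithmetic operation, comparison,
  memory access or random choice, and running time is the number of steps.\<close>

type_synonym config = "com list \<times> state"

fun step :: "complex mat \<Rightarrow> config \<Rightarrow> config pmf" where
  "step U ([], s) = return_pmf ([], s)"
| "step U (NConst r k # cs, s) = return_pmf (cs, set_nreg r k s)"
| "step U (NOp f r a b # cs, s) = return_pmf (cs, set_nreg r (apply_nat_op f (nreg s a) (nreg s b)) s)"
| "step U (NLoad r a # cs, s) = return_pmf (cs, set_nreg r (nreg s (nreg s a)) s)"
| "step U (NStore a r # cs, s) = return_pmf (cs, set_nreg (nreg s a) (nreg s r) s)"
| "step U (COfNat r a # cs, s) = return_pmf (cs, set_creg r (of_nat (nreg s a)) s)"
| "step U (COp f r a b # cs, s) = return_pmf (cs, set_creg r (apply_cpx_op f (creg s a) (creg s b)) s)"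
| "step U (CUnop f r a # cs, s) = return_pmf (cs, set_creg r (apply_cpx_unop f (creg s a)) s)"
| "step U (CLoad r a # cs, s) = return_pmf (cs, set_creg r (creg s (nreg s a)) s)"
| "step U (CStore a r # cs, s) = return_pmf (cs, set_creg (nreg s a) (creg s r) s)"
| "step U (Entry r a b # cs, s) =
     return_pmf (cs, set_creg r
       (if nreg s a < dim_row U \<and> nreg s b < dim_col U then U $$ (nreg s a, nreg s b) else 0) s)"
| "step U (Sample r a k # cs, s) =
     map_pmf (\<lambda>i. (cs, set_nreg r i s)) (draw (creg s) (nreg s a) (nreg s k))"
| "step U (Seq c d # cs, s) = return_pmf (c # d # cs, s)"
| "step U (Branch b c d # cs, s) = return_pmf ((if holds b s then c else d) # cs, s)"
| "step U (While b c # cs, s) = return_pmf (if holds b s then c # While b c # cs else cs, s)"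

primrec run :: "complex mat \<Rightarrow> nat \<Rightarrow> config \<Rightarrow> config pmf" where
  "run U 0 k = return_pmf k"
| "run U (Suc t) k = bind_pmf (step U k) (run U t)"

definition initial_state :: "nat \<Rightarrow> nat \<Rightarrow> real \<Rightarrow> real \<Rightarrow> real \<Rightarrow> state" where
  "initial_state n m x \<epsilon> \<delta> =
     \<lparr>nreg = (\<lambda>_. 0)(0 := n, 1 := m),
      creg = (\<lambda>_. 0)(0 := complex_of_real x, 1 := complex_of_real \<epsilon>, 2 := complex_of_real \<delta>)\<rparr>"

text \<open>Natural-number register 0 holds 0 to announce a collision; otherwise registers \<open>1, \<dots>, n\<close>
  hold the output modes.\<close>

definition read_output :: "nat \<Rightarrow> state \<Rightarrow> outcome" where
  "read_output n s = (if nreg s 0 = 0 then Collision else Clicks (map (nreg s) [1..<n + 1]))"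

definition sampler ::
  "com \<Rightarrow> nat \<Rightarrow> nat \<Rightarrow> complex mat \<Rightarrow> real \<Rightarrow> real \<Rightarrow> real \<Rightarrow> nat \<Rightarrow> outcome pmf \<Rightarrow> bool" where
  "sampler P n m U x \<epsilon> \<delta> t q \<longleftrightarrow>
     (let K = run U t ([P], initial_state n m x \<epsilon> \<delta>)
      in (\<forall>k\<in>set_pmf K. fst k = []) \<and> q = map_pmf (\<lambda>k. read_output n (snd k)) K)"

end

theory Submission
  imports
    Defs
    "HOL-Combinatorics.Permutations"
    "HOL-Real_Asymp.Real_Asymp"
begin

text \<open>Averaging over the Gaussian noise turns a noisy probability into
  \<open>\<Sum>\<^sub>j x ^ j c\<^sub>j\<close>, where the homogeneous chaos \<open>c\<^sub>j\<close> collects the terms in which \<open>j\<close> rows of \<open>U\<close>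
  enter through \<open>U\<^sub>i\<^sub>p U\<^sub>i\<^sub>q\<^sup>* - [p = q] / M\<close>. If \<open>U\<close> were Gaussian, the \<open>c\<^sub>j\<close> would have second moment
  \<open>(N! / M ^ N)\<^sup>2\<close>. For Haar measure the rows are exchanged one at a time for independent Gaussian-like
  rows: mixing row \<open>i\<close> with all later rows by a random unitary leaves the measure invariant, and as
  long as the entries of the first rows are at most \<open>N powr (- 3 / 2)\<close>, each exchange costs a factor
  \<open>1 + O(1 / N)\<close>. Since \<open>M\<close> exceeds \<open>N ^ 5\<close>, the entries are that small with overwhelming probability.
  Hence truncation at \<open>j \<le> K = O(log (1 / (\<epsilon> \<delta>)))\<close> has total error \<open>\<epsilon>\<close> with probability
  \<open>1 - \<delta>\<close>.

  The truncated expansion need not be nonnegative, but its sums over all outcomes with a prescribed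
  pattern in the first modes are again polynomial sums with \<open>M ^ O(K)\<close> terms, so an outcome can be
  drawn mode by mode, negative weights being cut off. The error made by cutting off telescopes along
  the decision tree and is bounded by the truncation error.\<close>

section \<open>Executing programs\<close>

text \<open>Invariance is applied to finitely many mixings at once: for each fixed \<open>U\<close>
  the mixed row is averaged over fourth roots of unity, and the comparison with the Gaussian row is
  a finite identity for quadratic forms, so no integral over matrix entries has to be computed. The
  Gaussian row only needs the right moments of degree at most two in the variable and in its
  conjugate, and an eight-valued variable has them. The size \<open>N powr (- 3 / 2)\<close> is what
  one exchange tolerates: \<open>N\<close> entries of squared modulus \<open>1 / N ^ 3\<close> add
  up to \<open>1 / N ^ 2\<close> per row, and fewer than \<open>N\<close> earlier rows are missing
  from the mixture. The \<open>N\<close> factors \<open>1 + 15 / N\<close> stay below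
  \<open>exp 15\<close>. The obstacle is that \<open>\<delta>\<close> is arbitrary and may be
  smaller than the probability of a large entry. Then the order demanded by the program reaches
  \<open>N\<close>, nothing is truncated, and the sampler is exact for every \<open>U\<close>.
  Otherwise \<open>\<delta>\<close> is at least \<open>((1 + x) / 2) ^ N\<close>, which dominates
  the probability of a large entry, at most a polynomial times
  \<open>exp (- (N ^ 2))\<close>.\<close>

lemma run_add: "run U (a + b) k = bind_pmf (run U a k) (run U b)"
proof (induction a arbitrary: k)
  case (Suc a)
  have "run U (a + b) = (\<lambda>k. bind_pmf (run U a k) (run U b))"
    by (rule ext) (rule Suc)
  then show ?case by (simp add: bind_assoc_pmf)
qed (simp add: bind_return_pmf)

lemma run_nil: "run U t ([], s) = return_pmf ([], s)"
  by (induction t) (auto simp: bind_return_pmf)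

text \<open>The step count is fixed before the continuation \<open>cs\<close>, so a fact about one
  command holds under every stack of pending commands. Since \<open>t\<close> is only a bound,
  branches of different length can be compared.\<close>

definition exec :: "complex mat => com => state => nat => state => bool" where
  "exec U c s t s' \<longleftrightarrow> (\<exists>t'\<le>t. \<forall>cs. run U t' (c # cs, s) = return_pmf (cs, s'))"

lemma exec_mono: "exec U c s t s' ==> t \<le> t' ==> exec U c s t' s'"
  unfolding exec_def by (meson le_trans)

lemma exec_1: "(\<And>cs. step U (c # cs, s) = return_pmf (cs, s')) ==> exec U c s 1 s'"
  unfolding exec_def by (intro exI[of _ 1]) (simp add: bind_return_pmf)

lemma exec_simple:
  "exec U (NConst r k) s 1 (set_nreg r k s)"
  "exec U (NOp f r a b) s 1 (set_nreg r (apply_nat_op f (nreg s a) (nreg s b)) s)"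
  "exec U (NLoad r a) s 1 (set_nreg r (nreg s (nreg s a)) s)"
  "exec U (NStore a r) s 1 (set_nreg (nreg s a) (nreg s r) s)"
  "exec U (COfNat r a) s 1 (set_creg r (of_nat (nreg s a)) s)"
  "exec U (COp g r a b) s 1 (set_creg r (apply_cpx_op g (creg s a) (creg s b)) s)"
  "exec U (CUnop h r a) s 1 (set_creg r (apply_cpx_unop h (creg s a)) s)"
  "exec U (Entry r a b) s 1 (set_creg r
     (if nreg s a < dim_row U \<and> nreg s b < dim_col U then U $$ (nreg s a, nreg s b) else 0) s)"
  by (rule exec_1, simp)+

lemma exec_Seq:
  assumes "exec U c s t1 s1" "exec U d s1 t2 s2"
  shows "exec U (Seq c d) s (t1 + t2 + 1) s2"
proof -
  obtain a b where ab: "a \<le> t1" "b \<le> t2"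
    "\<And>cs. run U a (c # cs, s) = return_pmf (cs, s1)" "\<And>cs. run U b (d # cs, s1) = return_pmf (cs, s2)"
    using assms unfolding exec_def by blast
  have "run U (Suc (a + b)) (Seq c d # cs, s) = return_pmf (cs, s2)" for cs
    by (simp add: bind_return_pmf run_add ab)
  then show ?thesis
    unfolding exec_def using ab by (intro exI[of _ "Suc (a + b)"]) auto
qed

lemma exec_Branch:
  assumes "exec U (if holds b s then c else d) s t s'"
  shows "exec U (Branch b c d) s (t + 1) s'"
proof -
  obtain a where a: "a \<le> t" "\<And>cs. run U a ((if holds b s then c else d) # cs, s) = return_pmf (cs, s')"
    using assms unfolding exec_def by blast
  then show ?thesis
    unfolding exec_def by (intro exI[of _ "Suc a"]) (auto simp: bind_return_pmf)
qed

lemma exec_While_stop: "\<not> holds b s ==> exec U (While b c) s 1 s"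
  by (rule exec_1) simp

lemma exec_While_step:
  assumes "holds b s" "exec U c s t1 s1" "exec U (While b c) s1 t2 s2"
  shows "exec U (While b c) s (t1 + t2 + 1) s2"
proof -
  obtain a a' where ab: "a \<le> t1" "a' \<le> t2"
    "\<And>cs. run U a (c # cs, s) = return_pmf (cs, s1)"
    "\<And>cs. run U a' (While b c # cs, s1) = return_pmf (cs, s2)"
    using assms unfolding exec_def by blast
  have "run U (Suc (a + a')) (While b c # cs, s) = return_pmf (cs, s2)" for cs
    using assms(1) by (simp add: bind_return_pmf run_add ab)
  then show ?thesis
    unfolding exec_def using ab by (intro exI[of _ "Suc (a + a')"]) auto
qed

text \<open>Bounds the number of steps until the program stops, with the distribution of the final state.\<close>

definition reach :: "complex mat => config => nat => state pmf => bool" where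
  "reach U k t D \<longleftrightarrow> run U t k = map_pmf (\<lambda>s. ([], s)) D"

lemma reach_nil: "reach U ([], s) t (return_pmf s)"
  by (simp add: reach_def run_nil)

text \<open>A configuration without commands is a fixed point of \<open>step\<close>, so surplus
  steps do no harm.\<close>

lemma reach_mono:
  assumes "reach U k t D" "t \<le> t'" shows "reach U k t' D"
proof -
  have "run U (t + (t' - t)) k = map_pmf (\<lambda>s. ([], s)) D"
    using assms(1) unfolding run_add reach_def by (simp add: bind_map_pmf run_nil) (simp add: map_pmf_def)
  with assms(2) show ?thesis by (simp add: reach_def)
qed

lemma reach_exec:
  assumes "exec U c s t1 s1" "reach U (cs, s1) t2 D"
  shows "reach U (c # cs, s) (t1 + t2) D"
proof -
  obtain a where a: "a \<le> t1" "run U a (c # cs, s) = return_pmf (cs, s1)"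
    using assms(1) unfolding exec_def by blast
  have "reach U (c # cs, s) (a + t2) D"
    using assms(2) unfolding reach_def by (simp add: run_add a bind_return_pmf)
  then show ?thesis by (rule reach_mono) (use a in simp)
qed

lemma reach_Seq: "reach U (c # d # cs, s) t D ==> reach U (Seq c d # cs, s) (Suc t) D"
  by (simp add: reach_def bind_return_pmf)

lemma reach_While:
  "reach U (if holds b s then c # While b c # cs else cs, s) t D ==>
   reach U (While b c # cs, s) (Suc t) D"
  by (simp add: reach_def bind_return_pmf)

section \<open>Compiling arithmetic expressions\<close>

text \<open>Everything the sampler computes is built from sums and products over bounded ranges,
  hence an expression language with folds: one structural induction then yields values, untouched
  registers and running time at once. \<open>NArr\<close> reads the list of clicks, which is stored
  data of growing length.\<close>

datatype nexp = NVar nat | NLit nat | NBin nat_op nexp nexp | NArr nexp | NFold nat_op nat nexp nexp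

datatype cexp = CVar nat | COf nexp | CBin cpx_op cexp cexp | CUn cpx_unop cexp
  | CEntry nexp nexp | CFold cpx_op nat nexp cexp

fun nunit :: "nat_op => nat" where "nunit NTimes = 1" | "nunit _ = 0"
fun cunit :: "cpx_op => nat" where "cunit CTimes = 1" | "cunit CDivide = 1" | "cunit _ = 0"

primrec iter_op :: "('a => 'a => 'a) => 'a => nat => (nat => 'a) => 'a" where
  "iter_op f u 0 g = u"
| "iter_op f u (Suc n) g = f (iter_op f u n g) (g n)"

lemma iter_op_sum_nat: "iter_op (apply_nat_op NPlus) 0 n g = (\<Sum>i<n. g i)"
  by (induction n) auto

lemma iter_op_prod_nat: "iter_op (apply_nat_op NTimes) 1 n g = (\<Prod>i<n. g i)"
  by (induction n) (auto simp: mult.commute)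

lemma iter_op_sum_cpx: "iter_op (apply_cpx_op CPlus) 0 n g = (\<Sum>i<n. g i)"
  by (induction n) auto

lemma iter_op_prod_cpx: "iter_op (apply_cpx_op CTimes) 1 n g = (\<Prod>i<n. g i)"
  by (induction n) (auto simp: mult.commute)

fun neval :: "(nat => nat) => (nat => nat) => nexp => nat" where
  "neval A \<rho> (NVar r) = \<rho> r"
| "neval A \<rho> (NLit k) = k"
| "neval A \<rho> (NBin f a b) = apply_nat_op f (neval A \<rho> a) (neval A \<rho> b)"
| "neval A \<rho> (NArr a) = A (neval A \<rho> a)"
| "neval A \<rho> (NFold f v n b) =
     iter_op (apply_nat_op f) (nunit f) (neval A \<rho> n) (\<lambda>i. neval A (\<rho>(v := i)) b)"

definition entry :: "complex mat => nat => nat => complex" where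
  "entry U i j = (if i < dim_row U \<and> j < dim_col U then U $$ (i, j) else 0)"

fun ceval :: "complex mat => (nat => nat) => (nat => complex) => (nat => nat) => cexp => complex" where
  "ceval U A \<gamma> \<rho> (CVar r) = \<gamma> r"
| "ceval U A \<gamma> \<rho> (COf a) = of_nat (neval A \<rho> a)"
| "ceval U A \<gamma> \<rho> (CBin f a b) = apply_cpx_op f (ceval U A \<gamma> \<rho> a) (ceval U A \<gamma> \<rho> b)"
| "ceval U A \<gamma> \<rho> (CUn f a) = apply_cpx_unop f (ceval U A \<gamma> \<rho> a)"
| "ceval U A \<gamma> \<rho> (CEntry a b) = entry U (neval A \<rho> a) (neval A \<rho> b)"
| "ceval U A \<gamma> \<rho> (CFold f v n b) =
     iter_op (apply_cpx_op f) (of_nat (cunit f)) (neval A \<rho> n) (\<lambda>i. ceval U A \<gamma> (\<rho>(v := i)) b)"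

fun nbv :: "nexp => nat set" where
  "nbv (NVar r) = {}"
| "nbv (NLit k) = {}"
| "nbv (NBin f a b) = nbv a \<union> nbv b"
| "nbv (NArr a) = nbv a"
| "nbv (NFold f v n b) = insert v (nbv n \<union> nbv b)"

fun nfv :: "nexp => nat set" where
  "nfv (NVar r) = {r}"
| "nfv (NLit k) = {}"
| "nfv (NBin f a b) = nfv a \<union> nfv b"
| "nfv (NArr a) = nfv a"
| "nfv (NFold f v n b) = nfv n \<union> (nfv b - {v})"

fun cbv :: "cexp => nat set" where
  "cbv (CVar r) = {}"
| "cbv (COf a) = nbv a"
| "cbv (CBin f a b) = cbv a \<union> cbv b"
| "cbv (CUn f a) = cbv a"
| "cbv (CEntry a b) = nbv a \<union> nbv b"
| "cbv (CFold f v n b) = insert v (nbv n \<union> cbv b)"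

fun cfv :: "cexp => nat set" where
  "cfv (CVar r) = {}"
| "cfv (COf a) = nfv a"
| "cfv (CBin f a b) = cfv a \<union> cfv b"
| "cfv (CUn f a) = cfv a"
| "cfv (CEntry a b) = nfv a \<union> nfv b"
| "cfv (CFold f v n b) = nfv n \<union> (cfv b - {v})"

fun ccv :: "cexp => nat set" where
  "ccv (CVar r) = {r}"
| "ccv (COf a) = {}"
| "ccv (CBin f a b) = ccv a \<union> ccv b"
| "ccv (CUn f a) = ccv a"
| "ccv (CEntry a b) = {}"
| "ccv (CFold f v n b) = ccv b"

lemma neval_cong: "(\<And>r. r \<in> nfv e ==> \<rho> r = \<rho>' r) ==> neval A \<rho> e = neval A \<rho>' e"
proof (induction e arbitrary: \<rho> \<rho>')
  case (NFold f v n b)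
  have 1: "neval A \<rho> n = neval A \<rho>' n"
    by (rule NFold.IH(1)) (use NFold.prems in auto)
  have 2: "neval A (\<rho>(v := i)) b = neval A (\<rho>'(v := i)) b" for i
    by (rule NFold.IH(2)) (use NFold.prems in auto)
  show ?case by (simp add: 1 2)
next
  case (NBin f a b)
  have "neval A \<rho> a = neval A \<rho>' a" "neval A \<rho> b = neval A \<rho>' b"
    using NBin.prems by (auto intro!: NBin.IH)
  then show ?case by simp
next
  case (NArr a)
  have "neval A \<rho> a = neval A \<rho>' a"
    using NArr.prems by (auto intro!: NArr.IH)
  then show ?case by simp
qed auto

lemma ceval_cong:
  "(\<And>r. r \<in> cfv e ==> \<rho> r = \<rho>' r) ==> (\<And>r. r \<in> ccv e ==> \<gamma> r = \<gamma>' r) ==>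
   ceval U A \<gamma> \<rho> e = ceval U A \<gamma>' \<rho>' e"
proof (induction e arbitrary: \<rho> \<rho>')
  case (CFold f v n b)
  have 1: "neval A \<rho> n = neval A \<rho>' n"
    by (rule neval_cong) (use CFold.prems in auto)
  have 2: "ceval U A \<gamma> (\<rho>(v := i)) b = ceval U A \<gamma>' (\<rho>'(v := i)) b" for i
    by (rule CFold.IH) (use CFold.prems in auto)
  show ?case by (simp add: 1 2)
next
  case (COf a)
  then show ?case using neval_cong[of a \<rho> \<rho>' A] by auto
next
  case (CEntry a b)
  then show ?case using neval_cong[of a \<rho> \<rho>' A] neval_cong[of b \<rho> \<rho>' A] by auto
next
  case (CBin f a b)
  have "ceval U A \<gamma> \<rho> a = ceval U A \<gamma>' \<rho>' a" "ceval U A \<gamma> \<rho> b = ceval U A \<gamma>' \<rho>' b"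
    using CBin.prems by (auto intro!: CBin.IH)
  then show ?case by simp
next
  case (CUn f a)
  have "ceval U A \<gamma> \<rho> a = ceval U A \<gamma>' \<rho>' a"
    using CUn.prems by (auto intro!: CUn.IH)
  then show ?case by simp
qed auto

text \<open>Subterms are evaluated one after the other, so the bound variables of the earlier ones, which
  the code overwrites, must not be read by the later ones. Registers 2 and 3 hold the number 1 and
  the base address of the array.\<close>

fun nwf :: "nexp => bool" where
  "nwf (NVar r) = True"
| "nwf (NLit k) = True"
| "nwf (NBin f a b) \<longleftrightarrow> nwf a \<and> nwf b \<and> nbv a \<inter> nfv b = {}"
| "nwf (NArr a) = nwf a"
| "nwf (NFold f v n b) \<longleftrightarrow> nwf n \<and> nwf b \<and> v \<notin> nbv b \<and> nbv n \<inter> (nfv b - {v}) = {} \<and>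
     nbv b \<inter> nfv b = {} \<and> v \<notin> {2, 3}"

fun cwf :: "cexp => bool" where
  "cwf (CVar r) = True"
| "cwf (COf a) = nwf a"
| "cwf (CBin f a b) \<longleftrightarrow> cwf a \<and> cwf b \<and> cbv a \<inter> cfv b = {}"
| "cwf (CUn f a) = cwf a"
| "cwf (CEntry a b) \<longleftrightarrow> nwf a \<and> nwf b \<and> nbv a \<inter> nfv b = {}"
| "cwf (CFold f v n b) \<longleftrightarrow> nwf n \<and> cwf b \<and> v \<notin> cbv b \<and> nbv n \<inter> (cfv b - {v}) = {} \<and>
     cbv b \<inter> cfv b = {} \<and> v \<notin> {2, 3}"

text \<open>Natural scratch registers from \<open>d\<close> on. An \<open>NBin\<close> keeps its
  left value while the right one is computed, and a fold keeps its bound and accumulator.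
  \<open>CBin\<close> needs no extra register, because its operands are kept in complex
  registers.\<close>

fun nwidth :: "nexp => nat" where
  "nwidth (NVar r) = 1"
| "nwidth (NLit k) = 1"
| "nwidth (NBin f a b) = max (nwidth a) (nwidth b + 1)"
| "nwidth (NArr a) = nwidth a"
| "nwidth (NFold f v n b) = max (nwidth n) (nwidth b + 2)"

fun cwidth :: "cexp => nat" where
  "cwidth (CVar r) = 1"
| "cwidth (COf a) = nwidth a"
| "cwidth (CBin f a b) = max (cwidth a) (cwidth b)"
| "cwidth (CUn f a) = cwidth a"
| "cwidth (CEntry a b) = max (nwidth a) (nwidth b + 1)"
| "cwidth (CFold f v n b) = max (nwidth n) (cwidth b + 2)"

text \<open>There is no move instruction, so a copy is written as zero plus the source. A fold holds
  its bound in \<open>d\<close> and its accumulator in \<open>d + 1\<close>; register 2 supplies the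
  increment.\<close>

fun ncode :: "nexp => nat => com" where
  "ncode (NVar r) d = Seq (NConst d 0) (NOp NPlus d d r)"
| "ncode (NLit k) d = NConst d k"
| "ncode (NBin f a b) d = Seq (ncode a d) (Seq (ncode b (d + 1)) (NOp f d d (d + 1)))"
| "ncode (NArr a) d = Seq (ncode a d) (Seq (NOp NPlus d d 3) (NLoad d d))"
| "ncode (NFold f v n b) d =
     Seq (ncode n d) (Seq (NConst (d + 1) (nunit f)) (Seq (NConst v 0)
       (Seq (While (NLess v d)
               (Seq (ncode b (d + 2)) (Seq (NOp f (d + 1) (d + 1) (d + 2)) (NOp NPlus v v 2))))
         (Seq (NConst d 0) (NOp NPlus d d (d + 1))))))"

fun ccode :: "cexp => nat => nat => com" where
  "ccode (CVar r) d c = Seq (NConst d 0) (Seq (COfNat c d) (COp CPlus c c r))"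
| "ccode (COf a) d c = Seq (ncode a d) (COfNat c d)"
| "ccode (CBin f a b) d c = Seq (ccode a d c) (Seq (ccode b d (c + 1)) (COp f c c (c + 1)))"
| "ccode (CUn f a) d c = Seq (ccode a d c) (CUnop f c c)"
| "ccode (CEntry a b) d c = Seq (ncode a d) (Seq (ncode b (d + 1)) (Entry c d (d + 1)))"
| "ccode (CFold f v n b) d c =
     Seq (ncode n d) (Seq (NConst (d + 1) (cunit f)) (Seq (COfNat c (d + 1)) (Seq (NConst v 0)
       (While (NLess v d)
         (Seq (ccode b (d + 2) (c + 1)) (Seq (COp f c c (c + 1)) (NOp NPlus v v 2)))))))"

abbreviation nloop :: "nat_op => nat => nexp => nat => com" where
  "nloop f v b d \<equiv> While (NLess v d) (Seq (ncode b (d + 2)) (Seq (NOp f (d + 1) (d + 1) (d + 2)) (NOp NPlus v v 2)))"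

abbreviation cloop :: "cpx_op => nat => cexp => nat => nat => com" where
  "cloop f v b d c \<equiv> While (NLess v d) (Seq (ccode b (d + 2) (c + 1)) (Seq (COp f c c (c + 1)) (NOp NPlus v v 2)))"

text \<open>\<open>Z\<close> stands for a common bound on the rounds of all folds, so this is a
  polynomial in \<open>Z\<close> whose degree is governed by the nesting of folds.\<close>

fun ntime :: "nat => nexp => nat" where
  "ntime Z (NVar r) = 3"
| "ntime Z (NLit k) = 1"
| "ntime Z (NBin f a b) = ntime Z a + ntime Z b + 3"
| "ntime Z (NArr a) = ntime Z a + 4"
| "ntime Z (NFold f v n b) = ntime Z n + Z * (ntime Z b + 5) + 10"

fun ctime :: "nat => cexp => nat" where
  "ctime Z (CVar r) = 5"
| "ctime Z (COf a) = ntime Z a + 2"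
| "ctime Z (CBin f a b) = ctime Z a + ctime Z b + 3"
| "ctime Z (CUn f a) = ctime Z a + 2"
| "ctime Z (CEntry a b) = ntime Z a + ntime Z b + 3"
| "ctime Z (CFold f v n b) = ntime Z n + Z * (ctime Z b + 5) + 10"

text \<open>Every fold reached during evaluation makes at most \<open>Z\<close> rounds. The
  condition depends on the state because ranges such as \<open>n ^ j\<close> involve variables bound
  further out.\<close>

fun nok :: "nat => (nat => nat) => (nat => nat) => nexp => bool" where
  "nok Z A \<rho> (NVar r) = True"
| "nok Z A \<rho> (NLit k) = True"
| "nok Z A \<rho> (NBin f a b) \<longleftrightarrow> nok Z A \<rho> a \<and> nok Z A \<rho> b"
| "nok Z A \<rho> (NArr a) = nok Z A \<rho> a"
| "nok Z A \<rho> (NFold f v n b) \<longleftrightarrow> nok Z A \<rho> n \<and> neval A \<rho> n \<le> Z \<and>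
     (\<forall>i<neval A \<rho> n. nok Z A (\<rho>(v := i)) b)"

fun cok :: "nat => (nat => nat) => (nat => nat) => cexp => bool" where
  "cok Z A \<rho> (CVar r) = True"
| "cok Z A \<rho> (COf a) = nok Z A \<rho> a"
| "cok Z A \<rho> (CBin f a b) \<longleftrightarrow> cok Z A \<rho> a \<and> cok Z A \<rho> b"
| "cok Z A \<rho> (CUn f a) = cok Z A \<rho> a"
| "cok Z A \<rho> (CEntry a b) \<longleftrightarrow> nok Z A \<rho> a \<and> nok Z A \<rho> b"
| "cok Z A \<rho> (CFold f v n b) \<longleftrightarrow> nok Z A \<rho> n \<and> neval A \<rho> n \<le> Z \<and>
     (\<forall>i<neval A \<rho> n. cok Z A (\<rho>(v := i)) b)"

lemma nok_cong: "(\<And>r. r \<in> nfv e ==> \<rho> r = \<rho>' r) ==> nok Z A \<rho> e \<longleftrightarrow> nok Z A \<rho>' e"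
proof (induction e arbitrary: \<rho> \<rho>')
  case (NFold f v n b)
  have 1: "neval A \<rho> n = neval A \<rho>' n"
    by (rule neval_cong) (use NFold.prems in auto)
  have 2: "nok Z A (\<rho>(v := i)) b = nok Z A (\<rho>'(v := i)) b" for i
    by (rule NFold.IH(2)) (use NFold.prems in auto)
  have 3: "nok Z A \<rho> n = nok Z A \<rho>' n"
    by (rule NFold.IH(1)) (use NFold.prems in auto)
  show ?case by (simp add: 1 2 3)
next
  case (NBin f a b)
  have "nok Z A \<rho> a = nok Z A \<rho>' a" "nok Z A \<rho> b = nok Z A \<rho>' b"
    using NBin.prems by (auto intro!: NBin.IH)
  then show ?case by simp
next
  case (NArr a)
  have "nok Z A \<rho> a = nok Z A \<rho>' a"
    using NArr.prems by (auto intro!: NArr.IH)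
  then show ?case by simp
qed auto

lemma cok_cong: "(\<And>r. r \<in> cfv e ==> \<rho> r = \<rho>' r) ==> cok Z A \<rho> e \<longleftrightarrow> cok Z A \<rho>' e"
proof (induction e arbitrary: \<rho> \<rho>')
  case (CFold f v n b)
  have 1: "neval A \<rho> n = neval A \<rho>' n"
    by (rule neval_cong) (use CFold.prems in auto)
  have 2: "cok Z A (\<rho>(v := i)) b = cok Z A (\<rho>'(v := i)) b" for i
    by (rule CFold.IH) (use CFold.prems in auto)
  have 3: "nok Z A \<rho> n = nok Z A \<rho>' n"
    by (rule nok_cong) (use CFold.prems in auto)
  show ?case by (simp add: 1 2 3)
next
  case (COf a)
  then show ?case using nok_cong[of a \<rho> \<rho>'] by auto
next
  case (CEntry a b)
  then show ?case using nok_cong[of a \<rho> \<rho>'] nok_cong[of b \<rho> \<rho>'] by auto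
next
  case (CBin f a b)
  have "cok Z A \<rho> a = cok Z A \<rho>' a" "cok Z A \<rho> b = cok Z A \<rho>' b"
    using CBin.prems by (auto intro!: CBin.IH)
  then show ?case by simp
next
  case (CUn f a)
  have "cok Z A \<rho> a = cok Z A \<rho>' a"
    using CUn.prems by (auto intro!: CUn.IH)
  then show ?case by simp
qed auto

lemma nreg_set [simp]:
  "nreg (set_nreg r k s) = (nreg s)(r := k)" "creg (set_nreg r k s) = creg s"
  "nreg (set_creg r z s) = nreg s" "creg (set_creg r z s) = (creg s)(r := z)"
  by (simp_all add: set_nreg_def set_creg_def)

lemma nwidth_pos: "0 < nwidth e"
  by (induction e) auto

lemma add_max_le [simp]: "d + max a b \<le> L \<longleftrightarrow> d + a \<le> L \<and> d + b \<le> (L :: nat)"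
  by auto

lemma step_count: "p \<le> q ==> n + (1 + (1 + (1 + (p + 1) + 1) + 1) + 1) + 1 \<le> n + q + (10 :: nat)"
  by simp

section \<open>Correctness of the compiled code\<close>

locale array_machine =
  fixes U :: "complex mat" and A :: "nat => nat" and B L Z :: nat
  assumes base: "L \<le> B" and low: "3 < L"
begin

definition ready :: "state => bool" where
  "ready s \<longleftrightarrow> nreg s 2 = 1 \<and> nreg s 3 = B \<and> (\<forall>t. nreg s (B + t) = A t)"

text \<open>What a piece of code may touch: its bound variables \<open>V\<close> and the scratch
  range from \<open>d\<close> to \<open>L - 1\<close>. Registers from \<open>L\<close> on, and with
  them the array at \<open>B\<close>, survive.\<close>

definition frame :: "nat set => nat => state => state => bool" where
  "frame V d s s' \<longleftrightarrow> (\<forall>r. r \<notin> V \<and> (r < d \<or> L \<le> r) \<longrightarrow> nreg s' r = nreg s r)"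

lemma frame_refl: "frame V d s s"
  by (simp add: frame_def)

lemma frame_trans: "frame V d s s' ==> frame V' d' s' s'' ==> V \<subseteq> W ==> V' \<subseteq> W ==> e \<le> d ==> e \<le> d' ==>
    frame W e s s''"
  unfolding frame_def by (metis (full_types) order_less_le_trans subsetD)

lemma frame_ready:
  assumes "frame V d s s'" "ready s" "V \<subseteq> {..<e}" "e \<le> L" "V \<subseteq> - {2, 3}" "3 < d"
  shows "ready s'"
proof -
  have eq: "nreg s' r = nreg s r" if "r = 2 \<or> r = 3 \<or> L \<le> r" for r
  proof -
    have "r \<notin> V" "r < d \<or> L \<le> r" using assms(3-6) that by auto
    then show ?thesis using assms(1) unfolding frame_def by blast
  qed
  have "L \<le> B + t" for t using base by simp
  then show ?thesis using assms(2) eq unfolding ready_def by simp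
qed

lemma frame_set: "r \<in> V \<or> (d \<le> r \<and> r < L) ==> frame V d s (set_nreg r k s)"
  by (auto simp: frame_def)

text \<open>Loop invariant: the accumulator \<open>d + 1\<close> holds the fold over the first
  \<open>nreg s v\<close> indices, and \<open>k\<close> rounds remain. The body enters only through
  the hypothesis \<open>step\<close>, so that the induction hypothesis of
  \<open>ncode_correct\<close> can be supplied for it.\<close>

lemma nfold_loop:
  fixes b :: nexp
  assumes step: "\<And>s. ready s ==> nok Z A (nreg s) b ==>
      \<exists>s'. exec U (ncode b (d + 2)) s T s' \<and> nreg s' (d + 2) = neval A (nreg s) b \<and>
           frame (nbv b) (d + 2) s s' \<and> creg s' = creg s"
    and wf: "v \<notin> nbv b" "nbv b \<inter> nfv b = {}" "v \<notin> {2, 3}" "v < d" "insert v (nbv b) \<subseteq> {..<d} - {2, 3}"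
      "nfv b \<subseteq> {..<d}" "d + 2 < L" "3 < d"
  shows "ready s ==> nreg s v + k = nreg s d ==>
    \<forall>i. nreg s v \<le> i \<and> i < nreg s d \<longrightarrow> nok Z A ((nreg s)(v := i)) b ==>
    nreg s (d + 1) = iter_op (apply_nat_op f) (nunit f) (nreg s v) (\<lambda>i. neval A ((nreg s)(v := i)) b) ==>
    \<exists>s'. exec U (nloop f v b d) s
        (k * (T + 5) + 1) s' \<and>
      nreg s' (d + 1) = iter_op (apply_nat_op f) (nunit f) (nreg s d) (\<lambda>i. neval A ((nreg s)(v := i)) b) \<and>
      frame (insert v (nbv b)) (d + 1) s s' \<and> creg s' = creg s"
proof (induction k arbitrary: s)
  case 0
  have "\<not> holds (NLess v d) s" using 0 by simp
  from exec_While_stop[OF this] show ?case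
    using 0 by (intro exI[of _ s]) (auto simp: frame_refl)
next
  case (Suc k)
  have lt: "nreg s v < nreg s d" using Suc.prems(2) by simp
  have "nok Z A ((nreg s)(v := nreg s v)) b" using Suc.prems(3) lt by blast
  then have "nok Z A (nreg s) b" by simp
  from step[OF Suc.prems(1) this] obtain s1 where s1: "exec U (ncode b (d + 2)) s T s1"
    "nreg s1 (d + 2) = neval A (nreg s) b" "frame (nbv b) (d + 2) s s1" "creg s1 = creg s" by blast
  have same: "nreg s1 r = nreg s r" if "r \<notin> nbv b" "r < d + 2 \<or> L \<le> r" for r
    using s1(3) that unfolding frame_def by blast
  have nb: "r \<notin> nbv b" if "d \<le> r" for r using wf that by (auto simp: subset_eq)
  define s2 where "s2 = set_nreg (d + 1) (apply_nat_op f (nreg s1 (d + 1)) (nreg s1 (d + 2))) s1"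
  define s3 where "s3 = set_nreg v (nreg s2 v + nreg s2 2) s2"
  have r2: "nreg s 2 = 1" using Suc.prems(1) by (simp add: ready_def)
  have r21: "nreg s2 2 = 1" using wf r2 same[of 2] unfolding s2_def by (auto simp: subset_eq)
  have v2: "nreg s2 v = nreg s v" using wf same[of v] unfolding s2_def by auto
  have ex: "exec U (Seq (ncode b (d + 2)) (Seq (NOp f (d + 1) (d + 1) (d + 2)) (NOp NPlus v v 2))) s
      (T + (1 + 1 + 1) + 1) s3"
    using exec_simple(2)[of U NPlus v v 2 s2, folded s3_def]
      exec_simple(2)[of U f "d + 1" "d + 1" "d + 2" s1, folded s2_def]
    unfolding s3_def by (intro exec_Seq[OF s1(1)] exec_Seq[where ?s1.0 = s2]) simp_all
  have d3: "nreg s3 d = nreg s d" using wf same[of d] nb unfolding s3_def s2_def by auto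
  have v3: "nreg s3 v = Suc (nreg s v)" unfolding s3_def using v2 r21 by simp
  have F: "frame (insert v (nbv b)) (d + 1) s s3"
    using s1(3) wf unfolding frame_def s3_def s2_def by auto
  have rd: "ready s3"
    by (rule frame_ready[OF F Suc.prems(1), of d]) (use wf in auto)
  \<comment> \<open>The only register read by the body that a round changes is \<open>v\<close>, so
    the folded values are those of the state before the round.\<close>
  have cong: "neval A ((nreg s3)(v := i)) b = neval A ((nreg s)(v := i)) b"
       "nok Z A ((nreg s3)(v := i)) b = nok Z A ((nreg s)(v := i)) b" for i
  proof -
    have eq: "((nreg s3)(v := i)) r = ((nreg s)(v := i)) r" if "r \<in> nfv b" for r
    proof -
      have "r < d" "r \<notin> nbv b" using that wf by auto
      then show ?thesis using F unfolding frame_def by auto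
    qed
    then show "neval A ((nreg s3)(v := i)) b = neval A ((nreg s)(v := i)) b"
      by (rule neval_cong)
    show "nok Z A ((nreg s3)(v := i)) b = nok Z A ((nreg s)(v := i)) b"
      by (rule nok_cong) (rule eq)
  qed
  have acc: "nreg s3 (d + 1) = iter_op (apply_nat_op f) (nunit f) (nreg s3 v)
       (\<lambda>i. neval A ((nreg s3)(v := i)) b)"
  proof -
    have "nreg s3 (d + 1) = apply_nat_op f (nreg s (d + 1)) (neval A (nreg s) b)"
      unfolding s3_def s2_def using wf s1(2) same[of "d + 1"] nb[of "d + 1"] by auto
    also have "\<dots> = iter_op (apply_nat_op f) (nunit f) (Suc (nreg s v)) (\<lambda>i. neval A ((nreg s)(v := i)) b)"
      by (simp only: Suc.prems(4) iter_op.simps fun_upd_triv)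
    finally show ?thesis by (simp add: v3 cong)
  qed
  have ok3: "\<forall>i. nreg s3 v \<le> i \<and> i < nreg s3 d \<longrightarrow> nok Z A ((nreg s3)(v := i)) b"
    unfolding v3 d3 cong using Suc.prems(3) Suc_leD by blast
  have "nreg s3 v + k = nreg s3 d" using Suc.prems(2) v3 d3 by simp
  from Suc.IH[OF rd this ok3 acc] obtain s' where s': "exec U (nloop f v b d) s3
        (k * (T + 5) + 1) s'"
      "nreg s' (d + 1) = iter_op (apply_nat_op f) (nunit f) (nreg s3 d) (\<lambda>i. neval A ((nreg s3)(v := i)) b)"
      "frame (insert v (nbv b)) (d + 1) s3 s'" "creg s' = creg s3" by blast
  have "exec U (nloop f v b d) s
        (T + (1 + 1 + 1) + 1 + (k * (T + 5) + 1) + 1) s'"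
    by (rule exec_While_step[OF _ ex s'(1)]) (use lt in simp)
  then have "exec U (nloop f v b d) s
        (Suc k * (T + 5) + 1) s'"
    by (rule exec_mono) simp
  moreover have "frame (insert v (nbv b)) (d + 1) s s'"
    by (rule frame_trans[OF F s'(3)]) auto
  moreover have "creg s' = creg s" using s'(4) s1(4) by (simp add: s3_def s2_def)
  moreover have "nreg s' (d + 1) =
      iter_op (apply_nat_op f) (nunit f) (nreg s d) (\<lambda>i. neval A ((nreg s)(v := i)) b)"
    using s'(2) unfolding cong d3 .
  ultimately show ?case by blast
qed

text \<open>Structural induction. By \<open>nwf\<close>, the variables overwritten by the first
  operand are not read by the second, so both are evaluated in effectively the same
  environment.\<close>

lemma ncode_correct:
  assumes "nwf e" "nfv e \<union> nbv e \<subseteq> {..<d}" "nbv e \<subseteq> - {2, 3}" "d + nwidth e \<le> L" "3 < d"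
    "ready s" "nok Z A (nreg s) e"
  shows "\<exists>s'. exec U (ncode e d) s (ntime Z e) s' \<and> nreg s' d = neval A (nreg s) e \<and>
           frame (nbv e) d s s' \<and> creg s' = creg s"
  using assms
proof (induction e arbitrary: d s)
  case (NVar r)
  have "exec U (ncode (NVar r) d) s (1 + 1 + 1) (set_nreg d (nreg s r) s)"
  proof -
    have "set_nreg d (apply_nat_op NPlus (nreg (set_nreg d 0 s) d) (nreg (set_nreg d 0 s) r))
        (set_nreg d 0 s) = set_nreg d (nreg s r) s"
      using NVar.prems by (auto simp: set_nreg_def)
    then show ?thesis
      using exec_Seq[OF exec_simple(1)[of U d 0 s] exec_simple(2)[of U NPlus d d r "set_nreg d 0 s"]] by simp
  qed
  then show ?case using NVar.prems
    by (intro exI[of _ "set_nreg d (nreg s r) s"]) (auto intro!: frame_set simp: numeral_eq_Suc)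
next
  case (NLit k)
  show ?case using NLit.prems exec_simple(1)[of U d k s]
    by (intro exI[of _ "set_nreg d k s"]) (auto intro!: frame_set)
next
  case (NBin f a b)
  from NBin.IH(1)[of d s] NBin.prems obtain s1 where s1: "exec U (ncode a d) s (ntime Z a) s1"
    "nreg s1 d = neval A (nreg s) a" "frame (nbv a) d s s1" "creg s1 = creg s" by auto
  have eq: "nreg s1 r = nreg s r" if "r \<in> nfv b" for r
    using s1(3) NBin.prems that unfolding frame_def by (auto simp: subset_eq)
  have rd: "ready s1" by (rule frame_ready[OF s1(3), of d]) (use NBin.prems in auto)
  have "nok Z A (nreg s1) b" using NBin.prems eq nok_cong[of b "nreg s1" "nreg s"] by auto
  from NBin.IH(2)[of "d + 1" s1] NBin.prems this rd obtain s2 where s2: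
    "exec U (ncode b (d + 1)) s1 (ntime Z b) s2"
    "nreg s2 (d + 1) = neval A (nreg s1) b" "frame (nbv b) (d + 1) s1 s2" "creg s2 = creg s1"
    by (auto simp: subset_eq less_Suc_eq)
  have e2: "neval A (nreg s1) b = neval A (nreg s) b" using eq by (rule neval_cong)
  have dd: "nreg s2 d = nreg s1 d" using s2(3) NBin.prems unfolding frame_def by (auto simp: subset_eq)
  let ?s3 = "set_nreg d (apply_nat_op f (nreg s2 d) (nreg s2 (d + 1))) s2"
  have "exec U (ncode (NBin f a b) d) s (ntime Z a + (ntime Z b + 1 + 1) + 1) ?s3"
    unfolding ncode.simps by (intro exec_Seq[OF s1(1)] exec_Seq[OF s2(1)] exec_simple)
  moreover have "frame (nbv (NBin f a b)) d s ?s3"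
    using s1(3) s2(3) NBin.prems unfolding frame_def by auto
  ultimately show ?case
    using s1 s2 e2 dd by (intro exI[of _ ?s3]) (auto simp: ac_simps numeral_eq_Suc)
next
  case (NArr a)
  from NArr.IH[of d s] NArr.prems obtain s1 where s1: "exec U (ncode a d) s (ntime Z a) s1"
    "nreg s1 d = neval A (nreg s) a" "frame (nbv a) d s s1" "creg s1 = creg s" by auto
  have rd: "ready s1" by (rule frame_ready[OF s1(3), of d]) (use NArr.prems in auto)
  let ?s2 = "set_nreg d (nreg s1 d + nreg s1 3) s1"
  let ?s3 = "set_nreg d (nreg ?s2 (nreg ?s2 d)) ?s2"
  have "exec U (ncode (NArr a) d) s (ntime Z a + (1 + 1 + 1) + 1) ?s3"
    unfolding ncode.simps using exec_simple(2)[of U NPlus d d 3 s1]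
    by (intro exec_Seq[OF s1(1)] exec_Seq[where ?s1.0 = ?s2] exec_simple) auto
  moreover have "nreg ?s3 d = A (neval A (nreg s) a)"
  proof -
    have "nreg s1 3 = B" "nreg s1 (B + nreg s1 d) = A (nreg s1 d)" using rd by (simp_all add: ready_def)
    moreover have "d < L" using NArr.prems(4) nwidth_pos[of a] by simp
    ultimately show ?thesis using s1(2) base by (simp add: add.commute)
  qed
  moreover have "frame (nbv (NArr a)) d s ?s3"
    using s1(3) NArr.prems nwidth_pos[of a] unfolding frame_def by auto
  ultimately show ?case
    using s1 by (intro exI[of _ ?s3]) (auto simp: ac_simps numeral_eq_Suc)
next
  case (NFold f v n b)
  from NFold.IH(1)[of d s] NFold.prems obtain s1 where s1: "exec U (ncode n d) s (ntime Z n) s1"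
    "nreg s1 d = neval A (nreg s) n" "frame (nbv n) d s s1" "creg s1 = creg s" by auto
  let ?s2 = "set_nreg (d + 1) (nunit f) s1"
  let ?s3 = "set_nreg v 0 ?s2"
  have vd: "v < d" using NFold.prems by auto
  have F: "frame (insert v (nbv n)) d s ?s3"
    using s1(3) NFold.prems unfolding frame_def by auto
  have rd: "ready ?s3" by (rule frame_ready[OF F, of d]) (use NFold.prems in auto)
  have d3: "nreg ?s3 d = neval A (nreg s) n" using s1(2) vd by auto
  have cong: "neval A ((nreg ?s3)(v := i)) b = neval A ((nreg s)(v := i)) b"
       "nok Z A ((nreg ?s3)(v := i)) b = nok Z A ((nreg s)(v := i)) b" for i
  proof -
    have eq: "((nreg ?s3)(v := i)) r = ((nreg s)(v := i)) r" if "r \<in> nfv b" for r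
    proof (cases "r = v")
      case False
      have "r \<notin> nbv n" "r < d" using NFold.prems that False by auto
      then show ?thesis using F False unfolding frame_def by auto
    qed auto
    then show "neval A ((nreg ?s3)(v := i)) b = neval A ((nreg s)(v := i)) b"
      by (rule neval_cong)
    show "nok Z A ((nreg ?s3)(v := i)) b = nok Z A ((nreg s)(v := i)) b"
      by (rule nok_cong) (rule eq)
  qed
  have "\<exists>s'. exec U (nloop f v b d) ?s3
        (neval A (nreg s) n * (ntime Z b + 5) + 1) s' \<and>
      nreg s' (d + 1) = iter_op (apply_nat_op f) (nunit f) (nreg ?s3 d) (\<lambda>i. neval A ((nreg ?s3)(v := i)) b) \<and>
      frame (insert v (nbv b)) (d + 1) ?s3 s' \<and> creg s' = creg ?s3"
  proof (rule nfold_loop)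
    fix s assume s: "ready s" "nok Z A (nreg s) b"
    show "\<exists>s'. exec U (ncode b (d + 2)) s (ntime Z b) s' \<and> nreg s' (d + 2) = neval A (nreg s) b \<and>
           frame (nbv b) (d + 2) s s' \<and> creg s' = creg s"
      by (rule NFold.IH(2)) (use NFold.prems s in \<open>auto simp: subset_eq less_Suc_eq\<close>)
  next
    show "\<forall>i. nreg ?s3 v \<le> i \<and> i < nreg ?s3 d \<longrightarrow> nok Z A ((nreg ?s3)(v := i)) b"
      unfolding d3 cong using NFold.prems(7) by auto
  next
    show "d + 2 < L" using NFold.prems(4) nwidth_pos[of b] by auto
    show "nreg ?s3 v + neval A (nreg s) n = nreg ?s3 d" using d3 vd by auto
    show "nreg ?s3 (d + 1) = iter_op (apply_nat_op f) (nunit f) (nreg ?s3 v)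
        (\<lambda>i. neval A ((nreg ?s3)(v := i)) b)" using vd by simp
    show "insert v (nbv b) \<subseteq> {..<d} - {2, 3}" "nfv b \<subseteq> {..<d}"
      using NFold.prems(2,3) by auto
  qed (use NFold.prems(1,5) vd rd in auto)
  then obtain s4 where s4: "exec U (nloop f v b d) ?s3
        (neval A (nreg s) n * (ntime Z b + 5) + 1) s4"
      "nreg s4 (d + 1) = iter_op (apply_nat_op f) (nunit f) (nreg ?s3 d) (\<lambda>i. neval A ((nreg ?s3)(v := i)) b)"
      "frame (insert v (nbv b)) (d + 1) ?s3 s4" "creg s4 = creg ?s3" by blast
  let ?s5 = "set_nreg d 0 s4"
  let ?s6 = "set_nreg d (nreg s4 (d + 1)) ?s5"
  have "exec U (ncode (NFold f v n b) d) s (ntime Z n + (1 + (1 +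
      ((neval A (nreg s) n * (ntime Z b + 5) + 1) + (1 + 1 + 1) + 1) + 1) + 1) + 1) ?s6"
    unfolding ncode.simps using exec_simple(2)[of U NPlus d d "d + 1" ?s5]
    by (intro exec_Seq[OF s1(1)] exec_Seq[OF exec_simple(1)] exec_Seq[OF s4(1)]) auto
  moreover have "neval A (nreg s) n * (ntime Z b + 5) \<le> Z * (ntime Z b + 5)"
    using NFold.prems(7) by (intro mult_right_mono) auto
  ultimately have "exec U (ncode (NFold f v n b) d) s (ntime Z (NFold f v n b)) ?s6"
    by (elim exec_mono) simp
  moreover have "frame (nbv (NFold f v n b)) d s ?s6"
    using F s4(3) NFold.prems unfolding frame_def by auto
  moreover have "nreg ?s6 d = neval A (nreg s) (NFold f v n b)"
    using s4(2) unfolding d3 cong by simp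
  ultimately show ?case using s4(4) s1(4) by (intro exI[of _ ?s6]) auto
qed

text \<open>As for natural numbers, with the accumulator in complex register \<open>c\<close>. The
  body preserves the complex registers up to \<open>c\<close> and, by
  \<open>ccv b \<subseteq> {..<c}\<close>, reads none that the loop overwrites.\<close>

lemma cfold_loop:
  fixes b :: cexp
  assumes step: "\<And>s. ready s ==> cok Z A (nreg s) b ==>
      \<exists>s'. exec U (ccode b (d + 2) (c + 1)) s T s' \<and> creg s' (c + 1) = ceval U A (creg s) (nreg s) b \<and>
           frame (cbv b) (d + 2) s s' \<and> (\<forall>r<c + 1. creg s' r = creg s r)"
    and wf: "v \<notin> cbv b" "cbv b \<inter> cfv b = {}" "v \<notin> {2, 3}" "v < d" "insert v (cbv b) \<subseteq> {..<d} - {2, 3}"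
      "cfv b \<subseteq> {..<d}" "d + 2 < L" "3 < d" "ccv b \<subseteq> {..<c}"
  shows "ready s ==> nreg s v + k = nreg s d ==>
    \<forall>i. nreg s v \<le> i \<and> i < nreg s d \<longrightarrow> cok Z A ((nreg s)(v := i)) b ==>
    creg s c = iter_op (apply_cpx_op f) (of_nat (cunit f)) (nreg s v)
      (\<lambda>i. ceval U A (creg s) ((nreg s)(v := i)) b) ==>
    \<exists>s'. exec U (cloop f v b d c) s
        (k * (T + 5) + 1) s' \<and>
      creg s' c = iter_op (apply_cpx_op f) (of_nat (cunit f)) (nreg s d)
        (\<lambda>i. ceval U A (creg s) ((nreg s)(v := i)) b) \<and>
      frame (insert v (cbv b)) (d + 1) s s' \<and> (\<forall>r<c. creg s' r = creg s r)"
proof (induction k arbitrary: s)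
  case 0
  have "\<not> holds (NLess v d) s" using 0 by simp
  from exec_While_stop[OF this] show ?case
    using 0 by (intro exI[of _ s]) (auto simp: frame_refl)
next
  case (Suc k)
  have lt: "nreg s v < nreg s d" using Suc.prems(2) by simp
  have "cok Z A ((nreg s)(v := nreg s v)) b" using Suc.prems(3) lt by blast
  then have "cok Z A (nreg s) b" by simp
  from step[OF Suc.prems(1) this] obtain s1 where s1: "exec U (ccode b (d + 2) (c + 1)) s T s1"
    "creg s1 (c + 1) = ceval U A (creg s) (nreg s) b" "frame (cbv b) (d + 2) s s1"
    "\<And>r. r < c + 1 ==> creg s1 r = creg s r" by blast
  have same: "nreg s1 r = nreg s r" if "r \<notin> cbv b" "r < d + 2 \<or> L \<le> r" for r
    using s1(3) that unfolding frame_def by blast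
  have nb: "r \<notin> cbv b" if "d \<le> r" for r using wf that by (auto simp: subset_eq)
  define s2 where "s2 = set_creg c (apply_cpx_op f (creg s1 c) (creg s1 (c + 1))) s1"
  define s3 where "s3 = set_nreg v (nreg s2 v + nreg s2 2) s2"
  have r2: "nreg s 2 = 1" using Suc.prems(1) by (simp add: ready_def)
  have r21: "nreg s2 2 = 1" using wf r2 same[of 2] unfolding s2_def by (auto simp: subset_eq)
  have v2: "nreg s2 v = nreg s v" using wf same[of v] unfolding s2_def by auto
  have ex: "exec U (Seq (ccode b (d + 2) (c + 1)) (Seq (COp f c c (c + 1)) (NOp NPlus v v 2))) s
      (T + (1 + 1 + 1) + 1) s3"
    using exec_simple(2)[of U NPlus v v 2 s2, folded s3_def]
      exec_simple(6)[of U f c c "c + 1" s1, folded s2_def]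
    unfolding s3_def by (intro exec_Seq[OF s1(1)] exec_Seq[where ?s1.0 = s2]) simp_all
  have d3: "nreg s3 d = nreg s d" using wf same[of d] nb unfolding s3_def s2_def by auto
  have v3: "nreg s3 v = Suc (nreg s v)" unfolding s3_def using v2 r21 by simp
  have c3: "creg s3 r = creg s r" if "r < c" for r
    using s1(4) that unfolding s3_def s2_def by simp
  have F: "frame (insert v (cbv b)) (d + 1) s s3"
    using s1(3) wf unfolding frame_def s3_def s2_def by auto
  have rd: "ready s3"
    by (rule frame_ready[OF F Suc.prems(1), of d]) (use wf in auto)
  have cong: "ceval U A (creg s3) ((nreg s3)(v := i)) b = ceval U A (creg s) ((nreg s)(v := i)) b"
       "cok Z A ((nreg s3)(v := i)) b = cok Z A ((nreg s)(v := i)) b" for i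
  proof -
    have eq: "((nreg s3)(v := i)) r = ((nreg s)(v := i)) r" if "r \<in> cfv b" for r
    proof -
      have "r < d" "r \<notin> cbv b" using that wf by auto
      then show ?thesis using F unfolding frame_def by auto
    qed
    then show "ceval U A (creg s3) ((nreg s3)(v := i)) b = ceval U A (creg s) ((nreg s)(v := i)) b"
      by (rule ceval_cong) (use wf c3 in auto)
    show "cok Z A ((nreg s3)(v := i)) b = cok Z A ((nreg s)(v := i)) b"
      by (rule cok_cong) (rule eq)
  qed
  have acc: "creg s3 c = iter_op (apply_cpx_op f) (of_nat (cunit f)) (nreg s3 v)
       (\<lambda>i. ceval U A (creg s3) ((nreg s3)(v := i)) b)"
  proof -
    have "creg s3 c = apply_cpx_op f (creg s c) (ceval U A (creg s) (nreg s) b)"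
      unfolding s3_def s2_def using s1(2) s1(4)[of c] by auto
    also have "\<dots> = iter_op (apply_cpx_op f) (of_nat (cunit f)) (Suc (nreg s v))
        (\<lambda>i. ceval U A (creg s) ((nreg s)(v := i)) b)"
      by (simp only: Suc.prems(4) iter_op.simps fun_upd_triv)
    finally show ?thesis by (simp add: v3 cong)
  qed
  have ok3: "\<forall>i. nreg s3 v \<le> i \<and> i < nreg s3 d \<longrightarrow> cok Z A ((nreg s3)(v := i)) b"
    unfolding v3 d3 cong using Suc.prems(3) Suc_leD by blast
  have "nreg s3 v + k = nreg s3 d" using Suc.prems(2) v3 d3 by simp
  from Suc.IH[OF rd this ok3 acc] obtain s' where s': "exec U (cloop f v b d c) s3
        (k * (T + 5) + 1) s'"
      "creg s' c = iter_op (apply_cpx_op f) (of_nat (cunit f)) (nreg s3 d)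
        (\<lambda>i. ceval U A (creg s3) ((nreg s3)(v := i)) b)"
      "frame (insert v (cbv b)) (d + 1) s3 s'" "\<And>r. r < c ==> creg s' r = creg s3 r" by blast
  have "exec U (cloop f v b d c) s
        (T + (1 + 1 + 1) + 1 + (k * (T + 5) + 1) + 1) s'"
    by (rule exec_While_step[OF _ ex s'(1)]) (use lt in simp)
  then have "exec U (cloop f v b d c) s
        (Suc k * (T + 5) + 1) s'"
    by (rule exec_mono) simp
  moreover have "frame (insert v (cbv b)) (d + 1) s s'"
    by (rule frame_trans[OF F s'(3)]) auto
  moreover have "\<forall>r<c. creg s' r = creg s r" using s'(4) c3 by simp
  moreover have "creg s' c = iter_op (apply_cpx_op f) (of_nat (cunit f)) (nreg s d)
        (\<lambda>i. ceval U A (creg s) ((nreg s)(v := i)) b)"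
    using s'(2) unfolding cong d3 .
  ultimately show ?case by blast
qed

lemma ccode_correct:
  assumes "cwf e" "cfv e \<union> cbv e \<subseteq> {..<d}" "cbv e \<subseteq> - {2, 3}" "d + cwidth e \<le> L" "3 < d"
    "ccv e \<subseteq> {..<c}" "ready s" "cok Z A (nreg s) e"
  shows "\<exists>s'. exec U (ccode e d c) s (ctime Z e) s' \<and> creg s' c = ceval U A (creg s) (nreg s) e \<and>
           frame (cbv e) d s s' \<and> (\<forall>r<c. creg s' r = creg s r)"
  using assms
proof (induction e arbitrary: d c s)
  case (CVar r)
  let ?s1 = "set_nreg d 0 s"
  let ?s2 = "set_creg c (of_nat (nreg ?s1 d)) ?s1"
  let ?s3 = "set_creg c (apply_cpx_op CPlus (creg ?s2 c) (creg ?s2 r)) ?s2"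
  have "exec U (ccode (CVar r) d c) s (1 + (1 + 1 + 1) + 1) ?s3"
    unfolding ccode.simps by (rule exec_Seq[OF exec_simple(1) exec_Seq[OF exec_simple(5) exec_simple(6)]])
  moreover have "frame (cbv (CVar r)) d s ?s3" using CVar.prems by (auto simp: frame_def)
  moreover have "creg ?s3 c = creg s r" "\<forall>r'<c. creg ?s3 r' = creg s r'" using CVar.prems by auto
  ultimately show ?case by (intro exI[of _ ?s3]) (simp add: numeral_eq_Suc)
next
  case (COf a)
  from ncode_correct[of a d s] COf.prems obtain s1 where s1: "exec U (ncode a d) s (ntime Z a) s1"
    "nreg s1 d = neval A (nreg s) a" "frame (nbv a) d s s1" "creg s1 = creg s" by auto
  let ?s2 = "set_creg c (of_nat (nreg s1 d)) s1"
  have "exec U (ccode (COf a) d c) s (ntime Z a + 1 + 1) ?s2"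
    unfolding ccode.simps by (intro exec_Seq[OF s1(1)] exec_simple)
  moreover have "frame (cbv (COf a)) d s ?s2" using s1(3) by (auto simp: frame_def)
  ultimately show ?case using s1 by (intro exI[of _ ?s2]) (simp add: numeral_eq_Suc)
next
  case (CBin f a b)
  from CBin.IH(1)[of d c s] CBin.prems obtain s1 where s1: "exec U (ccode a d c) s (ctime Z a) s1"
    "creg s1 c = ceval U A (creg s) (nreg s) a" "frame (cbv a) d s s1"
    "\<And>r. r < c ==> creg s1 r = creg s r" by auto
  have eq: "nreg s1 r = nreg s r" if "r \<in> cfv b" for r
    using s1(3) CBin.prems that unfolding frame_def by (auto simp: subset_eq)
  have rd: "ready s1"
    by (rule frame_ready[OF s1(3), of d]) (use CBin.prems in auto)
  have "cok Z A (nreg s1) b" using CBin.prems eq cok_cong[of b "nreg s1" "nreg s"] by auto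
  moreover have "ccv b \<subseteq> {..<c + 1}" using CBin.prems(6) by auto
  ultimately obtain s2 where s2:
    "exec U (ccode b d (c + 1)) s1 (ctime Z b) s2"
    "creg s2 (c + 1) = ceval U A (creg s1) (nreg s1) b" "frame (cbv b) d s1 s2"
    "\<And>r. r < c + 1 ==> creg s2 r = creg s1 r"
    using CBin.IH(2)[of d "c + 1" s1] CBin.prems rd by auto
  have e2: "ceval U A (creg s1) (nreg s1) b = ceval U A (creg s) (nreg s) b"
    by (rule ceval_cong) (use eq CBin.prems s1(4) in auto)
  let ?s3 = "set_creg c (apply_cpx_op f (creg s2 c) (creg s2 (c + 1))) s2"
  have "exec U (ccode (CBin f a b) d c) s (ctime Z a + (ctime Z b + 1 + 1) + 1) ?s3"
    unfolding ccode.simps by (intro exec_Seq[OF s1(1)] exec_Seq[OF s2(1)] exec_simple)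
  moreover have "frame (cbv (CBin f a b)) d s ?s3"
    using s1(3) s2(3) CBin.prems unfolding frame_def by auto
  moreover have "creg ?s3 c = ceval U A (creg s) (nreg s) (CBin f a b)"
    using s1(2) s2(2) s2(4)[of c] e2 by simp
  moreover have "\<forall>r<c. creg ?s3 r = creg s r" using s1(4) s2(4) by simp
  ultimately show ?case
    by (intro exI[of _ ?s3]) (auto simp: ac_simps numeral_eq_Suc)
next
  case (CUn f a)
  from CUn.IH[of d c s] CUn.prems obtain s1 where s1: "exec U (ccode a d c) s (ctime Z a) s1"
    "creg s1 c = ceval U A (creg s) (nreg s) a" "frame (cbv a) d s s1"
    "\<And>r. r < c ==> creg s1 r = creg s r" by auto
  let ?s2 = "set_creg c (apply_cpx_unop f (creg s1 c)) s1"
  have "exec U (ccode (CUn f a) d c) s (ctime Z a + 1 + 1) ?s2"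
    unfolding ccode.simps by (intro exec_Seq[OF s1(1)] exec_simple)
  moreover have "frame (cbv (CUn f a)) d s ?s2" using s1(3) by (auto simp: frame_def)
  ultimately show ?case using s1 by (intro exI[of _ ?s2]) (simp add: numeral_eq_Suc)
next
  case (CEntry a b)
  from ncode_correct[of a d s] CEntry.prems obtain s1 where s1: "exec U (ncode a d) s (ntime Z a) s1"
    "nreg s1 d = neval A (nreg s) a" "frame (nbv a) d s s1" "creg s1 = creg s" by auto
  have eq: "nreg s1 r = nreg s r" if "r \<in> nfv b" for r
    using s1(3) CEntry.prems that unfolding frame_def by (auto simp: subset_eq)
  have rd: "ready s1" by (rule frame_ready[OF s1(3), of d]) (use CEntry.prems in auto)
  have "nok Z A (nreg s1) b" using CEntry.prems eq nok_cong[of b "nreg s1" "nreg s"] by auto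
  moreover have "nfv b \<union> nbv b \<subseteq> {..<d + 1}" using CEntry.prems(2) by auto
  ultimately obtain s2 where s2: "exec U (ncode b (d + 1)) s1 (ntime Z b) s2"
    "nreg s2 (d + 1) = neval A (nreg s1) b" "frame (nbv b) (d + 1) s1 s2" "creg s2 = creg s1"
    using ncode_correct[of b "d + 1" s1] CEntry.prems rd by auto
  have e2: "neval A (nreg s1) b = neval A (nreg s) b" using eq by (rule neval_cong)
  have dd: "nreg s2 d = nreg s1 d" using s2(3) CEntry.prems unfolding frame_def by (auto simp: subset_eq)
  let ?s3 = "set_creg c (entry U (nreg s2 d) (nreg s2 (d + 1))) s2"
  have "exec U (ccode (CEntry a b) d c) s (ntime Z a + (ntime Z b + 1 + 1) + 1) ?s3"
    unfolding ccode.simps entry_def by (intro exec_Seq[OF s1(1)] exec_Seq[OF s2(1)] exec_simple)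
  moreover have "frame (cbv (CEntry a b)) d s ?s3"
    using s1(3) s2(3) CEntry.prems unfolding frame_def by auto
  ultimately show ?case
    using s1 s2 e2 dd by (intro exI[of _ ?s3]) (auto simp: ac_simps numeral_eq_Suc)
next
  case (CFold f v n b)
  from ncode_correct[of n d s] CFold.prems obtain s1 where s1: "exec U (ncode n d) s (ntime Z n) s1"
    "nreg s1 d = neval A (nreg s) n" "frame (nbv n) d s s1" "creg s1 = creg s" by auto
  let ?s2 = "set_nreg (d + 1) (cunit f) s1"
  let ?s3 = "set_creg c (of_nat (nreg ?s2 (d + 1))) ?s2"
  let ?s4 = "set_nreg v 0 ?s3"
  have vd: "v < d" using CFold.prems by auto
  have F: "frame (insert v (nbv n)) d s ?s4"
    using s1(3) CFold.prems unfolding frame_def by auto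
  have rd: "ready ?s4" by (rule frame_ready[OF F, of d]) (use CFold.prems in auto)
  have d3: "nreg ?s4 d = neval A (nreg s) n" using s1(2) vd by auto
  have c4: "creg ?s4 r = creg s r" if "r < c" for r using s1(4) that by simp
  have cong: "ceval U A (creg ?s4) ((nreg ?s4)(v := i)) b = ceval U A (creg s) ((nreg s)(v := i)) b"
       "cok Z A ((nreg ?s4)(v := i)) b = cok Z A ((nreg s)(v := i)) b" for i
  proof -
    have eq: "((nreg ?s4)(v := i)) r = ((nreg s)(v := i)) r" if "r \<in> cfv b" for r
    proof (cases "r = v")
      case False
      have "r \<notin> nbv n" "r < d" using CFold.prems that False by auto
      then show ?thesis using F False unfolding frame_def by auto
    qed auto
    then show "ceval U A (creg ?s4) ((nreg ?s4)(v := i)) b = ceval U A (creg s) ((nreg s)(v := i)) b"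
      by (rule ceval_cong) (use CFold.prems c4 in auto)
    show "cok Z A ((nreg ?s4)(v := i)) b = cok Z A ((nreg s)(v := i)) b"
      by (rule cok_cong) (rule eq)
  qed
  have "\<exists>s'. exec U (cloop f v b d c) ?s4
        (neval A (nreg s) n * (ctime Z b + 5) + 1) s' \<and>
      creg s' c = iter_op (apply_cpx_op f) (of_nat (cunit f)) (nreg ?s4 d)
        (\<lambda>i. ceval U A (creg ?s4) ((nreg ?s4)(v := i)) b) \<and>
      frame (insert v (cbv b)) (d + 1) ?s4 s' \<and> (\<forall>r<c. creg s' r = creg ?s4 r)"
  proof (rule cfold_loop)
    fix s assume s: "ready s" "cok Z A (nreg s) b"
    have "ccv b \<subseteq> {..<c + 1}" using CFold.prems(6) by auto
    then show "\<exists>s'. exec U (ccode b (d + 2) (c + 1)) s (ctime Z b) s' \<and>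
           creg s' (c + 1) = ceval U A (creg s) (nreg s) b \<and>
           frame (cbv b) (d + 2) s s' \<and> (\<forall>r<c + 1. creg s' r = creg s r)"
      by (intro CFold.IH) (use CFold.prems s in \<open>auto simp: subset_eq less_Suc_eq\<close>)
  next
    show "\<forall>i. nreg ?s4 v \<le> i \<and> i < nreg ?s4 d \<longrightarrow> cok Z A ((nreg ?s4)(v := i)) b"
      unfolding d3 cong using CFold.prems(8) by auto
    have "0 < cwidth b" using nwidth_pos by (induction b) (auto simp: less_max_iff_disj)
    then show "d + 2 < L" using CFold.prems(4) by auto
    show "nreg ?s4 v + neval A (nreg s) n = nreg ?s4 d" using d3 vd by auto
    show "creg ?s4 c = iter_op (apply_cpx_op f) (of_nat (cunit f)) (nreg ?s4 v)
        (\<lambda>i. ceval U A (creg ?s4) ((nreg ?s4)(v := i)) b)" using vd by simp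
    show "insert v (cbv b) \<subseteq> {..<d} - {2, 3}" "cfv b \<subseteq> {..<d}"
      using CFold.prems(2,3) by auto
  qed (use CFold.prems(1,5,6) vd rd in auto)
  then obtain s5 where s5: "exec U (cloop f v b d c) ?s4
        (neval A (nreg s) n * (ctime Z b + 5) + 1) s5"
      "creg s5 c = iter_op (apply_cpx_op f) (of_nat (cunit f)) (nreg ?s4 d)
        (\<lambda>i. ceval U A (creg ?s4) ((nreg ?s4)(v := i)) b)"
      "frame (insert v (cbv b)) (d + 1) ?s4 s5" "\<And>r. r < c ==> creg s5 r = creg ?s4 r" by blast
  have "exec U (ccode (CFold f v n b) d c) s (ntime Z n + (1 + (1 + (1 +
      (neval A (nreg s) n * (ctime Z b + 5) + 1) + 1) + 1) + 1) + 1) s5"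
    unfolding ccode.simps
    by (intro exec_Seq[OF s1(1)] exec_Seq[OF exec_simple(1)] exec_Seq[OF exec_simple(5)] s5(1))
  moreover have "neval A (nreg s) n * (ctime Z b + 5) \<le> Z * (ctime Z b + 5)"
    using CFold.prems(8) by (intro mult_right_mono) auto
  ultimately have "exec U (ccode (CFold f v n b) d c) s (ctime Z (CFold f v n b)) s5"
    apply (elim exec_mono) apply (unfold ctime.simps) apply (rule step_count) apply assumption done
  moreover have "frame (cbv (CFold f v n b)) d s s5"
    using F s5(3) CFold.prems unfolding frame_def by auto
  moreover have "creg s5 c = ceval U A (creg s) (nreg s) (CFold f v n b)"
    using s5(2) unfolding d3 cong by simp
  ultimately show ?case using s5(4) c4 by (intro exI[of _ s5]) auto
qed

end

section \<open>Evaluation time as a polynomial in the loop bound\<close>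

lemma poly_bound_add:
  assumes "x \<le> a * Z ^ k" "y \<le> b * Z ^ l" "1 \<le> (Z :: nat)"
  shows "x + y + c \<le> (a + b + c) * Z ^ (k + l)"
proof -
  have "a * Z ^ k \<le> a * Z ^ (k + l)" "b * Z ^ l \<le> b * Z ^ (k + l)" "c * 1 \<le> c * Z ^ (k + l)"
    using assms(3) by (auto intro!: mult_le_mono2 power_increasing one_le_power)
  with assms(1,2) show ?thesis unfolding distrib_right by linarith
qed

lemma poly_bound_loop:
  assumes "x \<le> a * Z ^ k" "y \<le> b * Z ^ l" "1 \<le> (Z :: nat)"
  shows "x + Z * (y + 5) + 10 \<le> (a + (b + 5) + 10) * Z ^ (k + (l + 1))"
proof (rule poly_bound_add[OF assms(1) _ assms(3)])
  have "y + 5 \<le> b * Z ^ l + 5 * Z ^ l" using assms(2,3) one_le_power[OF assms(3), of l] by linarith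
  then have "Z * (y + 5) \<le> Z * (b * Z ^ l + 5 * Z ^ l)" by (rule mult_le_mono2)
  then show "Z * (y + 5) \<le> (b + 5) * Z ^ (l + 1)" by (simp add: algebra_simps)
qed

lemma ntime_poly: "\<exists>a k. \<forall>Z\<ge>1. ntime Z e \<le> a * Z ^ k"
proof (induction e)
  case (NVar r) show ?case by (intro exI[of _ 3] exI[of _ 0]) simp
next
  case (NLit r) show ?case by (intro exI[of _ 1] exI[of _ 0]) simp
next
  case (NBin f x y)
  then show ?case unfolding ntime.simps by (meson poly_bound_add)
next
  case (NArr x)
  then obtain a k where "\<forall>Z\<ge>1. ntime Z x \<le> a * Z ^ k" by auto
  then show ?case using poly_bound_add[of _ a _ k 0 0 0 4]
    by (intro exI[of _ "a + 4"] exI[of _ k]) simp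
next
  case (NFold f v x y)
  then show ?case unfolding ntime.simps by (meson poly_bound_loop)
qed

lemma ctime_poly: "\<exists>a k. \<forall>Z\<ge>1. ctime Z e \<le> a * Z ^ k"
proof (induction e)
  case (CVar r) show ?case by (intro exI[of _ 5] exI[of _ 0]) simp
next
  case (COf x)
  obtain a k where "\<forall>Z\<ge>1. ntime Z x \<le> a * Z ^ k" using ntime_poly by blast
  then show ?case using poly_bound_add[of _ a _ k 0 0 0 2]
    by (intro exI[of _ "a + 2"] exI[of _ k]) simp
next
  case (CBin f x y)
  then show ?case unfolding ctime.simps by (meson poly_bound_add)
next
  case (CUn f x)
  then obtain a k where "\<forall>Z\<ge>1. ctime Z x \<le> a * Z ^ k" by auto
  then show ?case using poly_bound_add[of _ a _ k 0 0 0 2]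
    by (intro exI[of _ "a + 2"] exI[of _ k]) simp
next
  case (CEntry x y)
  show ?case using ntime_poly[of x] ntime_poly[of y] unfolding ctime.simps by (meson poly_bound_add)
next
  case (CFold f v x y)
  then show ?case using ntime_poly[of x] unfolding ctime.simps by (meson poly_bound_loop)
qed

section \<open>Averages over independent finite random variables\<close>

lemma sum_PiE_insert:
  assumes "finite I" "t \<notin> I"
  shows "(\<Sum>f\<in>PiE (insert t I) B. h f) = (\<Sum>k\<in>B t. \<Sum>f\<in>PiE I B. h (f(t := k)))"
proof -
  have "(\<Sum>f\<in>PiE (insert t I) B. h f) = (\<Sum>(k, f)\<in>B t \<times> PiE I B. h (f(t := k)))"
    unfolding PiE_insert_eq
    by (subst sum.reindex[OF inj_combinator[OF assms(2)]]) (simp add: case_prod_unfold)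
  then show ?thesis by (simp add: sum.cartesian_product)
qed

text \<open>Independent copies of a variable uniformly distributed on \<open>g 0, \<dots>, g (q - 1)\<close>.\<close>

definition av :: "nat => (nat => complex) => nat set => ((nat => complex) => 'a) => 'a :: real_normed_field" where
  "av q g I F = (\<Sum>f\<in>PiE I (\<lambda>_. {..<q}). F (\<lambda>l. g (f l))) / of_nat q ^ card I"

lemma av_add: "av q g I (\<lambda>b. F b + G b) = av q g I F + av q g I G"
  by (simp add: av_def sum.distrib add_divide_distrib)

lemma av_cmult: "av q g I (\<lambda>b. c * F b) = c * av q g I F"
  by (simp add: av_def sum_distrib_left[symmetric])

lemma av_sum: "av q g I (\<lambda>b. \<Sum>x\<in>X. F x b) = (\<Sum>x\<in>X. av q g I (F x))"
  unfolding av_def by (subst sum.swap) (simp add: sum_divide_distrib)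

lemma av_const: "finite I ==> 0 < q ==> av q g I (\<lambda>b. c) = c"
  by (simp add: av_def card_PiE)

lemma av_of_real: "av q g I (\<lambda>b. complex_of_real (F b)) = complex_of_real (av q g I F)"
  by (simp add: av_def)

text \<open>The only function on the empty index set is constantly \<open>undefined\<close>. The
  default value is harmless: where an induction ends here, \<open>F\<close> no longer reads any
  coordinate.\<close>

lemma av_empty: "av q g {} F = F (\<lambda>l. g undefined)"
  by (simp add: av_def)

lemma av_insert:
  assumes "finite I" "t \<notin> I"
  shows "av q g (insert t I) F = (\<Sum>k<q. av q g I (\<lambda>b. F (b(t := g k)))) / of_nat q"
proof -
  have "(\<lambda>l. g ((f(t := k)) l)) = (\<lambda>l. g (f l))(t := g k)" for f k by auto
  then show ?thesis
    using assms by (simp add: av_def sum_PiE_insert sum_divide_distrib mult.commute)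
qed

text \<open>The new variable is averaged first, for fixed values of the others; the induction on
  quadratic forms needs this order.\<close>

lemma av_insert':
  assumes "finite I" "t \<notin> I"
  shows "av q g (insert t I) F = av q g I (\<lambda>b. (\<Sum>k<q. F (b(t := g k))) / of_nat q)"
  unfolding av_insert[OF assms] divide_inverse
  by (simp add: av_cmult[symmetric] av_sum mult.commute[of _ "inverse _"] sum_distrib_left)

text \<open>The moments of a complex Gaussian of variance \<open>v\<close> up to order four, with a free fourth
  cumulant: it is \<open>s = v\<^sup>2\<close> for a Gaussian and \<open>s = 0\<close> for a uniform phase.\<close>

locale gauss_like =
  fixes q :: nat and g :: "nat => complex" and v s :: real
  assumes q: "0 < q"
    and m1: "(\<Sum>k<q. g k) = 0"
    and m2: "(\<Sum>k<q. (g k)\<^sup>2) = 0"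
    and m11: "(\<Sum>k<q. g k * cnj (g k)) = of_nat q * of_real v"
    and m21: "(\<Sum>k<q. (g k)\<^sup>2 * cnj (g k)) = 0"
    and m22: "(\<Sum>k<q. (g k * cnj (g k))\<^sup>2) = of_nat q * of_real (v\<^sup>2 + s)"
begin

lemma m_cnj: "(\<Sum>k<q. cnj (g k)) = 0" "(\<Sum>k<q. (cnj (g k))\<^sup>2) = 0"
  "(\<Sum>k<q. g k * (cnj (g k))\<^sup>2) = 0"
proof -
  show "(\<Sum>k<q. cnj (g k)) = 0" using arg_cong[OF m1, of cnj] by simp
  show "(\<Sum>k<q. (cnj (g k))\<^sup>2) = 0" using arg_cong[OF m2, of cnj] by simp
  show "(\<Sum>k<q. g k * (cnj (g k))\<^sup>2) = 0" using arg_cong[OF m21, of cnj] by (simp add: mult.commute)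
qed

text \<open>Expanding the square, only the monomials 1, \<open>g k * cnj (g k)\<close> and its
  square have nonzero mean. Their coefficients recombine into a completed square around
  \<open>c + v * z\<close>, and the free fourth cumulant \<open>s\<close> multiplies
  \<open>z\<close> alone.\<close>

lemma one_variable:
  fixes c y w z :: complex
  shows "(\<Sum>k<q. (cmod (c + g k * y + cnj (g k) * w + g k * cnj (g k) * z))\<^sup>2) / q =
     (cmod (c + v * z))\<^sup>2 + v * ((cmod y)\<^sup>2 + (cmod w)\<^sup>2) + s * (cmod z)\<^sup>2"
proof -
  let ?h = "\<lambda>k. c + g k * y + cnj (g k) * w + g k * cnj (g k) * z"
  have pt: "?h k * cnj (?h k) = c * cnj c + (y * cnj c + c * cnj w) * g k
      + (w * cnj c + c * cnj y) * cnj (g k) + (y * cnj w) * (g k)\<^sup>2 + (w * cnj y) * (cnj (g k))\<^sup>2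
      + (z * cnj c + c * cnj z + y * cnj y + w * cnj w) * (g k * cnj (g k))
      + (y * cnj z + z * cnj w) * ((g k)\<^sup>2 * cnj (g k))
      + (w * cnj z + z * cnj y) * (g k * (cnj (g k))\<^sup>2)
      + z * cnj z * (g k * cnj (g k))\<^sup>2" for k
    by (simp add: algebra_simps power2_eq_square)
  have "(\<Sum>k<q. ?h k * cnj (?h k)) = of_nat q * (c * cnj c
      + (z * cnj c + c * cnj z + y * cnj y + w * cnj w) * v + z * cnj z * (v\<^sup>2 + s))"
    unfolding pt sum.distrib sum_distrib_left[symmetric] m1 m2 m11 m21 m22 m_cnj
    by (simp add: algebra_simps)
  also have "\<dots> = of_nat q * ((c + v * z) * cnj (c + v * z) + v * (y * cnj y + w * cnj w) + s * (z * cnj z))"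
    by (simp add: algebra_simps power2_eq_square)
  finally have "complex_of_real (\<Sum>k<q. (cmod (?h k))\<^sup>2) =
      complex_of_real (q * ((cmod (c + v * z))\<^sup>2 + v * ((cmod y)\<^sup>2 + (cmod w)\<^sup>2) + s * (cmod z)\<^sup>2))"
    by (simp only: of_real_sum of_real_mult of_real_add complex_norm_square of_real_of_nat_eq)
  then show ?thesis using q by (simp only: of_real_eq_iff) simp
qed

lemma av_linear_form:
  fixes y :: "nat => complex"
  shows "finite I ==> av q g I (\<lambda>b. (cmod (c + (\<Sum>l\<in>I. y l * b l)))\<^sup>2) =
    (cmod c)\<^sup>2 + v * (\<Sum>l\<in>I. (cmod (y l))\<^sup>2)"
proof (induction I arbitrary: c rule: finite_induct)
  case empty show ?case by (simp add: av_empty)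
next
  case (insert t I)
  have eq: "c + (\<Sum>l\<in>insert t I. y l * (b(t := g k)) l) = (c + y t * g k) + (\<Sum>l\<in>I. y l * b l)" for b k
    using insert.hyps by (simp add: sum.cong[of I I "\<lambda>l. y l * (b(t := g k)) l" "\<lambda>l. y l * b l"] algebra_simps)
      (intro sum.cong, auto)
  have "av q g (insert t I) (\<lambda>b. (cmod (c + (\<Sum>l\<in>insert t I. y l * b l)))\<^sup>2) =
      (\<Sum>k<q. (cmod (c + y t * g k))\<^sup>2 + v * (\<Sum>l\<in>I. (cmod (y l))\<^sup>2)) / q"
    unfolding av_insert[OF insert.hyps] eq insert.IH by simp
  also have "\<dots> = (\<Sum>k<q. (cmod (c + g k * y t))\<^sup>2) / q + v * (\<Sum>l\<in>I. (cmod (y l))\<^sup>2)"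
    using q by (simp add: sum.distrib add_divide_distrib mult.commute)
  also have "(\<Sum>k<q. (cmod (c + g k * y t))\<^sup>2) / q = (cmod c)\<^sup>2 + v * (cmod (y t))\<^sup>2"
    using one_variable[of c "y t" 0 0] by simp
  finally show ?case using insert.hyps by (simp add: algebra_simps)
qed

lemma av_linear_form_cnj:
  "finite I ==> av q g I (\<lambda>b. (cmod (\<Sum>l\<in>I. y l * cnj (b l)))\<^sup>2) = v * (\<Sum>l\<in>I. (cmod (y l))\<^sup>2)"
proof -
  assume I: "finite I"
  have "cmod (\<Sum>l\<in>I. y l * cnj (b l)) = cmod (0 + (\<Sum>l\<in>I. cnj (y l) * b l))" for b
    using complex_mod_cnj[of "\<Sum>l\<in>I. cnj (y l) * b l"] by simp
  then show ?thesis using av_linear_form[OF I, of 0 "\<lambda>l. cnj (y l)"] by simp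
qed

text \<open>Split off one variable \<open>t\<close>: the form is affine in \<open>b t\<close>, its
  conjugate and its squared modulus, so \<open>one_variable\<close> applies. The diagonal entry
  moves into the constant, and row and column \<open>t\<close> become linear forms in the remaining
  variables, whose averages supply the new off-diagonal squares.\<close>

lemma av_quadratic_form:
  fixes A :: "nat => nat => complex" and a :: complex
  shows "finite I ==> av q g I (\<lambda>b. (cmod (a + (\<Sum>l\<in>I. \<Sum>l'\<in>I. A l l' * (b l * cnj (b l')))))\<^sup>2) =
     (cmod (a + v * (\<Sum>l\<in>I. A l l)))\<^sup>2
     + v\<^sup>2 * (\<Sum>l\<in>I. \<Sum>l'\<in>I - {l}. (cmod (A l l'))\<^sup>2) + s * (\<Sum>l\<in>I. (cmod (A l l))\<^sup>2)"
proof (induction I arbitrary: a rule: finite_induct)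
  case empty show ?case by (simp add: av_empty)
next
  case (insert t I)
  let ?Q = "\<lambda>b. \<Sum>l\<in>I. \<Sum>l'\<in>I. A l l' * (b l * cnj (b l'))"
  let ?y = "\<lambda>b. \<Sum>l\<in>I. A t l * cnj (b l)"
  let ?w = "\<lambda>b. \<Sum>l\<in>I. A l t * b l"
  have eq: "a + (\<Sum>l\<in>insert t I. \<Sum>l'\<in>insert t I. A l l' * ((b(t := g k)) l * cnj ((b(t := g k)) l'))) =
      (a + ?Q b) + g k * ?y b + cnj (g k) * ?w b + g k * cnj (g k) * A t t" for b k
  proof -
    have ne: "l \<noteq> t" if "l \<in> I" for l using that insert.hyps by auto
    have 1: "(\<Sum>l\<in>I. \<Sum>l'\<in>I. A l l' * ((b(t := g k)) l * cnj ((b(t := g k)) l'))) = ?Q b"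
      by (intro sum.cong refl) (simp add: ne)
    have 2: "(\<Sum>l'\<in>I. A t l' * (g k * cnj ((b(t := g k)) l'))) = g k * ?y b"
      unfolding sum_distrib_left by (intro sum.cong refl) (simp add: ne algebra_simps)
    have 3: "(\<Sum>l\<in>I. A l t * ((b(t := g k)) l * cnj (g k))) = cnj (g k) * ?w b"
      unfolding sum_distrib_left by (intro sum.cong refl) (simp add: ne algebra_simps)
    show ?thesis using insert.hyps 1 2 3
      by (simp add: sum.distrib)
  qed
  have "av q g (insert t I) (\<lambda>b. (cmod (a + (\<Sum>l\<in>insert t I. \<Sum>l'\<in>insert t I. A l l' * (b l * cnj (b l')))))\<^sup>2) =
     av q g I (\<lambda>b. (cmod ((a + v * A t t) + ?Q b))\<^sup>2 + v * ((cmod (?y b))\<^sup>2 + (cmod (?w b))\<^sup>2) + s * (cmod (A t t))\<^sup>2)"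
    unfolding av_insert'[OF insert.hyps] eq of_nat_id one_variable by (simp add: algebra_simps)
  also have "\<dots> = (cmod ((a + v * A t t) + v * (\<Sum>l\<in>I. A l l)))\<^sup>2
     + v\<^sup>2 * (\<Sum>l\<in>I. \<Sum>l'\<in>I - {l}. (cmod (A l l'))\<^sup>2) + s * (\<Sum>l\<in>I. (cmod (A l l))\<^sup>2)
     + v * (v * (\<Sum>l\<in>I. (cmod (A t l))\<^sup>2) + v * (\<Sum>l\<in>I. (cmod (A l t))\<^sup>2)) + s * (cmod (A t t))\<^sup>2"
    unfolding av_add av_cmult insert.IH av_linear_form_cnj[OF insert.hyps(1)]
    using av_linear_form[OF insert.hyps(1), of 0 "\<lambda>l. A l t"] insert.hyps(1) q
    by (simp add: av_const)
  also have "\<dots> = (cmod (a + v * (\<Sum>l\<in>insert t I. A l l)))\<^sup>2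
     + v\<^sup>2 * (\<Sum>l\<in>insert t I. \<Sum>l'\<in>insert t I - {l}. (cmod (A l l'))\<^sup>2) + s * (\<Sum>l\<in>insert t I. (cmod (A l l))\<^sup>2)"
  proof -
    have "(\<Sum>l'\<in>insert t I - {l}. (cmod (A l l'))\<^sup>2) = (cmod (A l t))\<^sup>2 + (\<Sum>l'\<in>I - {l}. (cmod (A l l'))\<^sup>2)"
      if "l \<in> I" for l
    proof -
      have "insert t I - {l} = insert t (I - {l})" using that insert.hyps by auto
      then show ?thesis using insert.hyps by simp
    qed
    then have "(\<Sum>l\<in>I. \<Sum>l'\<in>insert t I - {l}. (cmod (A l l'))\<^sup>2) =
        (\<Sum>l\<in>I. (cmod (A l t))\<^sup>2) + (\<Sum>l\<in>I. \<Sum>l'\<in>I - {l}. (cmod (A l l'))\<^sup>2)"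
      by (simp add: sum.distrib)
    moreover have "insert t I - {t} = I" using insert.hyps by auto
    ultimately show ?thesis using insert.hyps by (simp add: algebra_simps power2_eq_square)
  qed
  finally show ?case .
qed

end

section \<open>Finite variables with the moments of a phase and of a Gaussian\<close>

lemma sum_lessThan_4: "(\<Sum>k<4. h k) = h 0 + h 1 + h 2 + h (3 :: nat)"
  by (simp add: numeral_eq_Suc)

text \<open>Values repeat with period four. Fourth roots of unity agree with a uniform phase in all
  moments of degree at most two in the variable and at most two in its conjugate, and
  \<open>gauss_like\<close> asks for no others.\<close>

definition phase :: "real => nat => complex" where
  "phase r k = of_real r * \<i> ^ k"

lemma gauss_like_phase: "gauss_like 4 (phase r) (r\<^sup>2) 0"
proof
  have i3: "\<i> ^ 3 = -\<i>" by (simp add: power3_eq_cube)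
  show "(\<Sum>k<4. phase r k) = 0" by (simp add: sum_lessThan_4 phase_def i3)
  show "(\<Sum>k<4. (phase r k)\<^sup>2) = 0" by (simp add: sum_lessThan_4 phase_def i3 power_mult_distrib)
  show "(\<Sum>k<4. phase r k * cnj (phase r k)) = of_nat 4 * of_real (r\<^sup>2)"
    by (simp add: sum_lessThan_4 phase_def i3 power2_eq_square)
  show "(\<Sum>k<4. (phase r k)\<^sup>2 * cnj (phase r k)) = 0"
    by (simp add: sum_lessThan_4 phase_def i3 power2_eq_square)
  show "(\<Sum>k<4. (phase r k * cnj (phase r k))\<^sup>2) = of_nat 4 * of_real ((r\<^sup>2)\<^sup>2 + 0)"
    by (simp add: sum_lessThan_4 phase_def i3 power2_eq_square)
qed simp

text \<open>A finite substitute for a complex Gaussian of variance \<open>v\<close>: it vanishes with probability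
  one half, which doubles the fourth moment of a uniform phase.\<close>

definition pseudo_gauss :: "real => nat => complex" where
  "pseudo_gauss v k = (if k < 4 then 0 else phase (sqrt (2 * v)) k)"

lemma sum_lessThan_8: "(\<Sum>k<8. h k) = (\<Sum>k<4. h k) + (\<Sum>k<4. h (k + 4 :: nat))"
  by (simp add: numeral_eq_Suc add.assoc)

lemma gauss_like_pseudo_gauss:
  assumes "0 \<le> v" shows "gauss_like 8 (pseudo_gauss v) v (v\<^sup>2)"
proof -
  interpret p: gauss_like 4 "phase (sqrt (2 * v))" "(sqrt (2 * v))\<^sup>2" 0 by (rule gauss_like_phase)
  have 1: "pseudo_gauss v k = 0" if "k < 4" for k using that by (simp add: pseudo_gauss_def)
  have 2: "pseudo_gauss v (k + 4) = phase (sqrt (2 * v)) k" for k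
    by (simp add: pseudo_gauss_def phase_def power_add)
  have 3: "(sqrt (2 * v))\<^sup>2 = 2 * v" using assms by simp
  show ?thesis
  proof
    have sp: "(\<Sum>k<8. h (pseudo_gauss v k)) = (\<Sum>k<4. h (phase (sqrt (2 * v)) k))" if "h 0 = 0"
      for h :: "complex => complex"
      unfolding sum_lessThan_8 2 using that by (simp add: 1)
    show "(\<Sum>k<8. pseudo_gauss v k) = 0" using sp[of "\<lambda>x. x"] p.m1 by simp
    show "(\<Sum>k<8. (pseudo_gauss v k)\<^sup>2) = 0" using sp[of "\<lambda>x. x\<^sup>2"] p.m2 by simp
    show "(\<Sum>k<8. pseudo_gauss v k * cnj (pseudo_gauss v k)) = of_nat 8 * of_real v"
      unfolding sp[of "\<lambda>x. x * cnj x", simplified] p.m11 3 by simp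
    show "(\<Sum>k<8. (pseudo_gauss v k)\<^sup>2 * cnj (pseudo_gauss v k)) = 0"
      using sp[of "\<lambda>x. x\<^sup>2 * cnj x"] p.m21 by simp
    show "(\<Sum>k<8. (pseudo_gauss v k * cnj (pseudo_gauss v k))\<^sup>2) = of_nat 8 * of_real (v\<^sup>2 + v\<^sup>2)"
      using sp[of "\<lambda>x. (x * cnj x)\<^sup>2"] p.m22 3 by (simp add: power2_eq_square)
  qed simp
qed

section \<open>One row of a Haar-random unitary against a Gaussian row\<close>

lemma sum_rotate: "(\<Sum>l\<in>A. \<Sum>p\<in>B. \<Sum>q\<in>C. h l p q) = (\<Sum>p\<in>B. \<Sum>q\<in>C. \<Sum>l\<in>A. h l p q)"
  by (rule trans[OF sum.swap]) (intro sum.cong refl, rule sum.swap)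

text \<open>Parseval over all rows because the columns are orthonormal; restricting to the rows in
  \<open>I\<close> can only lose.\<close>

lemma bessel:
  fixes u :: "nat => nat => complex"
  assumes orth: "\<And>p q. p < N ==> q < N ==> (\<Sum>l<M. u l p * cnj (u l q)) = (if p = q then 1 else 0)"
    and I: "I \<subseteq> {..<M}"
  shows "(\<Sum>l\<in>I. (cmod (\<Sum>p<N. c p * u l p))\<^sup>2) \<le> (\<Sum>p<N. (cmod (c p))\<^sup>2)"
proof -
  have "complex_of_real (\<Sum>l<M. (cmod (\<Sum>p<N. c p * u l p))\<^sup>2) =
      (\<Sum>l<M. \<Sum>p<N. \<Sum>q<N. (c p * u l p) * cnj (c q * u l q))"
    unfolding of_real_sum complex_norm_square cnj_sum sum_product ..
  also have "\<dots> = (\<Sum>p<N. \<Sum>q<N. \<Sum>l<M. (c p * u l p) * cnj (c q * u l q))"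
    by (rule sum_rotate)
  also have "\<dots> = (\<Sum>p<N. \<Sum>q<N. c p * cnj (c q) * (\<Sum>l<M. u l p * cnj (u l q)))"
    by (intro sum.cong refl) (simp add: sum_distrib_left mult_ac)
  also have "\<dots> = (\<Sum>p<N. \<Sum>q<N. if p = q then c p * cnj (c q) else 0)"
    by (intro sum.cong refl) (simp add: orth)
  also have "\<dots> = complex_of_real (\<Sum>p<N. (cmod (c p))\<^sup>2)"
    unfolding of_real_sum complex_norm_square by (intro sum.cong refl) simp
  finally have "(\<Sum>l<M. (cmod (\<Sum>p<N. c p * u l p))\<^sup>2) = (\<Sum>p<N. (cmod (c p))\<^sup>2)"
    by (simp only: of_real_eq_iff)
  moreover have "(\<Sum>l\<in>I. (cmod (\<Sum>p<N. c p * u l p))\<^sup>2) \<le> (\<Sum>l<M. (cmod (\<Sum>p<N. c p * u l p))\<^sup>2)"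
    using I by (intro sum_mono2) auto
  ultimately show ?thesis by simp
qed

text \<open>Cauchy-Schwarz over index pairs: the Frobenius norm of \<open>A\<close> dominates its
  pairing with the rank-one matrix of \<open>x\<close>.\<close>

lemma quadratic_form_bound:
  fixes A :: "nat => nat => complex"
  shows "cmod (\<Sum>p<N. \<Sum>q<N. A p q * (x p * cnj (x q)))
     \<le> sqrt (\<Sum>p<N. \<Sum>q<N. (cmod (A p q))\<^sup>2) * (\<Sum>p<N. (cmod (x p))\<^sup>2)"
proof -
  let ?J = "{..<N} \<times> {..<N}"
  have "cmod (\<Sum>p<N. \<Sum>q<N. A p q * (x p * cnj (x q))) =
      cmod (\<Sum>(p, q)\<in>?J. A p q * (x p * cnj (x q)))" by (simp add: sum.cartesian_product)
  also have "\<dots> \<le> (\<Sum>(p, q)\<in>?J. cmod (A p q) * (cmod (x p) * cmod (x q)))"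
    by (rule order_trans[OF norm_sum]) (simp add: case_prod_unfold norm_mult)
  also have "\<dots> \<le> sqrt ((\<Sum>(p, q)\<in>?J. (cmod (A p q))\<^sup>2) * (\<Sum>(p, q)\<in>?J. (cmod (x p) * cmod (x q))\<^sup>2))"
    using Cauchy_Schwarz_ineq_sum[of "\<lambda>(p, q). cmod (A p q)" "\<lambda>(p, q). cmod (x p) * cmod (x q)" ?J]
    by (intro real_le_rsqrt) (simp add: case_prod_unfold)
  also have "(\<Sum>(p, q)\<in>?J. (cmod (x p) * cmod (x q))\<^sup>2) = (\<Sum>p<N. (cmod (x p))\<^sup>2)\<^sup>2"
    by (simp add: power_mult_distrib power2_eq_square[of "\<Sum>p<N. _ p"] sum_product sum.cartesian_product)
  also have "(\<Sum>(p, q)\<in>?J. (cmod (A p q))\<^sup>2) = (\<Sum>p<N. \<Sum>q<N. (cmod (A p q))\<^sup>2)"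
    by (simp add: sum.cartesian_product)
  finally show ?thesis by (simp add: real_sqrt_mult sum_nonneg)
qed

text \<open>The cross term of the expanded square is split by the inequality between geometric and
  arithmetic mean, so that a small shift costs only a small relative factor.\<close>

lemma shifted_square_bound:
  fixes \<alpha> \<beta> :: complex and \<kappa> F :: real
  assumes "cmod (\<beta> - \<alpha>) \<le> \<kappa> * F" "0 \<le> \<kappa>"
  shows "(cmod \<beta>)\<^sup>2 \<le> (1 + \<kappa>) * (cmod \<alpha>)\<^sup>2 + (\<kappa> + \<kappa>\<^sup>2) * F\<^sup>2"
proof -
  have "cmod \<beta> \<le> cmod \<alpha> + \<kappa> * F"
    using assms(1) norm_triangle_sub[of \<beta> \<alpha>] by linarith
  then have "(cmod \<beta>)\<^sup>2 \<le> (cmod \<alpha> + \<kappa> * F)\<^sup>2" by (intro power_mono) auto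
  also have "\<dots> = (cmod \<alpha>)\<^sup>2 + \<kappa> * (2 * cmod \<alpha> * F) + \<kappa>\<^sup>2 * F\<^sup>2"
    by (simp add: power2_eq_square algebra_simps)
  also have "\<dots> \<le> (cmod \<alpha>)\<^sup>2 + \<kappa> * ((cmod \<alpha>)\<^sup>2 + F\<^sup>2) + \<kappa>\<^sup>2 * F\<^sup>2"
    using assms(2) sum_squares_bound[of "cmod \<alpha>" F] by (intro add_mono mult_left_mono) auto
  finally show ?thesis by (simp add: algebra_simps)
qed

text \<open>In the phases \<open>b\<close> the form has the matrix \<open>B\<close>, the transform
  of \<open>A\<close> by the rows of \<open>u\<close>. Its average sees the trace of
  \<open>B\<close> over \<open>{i..<M}\<close> and the off-diagonal squares; the Gaussian average
  sees the trace of \<open>A\<close> and its Frobenius norm \<open>F\<close>. Orthonormal columns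
  bound the off-diagonal part by \<open>F\<close>. The weighted traces differ through the earlier
  rows, which \<open>small\<close> makes negligible, and through \<open>1 / m\<close> standing
  against \<open>1 / M\<close>.\<close>

lemma haar_row_step:
  fixes u A :: "nat => nat => complex" and a :: complex
  assumes orth: "\<And>p q. p < N ==> q < N ==> (\<Sum>l<M. u l p * cnj (u l q)) = (if p = q then 1 else 0)"
    and i: "i < N" and M: "N ^ 3 + N \<le> M"
    and small: "\<And>l. l < i ==> (\<Sum>p<N. (cmod (u l p))\<^sup>2) \<le> 1 / real N ^ 2"
  defines "f \<equiv> \<lambda>x. (cmod (a + (\<Sum>p<N. \<Sum>q<N. A p q * (x p * cnj (x q)))))\<^sup>2"
  shows "av 4 (phase (1 / sqrt (real (M - i)))) {i..<M} (\<lambda>b. f (\<lambda>p. \<Sum>l\<in>{i..<M}. b l * u l p))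
     \<le> (1 + 15 / real N) * av 8 (pseudo_gauss (1 / real M)) {..<N} f"
proof -
  define m where "m = real (M - i)"
  define v where "v = 1 / real M"
  define F where "F = sqrt (\<Sum>p<N. \<Sum>q<N. (cmod (A p q))\<^sup>2)"
  define B where "B = (\<lambda>l l'. \<Sum>p<N. \<Sum>q<N. A p q * (u l p * cnj (u l' q)))"
  let ?I = "{i..<M}"
  have N: "0 < N" using i by simp
  have "N \<le> M" using M by simp
  have m: "m = real M - real i" "0 < m" "real N ^ 3 \<le> m" "0 < real M"
  proof -
    have "real N ^ 3 + real N \<le> real M" using M by (simp flip: of_nat_power of_nat_add)
    moreover show "m = real M - real i" unfolding m_def using i \<open>N \<le> M\<close> by simp
    moreover have "real i < real N" "0 < real N ^ 3" using i by simp_all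
    ultimately show "0 < m" "real N ^ 3 \<le> m" "0 < real M" by linarith+
  qed
  have F2: "F\<^sup>2 = (\<Sum>p<N. \<Sum>q<N. (cmod (A p q))\<^sup>2)" "0 \<le> F"
    unfolding F_def by (simp_all add: sum_nonneg)
  interpret P: gauss_like 4 "phase (1 / sqrt m)" "1 / m" 0
    using gauss_like_phase[of "1 / sqrt m"] m by (simp add: power_divide)
  interpret G: gauss_like 8 "pseudo_gauss v" v "v\<^sup>2"
    by (rule gauss_like_pseudo_gauss) (simp add: v_def)
  have lhs: "f (\<lambda>p. \<Sum>l\<in>?I. b l * u l p) =
      (cmod (a + (\<Sum>l\<in>?I. \<Sum>l'\<in>?I. B l l' * (b l * cnj (b l')))))\<^sup>2" for b
  proof -
    have "(\<Sum>p<N. \<Sum>q<N. A p q * ((\<Sum>l\<in>?I. b l * u l p) * cnj (\<Sum>l\<in>?I. b l * u l q))) =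
        (\<Sum>p<N. \<Sum>q<N. \<Sum>l\<in>?I. \<Sum>l'\<in>?I. A p q * ((b l * u l p) * cnj (b l' * u l' q)))"
      by (simp only: cnj_sum sum_product) (simp only: sum_distrib_left)
    also have "\<dots> = (\<Sum>p<N. \<Sum>l\<in>?I. \<Sum>l'\<in>?I. \<Sum>q<N. A p q * ((b l * u l p) * cnj (b l' * u l' q)))"
      by (rule sum.cong[OF refl]) (rule sum_rotate)
    also have "\<dots> = (\<Sum>l\<in>?I. \<Sum>l'\<in>?I. \<Sum>p<N. \<Sum>q<N. A p q * ((b l * u l p) * cnj (b l' * u l' q)))"
      by (rule sum_rotate)
    also have "\<dots> = (\<Sum>l\<in>?I. \<Sum>l'\<in>?I. B l l' * (b l * cnj (b l')))"
      unfolding B_def sum_distrib_right by (intro sum.cong refl) (simp add: mult_ac)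
    finally show ?thesis unfolding f_def by simp
  qed
  \<comment> \<open>Bessel's inequality is used twice, once for each index of
    \<open>B\<close>.\<close>
  have diag: "(\<Sum>l\<in>?I. \<Sum>l'\<in>?I - {l}. (cmod (B l l'))\<^sup>2) \<le> F\<^sup>2"
  proof -
    have "(\<Sum>l\<in>?I. \<Sum>l'\<in>?I - {l}. (cmod (B l l'))\<^sup>2) \<le> (\<Sum>l\<in>?I. \<Sum>l'\<in>?I. (cmod (B l l'))\<^sup>2)"
      by (intro sum_mono sum_mono2) auto
    also have "\<dots> = (\<Sum>l'\<in>?I. \<Sum>l\<in>?I. (cmod (\<Sum>p<N. (\<Sum>q<N. A p q * cnj (u l' q)) * u l p))\<^sup>2)"
      unfolding B_def sum_distrib_right by (subst sum.swap) (intro sum.cong refl, simp add: mult_ac)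
    also have "\<dots> \<le> (\<Sum>l'\<in>?I. \<Sum>p<N. (cmod (\<Sum>q<N. A p q * cnj (u l' q)))\<^sup>2)"
      by (intro sum_mono bessel[OF orth]) auto
    also have "\<dots> = (\<Sum>p<N. \<Sum>l'\<in>?I. (cmod (\<Sum>q<N. cnj (A p q) * u l' q))\<^sup>2)"
    proof (subst sum.swap, intro sum.cong refl)
      fix p l' show "(cmod (\<Sum>q<N. A p q * cnj (u l' q)))\<^sup>2 = (cmod (\<Sum>q<N. cnj (A p q) * u l' q))\<^sup>2"
        using complex_mod_cnj[of "\<Sum>q<N. A p q * cnj (u l' q)"] by simp
    qed
    also have "\<dots> \<le> (\<Sum>p<N. \<Sum>q<N. (cmod (cnj (A p q)))\<^sup>2)"
      by (intro sum_mono bessel[OF orth]) auto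
    finally show ?thesis unfolding F2 by simp
  qed
  \<comment> \<open>Over all rows the trace of \<open>B\<close> is that of \<open>A\<close>; the
    rows before \<open>i\<close> are fixed and do not take part in the mixture.\<close>
  have tr: "(\<Sum>l\<in>?I. B l l) = (\<Sum>p<N. A p p) - (\<Sum>l<i. B l l)"
  proof -
    have "(\<Sum>l<M. B l l) = (\<Sum>p<N. \<Sum>q<N. A p q * (\<Sum>l<M. u l p * cnj (u l q)))"
      unfolding B_def sum_distrib_left by (rule sum_rotate)
    also have "\<dots> = (\<Sum>p<N. \<Sum>q<N. if p = q then A p q else 0)"
      by (intro sum.cong refl) (simp add: orth)
    also have "\<dots> = (\<Sum>p<N. A p p)" by simp
    finally have "(\<Sum>l<M. B l l) = (\<Sum>p<N. A p p)" .
    moreover have split: "{..<M} = {..<i} \<union> ?I" using i \<open>N \<le> M\<close> by auto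
    have "(\<Sum>l<M. B l l) = (\<Sum>l<i. B l l) + (\<Sum>l\<in>?I. B l l)"
      unfolding split by (rule sum.union_disjoint) auto
    ultimately show ?thesis by (simp add: eq_diff_eq add.commute)
  qed
  have Bl: "cmod (\<Sum>l<i. B l l) \<le> F / real N"
  proof -
    have "cmod (B l l) \<le> F * (1 / real N ^ 2)" if "l < i" for l
    proof -
      have "cmod (B l l) \<le> F * (\<Sum>p<N. (cmod (u l p))\<^sup>2)"
        unfolding B_def F_def by (rule quadratic_form_bound)
      also have "\<dots> \<le> F * (1 / real N ^ 2)" using small[OF that] F2 by (intro mult_left_mono) auto
      finally show ?thesis .
    qed
    then have "cmod (\<Sum>l<i. B l l) \<le> (\<Sum>l<i. F * (1 / real N ^ 2))"
      by (intro order_trans[OF norm_sum] sum_mono) auto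
    also have "\<dots> = real i * (F * (1 / real N ^ 2))" by simp
    also have "\<dots> \<le> real N * (F * (1 / real N ^ 2))"
      using i F2 by (intro mult_right_mono) auto
    finally show ?thesis using N by (simp add: power2_eq_square)
  qed
  have trA: "cmod (\<Sum>p<N. A p p) \<le> real N * F"
  proof -
    have "cmod (A p p) \<le> F" if "p < N" for p
    proof -
      have "(cmod (A p p))\<^sup>2 \<le> (\<Sum>q<N. (cmod (A p q))\<^sup>2)"
        using that by (intro member_le_sum) auto
      also have "\<dots> \<le> F\<^sup>2" unfolding F2
        using that by (intro member_le_sum[of p "{..<N}" "\<lambda>p. \<Sum>q<N. (cmod (A p q))\<^sup>2"]) (auto intro: sum_nonneg)
      finally show ?thesis using F2(2) by (rule power2_le_imp_le)
    qed
    then have "cmod (\<Sum>p<N. A p p) \<le> (\<Sum>p<N. F)" by (intro order_trans[OF norm_sum] sum_mono) auto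
    then show ?thesis by simp
  qed
  have ratio: "real M / m \<le> 1 + 1 / real N"
  proof -
    have "real M / m = 1 + real i / m" using m by (simp add: field_simps)
    also have "real i / m \<le> real N / real N ^ 3" using i m N by (intro frac_le) auto
    also have "\<dots> \<le> 1 / real N" using N by (simp add: field_simps power3_eq_cube)
    finally show ?thesis by simp
  qed
  \<comment> \<open>One share of \<open>1 / N\<close> comes from replacing \<open>1 / m\<close> by
    \<open>1 / M\<close> in front of the trace of \<open>A\<close>, two come from the missing
    diagonal entries, where \<open>M / m \<le> 2\<close>.\<close>
  define \<kappa> where "\<kappa> = 3 / real N"
  define \<alpha> where "\<alpha> = a + v * (\<Sum>p<N. A p p)"
  define \<beta> where "\<beta> = a + (1 / m) * (\<Sum>l\<in>?I. B l l)"
  have shift: "cmod (\<beta> - \<alpha>) \<le> \<kappa> * (v * F)"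
  proof -
    have c: "1 / m - v = (real i / m) * v" unfolding v_def using m by (simp add: field_simps)
    have "\<beta> - \<alpha> = complex_of_real (1 / m - v) * (\<Sum>p<N. A p p) - complex_of_real (1 / m) * (\<Sum>l<i. B l l)"
      unfolding \<beta>_def \<alpha>_def tr by (simp add: algebra_simps)
    also have "cmod \<dots> \<le> cmod (complex_of_real (1 / m - v) * (\<Sum>p<N. A p p)) + cmod (complex_of_real (1 / m) * (\<Sum>l<i. B l l))"
      by (rule norm_triangle_ineq4)
    also have "\<dots> \<le> (real i / m) * v * (real N * F) + (1 / m) * (F / real N)"
      unfolding c norm_mult norm_of_real using m trA Bl v_def by (intro add_mono mult_mono) auto
    also have "\<dots> = ((real i * real N / m) + (real M / m) / real N) * (v * F)"
      unfolding v_def using m by (simp add: field_simps)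
    also have "\<dots> \<le> (1 / real N + 2 / real N) * (v * F)"
    proof (intro mult_right_mono add_mono)
      have "real i * real N / m \<le> real N * real N / real N ^ 3" using i m N by (intro frac_le mult_mono) auto
      also have "\<dots> = 1 / real N" using N by (simp add: field_simps power3_eq_cube)
      finally show "real i * real N / m \<le> 1 / real N" .
      have "1 / real N \<le> 1" using N by simp
      then have "real M / m \<le> 2" using ratio by linarith
      then show "real M / m / real N \<le> 2 / real N" by (intro divide_right_mono) auto
    qed (use F2 v_def in auto)
    finally show ?thesis by (simp add: \<kappa>_def)
  qed
  have \<kappa>: "0 \<le> \<kappa>" "\<kappa>\<^sup>2 \<le> 9 / real N"
  proof -
    have "real N \<le> real N ^ 2" using N by (simp add: self_le_power)
    then show "\<kappa>\<^sup>2 \<le> 9 / real N" unfolding \<kappa>_def power_divide using N by (simp add: frac_le)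
  qed (simp add: \<kappa>_def)
  have "av 4 (phase (1 / sqrt m)) ?I (\<lambda>b. f (\<lambda>p. \<Sum>l\<in>?I. b l * u l p)) =
      (cmod \<beta>)\<^sup>2 + (1 / m)\<^sup>2 * (\<Sum>l\<in>?I. \<Sum>l'\<in>?I - {l}. (cmod (B l l'))\<^sup>2)"
    unfolding lhs \<beta>_def by (subst P.av_quadratic_form) simp_all
  also have "\<dots> \<le> ((1 + \<kappa>) * (cmod \<alpha>)\<^sup>2 + (\<kappa> + \<kappa>\<^sup>2) * (v * F)\<^sup>2) + (1 + 3 / real N) * (v * F)\<^sup>2"
  proof (intro add_mono shifted_square_bound[OF shift \<kappa>(1)])
    have "(1 / m)\<^sup>2 * (\<Sum>l\<in>?I. \<Sum>l'\<in>?I - {l}. (cmod (B l l'))\<^sup>2) \<le> (1 / m)\<^sup>2 * F\<^sup>2"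
      by (intro mult_left_mono diag) auto
    also have "\<dots> = (real M / m)\<^sup>2 * (v * F)\<^sup>2" unfolding v_def using m by (simp add: field_simps)
    also have "(real M / m)\<^sup>2 \<le> (1 + 1 / real N)\<^sup>2" using ratio m by (intro power_mono) auto
    also have "(1 + 1 / real N)\<^sup>2 \<le> 1 + 3 / real N"
    proof -
      have "1 / real N * (1 / real N) \<le> 1 / real N * 1" using N by (intro mult_left_mono) auto
      then show ?thesis by (simp add: power2_eq_square algebra_simps)
    qed
    finally show "(1 / m)\<^sup>2 * (\<Sum>l\<in>?I. \<Sum>l'\<in>?I - {l}. (cmod (B l l'))\<^sup>2) \<le> (1 + 3 / real N) * (v * F)\<^sup>2"
      by (simp add: mult_right_mono)
  qed
  \<comment> \<open>The constant is 3 + 9 + 3: from \<open>\<kappa>\<close>, from its square, and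
    from the squared ratio \<open>M / m\<close>.\<close>
  also have "\<dots> \<le> (1 + 15 / real N) * ((cmod \<alpha>)\<^sup>2 + (v * F)\<^sup>2)"
  proof -
    have "(1 + \<kappa>) * (cmod \<alpha>)\<^sup>2 \<le> (1 + 15 / real N) * (cmod \<alpha>)\<^sup>2"
      by (intro mult_right_mono) (auto simp: \<kappa>_def divide_right_mono)
    moreover have "(\<kappa> + \<kappa>\<^sup>2 + (1 + 3 / real N)) * (v * F)\<^sup>2 \<le> (1 + 15 / real N) * (v * F)\<^sup>2"
    proof (intro mult_right_mono)
      have "15 / real N = 3 / real N + 9 / real N + 3 / real N" by simp
      then show "\<kappa> + \<kappa>\<^sup>2 + (1 + 3 / real N) \<le> 1 + 15 / real N" using \<kappa>(2) unfolding \<kappa>_def by linarith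
    qed simp
    ultimately show ?thesis by (simp add: algebra_simps)
  qed
  also have "(cmod \<alpha>)\<^sup>2 + (v * F)\<^sup>2 = av 8 (pseudo_gauss v) {..<N} f"
  proof -
    have "(\<Sum>q<N. (cmod (A p q))\<^sup>2) = (cmod (A p p))\<^sup>2 + (\<Sum>q\<in>{..<N} - {p}. (cmod (A p q))\<^sup>2)" if "p < N" for p
      using that by (subst sum.remove[of _ p]) auto
    then have "F\<^sup>2 = (\<Sum>p<N. (cmod (A p p))\<^sup>2) + (\<Sum>p<N. \<Sum>q\<in>{..<N} - {p}. (cmod (A p q))\<^sup>2)"
      unfolding F2 by (simp add: sum.distrib)
    then show ?thesis unfolding f_def \<alpha>_def
      by (subst G.av_quadratic_form) (simp_all add: algebra_simps power_mult_distrib)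
  qed
  finally show ?thesis unfolding m_def v_def .
qed

section \<open>The homogeneous chaos of a squared permanent\<close>

lemma sum_pair_delta:
  fixes N :: nat
  assumes "p < N" "q < N"
  shows "(\<Sum>l<N. \<Sum>l'<N. (if l = p \<and> l' = q then c else 0) * y l l') = c * (y p q :: 'a :: comm_ring_1)"
proof -
  have "(\<Sum>l'<N. (if l = p \<and> l' = q then c else 0) * y l l') = (if l = p then c * y p q else 0)" for l
  proof -
    have "(\<Sum>l'<N. (if l = p \<and> l' = q then c else 0) * y l l') =
        (\<Sum>l'<N. if l' = q then (if l = p then c * y p q else 0) else 0)"
      by (intro sum.cong) auto
    then show ?thesis using assms by simp
  qed
  then show ?thesis using assms by simp
qed

context gauss_like
begin

text \<open>The trace produced by the quadratic form cancels the centring, so centred monomials have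
  mean zero and are orthogonal to each other. The condition \<open>s = v\<^sup>2\<close> gives
  diagonal monomials the same variance as off-diagonal ones.\<close>

lemma av_two_monomials:
  fixes a c d :: complex
  assumes s: "s = v\<^sup>2" and pq: "p < N" "q' < N" "p' < N" "q'' < N" "(p, q') \<noteq> (p', q'')"
  defines "w \<equiv> \<lambda>p q b. b p * cnj (b q) - (if p = q then complex_of_real v else 0)"
  shows "av q g {..<N} (\<lambda>b. (cmod (a + c * w p q' b + d * w p' q'' b))\<^sup>2)
    = (cmod a)\<^sup>2 + v\<^sup>2 * ((cmod c)\<^sup>2 + (cmod d)\<^sup>2)"
proof -
  define A where "A = (\<lambda>l l'. (if l = p \<and> l' = q' then c else 0) + (if l = p' \<and> l' = q'' then d else 0))"
  have lin: "(\<Sum>l<N. \<Sum>l'<N. A l l' * y l l') = c * y p q' + d * y p' q''" for y :: "nat => nat => complex"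
    unfolding A_def distrib_right sum.distrib using pq by (simp add: sum_pair_delta)
  have tr: "(\<Sum>l<N. A l l) = (if p = q' then c else 0) + (if p' = q'' then d else 0)"
  proof -
    have "(\<Sum>l<N. A l l) = (\<Sum>l<N. \<Sum>l'<N. A l l' * (if l' = l then 1 else 0))"
    proof (intro sum.cong refl)
      fix l assume "l \<in> {..<N}"
      moreover have "(\<Sum>l'<N. A l l' * (if l' = l then 1 else 0)) = (\<Sum>l'<N. if l' = l then A l l' else 0)"
        by (intro sum.cong) auto
      ultimately show "A l l = (\<Sum>l'<N. A l l' * (if l' = l then 1 else 0))" by simp
    qed
    also have "\<dots> = (if p = q' then c else 0) + (if p' = q'' then d else 0)" unfolding lin by simp
    finally show ?thesis .
  qed
  have sq: "(\<Sum>l<N. \<Sum>l'<N. (cmod (A l l'))\<^sup>2) = (cmod c)\<^sup>2 + (cmod d)\<^sup>2"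
  proof -
    have "(cmod (A l l'))\<^sup>2 = (if l = p \<and> l' = q' then (cmod c)\<^sup>2 else 0) * 1
        + (if l = p' \<and> l' = q'' then (cmod d)\<^sup>2 else 0) * 1" for l l'
      using pq(5) by (auto simp: A_def)
    then show ?thesis using pq by (simp only: sum.distrib sum_pair_delta)
  qed
  have "(\<Sum>l'<N. (cmod (A l l'))\<^sup>2) = (cmod (A l l))\<^sup>2 + (\<Sum>l'\<in>{..<N} - {l}. (cmod (A l l'))\<^sup>2)" if "l < N" for l
    using that by (subst sum.remove[of _ l]) auto
  then have split: "(\<Sum>l<N. \<Sum>l'<N. (cmod (A l l'))\<^sup>2) =
      (\<Sum>l<N. (cmod (A l l))\<^sup>2) + (\<Sum>l<N. \<Sum>l'\<in>{..<N} - {l}. (cmod (A l l'))\<^sup>2)"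
    by (simp add: sum.distrib)
  have "a + c * w p q' b + d * w p' q'' b =
      (a - v * (\<Sum>l<N. A l l)) + (\<Sum>l<N. \<Sum>l'<N. A l l' * (b l * cnj (b l')))" for b
    unfolding lin tr w_def by (simp add: algebra_simps)
  note eq = this
  have "av q g {..<N} (\<lambda>b. (cmod (a + c * w p q' b + d * w p' q'' b))\<^sup>2) =
      (cmod a)\<^sup>2 + v\<^sup>2 * (\<Sum>l<N. \<Sum>l'<N. (cmod (A l l'))\<^sup>2)"
    unfolding split eq by (subst av_quadratic_form) (simp_all add: s algebra_simps)
  then show ?thesis unfolding sq .
qed

end

lemma av_Re: "Re (av q g I F) = av q g I (\<lambda>b. Re (F b))"
proof -
  have "complex_of_nat q ^ card I = complex_of_real (real q ^ card I)" by simp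
  then show ?thesis unfolding av_def by (simp only: Re_divide_of_real Re_sum of_nat_power)
qed

lemma av_Im: "Im (av q g I F) = av q g I (\<lambda>b. Im (F b))"
proof -
  have "complex_of_nat q ^ card I = complex_of_real (real q ^ card I)" by simp
  then show ?thesis unfolding av_def by (simp only: Im_divide_of_real Im_sum of_nat_power)
qed

lemma cmod_add_square: "(cmod (a + b))\<^sup>2 = (cmod a)\<^sup>2 + (cmod b)\<^sup>2 + 2 * Re (a * cnj b)"
  unfolding cmod_power2 by (simp add: power2_eq_square algebra_simps)

text \<open>The two kinds of factors in the expansion of a squared permanent: the centred part of
  \<open>x\<^sub>p cnj x\<^sub>q\<close> and its expectation.\<close>

definition fac :: "real => bool => (nat => complex) => nat => nat => complex" where
  "fac v c x p q = (if c then x p * cnj (x q) - (if p = q then complex_of_real v else 0)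
                    else if p = q then complex_of_real v else 0)"

text \<open>Inner products are recovered from squared norms by polarisation, with coefficients 1 and
  \<open>\<i>\<close> for the real and imaginary parts.\<close>

lemma fac_orthogonal:
  assumes v: "0 \<le> v" and pq: "p < N" "q < N" "p' < N" "q' < N"
  shows "av 8 (pseudo_gauss v) {..<N} (\<lambda>x. fac v c x p q * cnj (fac v c' x p' q')) =
    (if c = c' \<and> (if c then p = p' \<and> q = q' else p = q \<and> p' = q') then complex_of_real (v\<^sup>2) else 0)"
proof -
  interpret gauss_like 8 "pseudo_gauss v" v "v\<^sup>2" by (rule gauss_like_pseudo_gauss[OF v])
  let ?av = "av 8 (pseudo_gauss v) {..<N}"
  let ?w = "\<lambda>p q x. fac v True x p q"
  note two = av_two_monomials[OF refl, of p N q p' q', folded fac_def[of v True, simplified]]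
  have sq: "?av (\<lambda>x. (cmod (a + c * ?w p q x))\<^sup>2) = (cmod a)\<^sup>2 + v\<^sup>2 * (cmod c)\<^sup>2"
    if "p < N" "q < N" for a c :: complex and p q
  \<comment> \<open>\<open>av_two_monomials\<close> asks for a second index pair, supplied here with
    coefficient 0; for \<open>N = 1\<close> there is none.\<close>
  proof (cases "N = 1")
    case True
    then have [simp]: "p = 0" "q = 0" using that by auto
    have eq: "(\<lambda>x. (cmod (a + c * ?w p q x))\<^sup>2) =
        (\<lambda>b. (cmod (a - c * v + (\<Sum>l\<in>{..<1}. \<Sum>l'\<in>{..<1}. c * (b l * cnj (b l')))))\<^sup>2)"
      by (auto simp: fac_def algebra_simps)
    show ?thesis unfolding True eq by (subst av_quadratic_form) (simp_all add: mult.commute)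
  next
    case False
    define r where "r = (if p = 0 then 1 else 0 :: nat)"
    have "r < N" "q < N" "(p, q) \<noteq> (r, q)" using that False by (auto simp: r_def)
    from av_two_monomials[OF refl that this, of a c 0] show ?thesis by (simp add: fac_def)
  qed
  have mean: "?av (\<lambda>x. ?w p q x) = 0" if "p < N" "q < N" for p q
  proof -
    \<comment> \<open>The averaged square of \<open>a + w\<close> has no cross term for any constant
      \<open>a\<close>, so the centred monomial \<open>w\<close> has mean zero.\<close>
    have "2 * ?av (\<lambda>x. Re (a * cnj (?w p q x))) = 0" for a
    proof -
      have "?av (\<lambda>x. (cmod (a + 1 * ?w p q x))\<^sup>2) =
          ?av (\<lambda>x. (cmod a)\<^sup>2 + (cmod (0 + 1 * ?w p q x))\<^sup>2 + 2 * Re (a * cnj (?w p q x)))"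
        by (simp only: cmod_add_square) simp
      then show ?thesis unfolding sq[OF that] av_add av_cmult by (simp add: av_const)
    qed
    from this[of 1] this[of \<i>] show ?thesis by (simp add: complex_eq_iff av_Re av_Im)
  qed
  have diag: "?av (\<lambda>x. ?w p q x * cnj (?w p q x)) = complex_of_real (v\<^sup>2)" if "p < N" "q < N" for p q
    using sq[OF that, of 0 1] unfolding complex_norm_square[symmetric] av_of_real by simp
  have off: "?av (\<lambda>x. ?w p q x * cnj (?w p' q' x)) = 0" if "(p, q) \<noteq> (p', q')"
  proof -
    have "2 * ?av (\<lambda>x. Re (?w p q x * cnj (c * ?w p' q' x))) = 0" if "cmod c = 1" for c
    proof -
      have "(cmod (0 + 1 * ?w p q x + c * ?w p' q' x))\<^sup>2 = (cmod (0 + 1 * ?w p q x))\<^sup>2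
          + (cmod (0 + c * ?w p' q' x))\<^sup>2 + 2 * Re (?w p q x * cnj (c * ?w p' q' x))" for x
        using cmod_add_square[of "?w p q x" "c * ?w p' q' x"] by simp
      then have "?av (\<lambda>x. (cmod (0 + 1 * ?w p q x + c * ?w p' q' x))\<^sup>2) =
          ?av (\<lambda>x. (cmod (0 + 1 * ?w p q x))\<^sup>2 + (cmod (0 + c * ?w p' q' x))\<^sup>2
            + 2 * Re (?w p q x * cnj (c * ?w p' q' x)))" by (simp only:)
      also have "?av (\<lambda>x. (cmod (0 + 1 * ?w p q x + c * ?w p' q' x))\<^sup>2) = v\<^sup>2 * (1 + 1)"
        using av_two_monomials[OF refl pq \<open>(p, q) \<noteq> (p', q')\<close>, of 0 1 c] that by (simp add: fac_def)
      finally show ?thesis unfolding av_add av_cmult using that by (simp only: sq pq) simp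
    qed
    from this[of 1] this[of \<i>] show ?thesis by (simp add: complex_eq_iff av_Re av_Im algebra_simps)
  qed
  have const: "fac v False x p q = (if p = q then complex_of_real v else 0)" for x p q by (simp add: fac_def)
  have mean': "?av (\<lambda>x. cnj (?w p' q' x)) = 0"
  proof -
    have "?av (\<lambda>x. cnj (?w p' q' x)) = cnj (?av (\<lambda>x. ?w p' q' x))" by (simp add: av_def)
    then show ?thesis using mean[OF pq(3,4)] by simp
  qed
  show ?thesis
  proof (cases c; cases c')
    assume "c" "c'"
    then show ?thesis using diag[OF pq(1,2)] off by auto
  next
    assume "c" "\<not> c'"
    then have "?av (\<lambda>x. fac v c x p q * cnj (fac v c' x p' q')) =
       ?av (\<lambda>x. cnj (if p' = q' then complex_of_real v else 0) * ?w p q x)"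
      by (simp add: const mult.commute)
    then show ?thesis using \<open>c\<close> \<open>\<not> c'\<close> mean[OF pq(1,2)] unfolding av_cmult by simp
  next
    assume "\<not> c" "c'"
    then have "?av (\<lambda>x. fac v c x p q * cnj (fac v c' x p' q')) =
       ?av (\<lambda>x. (if p = q then complex_of_real v else 0) * cnj (?w p' q' x))"
      by (simp add: const)
    then show ?thesis using \<open>\<not> c\<close> \<open>c'\<close> mean' unfolding av_cmult by simp
  next
    assume "\<not> c" "\<not> c'"
    then show ?thesis by (simp add: const av_const power2_eq_square)
  qed
qed

section \<open>Permutations and the homogeneous chaos\<close>

definition perms :: "nat => (nat => nat) set" where
  "perms N = {\<sigma>. \<sigma> permutes {..<N}}"

lemma finite_perms [simp]: "finite (perms N)"
  unfolding perms_def by (rule finite_permutations) simp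

lemma card_perms: "card (perms N) = fact N"
  unfolding perms_def by (rule card_permutations) auto

lemma perms_less: "\<sigma> \<in> perms N ==> i < N ==> \<sigma> i < N"
  unfolding perms_def using permutes_in_image[of \<sigma> "{..<N}" i] by auto

text \<open>Such \<open>\<tau>\<close> are exactly the \<open>\<sigma> \<circ> \<pi>\<close> with
  \<open>\<pi>\<close> permuting \<open>S\<close>.\<close>

lemma card_perms_agree:
  assumes \<sigma>: "\<sigma> \<in> perms N" and S: "S \<subseteq> {..<N}"
  shows "card {\<tau> \<in> perms N. \<forall>i\<in>{..<N} - S. \<tau> i = \<sigma> i} = fact (card S)"
proof -
  have \<sigma>': "\<sigma> permutes {..<N}" using \<sigma> by (simp add: perms_def)
  have "{\<tau> \<in> perms N. \<forall>i\<in>{..<N} - S. \<tau> i = \<sigma> i} = (\<lambda>\<pi>. \<sigma> \<circ> \<pi>) ` {\<pi>. \<pi> permutes S}"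
  proof (intro equalityI subsetI)
    fix \<tau> assume "\<tau> \<in> {\<tau> \<in> perms N. \<forall>i\<in>{..<N} - S. \<tau> i = \<sigma> i}"
    then have \<tau>: "\<tau> permutes {..<N}" "\<And>i. i \<in> {..<N} - S ==> \<tau> i = \<sigma> i" by (auto simp: perms_def)
    let ?\<pi> = "inv_into UNIV \<sigma> \<circ> \<tau>"
    have "?\<pi> permutes {..<N}" using \<tau>(1) \<sigma>' permutes_compose permutes_inv by blast
    moreover have "?\<pi> i = i" if "i \<in> {..<N} - S" for i
      using \<tau>(2)[OF that] \<sigma>' by (simp add: permutes_inverses(2))
    ultimately have "?\<pi> permutes S" by (rule permutes_superset) 
    moreover have "\<sigma> \<circ> ?\<pi> = \<tau>" using \<sigma>' by (auto simp: fun_eq_iff permutes_inverses(1))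
    ultimately show "\<tau> \<in> (\<lambda>\<pi>. \<sigma> \<circ> \<pi>) ` {\<pi>. \<pi> permutes S}" by (metis (mono_tags) image_eqI mem_Collect_eq)
  next
    fix \<tau> assume "\<tau> \<in> (\<lambda>\<pi>. \<sigma> \<circ> \<pi>) ` {\<pi>. \<pi> permutes S}"
    then obtain \<pi> where \<pi>: "\<tau> = \<sigma> \<circ> \<pi>" "\<pi> permutes S" by auto
    have "\<pi> permutes {..<N}" using \<pi>(2) S by (rule permutes_subset)
    then show "\<tau> \<in> {\<tau> \<in> perms N. \<forall>i\<in>{..<N} - S. \<tau> i = \<sigma> i}"
      using \<pi> \<sigma>' by (auto simp: perms_def permutes_compose permutes_not_in)
  qed
  moreover have "inj_on (\<lambda>\<pi>. \<sigma> \<circ> \<pi>) {\<pi>. \<pi> permutes S}"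
    using permutes_inj[OF \<sigma>'] by (auto simp: inj_on_def fun_eq_iff inj_def)
  ultimately have "card {\<tau> \<in> perms N. \<forall>i\<in>{..<N} - S. \<tau> i = \<sigma> i} = card {\<pi>. \<pi> permutes S}"
    by (simp add: card_image)
  also have "\<dots> = fact (card S)" using S finite_subset by (intro card_permutations) auto
  finally show ?thesis .
qed

definition subsets :: "nat => nat => nat set set" where
  "subsets N j = {S. S \<subseteq> {..<N} \<and> card S = j}"

lemma finite_subsets [simp]: "finite (subsets N j)"
  unfolding subsets_def by (rule finite_subset[of _ "Pow {..<N}"]) auto

lemma card_subsets: "card (subsets N j) = N choose j"
  unfolding subsets_def using n_subsets[of "{..<N}" j] by simp

definition chaos :: "nat => real => nat => (nat => nat => complex) => complex" where
  "chaos N v j X = (\<Sum>\<sigma>\<in>perms N. \<Sum>\<tau>\<in>perms N. \<Sum>S\<in>subsets N j. \<Prod>i<N. fac v (i \<in> S) (X i) (\<sigma> i) (\<tau> i))"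

text \<open>Averages the last \<open>d\<close> rows of a matrix with \<open>N\<close> rows.\<close>

primrec row_av :: "nat => real => ((nat => nat => complex) => 'a) => nat => (nat => nat => complex) => 'a :: real_normed_field" where
  "row_av N v F 0 = F"
| "row_av N v F (Suc d) = (\<lambda>X. av 8 (pseudo_gauss v) {..<N} (\<lambda>x. row_av N v F d (X(N - Suc d := x))))"

lemma row_av_sum: "row_av N v (\<lambda>X. \<Sum>t\<in>T. F t X) d = (\<lambda>X. \<Sum>t\<in>T. row_av N v (F t) d X)"
  by (induction d) (simp_all add: av_sum)

lemma row_av_of_real: "row_av N v (\<lambda>X. complex_of_real (F X)) d = (\<lambda>X. complex_of_real (row_av N v F d X))"
  by (induction d) (simp_all add: av_of_real)

text \<open>Rows are independent, so a product over rows averages factor by factor.\<close>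

lemma row_av_prod:
  "d \<le> N ==> row_av N v (\<lambda>X. \<Prod>i<N. \<phi> i (X i)) d =
    (\<lambda>X. (\<Prod>i<N - d. \<phi> i (X i)) * (\<Prod>i\<in>{N - d..<N}. av 8 (pseudo_gauss v) {..<N} (\<phi> i)))"
proof (induction d)
  case (Suc d)
  let ?a = "\<lambda>i. av 8 (pseudo_gauss v) {..<N} (\<phi> i)"
  have e: "N - d = Suc (N - Suc d)" using Suc.prems by simp
  have step: "(\<Prod>i<N - d. \<phi> i ((X(N - Suc d := x)) i)) = (\<Prod>i<N - Suc d. \<phi> i (X i)) * \<phi> (N - Suc d) x" for X x
    unfolding e prod.lessThan_Suc by (simp cong: prod.cong_simp)
  have "row_av N v (\<lambda>X. \<Prod>i<N. \<phi> i (X i)) (Suc d) X =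
      ((\<Prod>i<N - Suc d. \<phi> i (X i)) * (\<Prod>i\<in>{N - d..<N}. ?a i)) * ?a (N - Suc d)" for X
  proof -
    have "(\<lambda>x. (\<Prod>i<N - Suc d. \<phi> i (X i)) * \<phi> (N - Suc d) x * (\<Prod>i\<in>{N - d..<N}. ?a i)) =
        (\<lambda>x. ((\<Prod>i<N - Suc d. \<phi> i (X i)) * (\<Prod>i\<in>{N - d..<N}. ?a i)) * \<phi> (N - Suc d) x)"
      by (simp add: mult_ac)
    moreover have "row_av N v (\<lambda>X. \<Prod>i<N. \<phi> i (X i)) (Suc d) X = av 8 (pseudo_gauss v) {..<N}
        (\<lambda>x. (\<Prod>i<N - Suc d. \<phi> i (X i)) * \<phi> (N - Suc d) x * (\<Prod>i\<in>{N - d..<N}. ?a i))"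
      using Suc step by simp
    ultimately show ?thesis by (simp only: av_cmult)
  qed
  moreover have "{N - Suc d..<N} = insert (N - Suc d) {N - d..<N}" using Suc.prems by auto
  ultimately show ?case using Suc.prems by (auto simp: fun_eq_iff mult_ac)
qed simp

lemma sum_pairs_filter:
  assumes "finite T"
  shows "(\<Sum>(t, t')\<in>T \<times> T. if R t t' then c else 0) =
    of_nat (card {(t, t'). t \<in> T \<and> t' \<in> T \<and> R t t'}) * (c :: 'a :: comm_ring_1)"
proof -
  have "{(t, t'). t \<in> T \<and> t' \<in> T \<and> R t t'} = {x \<in> T \<times> T. R (fst x) (snd x)}" by auto
  moreover have "(\<Sum>x\<in>T \<times> T. if R (fst x) (snd x) then c else 0) = (\<Sum>x\<in>{x \<in> T \<times> T. R (fst x) (snd x)}. c)"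
    using assms by (intro sum.inter_filter[symmetric]) auto
  ultimately show ?thesis by (simp add: case_prod_unfold)
qed

text \<open>Expand the square over pairs of terms. Orthogonality in each row leaves
  \<open>S = S'\<close>; on \<open>S\<close> the two terms share \<open>\<sigma>\<close> and
  \<open>\<tau>\<close>, while off \<open>S\<close> only \<open>\<sigma> = \<tau>\<close> and
  \<open>\<sigma>' = \<tau>'\<close> hold. A surviving pair is worth \<open>v ^ (2 * N)\<close>, and
  at most \<open>(fact N)\<^sup>2\<close> pairs survive.\<close>

lemma chaos_second_moment:
  assumes v: "0 \<le> v"
  shows "row_av N v (\<lambda>X. (cmod (chaos N v j X))\<^sup>2) N X \<le> (fact N * v ^ N)\<^sup>2"
proof -
  let ?P = "perms N" and ?S = "subsets N j"
  let ?T = "?P \<times> ?P \<times> ?S"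
  let ?c = "\<lambda>(\<sigma>, \<tau>, S) X. \<Prod>i<N. fac v (i \<in> S) (X i) (\<sigma> i) (\<tau> i)"
  have ch: "chaos N v j X = (\<Sum>t\<in>?T. ?c t X)" for X
    unfolding chaos_def by (simp add: sum.cartesian_product case_prod_unfold)
  let ?ok = "\<lambda>(\<sigma>, \<tau>, S) (\<sigma>', \<tau>', S'). \<forall>i<N. (i \<in> S) = (i \<in> S') \<and>
      (if i \<in> S then \<sigma> i = \<sigma>' i \<and> \<tau> i = \<tau>' i else \<sigma> i = \<tau> i \<and> \<sigma>' i = \<tau>' i)"
  let ?K = "{(t, t'). t \<in> ?T \<and> t' \<in> ?T \<and> ?ok t t'}"
  have fin: "finite ?T" by simp
  have summand: "row_av N v (\<lambda>X. ?c t X * cnj (?c t' X)) N X = (if ?ok t t' then complex_of_real (v\<^sup>2) ^ N else 0)"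
    if "t \<in> ?T" "t' \<in> ?T" for t t'
  proof -
    obtain \<sigma> \<tau> S \<sigma>' \<tau>' S' where t: "t = (\<sigma>, \<tau>, S)" "t' = (\<sigma>', \<tau>', S')" by (metis prod.exhaust)
    have mem: "\<sigma> \<in> ?P" "\<tau> \<in> ?P" "\<sigma>' \<in> ?P" "\<tau>' \<in> ?P" using that t by auto
    have "row_av N v (\<lambda>X. ?c t X * cnj (?c t' X)) N X =
       row_av N v (\<lambda>X. \<Prod>i<N. fac v (i \<in> S) (X i) (\<sigma> i) (\<tau> i) * cnj (fac v (i \<in> S') (X i) (\<sigma>' i) (\<tau>' i))) N X"
      by (simp add: t prod.distrib)
    also have "\<dots> = (\<Prod>i<N. av 8 (pseudo_gauss v) {..<N}
        (\<lambda>x. fac v (i \<in> S) x (\<sigma> i) (\<tau> i) * cnj (fac v (i \<in> S') x (\<sigma>' i) (\<tau>' i))))"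
      by (subst row_av_prod) (simp_all add: lessThan_atLeast0)
    also have "\<dots> = (\<Prod>i<N. if (i \<in> S) = (i \<in> S') \<and> (if i \<in> S then \<sigma> i = \<sigma>' i \<and> \<tau> i = \<tau>' i
        else \<sigma> i = \<tau> i \<and> \<sigma>' i = \<tau>' i) then complex_of_real (v\<^sup>2) else 0)"
      by (intro prod.cong refl) (subst fac_orthogonal[OF v], use mem perms_less in auto)
    also have "\<dots> = (if ?ok t t' then complex_of_real (v\<^sup>2) ^ N else 0)"
    proof (cases "?ok t t'")
      case True
      then have "(\<Prod>i<N. if (i \<in> S) = (i \<in> S') \<and> (if i \<in> S then \<sigma> i = \<sigma>' i \<and> \<tau> i = \<tau>' i
        else \<sigma> i = \<tau> i \<and> \<sigma>' i = \<tau>' i) then complex_of_real (v\<^sup>2) else 0) =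
        (\<Prod>i<N. complex_of_real (v\<^sup>2))"
        by (intro prod.cong refl) (simp add: t)
      then show ?thesis using True by simp
    next
      case False
      then obtain i where "i < N" "\<not> ((i \<in> S) = (i \<in> S') \<and> (if i \<in> S then \<sigma> i = \<sigma>' i \<and> \<tau> i = \<tau>' i
        else \<sigma> i = \<tau> i \<and> \<sigma>' i = \<tau>' i))" by (auto simp: t)
      then have "(\<Prod>i<N. if (i \<in> S) = (i \<in> S') \<and> (if i \<in> S then \<sigma> i = \<sigma>' i \<and> \<tau> i = \<tau>' i
        else \<sigma> i = \<tau> i \<and> \<sigma>' i = \<tau>' i) then complex_of_real (v\<^sup>2) else 0) = 0"
        by (intro prod_zero bexI[of _ i]) (auto split: if_splits)
      then show ?thesis using False by (simp only: if_False)
    qed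
    finally show ?thesis .
  qed
  have "complex_of_real (row_av N v (\<lambda>X. (cmod (chaos N v j X))\<^sup>2) N X) =
      row_av N v (\<lambda>X. \<Sum>t\<in>?T. \<Sum>t'\<in>?T. ?c t X * cnj (?c t' X)) N X"
    unfolding row_av_of_real[symmetric, THEN fun_cong] complex_norm_square ch cnj_sum sum_product ..
  also have "\<dots> = (\<Sum>t\<in>?T. \<Sum>t'\<in>?T. if ?ok t t' then complex_of_real (v\<^sup>2) ^ N else 0)"
    unfolding row_av_sum by (intro sum.cong refl summand)
  also have "\<dots> = (\<Sum>(t, t')\<in>?T \<times> ?T. if ?ok t t' then complex_of_real (v\<^sup>2) ^ N else 0)"
    by (simp add: sum.cartesian_product)
  also have "\<dots> = of_nat (card ?K) * complex_of_real (v\<^sup>2) ^ N"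
    by (rule sum_pairs_filter[OF fin])
  also have "\<dots> = complex_of_real (real (card ?K) * (v\<^sup>2) ^ N)" by simp
  finally have eq: "row_av N v (\<lambda>X. (cmod (chaos N v j X))\<^sup>2) N X = real (card ?K) * (v\<^sup>2) ^ N"
    by (simp only: of_real_eq_iff)
  \<comment> \<open>The last permutation is determined: it equals \<open>\<tau>\<close> on
    \<open>S\<close> and \<open>\<sigma>'\<close> off \<open>S\<close>. Given \<open>S\<close> and
    \<open>\<sigma>\<close>, there are \<open>fact j\<close> choices of \<open>\<tau>\<close> and
    \<open>fact (N - j)\<close> of \<open>\<sigma>'\<close>.\<close>
  let ?f = "\<lambda>((\<sigma>, \<tau>, S), (\<sigma>', \<tau>', S')). (S, \<sigma>, \<tau>, \<sigma>')"
  let ?D = "SIGMA S : ?S. SIGMA \<sigma> : ?P. {\<tau> \<in> ?P. \<forall>i\<in>{..<N} - S. \<tau> i = \<sigma> i}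
      \<times> {\<sigma>' \<in> ?P. \<forall>i\<in>{..<N} - ({..<N} - S). \<sigma>' i = \<sigma> i}"
  have "inj_on ?f ?K"
  proof (rule inj_onI)
    fix x y assume xy: "x \<in> ?K" "y \<in> ?K" "?f x = ?f y"
    obtain \<sigma> \<tau> S \<sigma>' \<tau>' S' where x: "x = ((\<sigma>, \<tau>, S), (\<sigma>', \<tau>', S'))" by (metis surj_pair)
    obtain \<tau>'' S'' where y: "y = ((\<sigma>, \<tau>, S), (\<sigma>', \<tau>'', S''))"
      using xy(3) unfolding x by (cases y) auto
    have P: "\<tau>' \<in> ?P" "\<tau>'' \<in> ?P" and S: "S \<in> ?S" "S' \<in> ?S" "S'' \<in> ?S"
      and ok: "\<forall>i<N. (i \<in> S) = (i \<in> S') \<and> (if i \<in> S then \<sigma> i = \<sigma>' i \<and> \<tau> i = \<tau>' i else \<sigma> i = \<tau> i \<and> \<sigma>' i = \<tau>' i)"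
        "\<forall>i<N. (i \<in> S) = (i \<in> S'') \<and> (if i \<in> S then \<sigma> i = \<sigma>' i \<and> \<tau> i = \<tau>'' i else \<sigma> i = \<tau> i \<and> \<sigma>' i = \<tau>'' i)"
      using xy(1,2) unfolding x y by blast+
    have sub: "S \<subseteq> {..<N}" "S' \<subseteq> {..<N}" "S'' \<subseteq> {..<N}" using S by (simp_all add: subsets_def)
    have "i \<in> S' \<longleftrightarrow> i \<in> S" "i \<in> S'' \<longleftrightarrow> i \<in> S" for i
      by (cases "i < N"; use ok sub in blast)+
    then have "S' = S" "S'' = S" by auto
    moreover have "\<tau>' i = \<tau>'' i" for i
    proof (cases "i < N")
      case True
      then show ?thesis using ok by (cases "i \<in> S") auto
    next
      case False
      then show ?thesis using P by (simp add: perms_def permutes_not_in)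
    qed
    ultimately show "x = y" by (auto simp: x y)
  qed
  moreover have "?f ` ?K \<subseteq> ?D"
  proof (rule image_subsetI)
    fix x assume xK: "x \<in> ?K"
    obtain \<sigma> \<tau> S \<sigma>' \<tau>' S' where x: "x = ((\<sigma>, \<tau>, S), (\<sigma>', \<tau>', S'))" by (metis surj_pair)
    have ok: "\<forall>i<N. (i \<in> S) = (i \<in> S') \<and>
        (if i \<in> S then \<sigma> i = \<sigma>' i \<and> \<tau> i = \<tau>' i else \<sigma> i = \<tau> i \<and> \<sigma>' i = \<tau>' i)"
      and S: "S \<in> ?S" "\<tau> \<in> ?P" "\<sigma>' \<in> ?P" "\<sigma> \<in> ?P"
      using xK unfolding x by blast+
    have "\<forall>i\<in>{..<N} - S. \<tau> i = \<sigma> i" "\<forall>i\<in>{..<N} - ({..<N} - S). \<sigma>' i = \<sigma> i"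
      using ok by auto
    with S have "(S, \<sigma>, \<tau>, \<sigma>') \<in> ?D"
      by (intro SigmaI CollectI conjI)
    then show "?f x \<in> ?D" by (simp add: x)
  qed
  moreover have "finite ?D" by (intro finite_SigmaI finite_cartesian_product) auto
  ultimately have "card ?K \<le> card ?D" by (rule card_inj_on_le)
  also have "\<dots> = (\<Sum>S\<in>?S. \<Sum>\<sigma>\<in>?P. fact j * fact (N - j))"
  proof (subst card_SigmaI)
    show "\<forall>S\<in>?S. finite (SIGMA \<sigma> : ?P. {\<tau> \<in> ?P. \<forall>i\<in>{..<N} - S. \<tau> i = \<sigma> i}
      \<times> {\<sigma>' \<in> ?P. \<forall>i\<in>{..<N} - ({..<N} - S). \<sigma>' i = \<sigma> i})"
      by (intro ballI finite_SigmaI finite_cartesian_product) auto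
    show "(\<Sum>S\<in>?S. card (SIGMA \<sigma> : ?P. {\<tau> \<in> ?P. \<forall>i\<in>{..<N} - S. \<tau> i = \<sigma> i}
      \<times> {\<sigma>' \<in> ?P. \<forall>i\<in>{..<N} - ({..<N} - S). \<sigma>' i = \<sigma> i})) =
      (\<Sum>S\<in>?S. \<Sum>\<sigma>\<in>?P. fact j * fact (N - j))"
    proof (rule sum.cong[OF refl])
      fix S assume S: "S \<in> ?S"
      then have S': "S \<subseteq> {..<N}" "card S = j" "card ({..<N} - S) = N - j"
        using card_Diff_subset[of S "{..<N}"] finite_subset[of S "{..<N}"] by (simp_all add: subsets_def)
      have "card ({\<tau> \<in> ?P. \<forall>i\<in>{..<N} - S. \<tau> i = \<sigma> i} \<times> {\<sigma>' \<in> ?P. \<forall>i\<in>{..<N} - ({..<N} - S). \<sigma>' i = \<sigma> i})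
          = fact j * fact (N - j)" if "\<sigma> \<in> ?P" for \<sigma>
        unfolding card_cartesian_product card_perms_agree[OF that S'(1)]
          card_perms_agree[OF that Diff_subset] S' ..
      then show "card (SIGMA \<sigma> : ?P. {\<tau> \<in> ?P. \<forall>i\<in>{..<N} - S. \<tau> i = \<sigma> i}
        \<times> {\<sigma>' \<in> ?P. \<forall>i\<in>{..<N} - ({..<N} - S). \<sigma>' i = \<sigma> i}) = (\<Sum>\<sigma>\<in>?P. fact j * fact (N - j))"
        by (subst card_SigmaI) auto
    qed
  qed auto
  \<comment> \<open>There are \<open>N choose j\<close> sets and \<open>fact N\<close> permutations
    \<open>\<sigma>\<close>; the binomial coefficient cancels the two factorials.\<close>
  also have "\<dots> \<le> fact N * fact N"
  proof (cases "j \<le> N")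
    case True
    then show ?thesis using binomial_fact_lemma[OF True] by (simp add: card_subsets card_perms mult_ac)
  qed (simp add: card_subsets binomial_eq_0)
  finally have "real (card ?K) \<le> fact N * fact N"
    by (simp flip: of_nat_le_iff[where 'a = real])
  then have "real (card ?K) * (v\<^sup>2) ^ N \<le> (fact N * fact N) * (v\<^sup>2) ^ N"
    by (rule mult_right_mono) simp
  also have "\<dots> = (fact N * v ^ N)\<^sup>2" by (simp add: power2_eq_square power_mult_distrib)
  finally show ?thesis unfolding eq .
qed

section \<open>Integration over the unitary group\<close>

lemma mat_adjoint_index [simp]:
  "i < dim_col A ==> j < dim_row A ==> mat_adjoint A $$ (i, j) = conjugate (A $$ (j, i))"
  unfolding mat_adjoint_def by (simp add: mat_of_rows_def)

lemma mat_adjoint_carrier: "A \<in> carrier_mat n m ==> mat_adjoint A \<in> carrier_mat m n"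
  unfolding mat_adjoint_def by (auto intro!: carrier_matI)

text \<open>For square matrices a right inverse is a left inverse, so orthonormal rows
  suffice.\<close>

lemma unitary_groupI:
  assumes "\<And>i j. i < n ==> j < n ==> (\<Sum>k<n. h i k * cnj (h j k)) = (if i = j then 1 else 0)"
  shows "mat n n (\<lambda>(i, j). h i j) \<in> unitary_group n"
proof -
  let ?A = "mat n n (\<lambda>(i, j). h i j)"
  have A: "?A \<in> carrier_mat n n" "mat_adjoint ?A \<in> carrier_mat n n" by (auto intro: mat_adjoint_carrier)
  have "?A * mat_adjoint ?A = 1\<^sub>m n"
    using A assms by (intro eq_matI) (auto simp: scalar_prod_def atLeast0LessThan)
  then show ?thesis
    unfolding unitary_group_def using A mat_mult_left_right_inverse[OF A] by auto
qed

lemma unitary_column_orthonormal: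
  assumes "U \<in> unitary_group n" "s < n" "t < n"
  shows "(\<Sum>l<n. U $$ (l, s) * cnj (U $$ (l, t))) = (if s = t then 1 else 0)"
proof -
  have U: "U \<in> carrier_mat n n" "mat_adjoint U * U = 1\<^sub>m n" using assms(1) by (auto simp: unitary_group_def)
  have "(mat_adjoint U * U) $$ (t, s) = (\<Sum>l<n. cnj (U $$ (l, t)) * U $$ (l, s))"
    using U(1) assms(2,3) mat_adjoint_carrier[OF U(1)] by (auto simp: scalar_prod_def atLeast0LessThan)
  moreover have "(mat_adjoint U * U) $$ (t, s) = (if s = t then 1 else 0)"
    unfolding U(2) using assms(2,3) by auto
  ultimately show ?thesis by (simp add: mult.commute)
qed

lemma unitary_group_mult:
  assumes "V \<in> unitary_group n" "U \<in> unitary_group n"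
  shows "V * U \<in> unitary_group n"
proof -
  have VU: "V \<in> carrier_mat n n" "U \<in> carrier_mat n n" using assms by (auto simp: unitary_group_def)
  have gram: "(\<Sum>k<n. V $$ (i, k) * cnj (V $$ (j, k))) = (if i = j then 1 else 0)" if "i < n" "j < n" for i j
  proof -
    have "V * mat_adjoint V = 1\<^sub>m n" using assms by (auto simp: unitary_group_def)
    then have "(V * mat_adjoint V) $$ (i, j) = (if i = j then 1 else 0)" using that by simp
    moreover have "(V * mat_adjoint V) $$ (i, j) = (\<Sum>k<n. V $$ (i, k) * cnj (V $$ (j, k)))"
      using VU(1) that mat_adjoint_carrier[OF VU(1)] by (auto simp: scalar_prod_def atLeast0LessThan)
    ultimately show ?thesis by simp
  qed
  have gramU: "(\<Sum>k<n. U $$ (i, k) * cnj (U $$ (j, k))) = (if i = j then 1 else 0)" if "i < n" "j < n" for i j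
  proof -
    have "U * mat_adjoint U = 1\<^sub>m n" using assms by (auto simp: unitary_group_def)
    then have "(U * mat_adjoint U) $$ (i, j) = (if i = j then 1 else 0)" using that by simp
    moreover have "(U * mat_adjoint U) $$ (i, j) = (\<Sum>k<n. U $$ (i, k) * cnj (U $$ (j, k)))"
      using VU(2) that mat_adjoint_carrier[OF VU(2)] by (auto simp: scalar_prod_def atLeast0LessThan)
    ultimately show ?thesis by simp
  qed
  let ?h = "\<lambda>i j. \<Sum>k<n. V $$ (i, k) * U $$ (k, j)"
  have "(\<Sum>k<n. ?h i k * cnj (?h j k)) = (if i = j then 1 else 0)" if "i < n" "j < n" for i j
  proof -
    have "(\<Sum>k<n. ?h i k * cnj (?h j k)) =
        (\<Sum>k<n. \<Sum>a<n. \<Sum>b<n. (V $$ (i, a) * U $$ (a, k)) * cnj (V $$ (j, b) * U $$ (b, k)))"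
      by (simp only: cnj_sum sum_product)
    also have "\<dots> = (\<Sum>a<n. \<Sum>b<n. \<Sum>k<n. (V $$ (i, a) * U $$ (a, k)) * cnj (V $$ (j, b) * U $$ (b, k)))"
      by (rule sum_rotate)
    also have "\<dots> = (\<Sum>a<n. \<Sum>b<n. V $$ (i, a) * cnj (V $$ (j, b)) * (\<Sum>k<n. U $$ (a, k) * cnj (U $$ (b, k))))"
      by (intro sum.cong refl) (simp add: sum_distrib_left mult_ac)
    also have "\<dots> = (\<Sum>a<n. \<Sum>b<n. if a = b then V $$ (i, a) * cnj (V $$ (j, b)) else 0)"
      by (intro sum.cong refl) (simp add: gramU)
    also have "\<dots> = (\<Sum>a<n. V $$ (i, a) * cnj (V $$ (j, a)))" by simp
    finally show ?thesis using gram[OF that] by simp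
  qed
  then have "mat n n (\<lambda>(i, j). ?h i j) \<in> unitary_group n" by (rule unitary_groupI)
  moreover have "V * U = mat n n (\<lambda>(i, j). ?h i j)"
    using VU by (intro eq_matI) (auto simp: scalar_prod_def atLeast0LessThan)
  ultimately show ?thesis by simp
qed

section \<open>Haar measure: measurable entries and left invariance\<close>

locale haar =
  fixes n :: nat and \<mu> :: "complex mat measure"
  assumes haar: "haar_measure n \<mu>"
begin

sublocale prob_space \<mu>
  using haar by (simp add: haar_measure_def)

lemma sets_haar: "sets \<mu> = sets (restrict_space (borel_mat n n) (unitary_group n))"
  using haar by (simp add: haar_measure_def)

lemma space_haar: "space \<mu> = unitary_group n"
  using sets_eq_imp_space_eq[OF sets_haar]
  by (auto simp: space_restrict_space borel_mat_def unitary_group_def)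

lemma measurable_entry [measurable]:
  assumes "i < n" "j < n" shows "(\<lambda>U. U $$ (i, j)) \<in> borel_measurable \<mu>"
proof -
  let ?P = "PiM ({..<n} \<times> {..<n}) (\<lambda>_. borel) :: (nat \<times> nat => complex) measure"
  have "(\<lambda>A. \<lambda>ij\<in>{..<n} \<times> {..<n}. A $$ ij) \<in> measurable (borel_mat n n) ?P"
    unfolding borel_mat_def by (rule measurable_vimage_algebra1) (auto simp: space_PiM)
  moreover have "(\<lambda>f. f (i, j)) \<in> measurable ?P borel"
    by (rule measurable_component_singleton) (use assms in auto)
  ultimately have "(\<lambda>A. (\<lambda>ij\<in>{..<n} \<times> {..<n}. A $$ ij) (i, j)) \<in> measurable (borel_mat n n) borel"
    by (rule measurable_compose)
  then have "(\<lambda>A. A $$ (i, j)) \<in> measurable (borel_mat n n) borel" using assms by simp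
  then have "(\<lambda>A. A $$ (i, j)) \<in> measurable (restrict_space (borel_mat n n) (unitary_group n)) borel"
    by (rule measurable_restrict_space1)
  then show ?thesis by (simp cong: measurable_cong_sets add: measurable_cong_sets[OF sets_haar refl])
qed

lemma measurable_left_mult:
  assumes V: "V \<in> unitary_group n" shows "(\<lambda>U. V * U) \<in> measurable \<mu> \<mu>"
proof -
  have Vc: "V \<in> carrier_mat n n" using V by (simp add: unitary_group_def)
  have "(\<lambda>U. V * U) \<in> measurable \<mu> (restrict_space (borel_mat n n) (unitary_group n))"
  proof (rule measurable_restrict_space2)
    show "(\<lambda>U. V * U) \<in> space \<mu> \<rightarrow> unitary_group n"
      using V by (auto simp: space_haar intro: unitary_group_mult)
    show "(\<lambda>U. V * U) \<in> measurable \<mu> (borel_mat n n)"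
      unfolding borel_mat_def
    proof (rule measurable_vimage_algebra2)
      show "(\<lambda>U. V * U) \<in> space \<mu> \<rightarrow> carrier_mat n n"
        using Vc by (auto simp: space_haar unitary_group_def)
      show "(\<lambda>U. \<lambda>ij\<in>{..<n} \<times> {..<n}. (V * U) $$ ij) \<in> measurable \<mu> (PiM ({..<n} \<times> {..<n}) (\<lambda>_. borel))"
      proof (rule measurable_restrict)
        fix ij assume "ij \<in> {..<n} \<times> {..<n}"
        then obtain i j where ij: "ij = (i, j)" "i < n" "j < n" by auto
        have "(\<lambda>U. \<Sum>k<n. V $$ (i, k) * U $$ (k, j)) \<in> borel_measurable \<mu>"
          using ij by (intro borel_measurable_sum borel_measurable_times measurable_const measurable_entry) auto
        moreover have "(V * U) $$ ij = (\<Sum>k<n. V $$ (i, k) * U $$ (k, j))" if "U \<in> space \<mu>" for U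
          using that Vc ij by (auto simp: space_haar unitary_group_def scalar_prod_def atLeast0LessThan)
        ultimately show "(\<lambda>U. (V * U) $$ ij) \<in> borel_measurable \<mu>"
          by (subst measurable_cong) auto
      qed
    qed
  qed
  then show ?thesis by (simp add: measurable_cong_sets[OF refl sets_haar])
qed

lemma nn_integral_left_mult:
  assumes V: "V \<in> unitary_group n" and f: "f \<in> borel_measurable \<mu>"
  shows "(\<integral>\<^sup>+U. f (V * U) \<partial>\<mu>) = (\<integral>\<^sup>+U. f U \<partial>\<mu>)"
proof -
  have "distr \<mu> \<mu> (\<lambda>U. V * U) = \<mu>" using haar V by (simp add: haar_measure_def)
  then show ?thesis
    using nn_integral_distr[OF measurable_left_mult[OF V], of f] f by simp
qed

end

text \<open>A Householder reflection maps the basis vector \<open>e\<^sub>i\<close> to the constant vector on \<open>{i..<n}\<close>; its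
  columns are then multiplied by phases.\<close>

lemma unitary_mixing_row:
  assumes i: "i < n" and f: "f \<in> PiE {i..<n} (\<lambda>_. {..<4})"
  shows "\<exists>V\<in>unitary_group n. \<forall>U\<in>carrier_mat n n. \<forall>t<n.
     (\<forall>l<i. (V * U) $$ (l, t) = U $$ (l, t)) \<and>
     (V * U) $$ (i, t) = (\<Sum>l\<in>{i..<n}. phase (1 / sqrt (real (n - i))) (f l) * U $$ (l, t))"
proof -
  define m where "m = real (n - i)"
  define r where "r = 1 / sqrt m"
  \<comment> \<open>The Householder vector: \<open>e\<^sub>i\<close> minus the unit vector that is
    constant on \<open>{i..<n}\<close>.\<close>
  define w where "w = (\<lambda>p. (if p = i then 1 else 0) - (if i \<le> p then r else 0))"
  \<comment> \<open>For \<open>n - i = 1\<close> the two vectors coincide, \<open>w\<close>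
    vanishes, and \<open>2 / 0 = 0\<close> makes the reflection the identity.\<close>
  define c where "c = 2 / (\<Sum>p<n. (w p)\<^sup>2)"
  define h where "h = (\<lambda>p q. (if p = q then 1 else 0) - c * w p * w q)"
  define d where "d = (\<lambda>q. if i \<le> q then \<i> ^ f q else 1)"
  have m: "0 < m" using i by (simp add: m_def)
  have r2: "r\<^sup>2 * m = 1" using m by (simp add: r_def power_divide)
  have split: "{..<n} = {..<i} \<union> {i..<n}" using i by auto
  have sum_split: "(\<Sum>p<n. g p) = (\<Sum>p<i. g p) + (\<Sum>p\<in>{i..<n}. g p)" for g :: "nat => real"
    unfolding split by (rule sum.union_disjoint) auto
  have w2: "(\<Sum>p<n. (w p)\<^sup>2) = 2 * (1 - r)"
  proof -
    have "(\<Sum>p<n. (w p)\<^sup>2) = (\<Sum>p\<in>{i..<n}. ((if p = i then 1 else 0) - r)\<^sup>2)"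
      unfolding sum_split w_def by simp
    also have "\<dots> = (\<Sum>p\<in>{i..<n}. (if p = i then 1 - 2 * r else 0) + r\<^sup>2)"
      by (intro sum.cong refl) (simp add: power2_eq_square algebra_simps)
    also have "\<dots> = (1 - 2 * r) + m * r\<^sup>2" using i by (simp add: sum.distrib m_def)
    finally show ?thesis using r2 by (simp add: mult.commute)
  qed
  \<comment> \<open>Normally \<open>c * w i = 1\<close>, because the squared norm of
    \<open>w\<close> is \<open>2 * (1 - r)\<close> and \<open>w i = 1 - r\<close>; hence row
    \<open>i\<close> of the reflection is the constant vector. If \<open>r = 1\<close>, both sides
    vanish.\<close>
  have cw: "c * w i * w q = w q" if "q < n" for q
  proof (cases "r = 1")
    case True
    then have "n - i = 1" using r2 by (simp add: m_def del: of_nat_diff)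
    then have "w q = 0" using that True unfolding w_def by auto
    then show ?thesis by simp
  next
    case False
    then show ?thesis unfolding c_def w2 by (simp add: w_def)
  qed
  have hh: "(\<Sum>k<n. h p k * h q k) = (if p = q then 1 else 0)" if "p < n" "q < n" for p q
  proof -
    have "h p k * h q k = (if k = p then (if p = q then 1 else 0) - c * w q * w p else 0)
        + (if k = q then - (c * w p * w q) else 0) + (c * c * w p * w q) * (w k)\<^sup>2" for k
      unfolding h_def by (auto simp: algebra_simps power2_eq_square)
    then have "(\<Sum>k<n. h p k * h q k) = (if p = q then 1 else 0) - c * w q * w p - c * w p * w q
        + (c * c * w p * w q) * (\<Sum>k<n. (w k)\<^sup>2)"
      using that by (simp add: sum.distrib sum_distrib_left)
    also have "(c * c * w p * w q) * (\<Sum>k<n. (w k)\<^sup>2) = 2 * c * w p * w q"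
      by (cases "(\<Sum>k<n. (w k)\<^sup>2) = 0") (simp_all add: c_def)
    finally show ?thesis by (simp add: algebra_simps)
  qed
  have dd: "d q * cnj (d q) = 1" for q
  proof -
    have "\<i> ^ m * (- \<i>) ^ m = (1 :: complex)" for m by (simp flip: power_mult_distrib)
    then show ?thesis by (simp add: d_def)
  qed
  define V where "V = mat n n (\<lambda>(p, q). complex_of_real (h p q) * d q)"
  have V: "V \<in> unitary_group n"
    unfolding V_def
  proof (rule unitary_groupI)
    fix p q assume pq: "p < n" "q < n"
    have "(\<Sum>k<n. complex_of_real (h p k) * d k * cnj (complex_of_real (h q k) * d k)) =
        (\<Sum>k<n. complex_of_real (h p k * h q k) * (d k * cnj (d k)))"
      by (intro sum.cong refl) (simp add: mult_ac)
    also have "\<dots> = complex_of_real (\<Sum>k<n. h p k * h q k)" by (simp add: dd)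
    finally show "(\<Sum>k<n. complex_of_real (h p k) * d k * cnj (complex_of_real (h q k) * d k)) =
        (if p = q then 1 else 0)" using hh[OF pq] by simp
  qed
  moreover have "(\<forall>l<i. (V * U) $$ (l, t) = U $$ (l, t)) \<and>
     (V * U) $$ (i, t) = (\<Sum>l\<in>{i..<n}. phase r (f l) * U $$ (l, t))" if U: "U \<in> carrier_mat n n" and t: "t < n" for U t
  proof (intro conjI allI impI)
    have VU: "(V * U) $$ (l, t) = (\<Sum>k<n. complex_of_real (h l k) * d k * U $$ (k, t))" if "l < n" for l
      using that U t by (auto simp: V_def scalar_prod_def atLeast0LessThan)
    fix l assume l: "l < i"
    then have "complex_of_real (h l k) * d k * U $$ (k, t) = (if k = l then U $$ (l, t) else 0)" for k
      by (auto simp: h_def w_def d_def)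
    then show "(V * U) $$ (l, t) = U $$ (l, t)" using VU[of l] l i by simp
  next
    have "(V * U) $$ (i, t) = (\<Sum>k<n. complex_of_real (h i k) * d k * U $$ (k, t))"
      using i U t by (auto simp: V_def scalar_prod_def atLeast0LessThan)
    also have "\<dots> = (\<Sum>k<n. if k \<in> {i..<n} then phase r (f k) * U $$ (k, t) else 0)"
    proof (intro sum.cong refl)
      fix k assume "k \<in> {..<n}"
      then have k: "k < n" by simp
      have "h i k = (if i \<le> k then r else 0)" unfolding h_def cw[OF k] by (auto simp: w_def)
      then show "complex_of_real (h i k) * d k * U $$ (k, t) =
          (if k \<in> {i..<n} then phase r (f k) * U $$ (k, t) else 0)"
        using k by (simp add: d_def phase_def)
    qed
    also have "\<dots> = (\<Sum>k\<in>{i..<n}. phase r (f k) * U $$ (k, t))"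
      by (subst sum.inter_restrict[symmetric]) (auto intro!: sum.cong)
    finally show "(V * U) $$ (i, t) = (\<Sum>l\<in>{i..<n}. phase r (f l) * U $$ (l, t))" .
  qed
  ultimately show ?thesis unfolding r_def m_def by blast
qed

section \<open>The second moment of the chaos over the unitary group\<close>

text \<open>Mixtures of squared moduli of forms \<open>a + x A x\<^sup>*\<close>.\<close>

inductive quad :: "nat => ((nat => complex) => real) => bool" for N where
  quad_form: "quad N (\<lambda>x. (cmod (a + (\<Sum>p<N. \<Sum>q<N. A p q * (x p * cnj (x q)))))\<^sup>2)"
| quad_zero: "quad N (\<lambda>x. 0)"
| quad_add: "quad N f ==> quad N g ==> quad N (\<lambda>x. f x + g x)"
| quad_scale: "0 \<le> c ==> quad N f ==> quad N (\<lambda>x. c * f x)"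

lemma quad_sum: "finite T ==> (\<And>t. t \<in> T ==> quad N (f t)) ==> quad N (\<lambda>x. \<Sum>t\<in>T. f t x)"
  by (induction T rule: finite_induct) (auto intro: quad_zero quad_add)

lemma quad_av: "finite I ==> (\<And>y. quad N (\<lambda>x. f x y)) ==> quad N (\<lambda>x. av q g I (f x))"
  unfolding av_def divide_inverse mult.commute[of _ "inverse _"]
  by (intro quad_scale quad_sum finite_PiE) auto

lemma av_nonneg: "(\<And>b. 0 \<le> F b) ==> 0 \<le> (av q g I F :: real)"
  unfolding av_def by (intro divide_nonneg_nonneg sum_nonneg) auto

lemma quad_nonneg: "quad N f ==> 0 \<le> f x"
  by (induction rule: quad.induct) auto

text \<open>Both sides are linear in \<open>f\<close>, so the comparison passes from single squares
  to nonnegative mixtures, which is what averages over later rows produce.\<close>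

lemma quad_haar_row_step:
  fixes u :: "nat => nat => complex"
  assumes orth: "\<And>p q. p < N ==> q < N ==> (\<Sum>l<M. u l p * cnj (u l q)) = (if p = q then 1 else 0)"
    and i: "i < N" and M: "N ^ 3 + N \<le> M"
    and small: "\<And>l. l < i ==> (\<Sum>p<N. (cmod (u l p))\<^sup>2) \<le> 1 / real N ^ 2"
    and f: "quad N f"
  shows "av 4 (phase (1 / sqrt (real (M - i)))) {i..<M} (\<lambda>b. f (\<lambda>p. \<Sum>l\<in>{i..<M}. b l * u l p))
     \<le> (1 + 15 / real N) * av 8 (pseudo_gauss (1 / real M)) {..<N} f"
  using f
proof (induction rule: quad.induct)
  case (quad_form a A)
  show ?case by (rule haar_row_step) (use orth i M small in auto)
next
  case quad_zero
  show ?case by (simp add: av_def)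
next
  case (quad_add f g)
  then show ?case unfolding av_add by (simp add: algebra_simps)
next
  case (quad_scale c f)
  then show ?case unfolding av_cmult using mult_left_mono[OF quad_scale.IH quad_scale.hyps(1)]
    by (simp add: mult_ac)
qed

text \<open>Each product in \<open>chaos\<close> has exactly one factor from row \<open>i\<close>,
  and that factor is affine in the products \<open>x p * cnj (x q)\<close>.\<close>

lemma chaos_quadratic_in_row:
  assumes i: "i < N"
  shows "quad N (\<lambda>x. (cmod (chaos N v j (X(i := x))))\<^sup>2)"
proof -
  define aff where "aff = (\<lambda>f :: (nat => complex) => complex.
    \<exists>a A. \<forall>x. f x = a + (\<Sum>p<N. \<Sum>q<N. A p q * (x p * cnj (x q))))"
  have aff_add: "aff (\<lambda>x. f x + g x)" if fg: "aff f" "aff g" for f g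
  proof -
    obtain a A b B where "\<forall>x. f x = a + (\<Sum>p<N. \<Sum>q<N. A p q * (x p * cnj (x q)))"
      "\<forall>x. g x = b + (\<Sum>p<N. \<Sum>q<N. B p q * (x p * cnj (x q)))" using fg unfolding aff_def by blast
    then show ?thesis unfolding aff_def
      by (intro exI[of _ "a + b"] exI[of _ "\<lambda>p q. A p q + B p q"]) (simp add: distrib_right sum.distrib)
  qed
  have aff_0: "aff (\<lambda>x. 0)" unfolding aff_def by (intro exI[of _ 0] exI[of _ "\<lambda>_ _. 0"]) simp
  have aff_sum: "aff (\<lambda>x. \<Sum>t\<in>T. f t x)" if "finite T" "\<And>t. t \<in> T ==> aff (f t)" for T and f :: "'t => _"
    using that by (induction T rule: finite_induct) (auto intro: aff_0 aff_add)
  have aff_fac: "aff (\<lambda>x. C * fac v c x p q)" if "p < N" "q < N" for C c p q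
  proof (cases c)
    case True
    have "C * fac v c x p q = - C * (if p = q then complex_of_real v else 0)
        + (\<Sum>l<N. \<Sum>l'<N. (if l = p \<and> l' = q then C else 0) * (x l * cnj (x l')))" for x
      unfolding sum_pair_delta[OF that] using True by (simp add: fac_def algebra_simps)
    then show ?thesis unfolding aff_def
      by (intro exI[of _ "- C * (if p = q then complex_of_real v else 0)"]
        exI[of _ "\<lambda>l l'. if l = p \<and> l' = q then C else 0"] allI)
  next
    case False
    then show ?thesis unfolding aff_def
      by (intro exI[of _ "C * (if p = q then complex_of_real v else 0)"] exI[of _ "\<lambda>_ _. 0"]) (simp add: fac_def)
  qed
  have "aff (\<lambda>x. chaos N v j (X(i := x)))"
    unfolding chaos_def
  proof (intro aff_sum)
    fix \<sigma> \<tau> S assume m: "\<sigma> \<in> perms N" "\<tau> \<in> perms N"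
    have "(\<Prod>l<N. fac v (l \<in> S) ((X(i := x)) l) (\<sigma> l) (\<tau> l)) =
      (\<Prod>l\<in>{..<N} - {i}. fac v (l \<in> S) (X l) (\<sigma> l) (\<tau> l)) * fac v (i \<in> S) x (\<sigma> i) (\<tau> i)" for x
      using i by (subst prod.remove[of _ i]) (auto simp: mult.commute intro!: arg_cong2[where f = "(*)"] prod.cong)
    then show "aff (\<lambda>x. \<Prod>l<N. fac v (l \<in> S) ((X(i := x)) l) (\<sigma> l) (\<tau> l))"
      using aff_fac perms_less[OF m(1) i] perms_less[OF m(2) i] by simp
  qed simp_all
  then obtain a A where "\<And>x. chaos N v j (X(i := x)) = a + (\<Sum>p<N. \<Sum>q<N. A p q * (x p * cnj (x q)))"
    unfolding aff_def by blast
  then show ?thesis by (simp add: quad_form)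
qed

text \<open>The averaged rows come after row \<open>i\<close>, so the two updates commute and the
  mixture property is inherited.\<close>

lemma row_av_quad:
  assumes "\<And>i X. i < N ==> quad N (\<lambda>x. F (X(i := x)))"
  shows "i < N - d ==> quad N (\<lambda>x. row_av N v F d (X(i := x)))"
proof (induction d arbitrary: X)
  case (Suc d)
  have "(X(i := x))(N - Suc d := y) = (X(N - Suc d := y))(i := x)" for x y
    using Suc.prems by (intro fun_upd_twist) auto
  note swap = this
  show ?case unfolding row_av.simps swap by (intro quad_av Suc.IH) (use Suc.prems in auto)
qed (use assms in simp)

text \<open>Averaged rows are overwritten, so only the first \<open>N - d\<close> rows of the
  argument matter.\<close>

lemma row_av_depends:
  assumes "\<And>X X'. (\<And>l p. l < N ==> p < N ==> X l p = X' l p) ==> F X = F X'"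
  shows "(\<And>l p. l < N - d ==> p < N ==> X l p = X' l p) ==> row_av N v F d X = row_av N v F d X'"
proof (induction d arbitrary: X X')
  case 0
  show ?case unfolding row_av.simps by (rule assms) (use 0 in simp)
next
  case (Suc d)
  have "row_av N v F d (X(N - Suc d := x)) = row_av N v F d (X'(N - Suc d := x))" for x
  proof (rule Suc.IH)
    fix l p assume "l < N - d" "p < N"
    then show "(X(N - Suc d := x)) l p = (X'(N - Suc d := x)) l p"
      using Suc.prems[of l p] by (cases "l = N - Suc d") auto
  qed
  then show ?case by simp
qed

lemma chaos_depends:
  "(\<And>l p. l < N ==> p < N ==> X l p = X' l p) ==> chaos N v j X = chaos N v j X'"
  unfolding chaos_def
  by (intro sum.cong prod.cong refl) (auto simp: fac_def perms_less)

text \<open>The hypothesis on \<open>F\<close> covers all families with measurable entries, so that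
  it can be applied after a row has been overwritten.\<close>

lemma row_av_measurable:
  fixes F :: "(nat => nat => complex) => real"
  assumes "\<And>Y. (\<And>l p. (\<lambda>U. Y U l p) \<in> borel_measurable \<mu>) ==> (\<lambda>U. F (Y U)) \<in> borel_measurable \<mu>"
  shows "(\<And>l p. (\<lambda>U. Y U l p) \<in> borel_measurable \<mu>) ==> (\<lambda>U. row_av N v F d (Y U)) \<in> borel_measurable \<mu>"
proof (induction d arbitrary: Y)
  case (Suc d)
  have "(\<lambda>U. row_av N v F d ((Y U)(N - Suc d := x))) \<in> borel_measurable \<mu>" for x
  proof (rule Suc.IH)
    fix l p show "(\<lambda>U. ((Y U)(N - Suc d := x)) l p) \<in> borel_measurable \<mu>"
      using Suc.prems[of l p] by (cases "l = N - Suc d") auto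
  qed
  then show ?case unfolding row_av.simps av_def by (intro borel_measurable_divide borel_measurable_sum) auto
qed (use assms in simp)

lemma chaos_measurable:
  assumes [measurable]: "\<And>l p. (\<lambda>U. Y U l p) \<in> borel_measurable \<mu>"
  shows "(\<lambda>U. chaos N v j (Y U)) \<in> borel_measurable \<mu>"
proof -
  have [measurable]: "(cnj :: complex => complex) \<in> borel_measurable borel"
    by (intro borel_measurable_continuous_onI continuous_intros)
  show ?thesis unfolding chaos_def fac_def by measurable
qed

text \<open>Summed over \<open>N\<close> columns this yields the bound \<open>1 / N ^ 2\<close> that
  \<open>haar_row_step\<close> asks of a row. All \<open>M\<close> columns are included so that one
  event serves every outcome.\<close>

definition flat_rows :: "nat => nat => nat => complex mat => bool" where
  "flat_rows N M i U \<longleftrightarrow> (\<forall>l\<in>{..<i}. \<forall>t\<in>{..<M}. (cmod (U $$ (l, t)))\<^sup>2 \<le> 1 / real N ^ 3)"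

lemma flat_rows_measurable [measurable]:
  assumes "haar M \<mu>" "i \<le> M" shows "Measurable.pred \<mu> (flat_rows N M i)"
proof -
  interpret haar M \<mu> by fact
  have "{U \<in> space \<mu>. \<forall>l\<in>{..<i}. \<forall>t\<in>{..<M}. (cmod (U $$ (l, t)))\<^sup>2 \<le> 1 / real N ^ 3} \<in> sets \<mu>"
  proof (intro sets.sets_Collect_finite_All finite_lessThan)
    fix l t assume "l \<in> {..<i}" "t \<in> {..<M}"
    then have [measurable]: "(\<lambda>U. U $$ (l, t)) \<in> borel_measurable \<mu>"
      using assms(2) by (intro measurable_entry) auto
    show "{U \<in> space \<mu>. (cmod (U $$ (l, t)))\<^sup>2 \<le> 1 / real N ^ 3} \<in> sets \<mu>" by measurable
  qed
  then show ?thesis by (simp only: flat_rows_def pred_def)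
qed

section \<open>The noisy click probabilities\<close>

lemma complex_gaussian_alt:
  "complex_gaussian v = distr (density lborel (normal_density 0 (sqrt (v / 2))) \<Otimes>\<^sub>M
     density lborel (normal_density 0 (sqrt (v / 2)))) borel (\<lambda>x. Complex (fst x) (snd x))"
  by (simp add: complex_gaussian_def Let_def case_prod_unfold)

lemma measurable_Complex [measurable]:
  "(\<lambda>x. Complex (fst x) (snd x)) \<in> borel_measurable (borel \<Otimes>\<^sub>M borel)"
proof -
  have "(\<lambda>x. complex_of_real (fst x) + \<i> * complex_of_real (snd x)) \<in> borel_measurable (borel \<Otimes>\<^sub>M borel)"
    by measurable
  then show ?thesis by (simp add: Complex_eq)
qed

context
  fixes v :: real
  assumes v: "0 < v"
begin

definition gauss_part where "gauss_part = density lborel (normal_density 0 (sqrt (v / 2)))"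

lemma sets_gauss_part [measurable_cong]: "sets gauss_part = sets borel"
  by (simp add: gauss_part_def)

lemma prob_space_gauss_part: "prob_space gauss_part"
  unfolding gauss_part_def using v by (intro prob_space_normal_density) auto

lemma gauss_part_moments:
  "integrable gauss_part (\<lambda>x. x)" "(\<integral>x. x \<partial>gauss_part) = 0"
  "integrable gauss_part (\<lambda>x. x\<^sup>2)" "(\<integral>x. x\<^sup>2 \<partial>gauss_part) = v / 2"
proof -
  have s: "0 < sqrt (v / 2)" using v by simp
  note d = integrable_density[OF _ _ AE_I2, of _ _ "normal_density 0 (sqrt (v / 2))"]
  show "integrable gauss_part (\<lambda>x. x)"
    unfolding gauss_part_def using integrable_normal_moment[OF s, of 0 1] by (subst integrable_density) auto
  show "(\<integral>x. x \<partial>gauss_part) = 0"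
    unfolding gauss_part_def using integral_normal_moment_nz_1[OF s, of 0] by (subst integral_density) auto
  show "integrable gauss_part (\<lambda>x. x\<^sup>2)"
    unfolding gauss_part_def using integrable_normal_moment[OF s, of 0 2] by (subst integrable_density) auto
  show "(\<integral>x. x\<^sup>2 \<partial>gauss_part) = v / 2"
    unfolding gauss_part_def using integral_normal_moment_even[OF s, of 0 1] v
    by (subst integral_density) (auto simp: power_divide)
qed

lemma complex_gaussian_distr:
  "complex_gaussian v = distr (gauss_part \<Otimes>\<^sub>M gauss_part) borel (\<lambda>x. Complex (fst x) (snd x))"
  by (simp add: complex_gaussian_alt gauss_part_def)

lemma prob_space_complex_gaussian: "prob_space (complex_gaussian v)"
proof -
  interpret p: prob_space gauss_part by (rule prob_space_gauss_part)
  interpret pp: pair_prob_space gauss_part gauss_part ..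
  show ?thesis unfolding complex_gaussian_distr by (intro pp.prob_space_distr) measurable
qed

lemma sets_complex_gaussian [measurable_cong]: "sets (complex_gaussian v) = sets borel"
  by (simp add: complex_gaussian_distr)

lemma complex_gaussian_moments:
  "integrable (complex_gaussian v) (\<lambda>y. y)" "(\<integral>y. y \<partial>complex_gaussian v) = 0"
  "integrable (complex_gaussian v) (\<lambda>y. y * cnj y)" "(\<integral>y. y * cnj y \<partial>complex_gaussian v) = complex_of_real v"
proof -
  interpret p: prob_space gauss_part by (rule prob_space_gauss_part)
  interpret pp: pair_prob_space gauss_part gauss_part ..
  let ?P = "gauss_part \<Otimes>\<^sub>M gauss_part"
  have [measurable]: "(cnj :: complex => complex) \<in> borel_measurable borel"
    by (intro borel_measurable_continuous_onI continuous_intros)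
  have fst: "integrable ?P (\<lambda>x. h (fst x))" "(\<integral>x. h (fst x) \<partial>?P) = (\<integral>x. h x \<partial>gauss_part)"
    if h: "integrable gauss_part h" for h :: "real => real"
  proof -
    have [measurable]: "h \<in> borel_measurable gauss_part" using h by auto
    have d: "distr ?P gauss_part fst = gauss_part" by (rule p.distr_pair_fst)
    show "integrable ?P (\<lambda>x. h (fst x))" using h by (subst integrable_distr_eq[symmetric, of fst ?P gauss_part]) (auto simp: d)
    show "(\<integral>x. h (fst x) \<partial>?P) = (\<integral>x. h x \<partial>gauss_part)"
      by (subst integral_distr[symmetric, of fst ?P gauss_part]) (auto simp: d)
  qed
  have snd: "integrable ?P (\<lambda>x. h (snd x))" "(\<integral>x. h (snd x) \<partial>?P) = (\<integral>x. h x \<partial>gauss_part)"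
    if h: "integrable gauss_part h" for h :: "real => real"
  proof -
    have [measurable]: "h \<in> borel_measurable gauss_part" using h by auto
    show "integrable ?P (\<lambda>x. h (snd x))"
      using pp.integrable_product_swap[OF fst(1)[OF h]] by (simp add: case_prod_unfold)
    have "(\<integral>x. h (snd x) \<partial>?P) = (\<integral>x. h (fst x) \<partial>?P)"
      using pp.integral_product_swap[of "\<lambda>x. h (fst x)"] by (simp add: case_prod_unfold)
    then show "(\<integral>x. h (snd x) \<partial>?P) = (\<integral>x. h x \<partial>gauss_part)" using fst(2)[OF h] by simp
  qed
  show "integrable (complex_gaussian v) (\<lambda>y. y)"
    unfolding complex_gaussian_distr
    by (subst integrable_distr_eq) (auto simp: Complex_eq intro!: fst(1) snd(1) gauss_part_moments integrable_of_real)
  show "(\<integral>y. y \<partial>complex_gaussian v) = 0"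
    unfolding complex_gaussian_distr
  proof (subst integral_distr)
    have 1: "integrable ?P (\<lambda>x. complex_of_real (fst x))" "integrable ?P (\<lambda>x. \<i> * complex_of_real (snd x))"
      by (intro integrable_mult_right integrable_of_real fst(1) snd(1) gauss_part_moments)+
    have "(\<integral>x. Complex (fst x) (snd x) \<partial>?P) = (\<integral>x. complex_of_real (fst x) \<partial>?P) + (\<integral>x. \<i> * complex_of_real (snd x) \<partial>?P)"
      unfolding Complex_eq by (rule Bochner_Integration.integral_add[OF 1])
    then show "(\<integral>x. Complex (fst x) (snd x) \<partial>?P) = 0"
      using fst(2)[OF gauss_part_moments(1)] snd(2)[OF gauss_part_moments(1)] gauss_part_moments(2) by simp
  qed measurable
  have sq: "Complex (fst x) (snd x) * cnj (Complex (fst x) (snd x)) = complex_of_real ((fst x)\<^sup>2 + (snd x)\<^sup>2)" for x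
    by (simp add: complex_eq_iff power2_eq_square)
  show "integrable (complex_gaussian v) (\<lambda>y. y * cnj y)"
    unfolding complex_gaussian_distr
    by (subst integrable_distr_eq) (auto simp: sq simp del: of_real_add of_real_power intro!: integrable_of_real Bochner_Integration.integrable_add fst(1) snd(1) gauss_part_moments)
  show "(\<integral>y. y * cnj y \<partial>complex_gaussian v) = complex_of_real v"
    unfolding complex_gaussian_distr
  proof (subst integral_distr)
    have "(\<integral>x. (fst x)\<^sup>2 + (snd x)\<^sup>2 \<partial>?P) = (\<integral>x. (fst x)\<^sup>2 \<partial>?P) + (\<integral>x. (snd x)\<^sup>2 \<partial>?P)"
      by (intro Bochner_Integration.integral_add fst(1) snd(1) gauss_part_moments)
    also have "\<dots> = v" using fst(2)[OF gauss_part_moments(3)] snd(2)[OF gauss_part_moments(3)] gauss_part_moments(4) by simp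
    finally show "(\<integral>x. Complex (fst x) (snd x) * cnj (Complex (fst x) (snd x)) \<partial>?P) = complex_of_real v"
      unfolding sq by (simp only: integral_complex_of_real)
  qed measurable
qed

end

text \<open>A matrix entry occurs in a given product of the expanded permanent or it does not; the
  flags \<open>c\<close> and \<open>c'\<close> insert 1 in the latter case. Linear terms vanish with
  the mean, and the variance survives only when both products contain the entry.\<close>

lemma affine_gaussian_integral:
  fixes a a' b :: complex
  assumes v: "0 < v"
  defines "f \<equiv> \<lambda>c u y. if c then u + b * y else (1 :: complex)"
  shows "integrable (complex_gaussian v) (\<lambda>y. f c a y * cnj (f c' a' y))"
    and "(\<integral>y. f c a y * cnj (f c' a' y) \<partial>complex_gaussian v) =
      (if c then a else 1) * cnj (if c' then a' else 1) + (if c \<and> c' then b * cnj b * v else 0)"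
proof -
  interpret p: prob_space "complex_gaussian v" by (rule prob_space_complex_gaussian[OF v])
  note m = complex_gaussian_moments[OF v]
  have icnj: "integrable (complex_gaussian v) (\<lambda>y. cnj y)" using m(1) by simp
  have ecnj: "(\<integral>y. cnj y \<partial>complex_gaussian v) = 0" using m(2) by simp
  have eq: "f c a y * cnj (f c' a' y) = (if c then a else 1) * cnj (if c' then a' else 1)
      + (if c then b * cnj (if c' then a' else 1) else 0) * y
      + (if c' then (if c then a else 1) * cnj b else 0) * cnj y
      + (if c \<and> c' then b * cnj b else 0) * (y * cnj y)" for y
    by (simp add: f_def algebra_simps)
  show "integrable (complex_gaussian v) (\<lambda>y. f c a y * cnj (f c' a' y))"
    unfolding eq using m(1,3) icnj by (intro Bochner_Integration.integrable_add integrable_mult_right) auto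
  show "(\<integral>y. f c a y * cnj (f c' a' y) \<partial>complex_gaussian v) =
      (if c then a else 1) * cnj (if c' then a' else 1) + (if c \<and> c' then b * cnj b * v else 0)"
    unfolding eq using m icnj ecnj
    by (subst Bochner_Integration.integral_add Bochner_Integration.integral_mult_right_zero;
        (intro Bochner_Integration.integrable_add integrable_mult_right)?; simp add: p.prob_space)+
qed

lemma permanent_submatrix:
  "permanent (output_submatrix n A z) = (\<Sum>\<sigma>\<in>perms n. \<Prod>i<n. A $$ (i, z ! \<sigma> i))"
proof -
  have "(\<Prod>i<n. output_submatrix n A z $$ (i, \<sigma> i)) = (\<Prod>i<n. A $$ (i, z ! \<sigma> i))" if "\<sigma> \<in> perms n" for \<sigma>
    using perms_less[OF that] by (intro prod.cong refl) (simp add: output_submatrix_def)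
  then show ?thesis
    by (simp add: permanent_def perms_def output_submatrix_def atLeast0LessThan)
qed

text \<open>The shape of the average over one row: columns other than the two selected ones
  contribute 1, and if these coincide the variance term \<open>c\<close> appears.\<close>

lemma prod_two_points:
  fixes a b c :: complex and m :: nat
  assumes "s < m" "s' < m"
  shows "(\<Prod>t<m. (if t = s then a else 1) * (if t = s' then b else 1) + (if t = s \<and> t = s' then c else 0)) =
    a * b + (if s = s' then c else 0)"
proof (cases "s = s'")
  case True
  have "(\<Prod>t<m. (if t = s then a else 1) * (if t = s' then b else 1) + (if t = s \<and> t = s' then c else 0)) =
      (\<Prod>t<m. if t = s then a * b + c else 1)" using True by (intro prod.cong) auto
  then show ?thesis using assms True by simp
next
  case False
  have "(\<Prod>t<m. (if t = s then a else 1) * (if t = s' then b else 1) + (if t = s \<and> t = s' then c else 0)) =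
      (\<Prod>t<m. (if t = s then a else 1) * (if t = s' then b else 1))" using False by (intro prod.cong) auto
  then show ?thesis using assms False by (simp add: prod.distrib)
qed

text \<open>Closed form of the average of a squared permanent with independent noise in each entry:
  noise contributes only where both permutations use the same entry.\<close>

definition noisy_sum :: "nat => real => real => (nat => nat => complex) => complex" where
  "noisy_sum n v x X = (\<Sum>\<sigma>\<in>perms n. \<Sum>\<tau>\<in>perms n. \<Prod>i<n.
     of_real x * (X i (\<sigma> i) * cnj (X i (\<tau> i))) + (if \<sigma> i = \<tau> i then of_real ((1 - x) * v) else 0))"

text \<open>Expand the square over pairs of permutations. Each product extends to all
  \<open>m * m\<close> independent entries, so the integral factorises. Row \<open>i\<close> selects
  the columns \<open>z ! \<sigma> i\<close> and \<open>z ! \<tau> i\<close>, which coincide exactly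
  if \<open>\<sigma> i = \<tau> i\<close>, because \<open>z\<close> has no repetitions.\<close>

lemma noisy_click_prob_eq:
  assumes U: "U \<in> carrier_mat m m" and z: "z \<in> collision_free n m" and n: "0 < n" "n \<le> m"
    and x: "0 \<le> x" "x \<le> 1"
  shows "complex_of_real (noisy_click_prob n m x U z) = noisy_sum n (1 / real m) x (\<lambda>i p. U $$ (i, z ! p))"
proof -
  define v where "v = 1 / real m"
  have v: "0 < v" using n by (simp add: v_def)
  have zlen: "length z = n" "sorted_wrt (<) z" "set z \<subseteq> {..<m}" using z by (auto simp: collision_free_def)
  have zm: "z ! p < m" if "p < n" for p using subsetD[OF zlen(3) nth_mem[of p z]] zlen(1) that by simp
  have zinj: "z ! p = z ! q \<longleftrightarrow> p = q" if "p < n" "q < n" for p q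
    using zlen that strict_sorted_iff[of z] by (simp add: nth_eq_iff_index_eq)
  let ?J = "{..<m} \<times> {..<m}"
  let ?G = "\<lambda>_ :: nat \<times> nat. complex_gaussian v"
  interpret product_prob_space ?G ?J
    using prob_space_complex_gaussian[OF v] by (auto simp: product_prob_space_def product_prob_space_axioms_def product_sigma_finite_def prob_space_imp_sigma_finite)
  define \<alpha> \<beta> where "\<alpha> = complex_of_real (sqrt x)" and "\<beta> = complex_of_real (sqrt (1 - x))"
  have \<alpha>: "\<alpha> * cnj \<alpha> = of_real x" and \<beta>: "\<beta> * cnj \<beta> = of_real (1 - x)"
    using x unfolding \<alpha>_def \<beta>_def by (simp_all flip: of_real_mult)
  let ?A = "\<lambda>y i t. \<alpha> * U $$ (i, t) + \<beta> * y (i, t)"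
  have entry: "noisy_matrix m x U y $$ (i, t) = ?A y i t" if "i < m" "t < m" for y i t
    using that U by (simp add: noisy_matrix_def \<alpha>_def \<beta>_def)
  let ?f = "\<lambda>c u y. if c then u + \<beta> * y else (1 :: complex)"
  \<comment> \<open>Entries below the first \<open>n\<close> rows, or not selected by a permutation,
    contribute the factor 1, so that the product runs over the whole index set of the product
    measure.\<close>
  let ?h = "\<lambda>\<sigma> \<tau> it y. ?f (fst it < n \<and> snd it = z ! \<sigma> (fst it)) (\<alpha> * U $$ it) y
      * cnj (?f (fst it < n \<and> snd it = z ! \<tau> (fst it)) (\<alpha> * U $$ it) y)"
  have factor: "(\<Prod>i<n. ?A y i (z ! \<sigma> i) * cnj (?A y i (z ! \<tau> i))) = (\<Prod>it\<in>?J. ?h \<sigma> \<tau> it (y it))"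
    if st: "\<sigma> \<in> perms n" "\<tau> \<in> perms n" for \<sigma> \<tau> y
  proof -
    have inner: "(\<Prod>t<m. ?h \<sigma> \<tau> (i, t) (y (i, t))) = (if i < n then ?A y i (z ! \<sigma> i) * cnj (?A y i (z ! \<tau> i)) else 1)" for i
    proof (cases "i < n")
      case True
      have "(\<Prod>t<m. ?h \<sigma> \<tau> (i, t) (y (i, t))) =
          (\<Prod>t<m. if t = z ! \<sigma> i then ?A y i t else 1) * (\<Prod>t<m. if t = z ! \<tau> i then cnj (?A y i t) else 1)"
        unfolding prod.distrib[symmetric] using True by (intro prod.cong) auto
      then show ?thesis using True zm perms_less[OF st(1)] perms_less[OF st(2)] by simp
    qed simp
    have "(\<Prod>it\<in>?J. ?h \<sigma> \<tau> it (y it)) = (\<Prod>i<m. \<Prod>t<m. ?h \<sigma> \<tau> (i, t) (y (i, t)))"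
      by (simp only: prod.cartesian_product case_prod_unfold prod.collapse)
    also have "\<dots> = (\<Prod>i<m. if i < n then ?A y i (z ! \<sigma> i) * cnj (?A y i (z ! \<tau> i)) else 1)"
      unfolding inner ..
    also have "\<dots> = (\<Prod>i<n. ?A y i (z ! \<sigma> i) * cnj (?A y i (z ! \<tau> i)))"
      using n(2) by (intro prod.mono_neutral_cong_right) auto
    finally show ?thesis by simp
  qed
  have hint: "integrable (complex_gaussian v) (?h \<sigma> \<tau> it)" for \<sigma> \<tau> it
    by (rule affine_gaussian_integral(1)[OF v])
  have int: "integrable (PiM ?J ?G) (\<lambda>y. \<Prod>it\<in>?J. ?h \<sigma> \<tau> it (y it))" for \<sigma> \<tau>
    by (intro product_integrable_prod hint) auto
  have val: "(\<integral>y. (\<Prod>it\<in>?J. ?h \<sigma> \<tau> it (y it)) \<partial>PiM ?J ?G) =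
      (\<Prod>i<n. of_real x * (U $$ (i, z ! \<sigma> i) * cnj (U $$ (i, z ! \<tau> i))) + (if \<sigma> i = \<tau> i then of_real ((1 - x) * v) else 0))"
    if st: "\<sigma> \<in> perms n" "\<tau> \<in> perms n" for \<sigma> \<tau>
  proof -
    let ?e = "\<lambda>it. (\<integral>y. ?h \<sigma> \<tau> it y \<partial>complex_gaussian v)"
    have inner: "(\<Prod>t<m. ?e (i, t)) = (if i < n then of_real x * (U $$ (i, z ! \<sigma> i) * cnj (U $$ (i, z ! \<tau> i)))
        + (if \<sigma> i = \<tau> i then of_real ((1 - x) * v) else 0) else 1)" for i
    proof (cases "i < n")
      case True
      have s: "\<sigma> i < n" "\<tau> i < n" using perms_less[OF st(1) True] perms_less[OF st(2) True] by auto
      have "(\<Prod>t<m. ?e (i, t)) = (\<Prod>t<m. (if t = z ! \<sigma> i then \<alpha> * U $$ (i, z ! \<sigma> i) else 1) *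
          (if t = z ! \<tau> i then cnj (\<alpha> * U $$ (i, z ! \<tau> i)) else 1) +
          (if t = z ! \<sigma> i \<and> t = z ! \<tau> i then \<beta> * cnj \<beta> * v else 0))"
        using True by (intro prod.cong refl) (subst affine_gaussian_integral(2)[OF v], auto)
      also have "\<dots> = \<alpha> * U $$ (i, z ! \<sigma> i) * cnj (\<alpha> * U $$ (i, z ! \<tau> i)) + (if z ! \<sigma> i = z ! \<tau> i then \<beta> * cnj \<beta> * v else 0)"
        by (rule prod_two_points) (use s zm in auto)
      also have "\<alpha> * U $$ (i, z ! \<sigma> i) * cnj (\<alpha> * U $$ (i, z ! \<tau> i)) = (\<alpha> * cnj \<alpha>) * (U $$ (i, z ! \<sigma> i) * cnj (U $$ (i, z ! \<tau> i)))"
        by (simp add: mult_ac)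
      finally show ?thesis using True zinj[OF s] unfolding \<alpha> \<beta> by simp
    next
      case False
      have "?e (i, t) = 1" for t using False by (subst affine_gaussian_integral(2)[OF v]) simp
      then show ?thesis using False by simp
    qed
    have "(\<integral>y. (\<Prod>it\<in>?J. ?h \<sigma> \<tau> it (y it)) \<partial>PiM ?J ?G) = (\<Prod>it\<in>?J. ?e it)"
      by (intro product_integral_prod hint) auto
    also have "\<dots> = (\<Prod>i<m. \<Prod>t<m. ?e (i, t))" by (simp only: prod.cartesian_product case_prod_unfold prod.collapse)
    also have "\<dots> = (\<Prod>i<n. of_real x * (U $$ (i, z ! \<sigma> i) * cnj (U $$ (i, z ! \<tau> i))) + (if \<sigma> i = \<tau> i then of_real ((1 - x) * v) else 0))"
      unfolding inner using n(2) by (intro prod.mono_neutral_cong_right) auto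
    finally show ?thesis .
  qed
  have sq: "complex_of_real ((cmod (permanent (output_submatrix n (noisy_matrix m x U y) z)))\<^sup>2) =
      (\<Sum>\<sigma>\<in>perms n. \<Sum>\<tau>\<in>perms n. \<Prod>it\<in>?J. ?h \<sigma> \<tau> it (y it))" for y
  proof -
    have "permanent (output_submatrix n (noisy_matrix m x U y) z) = (\<Sum>\<sigma>\<in>perms n. \<Prod>i<n. ?A y i (z ! \<sigma> i))"
      unfolding permanent_submatrix
      by (intro sum.cong prod.cong refl entry) (use zm perms_less n in auto)
    then have "complex_of_real ((cmod (permanent (output_submatrix n (noisy_matrix m x U y) z)))\<^sup>2) =
        (\<Sum>\<sigma>\<in>perms n. \<Sum>\<tau>\<in>perms n. (\<Prod>i<n. ?A y i (z ! \<sigma> i)) * cnj (\<Prod>i<n. ?A y i (z ! \<tau> i)))"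
      unfolding complex_norm_square by (simp only: cnj_sum sum_product)
    also have "\<dots> = (\<Sum>\<sigma>\<in>perms n. \<Sum>\<tau>\<in>perms n. \<Prod>it\<in>?J. ?h \<sigma> \<tau> it (y it))"
    proof (intro sum.cong refl)
      fix \<sigma> \<tau> assume st: "\<sigma> \<in> perms n" "\<tau> \<in> perms n"
      have "(\<Prod>i<n. ?A y i (z ! \<sigma> i)) * cnj (\<Prod>i<n. ?A y i (z ! \<tau> i)) = (\<Prod>i<n. ?A y i (z ! \<sigma> i) * cnj (?A y i (z ! \<tau> i)))"
        unfolding prod.distrib cnj_prod ..
      then show "(\<Prod>i<n. ?A y i (z ! \<sigma> i)) * cnj (\<Prod>i<n. ?A y i (z ! \<tau> i)) = (\<Prod>it\<in>?J. ?h \<sigma> \<tau> it (y it))"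
        using factor[OF st] by simp
    qed
    finally show ?thesis .
  qed
  have "complex_of_real (noisy_click_prob n m x U z) =
      (\<integral>y. complex_of_real ((cmod (permanent (output_submatrix n (noisy_matrix m x U y) z)))\<^sup>2) \<partial>PiM ?J ?G)"
    unfolding noisy_click_prob_def gaussian_entries_def v_def by (simp only: integral_complex_of_real)
  also have "\<dots> = (\<Sum>\<sigma>\<in>perms n. \<Sum>\<tau>\<in>perms n. \<integral>y. (\<Prod>it\<in>?J. ?h \<sigma> \<tau> it (y it)) \<partial>PiM ?J ?G)"
    unfolding sq using int by (subst Bochner_Integration.integral_sum; (intro Bochner_Integration.integrable_sum)?; simp)+
  also have "\<dots> = noisy_sum n v x (\<lambda>i p. U $$ (i, z ! p))"
    unfolding noisy_sum_def by (intro sum.cong refl val)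
  finally show ?thesis by (simp add: v_def)
qed

section \<open>Chaos expansion of the noisy click probabilities\<close>

lemma sum_Pow_card:
  "(\<Sum>S\<in>Pow {..<n}. h S) = (\<Sum>j\<le>n. \<Sum>S\<in>subsets n j. h S)"
proof -
  have "(\<Sum>j\<in>{..n}. sum h {S \<in> Pow {..<n}. card S = j}) = sum h (Pow {..<n})"
  proof (rule sum.group)
    show "card ` Pow {..<n} \<subseteq> {..n}"
      using card_mono[of "{..<n}"] by fastforce
  qed auto
  moreover have "{S \<in> Pow {..<n}. card S = j} = subsets n j" for j
    by (auto simp: subsets_def)
  ultimately show ?thesis by simp
qed

lemma prod_if_subset:
  assumes "S \<subseteq> {..<n :: nat}"
  shows "(\<Prod>i<n. if i \<in> S then f i else g i) = (\<Prod>i\<in>S. f i) * (\<Prod>i\<in>{..<n} - S. g i :: complex)"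
proof -
  have "(\<Prod>i<n. if i \<in> S then f i else g i) =
      (\<Prod>i\<in>{..<n} - S. if i \<in> S then f i else g i) * (\<Prod>i\<in>S. if i \<in> S then f i else g i)"
    by (rule prod.subset_diff[OF assms]) simp
  also have "(\<Prod>i\<in>{..<n} - S. if i \<in> S then f i else g i) = (\<Prod>i\<in>{..<n} - S. g i)"
    by (intro prod.cong) auto
  also have "(\<Prod>i\<in>S. if i \<in> S then f i else g i) = (\<Prod>i\<in>S. f i)"
    by (intro prod.cong) auto
  finally show ?thesis by (simp only: mult.commute)
qed

text \<open>Each factor is \<open>x\<close> times the centred factor plus the constant one, because
  the mean subtracted with weight \<open>x\<close> completes \<open>(1 - x) * v\<close> to
  \<open>v\<close>. Expanding the product, \<open>S\<close> is the set of rows that contribute a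
  centred factor.\<close>

lemma noisy_sum_eq_chaos:
  "(\<Sum>\<sigma>\<in>perms n. \<Sum>\<tau>\<in>perms n. \<Prod>i<n. of_real x * (X i (\<sigma> i) * cnj (X i (\<tau> i)))
      + (if \<sigma> i = \<tau> i then of_real ((1 - x) * v) else 0)) =
   (\<Sum>j\<le>n. of_real x ^ j * chaos n v j X)"
proof -
  have "(\<Prod>i<n. of_real x * (X i (\<sigma> i) * cnj (X i (\<tau> i))) + (if \<sigma> i = \<tau> i then of_real ((1 - x) * v) else 0)) =
      (\<Sum>j\<le>n. \<Sum>S\<in>subsets n j. of_real x ^ j * (\<Prod>i<n. fac v (i \<in> S) (X i) (\<sigma> i) (\<tau> i)))" for \<sigma> \<tau>
  proof -
    have "(\<Prod>i<n. of_real x * (X i (\<sigma> i) * cnj (X i (\<tau> i))) + (if \<sigma> i = \<tau> i then of_real ((1 - x) * v) else 0)) =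
        (\<Prod>i<n. of_real x * fac v True (X i) (\<sigma> i) (\<tau> i) + fac v False (X i) (\<sigma> i) (\<tau> i))"
      by (intro prod.cong refl) (auto simp: fac_def algebra_simps)
    also have "\<dots> = (\<Sum>S\<in>Pow {..<n}. (\<Prod>i\<in>S. of_real x * fac v True (X i) (\<sigma> i) (\<tau> i)) *
        (\<Prod>i\<in>{..<n} - S. fac v False (X i) (\<sigma> i) (\<tau> i)))"
      by (rule prod_add) simp
    also have "\<dots> = (\<Sum>S\<in>Pow {..<n}. of_real x ^ card S * (\<Prod>i<n. fac v (i \<in> S) (X i) (\<sigma> i) (\<tau> i)))"
    proof (intro sum.cong refl)
      fix S assume "S \<in> Pow {..<n}"
      then have S: "S \<subseteq> {..<n}" by simp
      have "(\<Prod>i<n. fac v (i \<in> S) (X i) (\<sigma> i) (\<tau> i)) =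
          (\<Prod>i<n. if i \<in> S then fac v True (X i) (\<sigma> i) (\<tau> i) else fac v False (X i) (\<sigma> i) (\<tau> i))"
        by (intro prod.cong) auto
      then show "(\<Prod>i\<in>S. of_real x * fac v True (X i) (\<sigma> i) (\<tau> i)) * (\<Prod>i\<in>{..<n} - S. fac v False (X i) (\<sigma> i) (\<tau> i))
          = of_real x ^ card S * (\<Prod>i<n. fac v (i \<in> S) (X i) (\<sigma> i) (\<tau> i))"
        unfolding prod_if_subset[OF S] by (simp add: prod.distrib)
    qed
    also have "\<dots> = (\<Sum>j\<le>n. \<Sum>S\<in>subsets n j. of_real x ^ j * (\<Prod>i<n. fac v (i \<in> S) (X i) (\<sigma> i) (\<tau> i)))"
      unfolding sum_Pow_card by (intro sum.cong refl) (simp add: subsets_def)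
    finally show ?thesis .
  qed
  then have "(\<Sum>\<sigma>\<in>perms n. \<Sum>\<tau>\<in>perms n. \<Prod>i<n. of_real x * (X i (\<sigma> i) * cnj (X i (\<tau> i)))
      + (if \<sigma> i = \<tau> i then of_real ((1 - x) * v) else 0)) =
    (\<Sum>\<sigma>\<in>perms n. \<Sum>\<tau>\<in>perms n. \<Sum>j\<le>n. \<Sum>S\<in>subsets n j. of_real x ^ j * (\<Prod>i<n. fac v (i \<in> S) (X i) (\<sigma> i) (\<tau> i)))"
    by simp
  also have "\<dots> = (\<Sum>j\<le>n. \<Sum>\<sigma>\<in>perms n. \<Sum>\<tau>\<in>perms n. \<Sum>S\<in>subsets n j. of_real x ^ j * (\<Prod>i<n. fac v (i \<in> S) (X i) (\<sigma> i) (\<tau> i)))"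
    by (rule sum_rotate[symmetric])
  finally show ?thesis unfolding chaos_def sum_distrib_left .
qed

section \<open>From permutations to injections of few points\<close>

definition injections :: "nat => nat => (nat => nat) set" where
  "injections j n = {r \<in> {..<j} \<rightarrow>\<^sub>E {..<n}. inj_on r {..<j}}"

lemma finite_injections [simp]: "finite (injections j n)"
  unfolding injections_def by (rule finite_subset[of _ "{..<j} \<rightarrow>\<^sub>E {..<n}"]) (auto intro: finite_PiE)

lemma injectionsD:
  assumes "r \<in> injections j n"
  shows "inj_on r {..<j}" "l < j ==> r l < n" "r ` {..<j} \<in> subsets n j"
  using assms by (auto simp: injections_def subsets_def PiE_iff card_image)

lemma injections_ext:
  "r \<in> injections j n ==> r' \<in> injections j n ==> (\<And>l. l < j ==> r l = r' l) ==> r = r'"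
  unfolding injections_def by (auto intro: PiE_ext)

lemma restrict_comp_injections:
  "\<sigma> \<in> perms n ==> r \<in> injections j n ==> restrict (\<sigma> \<circ> r) {..<j} \<in> injections j n"
  unfolding injections_def using perms_less[of \<sigma> n]
  by (auto simp: inj_on_def PiE_iff perms_def dest!: injD[OF permutes_inj])

lemma restrict_comp_perm_injections:
  "\<pi> \<in> perms j ==> r \<in> injections j n ==> restrict (r \<circ> \<pi>) {..<j} \<in> injections j n"
proof -
  assume \<pi>: "\<pi> \<in> perms j" and r: "r \<in> injections j n"
  have "inj_on (r \<circ> \<pi>) {..<j}"
    using \<pi> injectionsD(1)[OF r] perms_less[OF \<pi>]
    by (intro comp_inj_on) (auto simp: perms_def intro: inj_on_subset permutes_inj_on)
  then show ?thesis
    using injectionsD(2)[OF r] perms_less[OF \<pi>] by (auto simp: injections_def inj_on_def)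
qed

text \<open>The complements of two images of size \<open>j\<close> have equal size, so the
  prescribed values extend to a bijection.\<close>

lemma extend_to_perm:
  assumes r: "r \<in> injections j n" and s: "s \<in> injections j n"
  shows "\<exists>\<sigma>\<in>perms n. \<forall>l<j. \<sigma> (r l) = s l"
proof -
  let ?A = "r ` {..<j}" and ?B = "s ` {..<j}"
  have A: "?A \<subseteq> {..<n}" "card ?A = j" and B: "?B \<subseteq> {..<n}" "card ?B = j"
    using injectionsD(3)[OF r] injectionsD(3)[OF s] by (auto simp: subsets_def)
  have "card ({..<n} - ?A) = card ({..<n} - ?B)"
    using A B by (simp add: card_Diff_subset)
  then obtain g where g: "bij_betw g ({..<n} - ?A) ({..<n} - ?B)"
    using finite_same_card_bij[of "{..<n} - ?A" "{..<n} - ?B"] by auto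
  define f where "f = s \<circ> inv_into {..<j} r"
  have f: "bij_betw f ?A ?B"
    unfolding f_def using injectionsD(1)[OF r] injectionsD(1)[OF s]
    by (intro bij_betw_trans[OF bij_betw_inv_into]) (auto simp: bij_betw_def)
  define \<sigma> where "\<sigma> = (\<lambda>i. if i \<in> ?A then f i else if i < n then g i else i)"
  have "bij_betw \<sigma> (?A \<union> ({..<n} - ?A)) (?B \<union> ({..<n} - ?B))"
  proof (rule bij_betw_combine)
    show "bij_betw \<sigma> ?A ?B" using f by (rule bij_betw_cong[THEN iffD1, rotated]) (simp add: \<sigma>_def)
    show "bij_betw \<sigma> ({..<n} - ?A) ({..<n} - ?B)" using g by (rule bij_betw_cong[THEN iffD1, rotated]) (simp add: \<sigma>_def)
  qed auto
  moreover have "?A \<union> ({..<n} - ?A) = {..<n}" "?B \<union> ({..<n} - ?B) = {..<n}" using A B by auto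
  ultimately have "bij_betw \<sigma> {..<n} {..<n}" by simp
  then have "\<sigma> permutes {..<n}"
    by (rule bij_imp_permutes) (use A in \<open>auto simp: \<sigma>_def\<close>)
  moreover have "\<sigma> (r l) = s l" if "l < j" for l
    using that injectionsD(1)[OF r] by (simp add: \<sigma>_def f_def)
  ultimately show ?thesis by (auto simp: perms_def)
qed

text \<open>The summand sees \<open>\<sigma>\<close> only on the image of \<open>r\<close>, and each
  injection arises from \<open>fact (n - j)\<close> permutations.\<close>

lemma sum_perms_restrict:
  fixes h :: "(nat => nat) => complex"
  assumes r: "r \<in> injections j n"
  shows "(\<Sum>\<sigma>\<in>perms n. h (restrict (\<sigma> \<circ> r) {..<j})) = fact (n - j) * (\<Sum>s\<in>injections j n. h s)"
proof -
  have "(\<Sum>\<sigma>\<in>perms n. h (restrict (\<sigma> \<circ> r) {..<j})) =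
      (\<Sum>s\<in>injections j n. \<Sum>\<sigma>\<in>{\<sigma> \<in> perms n. restrict (\<sigma> \<circ> r) {..<j} = s}. h (restrict (\<sigma> \<circ> r) {..<j}))"
    by (rule sum.group[symmetric]) (use restrict_comp_injections[OF _ r] in auto)
  also have "\<dots> = (\<Sum>s\<in>injections j n. fact (n - j) * h s)"
  proof (intro sum.cong refl)
    fix s assume s: "s \<in> injections j n"
    obtain \<sigma>0 where \<sigma>0: "\<sigma>0 \<in> perms n" "\<And>l. l < j ==> \<sigma>0 (r l) = s l"
      using extend_to_perm[OF r s] by blast
    let ?S = "r ` {..<j}"
    have S: "?S \<subseteq> {..<n}" "card ?S = j" using injectionsD(3)[OF r] by (auto simp: subsets_def)
    have "{\<sigma> \<in> perms n. restrict (\<sigma> \<circ> r) {..<j} = s} = {\<sigma> \<in> perms n. \<forall>i\<in>{..<n} - ({..<n} - ?S). \<sigma> i = \<sigma>0 i}"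
    proof (intro Collect_cong conj_cong refl)
      fix \<sigma> assume \<sigma>: "\<sigma> \<in> perms n"
      have "restrict (\<sigma> \<circ> r) {..<j} = s \<longleftrightarrow> (\<forall>l<j. \<sigma> (r l) = s l)"
      proof
        assume "\<forall>l<j. \<sigma> (r l) = s l"
        then show "restrict (\<sigma> \<circ> r) {..<j} = s"
          by (intro injections_ext[OF restrict_comp_injections[OF \<sigma> r] s]) simp
      qed auto
      also have "\<dots> \<longleftrightarrow> (\<forall>i\<in>{..<n} - ({..<n} - ?S). \<sigma> i = \<sigma>0 i)" using S \<sigma>0(2) by auto
      finally show "restrict (\<sigma> \<circ> r) {..<j} = s \<longleftrightarrow> (\<forall>i\<in>{..<n} - ({..<n} - ?S). \<sigma> i = \<sigma>0 i)" .
    qed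
    moreover have "card {\<sigma> \<in> perms n. \<forall>i\<in>{..<n} - ({..<n} - ?S). \<sigma> i = \<sigma>0 i} = fact (n - j)"
      using card_perms_agree[OF \<sigma>0(1), of "{..<n} - ?S"] S by (simp add: card_Diff_subset finite_subset[OF S(1)])
    ultimately have "of_nat (card {\<sigma> \<in> perms n. restrict (\<sigma> \<circ> r) {..<j} = s}) = (fact (n - j) :: complex)" by simp
    then show "(\<Sum>\<sigma>\<in>{\<sigma> \<in> perms n. restrict (\<sigma> \<circ> r) {..<j} = s}. h (restrict (\<sigma> \<circ> r) {..<j})) = fact (n - j) * h s"
      by simp
  qed
  finally show ?thesis by (simp add: sum_distrib_left)
qed

text \<open>The sum over a second permutation that agrees with \<open>\<sigma>\<close> outside \<open>S\<close>, for an enumeration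
  \<open>r\<close> of \<open>S\<close>.\<close>

lemma sum_perms_agree:
  fixes h :: "(nat => nat) => complex"
  assumes \<sigma>: "\<sigma> \<in> perms n" and r: "r \<in> injections j n"
  shows "(\<Sum>\<tau>\<in>{\<tau> \<in> perms n. \<forall>i\<in>{..<n} - r ` {..<j}. \<tau> i = \<sigma> i}. h (restrict (\<tau> \<circ> r) {..<j})) =
    (\<Sum>\<pi>\<in>perms j. h (restrict (\<sigma> \<circ> r \<circ> \<pi>) {..<j}))"
proof -
  let ?S = "r ` {..<j}"
  let ?ri = "inv_into {..<j} r"
  \<comment> \<open>On the image of \<open>r\<close>, \<open>\<pi>\<close> acts on the labels before
    \<open>\<sigma>\<close> is applied; the map \<open>?bwd\<close> recovers it by undoing
    \<open>\<sigma>\<close> and reading off labels.\<close>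
  let ?fwd = "\<lambda>\<pi> i. if i \<in> ?S then \<sigma> (r (\<pi> (?ri i))) else \<sigma> i"
  let ?bwd = "\<lambda>\<tau> l. if l < j then ?ri (inv_into UNIV \<sigma> (\<tau> (r l))) else l"
  have \<sigma>p: "\<sigma> permutes {..<n}" using \<sigma> by (simp add: perms_def)
  have ri: "?ri (r l) = l" if "l < j" for l using that injectionsD(1)[OF r] by simp
  have ri': "r (?ri i) = i" "?ri i < j" if "i \<in> ?S" for i
    using that f_inv_into_f[of i r "{..<j}"] inv_into_into[of i r "{..<j}"] by auto
  have S: "?S \<subseteq> {..<n}" using injectionsD(3)[OF r] by (auto simp: subsets_def)
  show ?thesis
  proof (rule sum.reindex_bij_witness[where i = ?fwd and j = ?bwd])
    fix \<pi> assume \<pi>: "\<pi> \<in> perms j"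
    then have \<pi>p: "\<pi> permutes {..<j}" by (simp add: perms_def)
    define \<rho> where "\<rho> = (\<lambda>i. if i \<in> ?S then r (\<pi> (?ri i)) else i)"
    have "\<rho> permutes ?S"
    proof (rule bij_imp_permutes)
      have "bij_betw (r \<circ> \<pi> \<circ> ?ri) ?S ?S"
        using injectionsD(1)[OF r] permutes_imp_bij[OF \<pi>p]
        by (intro bij_betw_trans[OF bij_betw_inv_into] bij_betw_trans) (auto simp: bij_betw_def)
      then show "bij_betw \<rho> ?S ?S" by (rule bij_betw_cong[THEN iffD1, rotated]) (simp add: \<rho>_def)
    qed (simp add: \<rho>_def)
    then have "\<rho> permutes {..<n}" using S by (rule permutes_subset)
    then have "\<sigma> \<circ> \<rho> permutes {..<n}" using \<sigma>p by (rule permutes_compose)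
    moreover have "\<sigma> \<circ> \<rho> = ?fwd \<pi>" by (auto simp: \<rho>_def fun_eq_iff)
    ultimately have fp: "?fwd \<pi> permutes {..<n}" by simp
    then show "?fwd \<pi> \<in> {\<tau> \<in> perms n. \<forall>i\<in>{..<n} - ?S. \<tau> i = \<sigma> i}" by (auto simp: perms_def)
    show "?bwd (?fwd \<pi>) = \<pi>"
    proof
      fix l show "?bwd (?fwd \<pi>) l = \<pi> l"
        using \<pi>p perms_less[OF \<pi>, of l] \<sigma>p by (auto simp: ri permutes_inverses(2) permutes_not_in)
    qed
  next
    fix \<tau> assume "\<tau> \<in> {\<tau> \<in> perms n. \<forall>i\<in>{..<n} - ?S. \<tau> i = \<sigma> i}"
    then have \<tau>: "\<tau> permutes {..<n}" "\<And>i. i \<in> {..<n} - ?S ==> \<tau> i = \<sigma> i" by (auto simp: perms_def)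
    define \<rho> where "\<rho> = inv_into UNIV \<sigma> \<circ> \<tau>"
    have "\<rho> permutes {..<n}" unfolding \<rho>_def using \<tau>(1) \<sigma>p permutes_compose permutes_inv by blast
    moreover have "\<rho> i = i" if "i \<in> {..<n} - ?S" for i
      using \<tau>(2)[OF that] \<sigma>p by (simp add: \<rho>_def permutes_inverses(2))
    ultimately have \<rho>: "\<rho> permutes ?S" by (rule permutes_superset)
    have \<rho>S: "\<rho> i \<in> ?S" if "i \<in> ?S" for i using permutes_in_image[OF \<rho>] that by simp
    have bwd: "?bwd \<tau> = (\<lambda>l. if l < j then ?ri (\<rho> (r l)) else l)" by (auto simp: \<rho>_def fun_eq_iff)
    have "?bwd \<tau> permutes {..<j}"
      unfolding bwd
    proof (rule bij_imp_permutes)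
      have "bij_betw (?ri \<circ> \<rho> \<circ> r) {..<j} {..<j}"
        using injectionsD(1)[OF r] permutes_imp_bij[OF \<rho>]
        by (intro bij_betw_trans[of r _ ?S] bij_betw_trans[of \<rho> ?S ?S] bij_betw_inv_into) (auto simp: bij_betw_def)
      then show "bij_betw (\<lambda>l. if l < j then ?ri (\<rho> (r l)) else l) {..<j} {..<j}"
        by (rule bij_betw_cong[THEN iffD1, rotated]) simp
    qed simp
    then show "?bwd \<tau> \<in> perms j" by (simp add: perms_def)
    have "restrict (\<sigma> \<circ> r \<circ> ?bwd \<tau>) {..<j} = restrict (\<tau> \<circ> r) {..<j}"
    proof (rule restrict_ext)
      fix l assume "l \<in> {..<j}"
      then show "(\<sigma> \<circ> r \<circ> ?bwd \<tau>) l = (\<tau> \<circ> r) l"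
        using \<rho>S[of "r l"] ri'(1)[of "\<rho> (r l)"] \<sigma>p by (simp add: bwd) (simp add: \<rho>_def permutes_inverses(1))
    qed
    then show "h (restrict (\<sigma> \<circ> r \<circ> ?bwd \<tau>) {..<j}) = h (restrict (\<tau> \<circ> r) {..<j})" by (rule arg_cong)
    show "?fwd (?bwd \<tau>) = \<tau>"
    proof
      fix i show "?fwd (?bwd \<tau>) i = \<tau> i"
      proof (cases "i \<in> ?S")
        case True
        then have "?bwd \<tau> (?ri i) = ?ri (\<rho> i)" by (simp add: ri' \<rho>_def)
        then have "?fwd (?bwd \<tau>) i = \<sigma> (r (?ri (\<rho> i)))" using True by (simp only: if_True)
        then have "?fwd (?bwd \<tau>) i = \<sigma> (\<rho> i)" by (simp only: ri'(1)[OF \<rho>S[OF True]])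
        then show ?thesis using \<sigma>p by (simp add: \<rho>_def permutes_inverses(1))
      next
        case False
        then show ?thesis using \<tau> \<sigma>p by (cases "i < n") (auto simp: permutes_not_in)
      qed
    qed
  qed
qed

text \<open>All enumerations of \<open>S\<close> arise from one of them by permuting the
  labels.\<close>

lemma card_injections_onto:
  assumes S: "S \<in> subsets n j"
  shows "card {r \<in> injections j n. r ` {..<j} = S} = fact j"
proof -
  have S': "finite S" "card S = j" "S \<subseteq> {..<n}" using S by (auto simp: subsets_def intro: finite_subset)
  obtain r0 where r0: "bij_betw r0 {..<j} S"
    using finite_same_card_bij[of "{..<j}" S] S' by auto
  have r0i: "inj_on r0 {..<j}" "r0 ` {..<j} = S" using r0 by (auto simp: bij_betw_def)
  have r0m: "restrict r0 {..<j} \<in> injections j n"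
    using r0i S' by (auto simp: injections_def inj_on_def)
  have "{r \<in> injections j n. r ` {..<j} = S} = (\<lambda>\<pi>. restrict (r0 \<circ> \<pi>) {..<j}) ` perms j"
  proof (intro equalityI subsetI)
    fix r assume "r \<in> {r \<in> injections j n. r ` {..<j} = S}"
    then have r: "r \<in> injections j n" "r ` {..<j} = S" by auto
    define \<pi> where "\<pi> = (\<lambda>l. if l < j then inv_into {..<j} r0 (r l) else l)"
    have "bij_betw (inv_into {..<j} r0 \<circ> r) {..<j} {..<j}"
      using injectionsD(1)[OF r(1)] r(2) bij_betw_inv_into[OF r0]
      by (intro bij_betw_trans[of r _ S]) (auto simp: bij_betw_def)
    then have "bij_betw \<pi> {..<j} {..<j}" by (rule bij_betw_cong[THEN iffD1, rotated]) (simp add: \<pi>_def)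
    then have "\<pi> permutes {..<j}" by (rule bij_imp_permutes) (simp add: \<pi>_def)
    moreover have "r = restrict (r0 \<circ> \<pi>) {..<j}"
    proof
      fix l show "r l = restrict (r0 \<circ> \<pi>) {..<j} l"
      proof (cases "l < j")
        case True
        then have "r l \<in> r0 ` {..<j}" using r(2) r0i(2) by auto
        then show ?thesis using True by (simp add: \<pi>_def f_inv_into_f)
      next
        case False
        then show ?thesis using r(1) by (auto simp: injections_def PiE_iff extensional_def)
      qed
    qed
    ultimately show "r \<in> (\<lambda>\<pi>. restrict (r0 \<circ> \<pi>) {..<j}) ` perms j" by (auto simp: perms_def)
  next
    fix r assume "r \<in> (\<lambda>\<pi>. restrict (r0 \<circ> \<pi>) {..<j}) ` perms j"
    then obtain \<pi> where \<pi>: "\<pi> \<in> perms j" "r = restrict (r0 \<circ> \<pi>) {..<j}" by auto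
    have "restrict (restrict r0 {..<j} \<circ> \<pi>) {..<j} \<in> injections j n"
      by (rule restrict_comp_perm_injections[OF \<pi>(1) r0m])
    moreover have "restrict (restrict r0 {..<j} \<circ> \<pi>) {..<j} = r"
      unfolding \<pi>(2) by (rule restrict_ext) (use perms_less[OF \<pi>(1)] in simp)
    moreover have "r ` {..<j} = S"
    proof -
      have "\<pi> ` {..<j} = {..<j}" using \<pi>(1) by (simp add: perms_def permutes_image)
      moreover have "(\<lambda>x. r0 (\<pi> x)) ` {..<j} = r0 ` (\<pi> ` {..<j})" by (simp only: image_image)
      ultimately show ?thesis unfolding \<pi>(2) using r0i(2) by simp
    qed
    ultimately show "r \<in> {r \<in> injections j n. r ` {..<j} = S}" by simp
  qed
  moreover have "inj_on (\<lambda>\<pi>. restrict (r0 \<circ> \<pi>) {..<j}) (perms j)"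
  proof (rule inj_onI)
    fix \<pi> \<pi>' assume p: "\<pi> \<in> perms j" "\<pi>' \<in> perms j"
      and eq: "restrict (r0 \<circ> \<pi>) {..<j} = restrict (r0 \<circ> \<pi>') {..<j}"
    show "\<pi> = \<pi>'"
    proof
      fix l show "\<pi> l = \<pi>' l"
      proof (cases "l < j")
        case True
        then have "r0 (\<pi> l) = r0 (\<pi>' l)" using fun_cong[OF eq, of l] by simp
        then show ?thesis using r0i(1) perms_less[OF p(1) True] perms_less[OF p(2) True] by (simp add: inj_on_def)
      next
        case False
        then show ?thesis using p by (simp add: perms_def permutes_not_in)
      qed
    qed
  qed
  ultimately show ?thesis by (simp add: card_image card_perms)
qed

text \<open>Off \<open>S\<close> the constant factors force \<open>\<tau> = \<sigma>\<close> and
  give \<open>v ^ (n - j)\<close>. The rest depends on \<open>\<sigma>\<close> only through its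
  values on \<open>S\<close>, which yields \<open>fact (n - j)\<close>, and \<open>fact j\<close> on
  the left counts the enumerations of \<open>S\<close>. At most \<open>n ^ (2 * j) * fact j\<close>
  terms remain, few enough to be summed when \<open>j\<close> is small.\<close>

lemma chaos_eq_injections:
  assumes j: "j \<le> n"
  shows "of_nat (fact j) * chaos n v j X = of_real v ^ (n - j) * of_nat (fact (n - j)) *
    (\<Sum>r\<in>injections j n. \<Sum>s\<in>injections j n. \<Sum>\<pi>\<in>perms j. \<Prod>l<j. fac v True (X (r l)) (s l) (s (\<pi> l)))"
proof -
  define G where "G = (\<lambda>\<sigma> S. \<Sum>\<tau>\<in>{\<tau> \<in> perms n. \<forall>i\<in>{..<n} - S. \<tau> i = \<sigma> i}.
     \<Prod>i\<in>S. fac v True (X i) (\<sigma> i) (\<tau> i))"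
  define H where "H = (\<lambda>r s. \<Sum>\<pi>\<in>perms j. \<Prod>l<j. fac v True (X (r l)) (s l) (s (\<pi> l)))"
  have inner: "(\<Sum>\<tau>\<in>perms n. \<Prod>i<n. fac v (i \<in> S) (X i) (\<sigma> i) (\<tau> i)) = of_real v ^ (n - j) * G \<sigma> S"
    if "\<sigma> \<in> perms n" and S: "S \<in> subsets n j" for \<sigma> S
  proof -
    have S': "S \<subseteq> {..<n}" "card S = j" "finite S" using S by (auto simp: subsets_def intro: finite_subset)
    have "(\<Prod>i<n. fac v (i \<in> S) (X i) (\<sigma> i) (\<tau> i)) =
        (if \<forall>i\<in>{..<n} - S. \<tau> i = \<sigma> i then of_real v ^ (n - j) * (\<Prod>i\<in>S. fac v True (X i) (\<sigma> i) (\<tau> i)) else 0)" for \<tau>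
    proof -
      have "(\<Prod>i<n. fac v (i \<in> S) (X i) (\<sigma> i) (\<tau> i)) =
          (\<Prod>i<n. if i \<in> S then fac v True (X i) (\<sigma> i) (\<tau> i) else fac v False (X i) (\<sigma> i) (\<tau> i))"
        by (intro prod.cong) auto
      also have "\<dots> = (\<Prod>i\<in>S. fac v True (X i) (\<sigma> i) (\<tau> i)) * (\<Prod>i\<in>{..<n} - S. fac v False (X i) (\<sigma> i) (\<tau> i))"
        by (rule prod_if_subset[OF S'(1)])
      also have "(\<Prod>i\<in>{..<n} - S. fac v False (X i) (\<sigma> i) (\<tau> i)) = (if \<forall>i\<in>{..<n} - S. \<tau> i = \<sigma> i then of_real v ^ (n - j) else 0)"
      proof (cases "\<forall>i\<in>{..<n} - S. \<tau> i = \<sigma> i")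
        case True
        then have "(\<Prod>i\<in>{..<n} - S. fac v False (X i) (\<sigma> i) (\<tau> i)) = (\<Prod>i\<in>{..<n} - S. of_real v)"
          by (intro prod.cong) (auto simp: fac_def)
        then show ?thesis using True S' by (simp add: card_Diff_subset)
      next
        case False
        then obtain i where "i \<in> {..<n} - S" "\<tau> i \<noteq> \<sigma> i" by blast
        then show ?thesis using False by (auto simp: fac_def intro!: prod_zero bexI[of _ i])
      qed
      finally show ?thesis by simp
    qed
    then have "(\<Sum>\<tau>\<in>perms n. \<Prod>i<n. fac v (i \<in> S) (X i) (\<sigma> i) (\<tau> i)) =
       (\<Sum>\<tau>\<in>{\<tau> \<in> perms n. \<forall>i\<in>{..<n} - S. \<tau> i = \<sigma> i}. of_real v ^ (n - j) * (\<Prod>i\<in>S. fac v True (X i) (\<sigma> i) (\<tau> i)))"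
      by (simp only: sum.inter_filter[OF finite_perms])
    then show ?thesis by (simp add: G_def sum_distrib_left)
  qed
  have GH: "G \<sigma> (r ` {..<j}) = H r (restrict (\<sigma> \<circ> r) {..<j})" if \<sigma>: "\<sigma> \<in> perms n" and r: "r \<in> injections j n" for \<sigma> r
  proof -
    have "G \<sigma> (r ` {..<j}) = (\<Sum>\<tau>\<in>{\<tau> \<in> perms n. \<forall>i\<in>{..<n} - r ` {..<j}. \<tau> i = \<sigma> i}.
       \<Prod>l<j. fac v True (X (r l)) (\<sigma> (r l)) (restrict (\<tau> \<circ> r) {..<j} l))"
      unfolding G_def by (intro sum.cong refl) (simp add: prod.reindex[OF injectionsD(1)[OF r]])
    also have "\<dots> = (\<Sum>\<pi>\<in>perms j. \<Prod>l<j. fac v True (X (r l)) (\<sigma> (r l)) (restrict (\<sigma> \<circ> r \<circ> \<pi>) {..<j} l))"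
      by (rule sum_perms_agree[OF \<sigma> r, of "\<lambda>f. \<Prod>l<j. fac v True (X (r l)) (\<sigma> (r l)) (f l)"])
    also have "\<dots> = H r (restrict (\<sigma> \<circ> r) {..<j})"
      unfolding H_def by (intro sum.cong prod.cong refl) (use perms_less in auto)
    finally show ?thesis .
  qed
  have "chaos n v j X = (\<Sum>\<sigma>\<in>perms n. \<Sum>S\<in>subsets n j. \<Sum>\<tau>\<in>perms n. \<Prod>i<n. fac v (i \<in> S) (X i) (\<sigma> i) (\<tau> i))"
    unfolding chaos_def by (rule sum.cong[OF refl], rule sum.swap)
  also have "\<dots> = (\<Sum>\<sigma>\<in>perms n. \<Sum>S\<in>subsets n j. of_real v ^ (n - j) * G \<sigma> S)"
    by (intro sum.cong refl inner)
  finally have "of_nat (fact j) * chaos n v j X =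
      of_real v ^ (n - j) * (\<Sum>\<sigma>\<in>perms n. \<Sum>S\<in>subsets n j. of_nat (fact j) * G \<sigma> S)"
    by (simp only: sum_distrib_left mult.left_commute)
  also have "(\<Sum>\<sigma>\<in>perms n. \<Sum>S\<in>subsets n j. of_nat (fact j) * G \<sigma> S) =
      (\<Sum>\<sigma>\<in>perms n. \<Sum>r\<in>injections j n. G \<sigma> (r ` {..<j}))"
  proof (rule sum.cong[OF refl])
    fix \<sigma>
    have "(\<Sum>r\<in>injections j n. G \<sigma> (r ` {..<j})) =
        (\<Sum>S\<in>subsets n j. \<Sum>r\<in>{r \<in> injections j n. r ` {..<j} = S}. G \<sigma> (r ` {..<j}))"
      by (rule sum.group[symmetric]) (use injectionsD(3) in auto)
    also have "\<dots> = (\<Sum>S\<in>subsets n j. of_nat (fact j) * G \<sigma> S)"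
    proof (rule sum.cong[OF refl])
      fix S assume S: "S \<in> subsets n j"
      have "(\<Sum>r\<in>{r \<in> injections j n. r ` {..<j} = S}. G \<sigma> (r ` {..<j})) =
          (\<Sum>r\<in>{r \<in> injections j n. r ` {..<j} = S}. G \<sigma> S)" by (intro sum.cong) auto
      then show "(\<Sum>r\<in>{r \<in> injections j n. r ` {..<j} = S}. G \<sigma> (r ` {..<j})) = of_nat (fact j) * G \<sigma> S"
        unfolding sum_constant card_injections_onto[OF S] .
    qed
    finally show "(\<Sum>S\<in>subsets n j. of_nat (fact j) * G \<sigma> S) = (\<Sum>r\<in>injections j n. G \<sigma> (r ` {..<j}))" ..
  qed
  also have "\<dots> = (\<Sum>r\<in>injections j n. \<Sum>\<sigma>\<in>perms n. H r (restrict (\<sigma> \<circ> r) {..<j}))"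
    by (subst sum.swap) (intro sum.cong refl GH)
  also have "\<dots> = (\<Sum>r\<in>injections j n. fact (n - j) * (\<Sum>s\<in>injections j n. H r s))"
    by (intro sum.cong refl sum_perms_restrict)
  finally show ?thesis by (simp add: H_def sum_distrib_left mult.assoc)
qed

lemma prod_falling: "j \<le> n ==> (\<Prod>l<j. real (n - l)) * fact (n - j) = fact n"
proof (induction j)
  case (Suc j)
  then have "n - j = Suc (n - Suc j)" by simp
  then have "(fact (n - j) :: real) = real (n - j) * fact (n - Suc j)" by (metis fact_Suc)
  then show ?case using Suc by (simp add: mult.assoc del: of_nat_diff)
qed simp

text \<open>Here the sum over injections of rows into clicked positions becomes a sum over injections
  into all columns, restricted to those with image among the clicks.\<close>

lemma chaos_eq_columns:
  assumes z: "z \<in> collision_free n m" and n: "0 < n" "n \<le> m" and j: "j \<le> n"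
  defines "v \<equiv> 1 / real m"
  shows "of_real x ^ j * chaos n v j (\<lambda>i p. U $$ (i, z ! p)) = of_real (fact n * v ^ n) *
    (\<Sum>r\<in>injections j n. \<Sum>s\<in>injections j m. \<Sum>\<pi>\<in>perms j. if s ` {..<j} \<subseteq> set z then
       \<Prod>l<j. of_real (x * real m / (real (l + 1) * real (n - l))) * fac v True (\<lambda>t. U $$ (r l, t)) (s l) (s (\<pi> l)) else 0)"
proof -
  have zlen: "length z = n" "sorted_wrt (<) z" "set z \<subseteq> {..<m}" using z by (auto simp: collision_free_def)
  have zinj: "inj_on ((!) z) {..<n}"
    using zlen strict_sorted_iff[of z] by (auto simp: inj_on_def nth_eq_iff_index_eq)
  have zset: "(!) z ` {..<n} = set z" using zlen by (auto simp: set_conv_nth)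
  have v: "v \<noteq> 0" using n by (simp add: v_def)
  define P where "P = (\<lambda>r s. \<Sum>\<pi>\<in>perms j. \<Prod>l<j. fac v True (\<lambda>t. U $$ (r l, t)) (s l) (s (\<pi> l)))"
  \<comment> \<open>Positions in \<open>z\<close> are exchanged for the modes found there.\<close>
  have reindex: "(\<Sum>s\<in>injections j n. P r (restrict ((!) z \<circ> s) {..<j})) =
      (\<Sum>s\<in>{s \<in> injections j m. s ` {..<j} \<subseteq> set z}. P r s)" for r
  proof (rule sum.reindex_bij_witness[where j = "\<lambda>s. restrict ((!) z \<circ> s) {..<j}"
        and i = "\<lambda>s. restrict (inv_into {..<n} ((!) z) \<circ> s) {..<j}"])
    fix s assume s: "s \<in> injections j n"
    have "inv_into {..<n} ((!) z) (z ! s l) = s l" if "l < j" for l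
      using injectionsD(2)[OF s that] zinj by (intro inv_into_f_f) auto
    then show "restrict (inv_into {..<n} ((!) z) \<circ> restrict ((!) z \<circ> s) {..<j}) {..<j} = s"
      using s by (auto simp: fun_eq_iff injections_def PiE_iff extensional_def)
    have "inj_on ((!) z \<circ> s) {..<j}"
      using injectionsD(1,2)[OF s] zinj by (intro comp_inj_on) (auto intro: inj_on_subset)
    moreover have "z ! s l \<in> set z" "z ! s l < m" if "l < j" for l
      using injectionsD(2)[OF s that] zlen(1) subsetD[OF zlen(3) nth_mem, of "s l"] by simp_all
    ultimately show "restrict ((!) z \<circ> s) {..<j} \<in> {s \<in> injections j m. s ` {..<j} \<subseteq> set z}"
      by (auto simp: injections_def inj_on_def)
  next
    fix s assume "s \<in> {s \<in> injections j m. s ` {..<j} \<subseteq> set z}"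
    then have s: "s \<in> injections j m" "\<And>l. l < j ==> s l \<in> (!) z ` {..<n}" using zset by auto
    have "z ! inv_into {..<n} ((!) z) (s l) = s l" "inv_into {..<n} ((!) z) (s l) < n" if "l < j" for l
      using f_inv_into_f[OF s(2)[OF that]] inv_into_into[OF s(2)[OF that]] by auto
    note inv = this
    show "restrict ((!) z \<circ> restrict (inv_into {..<n} ((!) z) \<circ> s) {..<j}) {..<j} = s"
    proof
      fix l
      show "restrict ((!) z \<circ> restrict (inv_into {..<n} ((!) z) \<circ> s) {..<j}) {..<j} l = s l"
        using inv(1)[of l] s(1) by (cases "l < j") (simp_all add: injections_def PiE_iff extensional_def)
    qed
    show "restrict (inv_into {..<n} ((!) z) \<circ> s) {..<j} \<in> injections j n"
    proof -
      have "l = l'" if "l < j" "l' < j" "inv_into {..<n} ((!) z) (s l) = inv_into {..<n} ((!) z) (s l')" for l l'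
      proof -
        have "s l = s l'" using arg_cong[OF that(3), of "(!) z"] unfolding inv(1)[OF that(1)] inv(1)[OF that(2)] .
        then show ?thesis using injectionsD(1)[OF s(1)] that(1,2) by (simp add: inj_on_def)
      qed
      then have "inj_on (restrict (inv_into {..<n} ((!) z) \<circ> s) {..<j}) {..<j}"
        by (intro inj_onI) simp
      moreover have "restrict (inv_into {..<n} ((!) z) \<circ> s) {..<j} \<in> {..<j} \<rightarrow>\<^sub>E {..<n}"
        using inv(2) by (intro restrict_PiE_iff[THEN iffD2]) simp
      ultimately show ?thesis unfolding injections_def by blast
    qed
  qed simp
  have facz: "fac v True (\<lambda>p. U $$ (i, z ! p)) p q = fac v True (\<lambda>t. U $$ (i, t)) (z ! p) (z ! q)"
    if "p < n" "q < n" for i p q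
    using that zinj by (auto simp: fac_def inj_on_def)
  have P: "(\<Sum>\<pi>\<in>perms j. \<Prod>l<j. fac v True (\<lambda>p. U $$ (r l, z ! p)) (s l) (s (\<pi> l))) = P r (restrict ((!) z \<circ> s) {..<j})"
    if "s \<in> injections j n" for r s
    unfolding P_def
    by (intro sum.cong prod.cong refl) (use injectionsD(2)[OF that] perms_less in \<open>auto simp: facz\<close>)
  have key: "of_nat (fact j) * chaos n v j (\<lambda>i p. U $$ (i, z ! p)) = of_real v ^ (n - j) * of_nat (fact (n - j)) *
      (\<Sum>r\<in>injections j n. \<Sum>s\<in>{s \<in> injections j m. s ` {..<j} \<subseteq> set z}. P r s)"
    unfolding chaos_eq_injections[OF j] using P reindex by simp
  have "(\<Prod>l<j. real (n - l)) = fact n / fact (n - j)"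
    using prod_falling[OF j] by (simp add: field_simps del: of_nat_diff)
  moreover have "(\<Prod>l<j. real (l + 1)) = fact j" by (induction j) (auto simp: mult.commute)
  \<comment> \<open>The prefactor of the chaos, relative to \<open>fact n * v ^ n\<close>, is spread
    over the \<open>j\<close> factors, so that a program can build it up factor by factor.\<close>
  ultimately have "(\<Prod>l<j. x * real m / (real (l + 1) * real (n - l))) = x ^ j * real m ^ j * fact (n - j) / (fact j * fact n)"
    by (simp add: prod_dividef prod.distrib power_mult_distrib del: of_nat_diff of_nat_Suc of_nat_add)
  also have "\<dots> = x ^ j * v ^ (n - j) * fact (n - j) / (fact j * (fact n * v ^ n))"
  proof -
    have "v ^ n = v ^ (n - j) * v ^ j" using j by (simp flip: power_add)
    moreover have "real m ^ j * v ^ j = 1" using n by (simp add: v_def flip: power_mult_distrib)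
    ultimately show ?thesis using v n by (simp add: field_simps v_def)
  qed
  finally have coeff: "(\<Prod>l<j. x * real m / (real (l + 1) * real (n - l))) * (fact n * v ^ n) * fact j = x ^ j * v ^ (n - j) * fact (n - j)"
    using v by simp
  let ?c = "\<lambda>l. complex_of_real (x * real m / (real (l + 1) * real (n - l)))"
  have coeffc: "(\<Prod>l<j. ?c l) * of_real (fact n * v ^ n) * of_nat (fact j) = of_real x ^ j * of_real v ^ (n - j) * of_nat (fact (n - j))"
    using arg_cong[OF coeff, of complex_of_real] by (simp only: of_real_mult of_real_prod of_real_power of_real_fact of_nat_fact)
  have rhs: "(\<Sum>\<pi>\<in>perms j. if s ` {..<j} \<subseteq> set z then
       \<Prod>l<j. ?c l * fac v True (\<lambda>t. U $$ (r l, t)) (s l) (s (\<pi> l)) else 0) =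
     (if s ` {..<j} \<subseteq> set z then (\<Prod>l<j. ?c l) * P r s else 0)" for r s
    unfolding P_def
    by (cases "s ` {..<j} \<subseteq> set z") (simp_all only: if_True if_False sum_distrib_left prod.distrib sum.neutral_const)
  have "of_nat (fact j) * (of_real x ^ j * chaos n v j (\<lambda>i p. U $$ (i, z ! p))) =
      of_real x ^ j * (of_nat (fact j) * chaos n v j (\<lambda>i p. U $$ (i, z ! p)))" by simp
  also have "\<dots> = (of_real x ^ j * of_real v ^ (n - j) * of_nat (fact (n - j))) *
      (\<Sum>r\<in>injections j n. \<Sum>s\<in>{s \<in> injections j m. s ` {..<j} \<subseteq> set z}. P r s)"
    unfolding key by (simp only: mult.assoc)
  also have "\<dots> = of_nat (fact j) * (of_real (fact n * v ^ n) * (\<Sum>r\<in>injections j n.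
      \<Sum>s\<in>{s \<in> injections j m. s ` {..<j} \<subseteq> set z}. (\<Prod>l<j. ?c l) * P r s))"
    unfolding coeffc[symmetric] sum_distrib_left[symmetric] by (simp only: mult_ac)
  also have "\<dots> = of_nat (fact j) * (of_real (fact n * v ^ n) * (\<Sum>r\<in>injections j n. \<Sum>s\<in>injections j m.
      \<Sum>\<pi>\<in>perms j. if s ` {..<j} \<subseteq> set z then
       \<Prod>l<j. ?c l * fac v True (\<lambda>t. U $$ (r l, t)) (s l) (s (\<pi> l)) else 0))"
    unfolding rhs sum.inter_filter[OF finite_injections] ..
  finally show ?thesis by simp
qed

section \<open>The collision probability\<close>

lemma unitary_row_orthonormal:
  assumes "U \<in> unitary_group n" "i < n" "k < n"
  shows "(\<Sum>t<n. U $$ (i, t) * cnj (U $$ (k, t))) = (if i = k then 1 else 0)"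
proof -
  have U: "U \<in> carrier_mat n n" "U * mat_adjoint U = 1\<^sub>m n" using assms(1) by (auto simp: unitary_group_def)
  have "(U * mat_adjoint U) $$ (i, k) = (\<Sum>t<n. U $$ (i, t) * cnj (U $$ (k, t)))"
    using U(1) assms(2,3) mat_adjoint_carrier[OF U(1)] by (auto simp: scalar_prod_def atLeast0LessThan)
  then show ?thesis using U(2) assms(2,3) by simp
qed

lemma noisy_click_prob_nonneg: "0 \<le> noisy_click_prob n m x U z"
  unfolding noisy_click_prob_def by (intro integral_nonneg_AE) simp

text \<open>Any \<open>X\<close> is the leading block of some matrix \<open>?V\<close>, for which
  the closed form is the integral of a square. This also covers tuples of modes with repetitions,
  which are not outcomes in \<open>collision_free\<close>.\<close>

lemma noisy_sum_nonneg:
  assumes "0 < n" "n \<le> m" "0 \<le> x" "x \<le> 1"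
  shows "0 \<le> Re (noisy_sum n (1 / real m) x X)"
proof -
  let ?V = "mat m m (\<lambda>(i, t). X i t)"
  have "complex_of_real (noisy_click_prob n m x ?V [0..<n]) = noisy_sum n (1 / real m) x (\<lambda>i p. ?V $$ (i, [0..<n] ! p))"
    using assms by (intro noisy_click_prob_eq) (auto simp: collision_free_def)
  also have "\<dots> = noisy_sum n (1 / real m) x X"
    unfolding noisy_sum_def
  proof (intro sum.cong prod.cong refl)
    fix \<sigma> \<tau> i assume "\<sigma> \<in> perms n" "\<tau> \<in> perms n" "i \<in> {..<n}"
    then have "i < m" "\<sigma> i < n" "\<tau> i < n" "\<sigma> i < m" "\<tau> i < m"
      using perms_less[of \<sigma> n i] perms_less[of \<tau> n i] assms(2) by auto
    then show "complex_of_real x * (?V $$ (i, [0..<n] ! \<sigma> i) * cnj (?V $$ (i, [0..<n] ! \<tau> i))) +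
        (if \<sigma> i = \<tau> i then of_real ((1 - x) * (1 / real m)) else 0) =
      of_real x * (X i (\<sigma> i) * cnj (X i (\<tau> i))) + (if \<sigma> i = \<tau> i then of_real ((1 - x) * (1 / real m)) else 0)"
      by simp
  qed
  finally have "Re (noisy_sum n (1 / real m) x X) = noisy_click_prob n m x ?V [0..<n]"
    by (metis Re_complex_of_real)
  then show ?thesis using noisy_click_prob_nonneg by simp
qed

text \<open>Relabelling the columns composes both permutations with \<open>\<pi>\<close>, which only
  reorders the two sums.\<close>

lemma noisy_sum_permute:
  assumes "\<pi> \<in> perms n"
  shows "noisy_sum n v x (\<lambda>i p. X i (\<pi> p)) = noisy_sum n v x X"
proof -
  have \<pi>: "\<pi> permutes {..<n}" using assms by (simp add: perms_def)
  have inj: "\<pi> a = \<pi> b \<longleftrightarrow> a = b" for a b using permutes_inj[OF \<pi>] by (auto dest: injD)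
  let ?t = "\<lambda>\<sigma> \<tau>. \<Prod>i<n. of_real x * (X i (\<sigma> i) * cnj (X i (\<tau> i))) + (if \<sigma> i = \<tau> i then of_real ((1 - x) * v) else 0)"
  have "noisy_sum n v x (\<lambda>i p. X i (\<pi> p)) = (\<Sum>\<sigma>\<in>perms n. \<Sum>\<tau>\<in>perms n. ?t (\<pi> \<circ> \<sigma>) (\<pi> \<circ> \<tau>))"
    unfolding noisy_sum_def by (intro sum.cong refl prod.cong) (simp add: inj)
  also have "\<dots> = (\<Sum>\<sigma>\<in>perms n. \<Sum>\<tau>\<in>perms n. ?t (\<pi> \<circ> \<sigma>) \<tau>)"
    unfolding perms_def by (intro sum.cong refl setum_permutations_compose_left[OF \<pi>, symmetric])
  also have "\<dots> = (\<Sum>\<sigma>\<in>perms n. \<Sum>\<tau>\<in>perms n. ?t \<sigma> \<tau>)"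
    unfolding perms_def by (rule setum_permutations_compose_left[OF \<pi>, symmetric])
  finally show ?thesis unfolding noisy_sum_def .
qed

text \<open>Agreement off \<open>S\<close> forces \<open>\<sigma>\<close> and \<open>\<tau>\<close>
  to map \<open>S\<close> onto the same set of positions. The sum over tuples then factorises over
  positions: inside this set, orthonormal rows give 1 or 0 according to whether the two rows meeting
  there are equal; each position outside gives \<open>m\<close>.\<close>

lemma sum_functions_partial_product:
  fixes A :: "nat => nat => complex"
  assumes orth: "\<And>i k. i < n ==> k < n ==> (\<Sum>t<m. A i t * cnj (A k t)) = (if i = k then 1 else 0)"
    and \<sigma>: "\<sigma> permutes {..<n}" and \<tau>: "\<tau> permutes {..<n}" and S: "S \<subseteq> {..<n}"
    and agree: "\<And>i. i \<in> {..<n} - S ==> \<sigma> i = \<tau> i"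
  shows "(\<Sum>t\<in>PiE {..<n} (\<lambda>_. {..<m}). \<Prod>i\<in>S. A i (t (\<sigma> i)) * cnj (A i (t (\<tau> i)))) =
    (if \<sigma> = \<tau> then of_nat m ^ (n - card S) else 0)"
proof -
  let ?s = "inv_into UNIV \<sigma>" and ?u = "inv_into UNIV \<tau>"
  have fS: "finite S" using S finite_subset by blast
  have inj: "inj \<sigma>" "inj \<tau>" using \<sigma> \<tau> permutes_inj by auto
  have T: "\<tau> ` S = \<sigma> ` S"
  proof -
    have "\<rho> ` S = {..<n} - \<rho> ` ({..<n} - S)" if "\<rho> permutes {..<n}" for \<rho>
    proof -
      have "\<rho> ` ({..<n} - S) = \<rho> ` {..<n} - \<rho> ` S" by (rule image_set_diff[OF permutes_inj[OF that]])
      moreover have "\<rho> ` S \<subseteq> \<rho> ` {..<n}" using S by (rule image_mono)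
      ultimately show ?thesis using permutes_image[OF that] by auto
    qed
    moreover have "\<sigma> ` ({..<n} - S) = \<tau> ` ({..<n} - S)" using agree by (intro image_cong) auto
    ultimately show ?thesis using \<sigma> \<tau> by metis
  qed
  let ?T = "\<sigma> ` S"
  have Tn: "?T \<subseteq> {..<n}" using S permutes_image[OF \<sigma>] by blast
  have cT: "card ?T = card S" using inj(1) by (intro card_image inj_on_subset[OF inj(1)]) auto
  have s: "?s p < n" "?u p < n" if "p < n" for p
    using permutes_in_image[OF permutes_inv[OF \<sigma>], of p] permutes_in_image[OF permutes_inv[OF \<tau>], of p] that by auto
  have "(\<Prod>i\<in>S. A i (t (\<sigma> i)) * cnj (A i (t (\<tau> i)))) =
      (\<Prod>p<n. if p \<in> ?T then A (?s p) (t p) * cnj (A (?u p) (t p)) else 1)" for t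
  proof -
    have 1: "(\<Prod>p\<in>?T. A (?s p) (t p)) = (\<Prod>i\<in>S. A i (t (\<sigma> i)))"
      using inj by (subst prod.reindex) (auto intro: inj_on_subset)
    have 2: "(\<Prod>p\<in>?T. cnj (A (?u p) (t p))) = (\<Prod>i\<in>S. cnj (A i (t (\<tau> i))))"
      unfolding T[symmetric] using inj by (subst prod.reindex) (auto intro: inj_on_subset)
    have "(\<Prod>p<n. if p \<in> ?T then A (?s p) (t p) * cnj (A (?u p) (t p)) else 1) =
        (\<Prod>p\<in>?T. A (?s p) (t p) * cnj (A (?u p) (t p)))"
      using prod.inter_restrict[of "{..<n}" "\<lambda>p. A (?s p) (t p) * cnj (A (?u p) (t p))" ?T] Tn
      by (simp add: Int_absorb1)
    then show ?thesis unfolding prod.distrib 1 2 by simp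
  qed
  then have "(\<Sum>t\<in>PiE {..<n} (\<lambda>_. {..<m}). \<Prod>i\<in>S. A i (t (\<sigma> i)) * cnj (A i (t (\<tau> i)))) =
      (\<Sum>t\<in>PiE {..<n} (\<lambda>_. {..<m}). \<Prod>p<n. if p \<in> ?T then A (?s p) (t p) * cnj (A (?u p) (t p)) else 1)" by simp
  also have "\<dots> = (\<Prod>p<n. \<Sum>a<m. if p \<in> ?T then A (?s p) a * cnj (A (?u p) a) else 1)"
    by (subst prod_sum_PiE) auto
  also have "\<dots> = (\<Prod>p<n. if p \<in> ?T then (if ?s p = ?u p then 1 else 0) else of_nat m)"
    using s orth by (intro prod.cong refl) auto
  also have "\<dots> = (\<Prod>p\<in>?T. if ?s p = ?u p then 1 else 0) * (\<Prod>p\<in>{..<n} - ?T. of_nat m)"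
    by (rule prod_if_subset[OF Tn])
  also have "(\<Prod>p\<in>{..<n} - ?T. of_nat m :: complex) = of_nat m ^ (n - card S)"
    using Tn cT fS by (simp add: card_Diff_subset)
  also have "(\<Prod>p\<in>?T. if ?s p = ?u p then 1 else (0 :: complex)) = (if \<sigma> = \<tau> then 1 else 0)"
  proof (cases "\<forall>p\<in>?T. ?s p = ?u p")
    case True
    have "\<sigma> i = \<tau> i" for i
    proof (cases "i \<in> S")
      case True1: True
      then have "?u (\<sigma> i) = i" using True inj by (metis image_eqI inv_into_f_f UNIV_I)
      then show ?thesis using permutes_inverses(1)[OF \<tau>, of "\<sigma> i"] by simp
    next
      case False
      then show ?thesis using agree[of i] permutes_not_in[OF \<sigma>, of i] permutes_not_in[OF \<tau>, of i] by (cases "i < n") auto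
    qed
    then have "\<sigma> = \<tau>" by auto
    then show ?thesis by simp
  next
    case False
    then have "\<sigma> \<noteq> \<tau>" by auto
    moreover have "finite ?T" using fS by simp
    ultimately show ?thesis using False by (auto intro: prod_zero)
  qed
  finally show ?thesis by simp
qed

text \<open>The sum runs over all tuples of modes, collisions included. Only
  \<open>\<sigma> = \<tau>\<close> survives, and then the expansion over \<open>S\<close> is that of
  \<open>(x + (1 - x)) ^ n\<close>, since the \<open>m\<close> from a free position cancels the
  variance \<open>1 / m\<close>.\<close>

lemma sum_noisy_sum:
  fixes A :: "nat => nat => complex"
  assumes orth: "\<And>i k. i < n ==> k < n ==> (\<Sum>t<m. A i t * cnj (A k t)) = (if i = k then 1 else 0)"
    and m: "0 < m"
  shows "(\<Sum>t\<in>PiE {..<n} (\<lambda>_. {..<m}). noisy_sum n (1 / real m) x (\<lambda>i p. A i (t p))) = fact n"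
proof -
  let ?F = "PiE {..<n} (\<lambda>_. {..<m})"
  define y where "y = complex_of_real ((1 - x) * (1 / real m))"
  have one: "(\<Sum>t\<in>?F. \<Prod>i<n. of_real x * (A i (t (\<sigma> i)) * cnj (A i (t (\<tau> i)))) + (if \<sigma> i = \<tau> i then y else 0)) =
      (if \<sigma> = \<tau> then 1 else 0)" if "\<sigma> permutes {..<n}" "\<tau> permutes {..<n}" for \<sigma> \<tau>
  proof -
    have "(\<Sum>t\<in>?F. \<Prod>i<n. of_real x * (A i (t (\<sigma> i)) * cnj (A i (t (\<tau> i)))) + (if \<sigma> i = \<tau> i then y else 0)) =
        (\<Sum>t\<in>?F. \<Sum>S\<in>Pow {..<n}. (\<Prod>i\<in>S. of_real x * (A i (t (\<sigma> i)) * cnj (A i (t (\<tau> i))))) *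
          (\<Prod>i\<in>{..<n} - S. if \<sigma> i = \<tau> i then y else 0))"
      by (intro sum.cong refl prod_add) simp
    also have "\<dots> = (\<Sum>S\<in>Pow {..<n}. \<Sum>t\<in>?F. (\<Prod>i\<in>S. of_real x * (A i (t (\<sigma> i)) * cnj (A i (t (\<tau> i))))) *
          (\<Prod>i\<in>{..<n} - S. if \<sigma> i = \<tau> i then y else 0))" by (rule sum.swap)
    also have "\<dots> = (\<Sum>S\<in>Pow {..<n}. if \<sigma> = \<tau> then (\<Prod>i\<in>S. of_real x) * (\<Prod>i\<in>{..<n} - S. of_real (1 - x)) else 0)"
    proof (intro sum.cong refl)
      fix S assume "S \<in> Pow {..<n}"
      then have S: "S \<subseteq> {..<n}" "finite S" using finite_subset by auto
      let ?B = "\<Prod>i\<in>{..<n} - S. if \<sigma> i = \<tau> i then y else 0"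
      show "(\<Sum>t\<in>?F. (\<Prod>i\<in>S. of_real x * (A i (t (\<sigma> i)) * cnj (A i (t (\<tau> i))))) * ?B) =
        (if \<sigma> = \<tau> then (\<Prod>i\<in>S. of_real x) * (\<Prod>i\<in>{..<n} - S. of_real (1 - x)) else 0)"
      proof (cases "\<forall>i\<in>{..<n} - S. \<sigma> i = \<tau> i")
        case False
        then have "?B = 0" by (intro prod_zero) auto
        moreover have "\<sigma> \<noteq> \<tau>" using False by auto
        ultimately show ?thesis by simp
      next
        case True
        then have B: "?B = y ^ (n - card S)" using S by (simp add: card_Diff_subset)
        have "(\<Sum>t\<in>?F. (\<Prod>i\<in>S. of_real x * (A i (t (\<sigma> i)) * cnj (A i (t (\<tau> i))))) * ?B) =
            of_real x ^ card S * y ^ (n - card S) * (\<Sum>t\<in>?F. \<Prod>i\<in>S. A i (t (\<sigma> i)) * cnj (A i (t (\<tau> i))))"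
          unfolding B prod.distrib by (simp add: sum_distrib_left mult_ac)
        also have "\<dots> = of_real x ^ card S * y ^ (n - card S) * (if \<sigma> = \<tau> then of_nat m ^ (n - card S) else 0)"
          using sum_functions_partial_product[OF orth that S(1)] True by simp
        also have "\<dots> = (if \<sigma> = \<tau> then of_real x ^ card S * (y * of_nat m) ^ (n - card S) else 0)"
          by (simp add: power_mult_distrib)
        also have "y * of_nat m = of_real (1 - x)" using m by (simp add: y_def)
        finally show ?thesis using S by (simp add: card_Diff_subset)
      qed
    qed
    also have "\<dots> = (if \<sigma> = \<tau> then (\<Prod>i<n. of_real x + of_real (1 - x)) else 0)"
      by (subst prod_add) auto
    finally show ?thesis by simp
  qed
  have "(\<Sum>t\<in>?F. noisy_sum n (1 / real m) x (\<lambda>i p. A i (t p))) = (\<Sum>\<sigma>\<in>perms n. \<Sum>\<tau>\<in>perms n. 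
      \<Sum>t\<in>?F. \<Prod>i<n. of_real x * (A i (t (\<sigma> i)) * cnj (A i (t (\<tau> i)))) + (if \<sigma> i = \<tau> i then y else 0))"
    unfolding noisy_sum_def y_def[symmetric]
    by (rule trans[OF sum.swap], rule sum.cong[OF refl], rule sum.swap)
  also have "\<dots> = (\<Sum>\<sigma>\<in>perms n. \<Sum>\<tau>\<in>perms n. if \<sigma> = \<tau> then 1 else 0)"
    by (intro sum.cong refl one) (auto simp: perms_def)
  also have "\<dots> = fact n" by (simp add: card_perms)
  finally show ?thesis .
qed

text \<open>A collision-free outcome accounts for \<open>fact n\<close> distinct tuples of equal
  value, its rearrangements; the tuples with repetitions are dropped.\<close>

lemma sum_collision_free_le:
  fixes f :: "(nat => nat) => real"
  assumes f: "\<And>t. 0 \<le> f t" and cong: "\<And>t t'. (\<And>p. p < n ==> t p = t' p) ==> f t = f t'"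
    and sym: "\<And>t \<pi>. \<pi> \<in> perms n ==> f (\<lambda>p. t (\<pi> p)) = f t"
  shows "fact n * (\<Sum>z\<in>collision_free n m. f (\<lambda>p. z ! p)) \<le> (\<Sum>t\<in>PiE {..<n} (\<lambda>_. {..<m}). f t)"
proof -
  let ?g = "\<lambda>(z, \<pi>). \<lambda>p\<in>{..<n}. z ! \<pi> p"
  let ?D = "collision_free n m \<times> perms n"
  have inj: "inj_on ?g ?D"
  proof (rule inj_onI)
    fix a b assume ab: "a \<in> ?D" "b \<in> ?D" "?g a = ?g b"
    obtain z \<pi> w \<rho> where e: "a = (z, \<pi>)" "b = (w, \<rho>)" by (metis surj_pair)
    have zw: "z \<in> collision_free n m" "w \<in> collision_free n m" and p: "\<pi> permutes {..<n}" "\<rho> permutes {..<n}"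
      using ab e by (auto simp: perms_def)
    have eq: "z ! \<pi> p = w ! \<rho> p" if "p < n" for p
      using fun_cong[OF ab(3), of p] that unfolding e by simp
    have im: "set u = (\<lambda>p. u ! \<tau> p) ` {..<n}" if "u \<in> collision_free n m" "\<tau> permutes {..<n}" for u \<tau>
    proof -
      have "(\<lambda>p. u ! \<tau> p) ` {..<n} = (\<lambda>p. u ! p) ` (\<tau> ` {..<n})" by auto
      then show ?thesis using that permutes_image[OF that(2)] by (auto simp: collision_free_def set_conv_nth)
    qed
    have "set z = set w" unfolding im[OF zw(1) p(1)] im[OF zw(2) p(2)] using eq by (intro image_cong) auto
    then have z: "z = w" using zw by (auto simp: collision_free_def strict_sorted_equal)
    have "\<pi> p = \<rho> p" for p
    proof (cases "p < n")
      case True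
      have "distinct z" "length z = n" using zw(1) by (auto simp: collision_free_def strict_sorted_iff)
      moreover have "\<pi> p < n" "\<rho> p < n" using permutes_in_image[OF p(1), of p] permutes_in_image[OF p(2), of p] True by auto
      ultimately show ?thesis using eq[OF True] unfolding z[symmetric] by (simp add: nth_eq_iff_index_eq)
    next
      case False
      then show ?thesis using p by (simp add: permutes_not_in)
    qed
    then show "a = b" unfolding e z by auto
  qed
  have sub: "?g ` ?D \<subseteq> PiE {..<n} (\<lambda>_. {..<m})"
  proof
    fix h assume "h \<in> ?g ` ?D"
    then obtain z \<pi> where h: "h = (\<lambda>p\<in>{..<n}. z ! \<pi> p)" "z \<in> collision_free n m" "\<pi> \<in> perms n" by auto
    have "z ! q < m" if "q < n" for q
      using h(2) that subsetD[OF _ nth_mem[of q z], of "{..<m}"] by (auto simp: collision_free_def)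
    then show "h \<in> PiE {..<n} (\<lambda>_. {..<m})" using perms_less[OF h(3)] unfolding h(1) by auto
  qed
  have "(\<Sum>z\<in>collision_free n m. \<Sum>\<pi>\<in>perms n. f (\<lambda>p\<in>{..<n}. z ! \<pi> p)) = (\<Sum>z\<in>collision_free n m. \<Sum>\<pi>\<in>perms n. f (\<lambda>p. z ! p))"
  proof (intro sum.cong refl)
    fix z \<pi> assume \<pi>: "\<pi> \<in> perms n"
    have "f (\<lambda>p\<in>{..<n}. z ! \<pi> p) = f (\<lambda>p. z ! \<pi> p)" by (rule cong) simp
    also have "\<dots> = f (\<lambda>p. z ! p)" by (rule sym[OF \<pi>])
    finally show "f (\<lambda>p\<in>{..<n}. z ! \<pi> p) = f (\<lambda>p. z ! p)" .
  qed
  then have "fact n * (\<Sum>z\<in>collision_free n m. f (\<lambda>p. z ! p)) = (\<Sum>z\<in>collision_free n m. \<Sum>\<pi>\<in>perms n. f (\<lambda>p\<in>{..<n}. z ! \<pi> p))"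
    by (simp add: card_perms sum_distrib_left)
  also have "\<dots> = (\<Sum>a\<in>?D. f (?g a))"
    by (simp add: sum.cartesian_product prod.case_distrib)
  also have "\<dots> = (\<Sum>t\<in>?g ` ?D. f t)" by (simp add: sum.reindex[OF inj])
  also have "\<dots> \<le> (\<Sum>t\<in>PiE {..<n} (\<lambda>_. {..<m}). f t)"
    by (intro sum_mono2 sub finite_PiE) (auto intro: f)
  finally show ?thesis .
qed

lemma card_collision_free_le: "fact n * real (card (collision_free n m)) \<le> real m ^ n"
  using sum_collision_free_le[of "\<lambda>_. 1" n m] by (simp add: card_PiE)

text \<open>This makes the probability of the lumped outcome \<open>Collision\<close> nonnegative,
  which the error analysis of the sampler relies on.\<close>

lemma sum_noisy_click_prob_le_1:
  assumes U: "U \<in> unitary_group m" and n: "0 < n" "n \<le> m" and x: "0 \<le> x" "x \<le> 1"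
  shows "(\<Sum>z\<in>collision_free n m. noisy_click_prob n m x U z) \<le> 1"
proof -
  define f where "f = (\<lambda>t. Re (noisy_sum n (1 / real m) x (\<lambda>i p. U $$ (i, t p))))"
  have "fact n * (\<Sum>z\<in>collision_free n m. f (\<lambda>p. z ! p)) \<le> (\<Sum>t\<in>PiE {..<n} (\<lambda>_. {..<m}). f t)"
  proof (rule sum_collision_free_le)
    show "0 \<le> f t" for t unfolding f_def by (rule noisy_sum_nonneg[OF n x])
    show "f t = f t'" if "\<And>p. p < n ==> t p = t' p" for t t'
      unfolding f_def noisy_sum_def
      by (intro arg_cong[where f = Re] sum.cong prod.cong refl) (simp add: that perms_less)
    show "f (\<lambda>p. t (\<pi> p)) = f t" if "\<pi> \<in> perms n" for t \<pi>
      unfolding f_def using noisy_sum_permute[OF that, of _ x "\<lambda>i p. U $$ (i, t p)"] by simp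
  qed
  also have "(\<Sum>t\<in>PiE {..<n} (\<lambda>_. {..<m}). f t) = Re (\<Sum>t\<in>PiE {..<n} (\<lambda>_. {..<m}). noisy_sum n (1 / real m) x (\<lambda>i p. U $$ (i, t p)))"
    by (simp add: f_def)
  also have "(\<Sum>t\<in>PiE {..<n} (\<lambda>_. {..<m}). noisy_sum n (1 / real m) x (\<lambda>i p. U $$ (i, t p))) = fact n"
    using unitary_row_orthonormal[OF U] n by (intro sum_noisy_sum) auto
  also have "Re (fact n) = fact n" by (metis Re_complex_of_real of_real_fact)
  finally have "(\<Sum>z\<in>collision_free n m. f (\<lambda>p. z ! p)) \<le> 1" by simp
  moreover have "noisy_click_prob n m x U z = f (\<lambda>p. z ! p)" if "z \<in> collision_free n m" for z
  proof -
    have "complex_of_real (noisy_click_prob n m x U z) = noisy_sum n (1 / real m) x (\<lambda>i p. U $$ (i, z ! p))"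
      using U n x that by (intro noisy_click_prob_eq) (auto simp: unitary_group_def)
    then show ?thesis unfolding f_def by (metis Re_complex_of_real)
  qed
  ultimately show ?thesis by simp
qed

section \<open>Flatness of the rows of a random unitary\<close>

lemma cosh_le_exp: "cosh x \<le> exp (x\<^sup>2 / 2)" for x :: real
proof -
  have *: "cosh y \<le> exp (y\<^sup>2 / 2)" if "0 \<le> y" for y :: real
  proof -
    \<comment> \<open>Hoeffding's bound for a variable with two equally likely values at distance
      \<open>2 * y\<close>.\<close>
    have "- (2 * y) * (1 / 2) + ln (1 + 1 / 2 * (exp (2 * y) - 1)) \<le> (2 * y)\<^sup>2 / 8"
      by (rule Hoeffdings_lemma_aux) (use that in auto)
    moreover have "1 + 1 / 2 * (exp (2 * y) - 1) = exp y * cosh y"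
      by (simp add: cosh_field_def algebra_simps flip: exp_add)
    ultimately have "ln (cosh y) \<le> y\<^sup>2 / 2" by (simp add: ln_mult power2_eq_square)
    then show ?thesis by (metis cosh_real_pos exp_le_cancel_iff exp_ln)
  qed
  show ?thesis using *[of "\<bar>x\<bar>"] by (cases "0 \<le> x") (auto simp: abs_if)
qed

text \<open>The four phases produce the real and the imaginary part of \<open>y\<close>, each with
  both signs, hence two hyperbolic cosines.\<close>

lemma phase_mgf:
  "(\<Sum>k<4. exp (Re (y * phase r k))) / 4 \<le> exp (r\<^sup>2 * (cmod y)\<^sup>2 / 2)"
proof -
  have i3: "\<i> ^ 3 = -\<i>" by (simp add: power3_eq_cube)
  have "(\<Sum>k<4. exp (Re (y * phase r k))) / 4 = (cosh (r * Re y) + cosh (r * Im y)) / 2"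
    by (simp add: sum_lessThan_4 phase_def i3 cosh_field_def field_simps)
  also have "\<dots> \<le> (exp ((r * Re y)\<^sup>2 / 2) + exp ((r * Im y)\<^sup>2 / 2)) / 2"
    using cosh_le_exp[of "r * Re y"] cosh_le_exp[of "r * Im y"] by simp
  also have "\<dots> \<le> (exp (r\<^sup>2 * (cmod y)\<^sup>2 / 2) + exp (r\<^sup>2 * (cmod y)\<^sup>2 / 2)) / 2"
    by (intro divide_right_mono add_mono) (auto simp: cmod_power2 power_mult_distrib algebra_simps)
  finally show ?thesis by simp
qed

lemma av_phase_mgf:
  "finite I ==> av 4 (phase r) I (\<lambda>b. exp (Re (\<Sum>l\<in>I. y l * b l))) \<le> exp (r\<^sup>2 * (\<Sum>l\<in>I. (cmod (y l))\<^sup>2) / 2)"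
proof (induction I rule: finite_induct)
  case empty show ?case by (simp add: av_empty)
next
  case (insert t I)
  let ?E = "av 4 (phase r) I (\<lambda>b. exp (Re (\<Sum>l\<in>I. y l * b l)))"
  have eq: "exp (Re (\<Sum>l\<in>insert t I. y l * (b(t := phase r k)) l)) =
      exp (Re (y t * phase r k)) * exp (Re (\<Sum>l\<in>I. y l * b l))" for b k
  proof -
    have "(\<Sum>l\<in>I. y l * (b(t := phase r k)) l) = (\<Sum>l\<in>I. y l * b l)"
      using insert.hyps by (intro sum.cong) auto
    then show ?thesis using insert.hyps by (simp add: exp_add)
  qed
  have "av 4 (phase r) (insert t I) (\<lambda>b. exp (Re (\<Sum>l\<in>insert t I. y l * b l))) =
      (\<Sum>k<4. exp (Re (y t * phase r k))) / 4 * ?E"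
    unfolding av_insert[OF insert.hyps] eq av_cmult by (simp add: sum_distrib_right[symmetric])
  also have "\<dots> \<le> exp (r\<^sup>2 * (cmod (y t))\<^sup>2 / 2) * exp (r\<^sup>2 * (\<Sum>l\<in>I. (cmod (y l))\<^sup>2) / 2)"
    using insert.IH by (intro mult_mono phase_mgf av_nonneg) auto
  also have "\<dots> = exp (r\<^sup>2 * (\<Sum>l\<in>insert t I. (cmod (y l))\<^sup>2) / 2)"
    using insert.hyps by (simp add: algebra_simps add_divide_distrib flip: exp_add)
  finally show ?case .
qed

section \<open>Sub-Gaussian tails of the matrix entries\<close>

context haar
begin

text \<open>By invariance, row 0 may be replaced by any phase mixture of all rows. Averaging over
  the phases before integrating bounds the integrand for each \<open>U\<close> separately, because
  column \<open>t\<close> is a unit vector.\<close>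

lemma mgf_entry:
  assumes t: "t < n" and c: "cmod c = 1"
  shows "(\<integral>\<^sup>+U. ennreal (exp (s * Re (c * U $$ (0, t)))) \<partial>\<mu>) \<le> ennreal (exp (s\<^sup>2 / (2 * real n)))"
proof -
  let ?PE = "PiE {0..<n} (\<lambda>_. {..<4 :: nat})"
  define r where "r = 1 / sqrt (real n)"
  let ?b = "\<lambda>f U. \<Sum>l\<in>{0..<n}. phase r (f l) * U $$ (l, t)"
  let ?g = "\<lambda>u. ennreal (exp (s * Re (c * u)))"
  let ?K = "of_nat (card ?PE) :: ennreal"
  have card: "card ?PE = 4 ^ n" by (simp add: card_PiE)
  have m [measurable]: "(\<lambda>U. U $$ (l, t)) \<in> borel_measurable \<mu>" if "l < n" for l
    using that t by (rule measurable_entry)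
  have m0 [measurable]: "(\<lambda>U. U $$ (0, t)) \<in> borel_measurable \<mu>" using t by (intro m) auto
  have mb: "(\<lambda>U. ?g (?b f U)) \<in> borel_measurable \<mu>" for f
  proof -
    have [measurable]: "(\<lambda>U. ?b f U) \<in> borel_measurable \<mu>"
      by (intro borel_measurable_sum borel_measurable_times measurable_const m) auto
    show ?thesis by measurable
  qed
  have eq: "(\<integral>\<^sup>+U. ?g (U $$ (0, t)) \<partial>\<mu>) = (\<integral>\<^sup>+U. ?g (?b f U) \<partial>\<mu>)" if f: "f \<in> ?PE" for f
  proof -
    from unitary_mixing_row[of 0 n f] f t obtain V where V: "V \<in> unitary_group n" and
      VU: "\<forall>U\<in>carrier_mat n n. \<forall>t<n. (\<forall>l<0. (V * U) $$ (l, t) = U $$ (l, t)) \<and>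
          (V * U) $$ (0, t) = (\<Sum>l\<in>{0..<n}. phase (1 / sqrt (real (n - 0))) (f l) * U $$ (l, t))"
      by (auto elim!: bexE)
    have "(\<integral>\<^sup>+U. ?g (U $$ (0, t)) \<partial>\<mu>) = (\<integral>\<^sup>+U. ?g ((V * U) $$ (0, t)) \<partial>\<mu>)"
      by (intro nn_integral_left_mult[OF V, symmetric]) measurable
    also have "\<dots> = (\<integral>\<^sup>+U. ?g (?b f U) \<partial>\<mu>)"
    proof (intro nn_integral_cong)
      fix U assume "U \<in> space \<mu>"
      then have "U \<in> carrier_mat n n" by (simp add: space_haar unitary_group_def)
      then have "(V * U) $$ (0, t) = ?b f U" using VU t by (simp add: r_def)
      then show "?g ((V * U) $$ (0, t)) = ?g (?b f U)" by simp
    qed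
    finally show ?thesis .
  qed
  have "?K * (\<integral>\<^sup>+U. ?g (U $$ (0, t)) \<partial>\<mu>) = (\<Sum>f\<in>?PE. \<integral>\<^sup>+U. ?g (U $$ (0, t)) \<partial>\<mu>)" by simp
  also have "\<dots> = (\<Sum>f\<in>?PE. \<integral>\<^sup>+U. ?g (?b f U) \<partial>\<mu>)" by (intro sum.cong refl eq)
  also have "\<dots> = (\<integral>\<^sup>+U. (\<Sum>f\<in>?PE. ?g (?b f U)) \<partial>\<mu>)" by (intro nn_integral_sum[symmetric] mb)
  also have "\<dots> \<le> (\<integral>\<^sup>+U. ?K * ennreal (exp (s\<^sup>2 / (2 * real n))) \<partial>\<mu>)"
  proof (intro nn_integral_mono)
    fix U assume "U \<in> space \<mu>"
    then have U: "U \<in> unitary_group n" by (simp add: space_haar)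
    define y where "y = (\<lambda>l. of_real s * c * U $$ (l, t))"
    have "complex_of_real (\<Sum>l<n. (cmod (U $$ (l, t)))\<^sup>2) = 1"
      using unitary_column_orthonormal[OF U t t] unfolding of_real_sum complex_norm_square by simp
    then have "(\<Sum>l<n. (cmod (U $$ (l, t)))\<^sup>2) = 1" by (simp only: of_real_eq_1_iff)
    then have y2: "(\<Sum>l\<in>{0..<n}. (cmod (y l))\<^sup>2) = s\<^sup>2"
      using c by (simp add: y_def norm_mult power_mult_distrib sum_distrib_left[symmetric] atLeast0LessThan)
    have "(\<Sum>f\<in>?PE. exp (s * Re (c * ?b f U))) / real (card ?PE) =
        av 4 (phase r) {0..<n} (\<lambda>b. exp (Re (\<Sum>l\<in>{0..<n}. y l * b l)))"
    proof -
      have "s * Re (c * ?b f U) = Re (\<Sum>l\<in>{0..<n}. y l * phase r (f l))" for f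
      proof -
        have "s * Re (c * ?b f U) = Re (of_real s * (c * ?b f U))" by simp
        also have "of_real s * (c * ?b f U) = (\<Sum>l\<in>{0..<n}. y l * phase r (f l))"
          by (simp add: y_def sum_distrib_left mult_ac)
        finally show ?thesis .
      qed
      then show ?thesis unfolding av_def card by simp
    qed
    also have "\<dots> \<le> exp (r\<^sup>2 * s\<^sup>2 / 2)"
      using av_phase_mgf[of "{0..<n}" r y] unfolding y2 by simp
    finally have "(\<Sum>f\<in>?PE. exp (s * Re (c * ?b f U))) \<le> real (card ?PE) * exp (s\<^sup>2 / (2 * real n))"
      using t card by (simp add: r_def field_simps)
    then have "ennreal (\<Sum>f\<in>?PE. exp (s * Re (c * ?b f U))) \<le> ennreal (real (card ?PE) * exp (s\<^sup>2 / (2 * real n)))"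
      by (rule ennreal_leI)
    then show "(\<Sum>f\<in>?PE. ?g (?b f U)) \<le> ?K * ennreal (exp (s\<^sup>2 / (2 * real n)))"
      by (simp add: sum_ennreal ennreal_mult ennreal_of_nat_eq_real_of_nat)
  qed
  also have "\<dots> = ?K * ennreal (exp (s\<^sup>2 / (2 * real n)))" by (simp add: emeasure_space_1)
  finally show ?thesis
    unfolding card by (subst (asm) ennreal_mult_le_mult_iff) (auto simp: ennreal_of_nat_eq_real_of_nat)
qed

text \<open>If the squared modulus exceeds \<open>2 * s\<^sup>2\<close>, one of the four rotations
  by \<open>\<i> ^ k\<close> has real part at least \<open>s\<close>; Chernoff's bound is applied to
  each.\<close>

lemma large_entry_first_row:
  assumes t: "t < n" and s: "0 \<le> s"
  shows "emeasure \<mu> {U \<in> space \<mu>. 2 * s\<^sup>2 < (cmod (U $$ (0, t)))\<^sup>2} \<le> ennreal (4 * exp (- real n * s\<^sup>2 / 2))"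
proof -
  have [measurable]: "(\<lambda>U. U $$ (0, t)) \<in> borel_measurable \<mu>" using t by (intro measurable_entry) auto
  have n: "0 < real n" using t by simp
  \<comment> \<open>The exponent \<open>l\<close> that minimises
    \<open>l\<^sup>2 / (2 * n) - l * s\<close>.\<close>
  let ?l = "s * real n"
  let ?g = "\<lambda>k U. ennreal (exp (- ?l * s)) * ennreal (exp (?l * Re (\<i> ^ k * U $$ (0, t))))"
  have "emeasure \<mu> {U \<in> space \<mu>. 2 * s\<^sup>2 < (cmod (U $$ (0, t)))\<^sup>2} =
      (\<integral>\<^sup>+U. indicator {U \<in> space \<mu>. 2 * s\<^sup>2 < (cmod (U $$ (0, t)))\<^sup>2} U \<partial>\<mu>)"
    by (rule nn_integral_indicator[symmetric]) measurable
  also have "\<dots> \<le> (\<integral>\<^sup>+U. (\<Sum>k<4 :: nat. ?g k U) \<partial>\<mu>)"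
  proof (intro nn_integral_mono)
    fix U
    show "indicator {U \<in> space \<mu>. 2 * s\<^sup>2 < (cmod (U $$ (0, t)))\<^sup>2} U \<le> (\<Sum>k<4 :: nat. ?g k U)"
    proof (cases "2 * s\<^sup>2 < (cmod (U $$ (0, t)))\<^sup>2")
      case True
      let ?u = "U $$ (0, t)"
      have "s\<^sup>2 < (Re ?u)\<^sup>2 \<or> s\<^sup>2 < (Im ?u)\<^sup>2" using True unfolding cmod_power2 by linarith
      moreover have "s < \<bar>x\<bar>" if "s\<^sup>2 < x\<^sup>2" for x
        using power2_less_imp_less[of s "\<bar>x\<bar>"] that by simp
      ultimately have "s < \<bar>Re ?u\<bar> \<or> s < \<bar>Im ?u\<bar>" by blast
      then have "\<exists>k<4::nat. s \<le> Re (\<i> ^ k * ?u)"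
      proof
        assume "s < \<bar>Re ?u\<bar>"
        then show ?thesis
          using exI[of "\<lambda>k. k < 4 \<and> s \<le> Re (\<i> ^ k * ?u)" 0]
            exI[of "\<lambda>k. k < 4 \<and> s \<le> Re (\<i> ^ k * ?u)" 2] by (cases "0 \<le> Re ?u") auto
      next
        assume "s < \<bar>Im ?u\<bar>"
        then show ?thesis
          using exI[of "\<lambda>k. k < 4 \<and> s \<le> Re (\<i> ^ k * ?u)" 3]
            exI[of "\<lambda>k. k < 4 \<and> s \<le> Re (\<i> ^ k * ?u)" 1]
          by (cases "0 \<le> Im ?u") (auto simp: power3_eq_cube)
      qed
      then obtain k where k: "k < 4" "s \<le> Re (\<i> ^ k * ?u)" by blast
      have "ennreal 1 \<le> ennreal (exp (- ?l * s) * exp (?l * Re (\<i> ^ k * ?u)))"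
      proof (rule ennreal_leI)
        have "?l * s \<le> ?l * Re (\<i> ^ k * ?u)" using k s by (intro mult_left_mono) auto
        then show "1 \<le> exp (- ?l * s) * exp (?l * Re (\<i> ^ k * ?u))" by (simp flip: exp_add)
      qed
      also have "\<dots> = ?g k U" by (simp add: ennreal_mult)
      also have "\<dots> \<le> (\<Sum>k<4 :: nat. ?g k U)" using k by (intro member_le_sum) auto
      finally show ?thesis by (auto simp: indicator_def)
    qed (simp add: indicator_def)
  qed
  also have "\<dots> = (\<Sum>k<4 :: nat. ennreal (exp (- ?l * s)) * (\<integral>\<^sup>+U. ennreal (exp (?l * Re (\<i> ^ k * U $$ (0, t)))) \<partial>\<mu>))"
    by (simp add: nn_integral_sum nn_integral_cmult)
  also have "\<dots> \<le> (\<Sum>k<4 :: nat. ennreal (exp (- ?l * s)) * ennreal (exp (?l\<^sup>2 / (2 * real n))))"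
    by (intro sum_mono mult_left_mono mgf_entry[OF t]) (auto simp: norm_power)
  also have "\<dots> = ennreal (4 * (exp (- ?l * s) * exp (?l\<^sup>2 / (2 * real n))))"
    by (simp add: ennreal_mult)
  also have "exp (- ?l * s) * exp (?l\<^sup>2 / (2 * real n)) = exp (- real n * s\<^sup>2 / 2)"
    using n by (simp add: power2_eq_square field_simps flip: exp_add)
  finally show ?thesis .
qed

text \<open>Interchanging rows 0 and \<open>l\<close> is left multiplication by a permutation
  matrix, so the bound for row 0 carries over.\<close>

lemma large_entry:
  assumes l: "l < n" and t: "t < n" and s: "0 \<le> s"
  shows "emeasure \<mu> {U \<in> space \<mu>. 2 * s\<^sup>2 < (cmod (U $$ (l, t)))\<^sup>2} \<le> ennreal (4 * exp (- real n * s\<^sup>2 / 2))"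
proof -
  let ?h = "\<lambda>i j. (if Transposition.transpose 0 l i = j then 1 else 0) :: complex"
  let ?W = "mat n n (\<lambda>(i, j). ?h i j)"
  have tl: "Transposition.transpose 0 l i < n" if "i < n" for i
    using that l by (auto simp: Transposition.transpose_def)
  have W: "?W \<in> unitary_group n"
  proof (rule unitary_groupI)
    fix i j assume ij: "i < n" "j < n"
    have "(\<Sum>k<n. ?h i k * cnj (?h j k)) = (\<Sum>k<n. if k = Transposition.transpose 0 l i then ?h j k else 0)"
      by (intro sum.cong) auto
    also have "\<dots> = ?h j (Transposition.transpose 0 l i)" using tl[OF ij(1)] by simp
    also have "\<dots> = (if i = j then 1 else 0)" by (auto simp: transpose_eq_iff)
    finally show "(\<Sum>k<n. ?h i k * cnj (?h j k)) = (if i = j then 1 else 0)" .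
  qed
  have WU: "(?W * U) $$ (l, t) = U $$ (0, t)" if "U \<in> space \<mu>" for U
  proof -
    have "U \<in> carrier_mat n n" using that by (simp add: space_haar unitary_group_def)
    then have "(?W * U) $$ (l, t) = (\<Sum>k<n. ?h l k * U $$ (k, t))"
      using l t by (auto simp: scalar_prod_def atLeast0LessThan)
    also have "\<dots> = (\<Sum>k<n. if k = 0 then U $$ (k, t) else 0)" by (intro sum.cong) auto
    also have "\<dots> = U $$ (0, t)" using t by simp
    finally show ?thesis .
  qed
  have [measurable]: "(\<lambda>U. U $$ (l, t)) \<in> borel_measurable \<mu>" "(\<lambda>U. U $$ (0, t)) \<in> borel_measurable \<mu>"
    using l t by (auto intro!: measurable_entry)
  let ?f = "\<lambda>U. indicator {u. 2 * s\<^sup>2 < (cmod u)\<^sup>2} (U $$ (l, t)) :: ennreal"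
  have [measurable]: "{u :: complex. 2 * s\<^sup>2 < (cmod u)\<^sup>2} \<in> sets borel" by measurable
  have ind: "(\<integral>\<^sup>+U. indicator {u. 2 * s\<^sup>2 < (cmod u)\<^sup>2} (U $$ (k, t)) \<partial>\<mu>) =
      emeasure \<mu> {U \<in> space \<mu>. 2 * s\<^sup>2 < (cmod (U $$ (k, t)))\<^sup>2}" if "k < n" for k
  proof -
    have [measurable]: "(\<lambda>U. U $$ (k, t)) \<in> borel_measurable \<mu>" using that t by (rule measurable_entry)
    have "(\<integral>\<^sup>+U. indicator {u. 2 * s\<^sup>2 < (cmod u)\<^sup>2} (U $$ (k, t)) \<partial>\<mu>) =
       (\<integral>\<^sup>+U. indicator {U \<in> space \<mu>. 2 * s\<^sup>2 < (cmod (U $$ (k, t)))\<^sup>2} U \<partial>\<mu>)"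
      by (intro nn_integral_cong) (simp add: indicator_def)
    also have "\<dots> = emeasure \<mu> {U \<in> space \<mu>. 2 * s\<^sup>2 < (cmod (U $$ (k, t)))\<^sup>2}"
      by (rule nn_integral_indicator) measurable
    finally show ?thesis .
  qed
  have "(\<integral>\<^sup>+U. ?f U \<partial>\<mu>) = (\<integral>\<^sup>+U. ?f (?W * U) \<partial>\<mu>)"
    by (intro nn_integral_left_mult[OF W, symmetric]) measurable
  also have "\<dots> = (\<integral>\<^sup>+U. indicator {u. 2 * s\<^sup>2 < (cmod u)\<^sup>2} (U $$ (0, t)) \<partial>\<mu>)"
    by (intro nn_integral_cong) (simp only: WU)
  finally show ?thesis
    using large_entry_first_row[OF t s] l by (simp add: ind)
qed

lemma not_flat_rows:
  assumes N: "0 < N" "N \<le> n"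
  shows "measure \<mu> {U \<in> space \<mu>. \<not> flat_rows N n N U} \<le> 4 * real N * real n * exp (- real n / (4 * real N ^ 3))"
proof -
  \<comment> \<open>Chosen so that \<open>2 * s\<^sup>2\<close> is the threshold of
    \<open>flat_rows\<close>; the rest is a union bound over the entries.\<close>
  define s where "s = sqrt (1 / (2 * real N ^ 3))"
  have s: "0 \<le> s" "2 * s\<^sup>2 = 1 / real N ^ 3" "- real n * s\<^sup>2 / 2 = - real n / (4 * real N ^ 3)"
    by (simp_all add: s_def)
  let ?B = "\<lambda>l t. {U \<in> space \<mu>. 2 * s\<^sup>2 < (cmod (U $$ (l, t)))\<^sup>2}"
  have Bm: "?B l t \<in> sets \<mu>" if "l < N" "t < n" for l t
  proof -
    have [measurable]: "(\<lambda>U. U $$ (l, t)) \<in> borel_measurable \<mu>" using that N by (intro measurable_entry) auto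
    show ?thesis by measurable
  qed
  have "{U \<in> space \<mu>. \<not> flat_rows N n N U} = (\<Union>(l, t)\<in>{..<N} \<times> {..<n}. ?B l t)"
    unfolding flat_rows_def s(2) by (auto simp: not_le)
  also have "measure \<mu> \<dots> \<le> (\<Sum>(l, t)\<in>{..<N} \<times> {..<n}. measure \<mu> (?B l t))"
    using measure_UNION_le[of "{..<N} \<times> {..<n}" "\<lambda>(l, t). ?B l t" \<mu>] Bm by (auto simp: case_prod_unfold)
  also have "\<dots> \<le> (\<Sum>(l, t)\<in>{..<N} \<times> {..<n}. 4 * exp (- real n * s\<^sup>2 / 2))"
  proof (rule sum_mono)
    fix lt assume "lt \<in> {..<N} \<times> {..<n}"
    then obtain l t where lt: "lt = (l, t)" "l < N" "t < n" by auto
    then have "emeasure \<mu> (?B l t) \<le> ennreal (4 * exp (- real n * s\<^sup>2 / 2))"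
      using N by (intro large_entry s(1)) auto
    then show "(case lt of (l, t) => measure \<mu> (?B l t)) \<le> (case lt of (l, t) => 4 * exp (- real n * s\<^sup>2 / 2))"
      by (simp add: lt emeasure_eq_measure)
  qed
  also have "\<dots> = 4 * real N * real n * exp (- real n / (4 * real N ^ 3))"
    unfolding s(3) by simp
  finally show ?thesis .
qed

end

text \<open>Rows are exchanged from the last to the first. With \<open>d\<close> rows already
  averaged, row \<open>i = N - Suc d\<close> is mixed, which requires the rows before it to be
  untouched and flat. The event \<open>good i\<close> concerns those rows only and so survives the
  mixing, whereas flatness of row \<open>i\<close> itself is given up beforehand. After
  \<open>N\<close> exchanges the loss is \<open>(1 + 15 / N) ^ N \<le> exp 15\<close>.\<close>

lemma haar_chaos_second_moment:
  assumes "haar M \<mu>" and N: "0 < N" and M: "N ^ 3 + N \<le> M"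
    and z: "inj_on z {..<N}" "z ` {..<N} \<subseteq> {..<M}"
  shows "(\<integral>\<^sup>+U. indicator {U. flat_rows N M N U} U *
            ennreal ((cmod (chaos N (1 / real M) j (\<lambda>l p. U $$ (l, z p))))\<^sup>2) \<partial>\<mu>)
    \<le> ennreal (exp 15 * (fact N * (1 / real M) ^ N)\<^sup>2)"
proof -
  interpret haar M \<mu> by fact
  define v where "v = 1 / real M"
  define F where "F = (\<lambda>X. (cmod (chaos N v j X))\<^sup>2)"
  \<comment> \<open>Extended by 0 so that all entries are measurable functions of
    \<open>U\<close>.\<close>
  define Y where "Y = (\<lambda>U :: complex mat. \<lambda>l p. if l < N \<and> p < N then U $$ (l, z p) else 0)"
  define g where "g = (\<lambda>d U. row_av N v F d (Y U))"
  define good where "good = (\<lambda>i. {U. flat_rows N M i U})"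
  define c where "c = 1 + 15 / real N"
  have NM: "N \<le> M" using M by simp
  have c: "0 \<le> c" by (simp add: c_def)
  have zM: "z p < M" if "p < N" for p using z(2) that by auto
  have depF: "F X = F X'" if "\<And>l p. l < N ==> p < N ==> X l p = X' l p" for X X'
    unfolding F_def using chaos_depends[of N X X'] that by simp
  have dep: "row_av N v F d X = row_av N v F d X'"
    if "\<And>l p. l < N - d ==> p < N ==> X l p = X' l p" for d X X'
    using row_av_depends[of N F] depF that by blast
  have quadF: "quad N (\<lambda>x. F (X(i := x)))" if "i < N" for i X
    unfolding F_def by (rule chaos_quadratic_in_row[OF that])
  have Ym: "(\<lambda>U. Y U l p) \<in> borel_measurable \<mu>" for l p
    unfolding Y_def using NM zM by (cases "l < N \<and> p < N") (auto intro!: measurable_entry)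
  have gm: "g d \<in> borel_measurable \<mu>" for d
    unfolding g_def
  proof (rule row_av_measurable)
    fix Z :: "complex mat => nat => nat => complex"
    assume "\<And>l p. (\<lambda>U. Z U l p) \<in> borel_measurable \<mu>"
    then have [measurable]: "(\<lambda>U. chaos N v j (Z U)) \<in> borel_measurable \<mu>" by (rule chaos_measurable)
    show "(\<lambda>U. F (Z U)) \<in> borel_measurable \<mu>" unfolding F_def by measurable
  qed (rule Ym)
  have goodm: "(\<lambda>U. indicator (good i) U :: ennreal) \<in> borel_measurable \<mu>" if "i \<le> M" for i
  proof -
    have "Measurable.pred \<mu> (\<lambda>U. U \<in> good i)"
      unfolding good_def using flat_rows_measurable[OF \<open>haar M \<mu>\<close> that, of N] by simp
    then show ?thesis by (simp add: borel_measurable_indicator_iff pred_def Int_def conj_commute)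
  qed
  have gnn: "0 \<le> g d U" for d U
  proof -
    have "0 \<le> row_av N v F d X" for X
      by (induction d arbitrary: X) (simp_all add: F_def av_nonneg)
    then show ?thesis by (simp add: g_def)
  qed
  have step: "(\<integral>\<^sup>+U. indicator (good (N - d)) U * ennreal (g d U) \<partial>\<mu>) \<le>
      ennreal c * (\<integral>\<^sup>+U. indicator (good (N - Suc d)) U * ennreal (g (Suc d) U) \<partial>\<mu>)" if d: "Suc d \<le> N" for d
  proof -
    define i where "i = N - Suc d"
    have i: "i < N" "i < M" "N - d = Suc i" using d NM by (auto simp: i_def)
    let ?I = "{i..<M}" and ?r = "1 / sqrt (real (M - i))"
    let ?PE = "PiE ?I (\<lambda>_. {..<4 :: nat})"
    define b where "b = (\<lambda>(f :: nat => nat) l. phase ?r (f l))"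
    define row where "row = (\<lambda>b (U :: complex mat) p. if p < N then \<Sum>l\<in>?I. b l * U $$ (l, z p) else 0)"
    have mono: "(\<integral>\<^sup>+U. indicator (good (N - d)) U * ennreal (g d U) \<partial>\<mu>) \<le>
        (\<integral>\<^sup>+U. indicator (good i) U * ennreal (g d U) \<partial>\<mu>)"
      by (intro nn_integral_mono mult_right_mono) (auto simp: good_def flat_rows_def i split: split_indicator)
    have mixed: "(\<integral>\<^sup>+U. indicator (good i) U * ennreal (g d U) \<partial>\<mu>) =
        (\<integral>\<^sup>+U. indicator (good i) U * ennreal (row_av N v F d ((Y U)(i := row (b f) U))) \<partial>\<mu>)"
      if f: "f \<in> ?PE" for f
    proof -
      from unitary_mixing_row[OF i(2) f] obtain V where V: "V \<in> unitary_group M" and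
        VU': "\<forall>U\<in>carrier_mat M M. \<forall>t<M. (\<forall>l<i. (V * U) $$ (l, t) = U $$ (l, t)) \<and>
          (V * U) $$ (i, t) = (\<Sum>l\<in>{i..<M}. phase ?r (f l) * U $$ (l, t))"
        by (elim bexE)
      note VU = VU'[rule_format]
      have "(\<integral>\<^sup>+U. indicator (good i) U * ennreal (g d U) \<partial>\<mu>) =
          (\<integral>\<^sup>+U. indicator (good i) (V * U) * ennreal (g d (V * U)) \<partial>\<mu>)"
        using goodm[of i] gm[of d] i(2) by (intro nn_integral_left_mult[OF V, symmetric]) auto
      also have "\<dots> = (\<integral>\<^sup>+U. indicator (good i) U * ennreal (row_av N v F d ((Y U)(i := row (b f) U))) \<partial>\<mu>)"
      proof (intro nn_integral_cong)
        fix U assume "U \<in> space \<mu>"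
        then have U: "U \<in> carrier_mat M M" by (simp add: space_haar unitary_group_def)
        have "indicator (good i) (V * U) = (indicator (good i) U :: ennreal)"
          using VU[OF U] by (simp add: good_def flat_rows_def indicator_def)
        moreover have "g d (V * U) = row_av N v F d ((Y U)(i := row (b f) U))"
          unfolding g_def
        proof (rule dep)
          fix l p assume lp: "l < N - d" "p < N"
          show "Y (V * U) l p = ((Y U)(i := row (b f) U)) l p"
          proof (cases "l = i")
            case True
            then show ?thesis using lp i VU[OF U zM[OF lp(2)]] by (simp add: Y_def row_def b_def)
          next
            case False
            then have "l < i" using lp i by simp
            then show ?thesis using lp i VU[OF U zM[OF lp(2)]] by (simp add: Y_def)
          qed
        qed
        ultimately show "indicator (good i) (V * U) * ennreal (g d (V * U)) =
            indicator (good i) U * ennreal (row_av N v F d ((Y U)(i := row (b f) U)))" by simp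
      qed
      finally show ?thesis .
    qed
    let ?L = "\<integral>\<^sup>+U. indicator (good i) U * ennreal (g d U) \<partial>\<mu>"
    let ?R = "\<integral>\<^sup>+U. indicator (good i) U * ennreal (g (Suc d) U) \<partial>\<mu>"
    let ?K = "of_nat (card ?PE) :: ennreal"
    have card: "card ?PE = 4 ^ (M - i)" by (simp add: card_PiE)
    have rowm: "(\<lambda>U. row_av N v F d ((Y U)(i := row (b f) U))) \<in> borel_measurable \<mu>" for f
    proof (rule row_av_measurable)
      fix Z :: "complex mat => nat => nat => complex"
      assume "\<And>l p. (\<lambda>U. Z U l p) \<in> borel_measurable \<mu>"
      then have [measurable]: "(\<lambda>U. chaos N v j (Z U)) \<in> borel_measurable \<mu>" by (rule chaos_measurable)
      show "(\<lambda>U. F (Z U)) \<in> borel_measurable \<mu>" unfolding F_def by measurable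
    next
      fix l p
      have "(\<lambda>U. row (b f) U p) \<in> borel_measurable \<mu>"
        unfolding row_def using zM by (cases "p < N")
          (auto intro!: borel_measurable_sum borel_measurable_times measurable_entry)
      then show "(\<lambda>U. ((Y U)(i := row (b f) U)) l p) \<in> borel_measurable \<mu>"
        using Ym[of l p] by (cases "l = i") auto
    qed
    \<comment> \<open>Multiplying by the number of mixings, instead of averaging, avoids division in
      \<open>ennreal\<close>; the factor is cancelled at the end.\<close>
    have "?K * ?L = (\<Sum>f\<in>?PE. ?L)" by simp
    also have "\<dots> = (\<Sum>f\<in>?PE. \<integral>\<^sup>+U. indicator (good i) U * ennreal (row_av N v F d ((Y U)(i := row (b f) U))) \<partial>\<mu>)"
      by (intro sum.cong refl mixed)
    also have "\<dots> = (\<integral>\<^sup>+U. (\<Sum>f\<in>?PE. indicator (good i) U * ennreal (row_av N v F d ((Y U)(i := row (b f) U)))) \<partial>\<mu>)"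
      using goodm[of i] rowm i(2) by (intro nn_integral_sum[symmetric]) auto
    also have "\<dots> \<le> (\<integral>\<^sup>+U. (?K * ennreal c) * (indicator (good i) U * ennreal (g (Suc d) U)) \<partial>\<mu>)"
    proof (intro nn_integral_mono)
      fix U assume "U \<in> space \<mu>"
      then have U: "U \<in> unitary_group M" by (simp add: space_haar)
      show "(\<Sum>f\<in>?PE. indicator (good i) U * ennreal (row_av N v F d ((Y U)(i := row (b f) U)))) \<le>
          (?K * ennreal c) * (indicator (good i) U * ennreal (g (Suc d) U))"
      proof (cases "U \<in> good i")
        case False then show ?thesis by simp
      next
        case True
        \<comment> \<open>For fixed \<open>U\<close> this is a function of row \<open>i\<close>
          alone, to which the comparison for one row applies.\<close>
        define h where "h = (\<lambda>x. row_av N v F d ((Y U)(i := x)))"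
        have hq: "quad N h" unfolding h_def using row_av_quad[of N F i d] quadF i by simp
        have "av 4 (phase ?r) ?I (\<lambda>b. h (\<lambda>p. \<Sum>l\<in>?I. b l * U $$ (l, z p))) \<le>
            (1 + 15 / real N) * av 8 (pseudo_gauss (1 / real M)) {..<N} h"
        proof (rule quad_haar_row_step[OF _ i(1) M _ hq])
          fix p q assume pq: "p < N" "q < N"
          show "(\<Sum>l<M. U $$ (l, z p) * cnj (U $$ (l, z q))) = (if p = q then 1 else 0)"
            using unitary_column_orthonormal[OF U zM zM, OF pq] inj_onD[OF z(1), of p q] pq by auto
        next
          fix l assume l: "l < i"
          have "(\<Sum>p<N. (cmod (U $$ (l, z p)))\<^sup>2) \<le> (\<Sum>p<N. 1 / real N ^ 3)"
            using True l zM by (intro sum_mono) (auto simp: good_def flat_rows_def)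
          also have "\<dots> = 1 / real N ^ 2" using N by (simp add: power2_eq_square power3_eq_cube)
          finally show "(\<Sum>p<N. (cmod (U $$ (l, z p)))\<^sup>2) \<le> 1 / real N ^ 2" .
        qed
        moreover have "av 8 (pseudo_gauss (1 / real M)) {..<N} h = g (Suc d) U"
          by (simp add: g_def h_def i_def v_def)
        moreover have "av 4 (phase ?r) ?I (\<lambda>b. h (\<lambda>p. \<Sum>l\<in>?I. b l * U $$ (l, z p))) =
            (\<Sum>f\<in>?PE. row_av N v F d ((Y U)(i := row (b f) U))) / real (card ?PE)"
        proof -
          have "h (\<lambda>p. \<Sum>l\<in>?I. b l * U $$ (l, z p)) = row_av N v F d ((Y U)(i := row b U))" for b
            unfolding h_def
          proof (rule dep)
            fix l p assume "p < N"
            then show "((Y U)(i := \<lambda>p. \<Sum>l\<in>?I. b l * U $$ (l, z p))) l p = ((Y U)(i := row b U)) l p"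
              by (cases "l = i") (simp_all add: row_def)
          qed
          then show ?thesis unfolding av_def b_def card by (simp del: of_nat_diff)
        qed
        ultimately have "(\<Sum>f\<in>?PE. row_av N v F d ((Y U)(i := row (b f) U))) \<le> real (card ?PE) * (c * g (Suc d) U)"
          using card by (simp add: c_def field_simps)
        moreover have "0 \<le> row_av N v F d ((Y U)(i := row (b f) U))" for f
          using quad_nonneg[OF hq] by (simp add: h_def)
        ultimately have "(\<Sum>f\<in>?PE. ennreal (row_av N v F d ((Y U)(i := row (b f) U)))) \<le> ennreal (real (card ?PE) * (c * g (Suc d) U))"
          by (subst sum_ennreal) (auto intro!: ennreal_leI)
        also have "\<dots> = (?K * ennreal c) * ennreal (g (Suc d) U)"
          using c gnn by (simp add: ennreal_mult ennreal_of_nat_eq_real_of_nat mult.assoc)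
        finally show ?thesis using True by simp
      qed
    qed
    also have "\<dots> = ?K * (ennreal c * ?R)"
      using goodm[of i] gm[of "Suc d"] i(2) by (subst nn_integral_cmult) (auto simp: mult.assoc)
    finally have "?L \<le> ennreal c * ?R"
      unfolding card by (subst (asm) ennreal_mult_le_mult_iff) (auto simp: ennreal_of_nat_eq_real_of_nat)
    then show ?thesis using mono unfolding i_def by (rule order_trans[rotated])
  qed
  have iter: "(\<integral>\<^sup>+U. indicator (good N) U * ennreal (g 0 U) \<partial>\<mu>) \<le>
      ennreal (c ^ d) * (\<integral>\<^sup>+U. indicator (good (N - d)) U * ennreal (g d U) \<partial>\<mu>)" if "d \<le> N" for d
    using that
  proof (induction d)
    case (Suc d)
    have "(\<integral>\<^sup>+U. indicator (good N) U * ennreal (g 0 U) \<partial>\<mu>) \<le>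
      ennreal (c ^ d) * (\<integral>\<^sup>+U. indicator (good (N - d)) U * ennreal (g d U) \<partial>\<mu>)" using Suc by simp
    also have "\<dots> \<le> ennreal (c ^ d) * (ennreal c * (\<integral>\<^sup>+U. indicator (good (N - Suc d)) U * ennreal (g (Suc d) U) \<partial>\<mu>))"
      using step[OF Suc.prems] by (intro mult_left_mono) auto
    finally show ?case using c by (simp add: ennreal_mult mult_ac)
  qed simp
  have "(\<integral>\<^sup>+U. indicator (good N) U * ennreal ((cmod (chaos N v j (\<lambda>l p. U $$ (l, z p))))\<^sup>2) \<partial>\<mu>) =
      (\<integral>\<^sup>+U. indicator (good N) U * ennreal (g 0 U) \<partial>\<mu>)"
  proof -
    have "chaos N v j (\<lambda>l p. U $$ (l, z p)) = chaos N v j (Y U)" for U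
      by (rule chaos_depends) (simp add: Y_def)
    then show ?thesis by (simp add: g_def F_def)
  qed
  also have "\<dots> \<le> ennreal (c ^ N) * (\<integral>\<^sup>+U. indicator (good 0) U * ennreal (g N U) \<partial>\<mu>)"
    using iter[of N] by simp
  also have "\<dots> \<le> ennreal (c ^ N) * (\<integral>\<^sup>+U. ennreal ((fact N * v ^ N)\<^sup>2) \<partial>\<mu>)"
  proof (intro mult_left_mono nn_integral_mono)
    fix U
    have "g N U \<le> (fact N * v ^ N)\<^sup>2"
      unfolding g_def F_def by (rule chaos_second_moment) (simp add: v_def)
    then show "indicator (good 0) U * ennreal (g N U) \<le> ennreal ((fact N * v ^ N)\<^sup>2)"
      by (auto simp: indicator_def intro!: ennreal_leI)
  qed simp
  also have "\<dots> = ennreal (c ^ N * (fact N * v ^ N)\<^sup>2)"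
    using c by (simp add: emeasure_space_1 ennreal_mult)
  also have "\<dots> \<le> ennreal (exp 15 * (fact N * v ^ N)\<^sup>2)"
  proof (intro ennreal_leI mult_right_mono)
    have "c ^ N \<le> exp (15 / real N) ^ N"
      unfolding c_def by (intro power_mono) (auto simp: exp_ge_add_one_self)
    also have "\<dots> = exp 15" using N by (simp add: exp_of_nat_mult[symmetric])
    finally show "c ^ N \<le> exp 15" .
  qed simp
  finally show ?thesis unfolding v_def good_def by simp
qed

section \<open>Sampling from signed weights\<close>

text \<open>A subset of the modes is sampled mode by mode; \<open>p i o\<close> is the probability of a click in mode
  \<open>i\<close> if the earlier clicks were \<open>o\<close>.\<close>

primrec walk :: "(nat => nat list => real) => nat => nat => nat list => nat list pmf" where
  "walk p 0 i o1 = return_pmf o1"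
| "walk p (Suc d) i o1 =
     bind_pmf (bernoulli_pmf (p i o1)) (\<lambda>b. walk p d (Suc i) (if b then o1 @ [i] else o1))"

text \<open>The lists below a node of the decision tree. Any length is allowed, so that all branches
  have depth \<open>m\<close>; lists of length other than \<open>n\<close> will carry weight
  0.\<close>

definition leaves :: "nat => nat => nat list => nat list set" where
  "leaves m i o1 = {z. sorted_wrt (<) z \<and> set z \<subseteq> {..<m} \<and> filter (\<lambda>t. t < i) z = o1}"

lemma finite_sorted_lists: "finite {z. sorted_wrt (<) z \<and> set z \<subseteq> {..<m :: nat}}"
proof (rule finite_subset)
  show "{z. sorted_wrt (<) z \<and> set z \<subseteq> {..<m}} \<subseteq> {z. set z \<subseteq> {..<m} \<and> length z \<le> m}"
  proof safe
    fix z :: "nat list" assume z: "sorted_wrt (<) z" "set z \<subseteq> {..<m}"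
    have "length z = card (set z)" using z(1) strict_sorted_iff[of z] distinct_card[of z] by simp
    also have "\<dots> \<le> m" using card_mono[OF _ z(2)] by simp
    finally show "length z \<le> m" .
  qed
  show "finite {z. set z \<subseteq> {..<m} \<and> length z \<le> m}" by (rule finite_lists_length_le) simp
qed

lemma finite_leaves [simp]: "finite (leaves m i o1)"
  by (rule finite_subset[OF _ finite_sorted_lists[of m]]) (auto simp: leaves_def)

text \<open>In an increasing list the element \<open>i\<close> itself is all that can be gained, and
  it comes last.\<close>

lemma filter_less_Suc:
  assumes "sorted_wrt (<) (z :: nat list)"
  shows "filter (\<lambda>t. t < Suc i) z = (if i \<in> set z then filter (\<lambda>t. t < i) z @ [i] else filter (\<lambda>t. t < i) z)"
  using assms
proof (induction z)
  case (Cons a z)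
  show ?case
  proof (cases "a = i")
    case True
    have "filter (\<lambda>t. t < Suc i) z = []" "filter (\<lambda>t. t < i) z = []"
      using Cons.prems True by (auto simp: filter_empty_conv)
    then show ?thesis using True by simp
  next
    case False
    show ?thesis
    proof (cases "i < a")
      case True
      then have "i \<notin> set z" using Cons.prems by auto
      moreover have "filter (\<lambda>t. t < Suc i) z = []" "filter (\<lambda>t. t < i) z = []"
        using Cons.prems True by (auto simp: filter_empty_conv)
      ultimately show ?thesis using True by simp
    next
      case False
      then show ?thesis using \<open>a \<noteq> i\<close> Cons by auto
    qed
  qed
qed simp

lemma leaves_split:
  assumes "i < m" "i \<notin> set o1"
  shows "leaves m i o1 = leaves m (Suc i) (o1 @ [i]) \<union> leaves m (Suc i) o1"
    "leaves m (Suc i) (o1 @ [i]) \<inter> leaves m (Suc i) o1 = {}"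
proof -
  have "filter (\<lambda>t. t < i) z = o1 \<longleftrightarrow> filter (\<lambda>t. t < Suc i) z = o1 @ [i] \<or> filter (\<lambda>t. t < Suc i) z = o1"
    if z: "sorted_wrt (<) z" for z
  proof -
    have "i \<notin> set (filter (\<lambda>t. t < i) z)" by simp
    then have "filter (\<lambda>t. t < i) z \<noteq> o1 @ [i]" by (metis in_set_conv_decomp)
    then show ?thesis unfolding filter_less_Suc[OF z] using assms(2)
      by (auto simp: filter_less_Suc[OF z] split: if_splits) 
  qed
  then show "leaves m i o1 = leaves m (Suc i) (o1 @ [i]) \<union> leaves m (Suc i) o1"
    unfolding leaves_def by blast
  show "leaves m (Suc i) (o1 @ [i]) \<inter> leaves m (Suc i) o1 = {}"
    unfolding leaves_def by auto
qed

lemma leaves_final: "sorted_wrt (<) o1 ==> set o1 \<subseteq> {..<m} ==> leaves m m o1 = {o1}"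
proof -
  assume o: "sorted_wrt (<) o1" "set o1 \<subseteq> {..<m}"
  have "filter (\<lambda>t. t < m) z = z" if "set z \<subseteq> {..<m}" for z using that by (auto simp: filter_id_conv)
  then show ?thesis using o unfolding leaves_def by auto
qed

lemma set_walk:
  "sorted_wrt (<) o1 ==> set o1 \<subseteq> {..<i} ==> i + d = m ==> set_pmf (walk p d i o1) \<subseteq> leaves m i o1"
proof (induction d arbitrary: i o1)
  case 0
  then show ?case using leaves_final[of o1 m] by simp
next
  case (Suc d)
  have i: "i < m" "i \<notin> set o1" using Suc.prems by auto
  have 1: "set_pmf (walk p d (Suc i) (o1 @ [i])) \<subseteq> leaves m (Suc i) (o1 @ [i])"
    by (rule Suc.IH) (use Suc.prems in \<open>auto simp: sorted_wrt_append less_Suc_eq\<close>)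
  have 0: "set_pmf (walk p d (Suc i) o1) \<subseteq> leaves m (Suc i) o1"
    by (rule Suc.IH) (use Suc.prems in \<open>auto simp: less_Suc_eq\<close>)
  show ?case unfolding leaves_split(1)[OF i] using 0 1 by (auto split: if_splits)
qed

context
  fixes p :: "nat => nat list => real" and w :: "nat list => real" and m :: nat
  assumes p01: "\<And>i o1. 0 \<le> p i o1 \<and> p i o1 \<le> 1"
begin

definition weight :: "nat => nat list => real" where
  "weight i o1 = (\<Sum>z\<in>leaves m i o1. w z)"

lemma weight_split:
  "i < m ==> i \<notin> set o1 ==> weight i o1 = weight (Suc i) (o1 @ [i]) + weight (Suc i) o1"
  unfolding weight_def leaves_split(1) by (rule sum.union_disjoint) (auto simp: leaves_split(2))

text \<open>The total deviation from the positive parts of the weights telescopes along the tree.\<close>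

lemma walk_error:
  assumes p: "\<And>i o1. i < m ==> sorted_wrt (<) o1 ==> set o1 \<subseteq> {..<i} ==>
      p i o1 * (max 0 (weight (Suc i) (o1 @ [i])) + max 0 (weight (Suc i) o1)) = max 0 (weight (Suc i) (o1 @ [i]))"
  shows "sorted_wrt (<) o1 ==> set o1 \<subseteq> {..<i} ==> i + d = m ==> 0 \<le> c ==>
    (\<Sum>z\<in>leaves m i o1. \<bar>c * pmf (walk p d i o1) z - max 0 (w z)\<bar>)
      \<le> \<bar>c - max 0 (weight i o1)\<bar> + (\<Sum>z\<in>leaves m i o1. max 0 (w z)) - max 0 (weight i o1)"
proof (induction d arbitrary: i o1 c)
  case 0
  then have l: "leaves m i o1 = {o1}" using leaves_final[of o1 m] by simp
  then show ?case by (simp add: weight_def)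
next
  case (Suc d)
  have i: "i < m" "i \<notin> set o1" using Suc.prems by auto
  let ?L1 = "leaves m (Suc i) (o1 @ [i])" and ?L0 = "leaves m (Suc i) o1"
  let ?W1 = "max 0 (weight (Suc i) (o1 @ [i]))" and ?W0 = "max 0 (weight (Suc i) o1)"
  let ?p = "p i o1"
  have so1: "sorted_wrt (<) (o1 @ [i])" "set (o1 @ [i]) \<subseteq> {..<Suc i}"
    and so0: "set o1 \<subseteq> {..<Suc i}"
    using Suc.prems by (auto simp: sorted_wrt_append less_Suc_eq)
  have d: "Suc i + d = m" using Suc.prems by simp
  note s1 = set_walk[OF so1 d, of p] and s0 = set_walk[OF Suc.prems(1) so0 d, of p]
  have pm: "pmf (walk p (Suc d) i o1) z = ?p * pmf (walk p d (Suc i) (o1 @ [i])) z + (1 - ?p) * pmf (walk p d (Suc i) o1) z" for z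
    using p01[of i o1] by (simp add: pmf_bind)
  have z1: "pmf (walk p (Suc d) i o1) z = ?p * pmf (walk p d (Suc i) (o1 @ [i])) z" if "z \<in> ?L1" for z
  proof -
    have "z \<notin> set_pmf (walk p d (Suc i) o1)" using that s0 leaves_split(2)[OF i] by blast
    then show ?thesis unfolding pm by (simp add: set_pmf_eq)
  qed
  have z0: "pmf (walk p (Suc d) i o1) z = (1 - ?p) * pmf (walk p d (Suc i) o1) z" if "z \<in> ?L0" for z
  proof -
    have "z \<notin> set_pmf (walk p d (Suc i) (o1 @ [i]))" using that s1 leaves_split(2)[OF i] by blast
    then show ?thesis unfolding pm by (simp add: set_pmf_eq)
  qed
  have split: "(\<Sum>z\<in>leaves m i o1. h z) = (\<Sum>z\<in>?L1. h z) + (\<Sum>z\<in>?L0. h z)" for h :: "nat list => real"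
    unfolding leaves_split(1)[OF i] by (rule sum.union_disjoint) (auto simp: leaves_split(2)[OF i])
  have "(\<Sum>z\<in>leaves m i o1. \<bar>c * pmf (walk p (Suc d) i o1) z - max 0 (w z)\<bar>) =
      (\<Sum>z\<in>?L1. \<bar>(c * ?p) * pmf (walk p d (Suc i) (o1 @ [i])) z - max 0 (w z)\<bar>) +
      (\<Sum>z\<in>?L0. \<bar>(c * (1 - ?p)) * pmf (walk p d (Suc i) o1) z - max 0 (w z)\<bar>)"
    unfolding split by (intro arg_cong2[where f = "(+)"] sum.cong refl) (simp_all only: z1 z0 mult.assoc)
  also have "\<dots> \<le> (\<bar>c * ?p - ?W1\<bar> + (\<Sum>z\<in>?L1. max 0 (w z)) - ?W1) + (\<bar>c * (1 - ?p) - ?W0\<bar> + (\<Sum>z\<in>?L0. max 0 (w z)) - ?W0)"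
    using Suc.prems p01[of i o1] so0 by (intro add_mono Suc.IH so1 d) auto
  also have "\<dots> \<le> \<bar>c - max 0 (weight i o1)\<bar> + (\<Sum>z\<in>leaves m i o1. max 0 (w z)) - max 0 (weight i o1)"
  proof -
    \<comment> \<open>Cutting off is subadditive: the excess of the children over the parent is
      nonnegative, and these excesses telescope.\<close>
    have W: "max 0 (weight i o1) \<le> ?W1 + ?W0" using weight_split[OF i] by simp
    \<comment> \<open>The incoming mass \<open>c\<close> is divided in the ratio of the children's
      weights, so the split itself creates no error. If both weights vanish, any ratio will
      do.\<close>
    have "\<bar>c * ?p - ?W1\<bar> + \<bar>c * (1 - ?p) - ?W0\<bar> = \<bar>c - (?W1 + ?W0)\<bar>"
    proof (cases "?W1 + ?W0 = 0")
      case True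
      then have "?W1 = 0" "?W0 = 0" by linarith+
      moreover have "0 \<le> c * ?p" "0 \<le> c * (1 - ?p)" using Suc.prems(4) p01[of i o1] by auto
      moreover have "c * ?p + c * (1 - ?p) = c" unfolding distrib_left[symmetric] by simp
      ultimately show ?thesis by linarith
    next
      case False
      let ?s = "?W1 + ?W0"
      have 1: "?p * ?s = ?W1" using p[OF i(1) Suc.prems(1,2)] by simp
      then have 0: "(1 - ?p) * ?s = ?W0" by (simp add: algebra_simps)
      have "?p * (c - ?s) = ?p * c - ?p * ?s" "(1 - ?p) * (c - ?s) = (1 - ?p) * c - (1 - ?p) * ?s"
        by (rule right_diff_distrib)+
      then have "c * ?p - ?W1 = ?p * (c - ?s)" "c * (1 - ?p) - ?W0 = (1 - ?p) * (c - ?s)"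
        unfolding 0 1 by (simp_all only: mult.commute)
      then have "\<bar>c * ?p - ?W1\<bar> + \<bar>c * (1 - ?p) - ?W0\<bar> = ?p * \<bar>c - ?s\<bar> + (1 - ?p) * \<bar>c - ?s\<bar>"
        using p01[of i o1] by (simp only: abs_mult) simp
      then show ?thesis by (simp add: algebra_simps)
    qed
    moreover have "\<bar>c - (?W1 + ?W0)\<bar> \<le> \<bar>c - max 0 (weight i o1)\<bar> + (?W1 + ?W0 - max 0 (weight i o1))"
      using W by linarith
    ultimately show ?thesis unfolding split by linarith
  qed
  finally show ?case .
qed

end

section \<open>The error of the complete sampler\<close>

definition to_outcome :: "nat => nat list => outcome" where
  "to_outcome n z = (if length z = n then Clicks z else Collision)"

text \<open>A first draw separates clicks from the lumped collision outcome, which receives the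
  positive part of the missing weight. A walk that ends with a number of clicks other than
  \<open>n\<close>, as can happen after weights have been cut off, is also reported as a
  collision.\<close>

definition tree_sampler :: "nat => nat => real => (nat => nat list => real) => outcome pmf" where
  "tree_sampler n m p0 p = bind_pmf (bernoulli_pmf p0)
     (\<lambda>b. if b then map_pmf (to_outcome n) (walk p m 0 []) else return_pmf Collision)"

lemma set_tree_sampler: "set_pmf (tree_sampler n m p0 p) \<subseteq> outcomes n m"
proof -
  have "set_pmf (walk p m 0 []) \<subseteq> leaves m 0 []" by (rule set_walk) auto
  then have "to_outcome n z \<in> outcomes n m" if "z \<in> set_pmf (walk p m 0 [])" for z
    using that by (auto simp: to_outcome_def outcomes_def leaves_def collision_free_def)
  moreover have "Collision \<in> outcomes n m" by (simp add: outcomes_def)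
  ultimately show ?thesis by (auto simp: tree_sampler_def split: if_splits)
qed

lemma finite_collision_free [simp]: "finite (collision_free n m)"
  by (rule finite_subset[OF _ finite_sorted_lists[of m]]) (auto simp: collision_free_def)

text \<open>With \<open>E\<close> the distance between \<open>P\<close> and \<open>w\<close> on the
  clicks, three errors of at most \<open>E\<close> arise there: from \<open>P\<close> to
  \<open>w\<close>, from \<open>w\<close> to its positive part, and from there to the walk. Both
  distributions have total mass 1, so the collision outcome at most doubles this.\<close>

lemma tree_sampler_error:
  fixes P :: "outcome => real" and w :: "nat list => real"
  assumes p01: "\<And>i o1. 0 \<le> p i o1 \<and> p i o1 \<le> 1"
    and p: "\<And>i o1. i < m ==> sorted_wrt (<) o1 ==> set o1 \<subseteq> {..<i} ==>
      p i o1 * (max 0 (weight w m (Suc i) (o1 @ [i])) + max 0 (weight w m (Suc i) o1)) =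
      max 0 (weight w m (Suc i) (o1 @ [i]))"
    and w0: "\<And>z. length z \<noteq> n ==> w z = 0"
    and p0: "p0 = max 0 (\<Sum>z\<in>collision_free n m. w z) /
       (max 0 (\<Sum>z\<in>collision_free n m. w z) + max 0 (1 - (\<Sum>z\<in>collision_free n m. w z)))"
    and P: "\<And>z. z \<in> collision_free n m ==> 0 \<le> P (Clicks z)"
    and PC: "P Collision = 1 - (\<Sum>z\<in>collision_free n m. P (Clicks z))" "0 \<le> P Collision"
  shows "total_variation (outcomes n m) P (pmf (tree_sampler n m p0 p)) \<le>
    6 * (\<Sum>z\<in>collision_free n m. \<bar>P (Clicks z) - w z\<bar>)"
proof -
  let ?cf = "collision_free n m"
  define s where "s = (\<Sum>z\<in>?cf. w z)"
  define E where "E = (\<Sum>z\<in>?cf. \<bar>P (Clicks z) - w z\<bar>)"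
  define Q where "Q = pmf (walk p m 0 [])"
  define L where "L = leaves m 0 []"
  have L: "?cf \<subseteq> L" "z \<in> L ==> z \<notin> ?cf ==> length z \<noteq> n" for z
    by (auto simp: L_def leaves_def collision_free_def)
  have Lf: "finite L" by (simp add: L_def)
  have sL: "(\<Sum>z\<in>L. w z) = s" "(\<Sum>z\<in>L. max 0 (w z)) = (\<Sum>z\<in>?cf. max 0 (w z))"
    unfolding s_def using L Lf w0 by (auto intro!: sum.mono_neutral_right)
  have ws: "weight w m 0 [] = s" using sL by (simp add: weight_def[OF p01] L_def)
  let ?t = "max 0 s + max 0 (1 - s)"
  have t: "1 \<le> ?t" by linarith
  have p0': "p0 * ?t = max 0 s" "(1 - p0) * ?t = max 0 (1 - s)" "0 \<le> p0" "p0 \<le> 1"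
    using t unfolding p0 s_def[symmetric] by (auto simp: field_simps)
  have walk: "(\<Sum>z\<in>L. \<bar>p0 * Q z - max 0 (w z)\<bar>) \<le> \<bar>p0 - max 0 s\<bar> + (\<Sum>z\<in>?cf. max 0 (w z)) - max 0 s"
    using walk_error[OF p01 p, of "[]" 0 m p0] p0' unfolding ws L_def[symmetric] Q_def sL by simp
  have sE: "\<bar>s - (\<Sum>z\<in>?cf. P (Clicks z))\<bar> \<le> E"
    unfolding s_def E_def sum_subtractf[symmetric] by (rule order_trans[OF sum_abs]) (auto intro!: sum_mono)
  have neg: "(\<Sum>z\<in>?cf. max 0 (w z) - w z) \<le> E"
    unfolding E_def
  proof (rule sum_mono)
    fix z assume "z \<in> ?cf"
    then show "max 0 (w z) - w z \<le> \<bar>P (Clicks z) - w z\<bar>" using P[of z] by linarith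
  qed
  have pos: "(\<Sum>z\<in>?cf. max 0 (w z)) \<le> s + E" using neg by (simp add: sum_subtractf s_def)
  \<comment> \<open>The total positive mass \<open>?t\<close> is at least 1, so normalising lowers
    both weights and the deviations add up to \<open>?t - 1\<close>.\<close>
  have r1: "\<bar>p0 - max 0 s\<bar> + \<bar>(1 - p0) - max 0 (1 - s)\<bar> = ?t - 1"
  proof -
    have "p0 - max 0 s = p0 * (1 - ?t)" "(1 - p0) - max 0 (1 - s) = (1 - p0) * (1 - ?t)"
      using p0' by (simp_all add: right_diff_distrib)
    then have "\<bar>p0 - max 0 s\<bar> + \<bar>(1 - p0) - max 0 (1 - s)\<bar> = p0 * (?t - 1) + (1 - p0) * (?t - 1)"
      using p0'(3,4) t by (simp only: abs_mult) simp
    then show ?thesis by (simp add: algebra_simps)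
  qed
  have qC: "pmf (tree_sampler n m p0 p) (Clicks z) = p0 * Q z" if "z \<in> ?cf" for z
  proof -
    have "(\<lambda>z. to_outcome n z) -` {Clicks z} = {z}"
      using that by (auto simp: to_outcome_def collision_free_def split: if_splits)
    then have "pmf (map_pmf (to_outcome n) (walk p m 0 [])) (Clicks z) = Q z"
      by (simp add: pmf_map Q_def measure_pmf_single)
    then show ?thesis using p0'(3,4) by (simp add: tree_sampler_def pmf_bind)
  qed
  have qcol: "pmf (tree_sampler n m p0 p) Collision = 1 - (\<Sum>z\<in>?cf. p0 * Q z)"
  proof -
    have fin: "finite (outcomes n m)" by (simp add: outcomes_def)
    have "(\<Sum>y\<in>outcomes n m. pmf (tree_sampler n m p0 p) y) = 1"
      by (rule sum_pmf_eq_1[OF fin set_tree_sampler])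
    moreover have "(\<Sum>y\<in>outcomes n m. pmf (tree_sampler n m p0 p) y) =
        pmf (tree_sampler n m p0 p) Collision + (\<Sum>z\<in>?cf. pmf (tree_sampler n m p0 p) (Clicks z))"
      unfolding outcomes_def by (subst sum.insert) (auto simp: sum.reindex inj_on_def)
    ultimately show ?thesis using qC by simp
  qed
  let ?d = "\<Sum>z\<in>?cf. \<bar>P (Clicks z) - p0 * Q z\<bar>"
  have "total_variation (outcomes n m) P (pmf (tree_sampler n m p0 p)) =
      \<bar>P Collision - pmf (tree_sampler n m p0 p) Collision\<bar> + ?d"
    unfolding total_variation_def outcomes_def
    by (subst sum.insert) (auto simp: sum.reindex inj_on_def qC)
  also have "\<bar>P Collision - pmf (tree_sampler n m p0 p) Collision\<bar> \<le> ?d"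
  proof -
    have "P Collision - pmf (tree_sampler n m p0 p) Collision = (\<Sum>z\<in>?cf. p0 * Q z - P (Clicks z))"
      unfolding PC qcol by (simp add: sum_subtractf)
    also have "\<bar>\<dots>\<bar> \<le> (\<Sum>z\<in>?cf. \<bar>p0 * Q z - P (Clicks z)\<bar>)" by (rule sum_abs)
    finally show ?thesis by (simp add: abs_minus_commute)
  qed
  also have "?d \<le> 3 * E"
  proof -
    have "?d \<le> (\<Sum>z\<in>?cf. \<bar>P (Clicks z) - w z\<bar> + (max 0 (w z) - w z) + \<bar>p0 * Q z - max 0 (w z)\<bar>)"
      by (intro sum_mono) linarith
    also have "\<dots> = E + (\<Sum>z\<in>?cf. max 0 (w z) - w z) + (\<Sum>z\<in>?cf. \<bar>p0 * Q z - max 0 (w z)\<bar>)"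
      by (simp add: sum.distrib E_def)
    also have "(\<Sum>z\<in>?cf. \<bar>p0 * Q z - max 0 (w z)\<bar>) \<le> (\<Sum>z\<in>L. \<bar>p0 * Q z - max 0 (w z)\<bar>)"
      using L Lf by (intro sum_mono2) auto
    finally have "?d \<le> E + E + (\<bar>p0 - max 0 s\<bar> + (\<Sum>z\<in>?cf. max 0 (w z)) - max 0 s)"
      using neg walk by linarith
    moreover have "\<bar>p0 - max 0 s\<bar> + (\<Sum>z\<in>?cf. max 0 (w z)) - max 0 s \<le> E"
    proof -
      have "(\<Sum>z\<in>?cf. P (Clicks z)) \<le> 1" using PC by simp
      \<comment> \<open>An excess of the total over 1 and the negative parts are paid by the same
        \<open>E\<close>, outcome by outcome.\<close>
      have neg': "(\<Sum>z\<in>?cf. max 0 (w z)) - s + max 0 (s - 1) \<le> E"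
      proof -
        have "(\<Sum>z\<in>?cf. max 0 (w z)) - s = (\<Sum>z\<in>?cf. max 0 (- w z))"
          unfolding s_def sum_subtractf[symmetric] by (intro sum.cong) auto
        moreover have "s - 1 \<le> (\<Sum>z\<in>?cf. w z - P (Clicks z))" using PC by (simp add: sum_subtractf s_def)
        moreover have "(\<Sum>z\<in>?cf. max 0 (- w z)) + (\<Sum>z\<in>?cf. w z - P (Clicks z)) \<le> E"
          unfolding E_def sum.distrib[symmetric]
        proof (rule sum_mono)
          fix z assume "z \<in> ?cf"
          then show "max 0 (- w z) + (w z - P (Clicks z)) \<le> \<bar>P (Clicks z) - w z\<bar>" using P[of z] by linarith
        qed
        moreover have "(\<Sum>z\<in>?cf. max 0 (w z)) - s \<le> E" using pos by simp
        ultimately show ?thesis by linarith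
      qed
      have "\<bar>p0 - max 0 s\<bar> \<le> ?t - 1" using r1 by linarith
      then show ?thesis using neg' by linarith
    qed
    ultimately show ?thesis by linarith
  qed
  finally show ?thesis by (simp add: E_def)
qed

section \<open>Marginals of the truncated expansion\<close>

definition term_weight :: "nat => nat => real => complex mat => (nat => nat) => (nat => nat) => (nat => nat) => nat => complex" where
  "term_weight n m x U r s \<pi> l = of_real (x * real m / (real (l + 1) * real (n - l))) *
     fac (1 / real m) True (\<lambda>t. U $$ (r l, t)) (s l) (s (\<pi> l))"

definition estimate :: "nat => nat => real => complex mat => nat => nat list => complex" where
  "estimate n m x U K z = of_real (fact n * (1 / real m) ^ n) *
     (\<Sum>j\<le>K. \<Sum>r\<in>injections j n. \<Sum>s\<in>injections j m. \<Sum>\<pi>\<in>perms j.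
        if s ` {..<j} \<subseteq> set z then \<Prod>l<j. term_weight n m x U r s \<pi> l else 0)"

text \<open>If \<open>k\<close> of the modes \<open>{i..<m}\<close> are still to click, chosen uniformly, these are the factors of
  the conditional probability that \<open>s 0, s 1, \<dots>\<close> all click.\<close>

definition avail :: "nat => nat => nat => (nat => nat) => nat => real" where
  "avail m i k s l = (if s l < i then 1
     else real (k - card {l'. l' < l \<and> i \<le> s l'}) / real (m - i - card {l'. l' < l \<and> i \<le> s l'}))"

text \<open>Up to the prefactor of \<open>estimate\<close>, the average of the expansion over all
  ways of completing \<open>o1\<close> to \<open>n\<close> clicks. Taking an average rather than a
  sum keeps binomial coefficients out of the program.\<close>

definition node_sum :: "nat => nat => real => complex mat => nat => nat => nat list => complex" where
  "node_sum n m x U K i o1 =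
     (\<Sum>j\<le>K. \<Sum>r\<in>injections j n. \<Sum>s\<in>injections j m. \<Sum>\<pi>\<in>perms j.
        if \<forall>l<j. s l < i \<longrightarrow> s l \<in> set o1
        then \<Prod>l<j. of_real (avail m i (n - length o1) s l) * term_weight n m x U r s \<pi> l else 0)"

lemma estimate_eq_chaos:
  assumes "z \<in> collision_free n m" "0 < n" "n \<le> m" "K \<le> n"
  shows "estimate n m x U K z = (\<Sum>j\<le>K. of_real x ^ j * chaos n (1 / real m) j (\<lambda>i p. U $$ (i, z ! p)))"
proof -
  have "of_real x ^ j * chaos n (1 / real m) j (\<lambda>i p. U $$ (i, z ! p)) = of_real (fact n * (1 / real m) ^ n) *
     (\<Sum>r\<in>injections j n. \<Sum>s\<in>injections j m. \<Sum>\<pi>\<in>perms j.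
        if s ` {..<j} \<subseteq> set z then \<Prod>l<j. term_weight n m x U r s \<pi> l else 0)" if "j \<le> K" for j
    unfolding term_weight_def using chaos_eq_columns[OF assms(1-3), of j x U] that assms(4) by simp
  then show ?thesis unfolding estimate_def by (simp add: sum_distrib_left)
qed

lemma card_less_Suc_if: "card {l'. l' < Suc l \<and> P l'} = card {l'. l' < l \<and> P l'} + (if P l then 1 else 0)"
proof -
  have "{l'. l' < Suc l \<and> P l'} = (if P l then insert l {l'. l' < l \<and> P l'} else {l'. l' < l \<and> P l'})"
    by (auto simp: less_Suc_eq)
  then show ?thesis by simp
qed

text \<open>Factors for modes before \<open>i\<close> are 1, and the others count the modes already
  used, so only the number of later modes matters.\<close>

lemma prod_avail:
  "(\<Prod>l<j. avail m i k s l) = (\<Prod>a<card {l. l < j \<and> i \<le> s l}. real (k - a) / real (m - i - a))"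
proof (induction j)
  case (Suc j)
  then show ?case unfolding card_less_Suc_if by (simp add: avail_def not_less[symmetric])
qed simp

text \<open>The chance that \<open>u\<close> given elements all lie in a uniform
  \<open>k\<close>-subset of a \<open>d\<close>-set, with the denominator cleared.\<close>

lemma binomial_prod:
  "u \<le> d ==> real (d choose k) * (\<Prod>a<u. real (k - a) / real (d - a)) =
    (if u \<le> k then real ((d - u) choose (k - u)) else 0)"
proof (induction u)
  case (Suc u)
  then have IH: "real (d choose k) * (\<Prod>a<u. real (k - a) / real (d - a)) =
    (if u \<le> k then real ((d - u) choose (k - u)) else 0)" by simp
  have "real (d choose k) * (\<Prod>a<Suc u. real (k - a) / real (d - a)) =
    (if u \<le> k then real ((d - u) choose (k - u)) else 0) * (real (k - u) / real (d - u))"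
    unfolding prod.lessThan_Suc mult.assoc[symmetric] IH ..
  also have "\<dots> = (if Suc u \<le> k then real ((d - Suc u) choose (k - Suc u)) else 0)"
  proof (cases "Suc u \<le> k")
    case True
    have "(k - u) * ((d - u) choose (k - u)) = (d - u) * ((d - u - 1) choose (k - u - 1))"
      using True by (intro times_binomial_minus1_eq) simp
    then have "real (k - u) * real ((d - u) choose (k - u)) = real (d - u) * real ((d - Suc u) choose (k - Suc u))"
      by (simp flip: of_nat_mult)
    then show ?thesis using True Suc.prems by (simp add: field_simps del: of_nat_diff)
  qed simp
  finally show ?case .
qed simp

lemma card_subsets_containing:
  assumes "T \<subseteq> {i..<m :: nat}"
  shows "card {Z. Z \<subseteq> {i..<m} \<and> card Z = k \<and> T \<subseteq> Z} = (if card T \<le> k then (m - i - card T) choose (k - card T) else 0)"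
proof (cases "card T \<le> k")
  case True
  have fT: "finite T" using assms finite_subset by blast
  have "bij_betw (\<lambda>Z. Z - T) {Z. Z \<subseteq> {i..<m} \<and> card Z = k \<and> T \<subseteq> Z} {Z. Z \<subseteq> {i..<m} - T \<and> card Z = k - card T}"
  proof (rule bij_betwI[where g = "\<lambda>Z. Z \<union> T"])
    show "(\<lambda>Z. Z - T) \<in> {Z. Z \<subseteq> {i..<m} \<and> card Z = k \<and> T \<subseteq> Z} \<rightarrow> {Z. Z \<subseteq> {i..<m} - T \<and> card Z = k - card T}"
      using fT by (auto simp: card_Diff_subset)
    show "(\<lambda>Z. Z \<union> T) \<in> {Z. Z \<subseteq> {i..<m} - T \<and> card Z = k - card T} \<rightarrow> {Z. Z \<subseteq> {i..<m} \<and> card Z = k \<and> T \<subseteq> Z}"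
    proof
      fix Z assume Z: "Z \<in> {Z. Z \<subseteq> {i..<m} - T \<and> card Z = k - card T}"
      then have "finite Z" "Z \<inter> T = {}" using finite_subset[of Z "{i..<m}"] by auto
      then have "card (Z \<union> T) = k" using Z fT True by (simp add: card_Un_disjoint)
      then show "Z \<union> T \<in> {Z. Z \<subseteq> {i..<m} \<and> card Z = k \<and> T \<subseteq> Z}" using Z assms by auto
    qed
  qed auto
  then have "card {Z. Z \<subseteq> {i..<m} \<and> card Z = k \<and> T \<subseteq> Z} = card {Z. Z \<subseteq> {i..<m} - T \<and> card Z = k - card T}"
    by (rule bij_betw_same_card)
  also have "\<dots> = card ({i..<m} - T) choose (k - card T)" by (rule n_subsets) simp
  finally show ?thesis using True assms fT by (simp add: card_Diff_subset)
next
  case False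
  have "{Z. Z \<subseteq> {i..<m} \<and> card Z = k \<and> T \<subseteq> Z} = {}"
    using False card_mono[of _ T] finite_subset[of _ "{i..<m}"] by fastforce
  then show ?thesis using False by (simp only: card.empty if_False)
qed

lemma sorted_filter_append:
  "sorted_wrt (<) (z :: nat list) ==> filter (\<lambda>t. t < i) z @ filter (\<lambda>t. i \<le> t) z = z"
proof (induction z)
  case (Cons a z)
  show ?case
  proof (cases "a < i")
    case True
    then show ?thesis using Cons by auto
  next
    case False
    then have "filter (\<lambda>t. t < i) z = []" "filter (\<lambda>t. i \<le> t) z = z"
      using Cons.prems by (auto simp: filter_empty_conv filter_id_conv)
    then show ?thesis using False by simp
  qed
qed simp

text \<open>Completions correspond to the subsets of \<open>{i..<m}\<close> of the missing size that
  contain the required modes from \<open>i\<close> on; a required mode before \<open>i\<close> must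
  already have clicked.\<close>

lemma card_completions:
  assumes o1: "sorted_wrt (<) o1" "set o1 \<subseteq> {..<i}" "length o1 \<le> n" and i: "i \<le> m"
    and s: "s \<in> injections j m"
  shows "real (card {z \<in> collision_free n m. filter (\<lambda>t. t < i) z = o1 \<and> s ` {..<j} \<subseteq> set z}) =
    (if \<forall>l<j. s l < i \<longrightarrow> s l \<in> set o1
     then real ((m - i) choose (n - length o1)) * (\<Prod>l<j. avail m i (n - length o1) s l) else 0)"
proof (cases "\<forall>l<j. s l < i \<longrightarrow> s l \<in> set o1")
  case False
  then obtain l where l: "l < j" "s l < i" "s l \<notin> set o1" by blast
  have "{z \<in> collision_free n m. filter (\<lambda>t. t < i) z = o1 \<and> s ` {..<j} \<subseteq> set z} = {}"
    using l by (auto simp: image_subset_iff)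
  then show ?thesis using False by (simp only: card.empty if_False of_nat_0)
next
  case True
  let ?k = "n - length o1"
  let ?T = "s ` {..<j} \<inter> {i..<m}"
  let ?Z = "{z \<in> collision_free n m. filter (\<lambda>t. t < i) z = o1 \<and> s ` {..<j} \<subseteq> set z}"
  let ?S = "{Z. Z \<subseteq> {i..<m} \<and> card Z = ?k \<and> ?T \<subseteq> Z}"
  have sm: "s l < m" if "l < j" for l using injectionsD(2)[OF s that] .
  have "bij_betw (\<lambda>Z. o1 @ sorted_list_of_set Z) ?S
    ?Z"
  proof (rule bij_betwI[where g = "\<lambda>z. set (filter (\<lambda>t. i \<le> t) z)"])
    show "(\<lambda>Z. o1 @ sorted_list_of_set Z) \<in> ?S \<rightarrow>
      ?Z"
    proof
      fix Z assume "Z \<in> ?S"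
      then have Z: "Z \<subseteq> {i..<m}" "card Z = ?k" "?T \<subseteq> Z" by auto
      have fZ: "finite Z" using Z(1) finite_subset by blast
      have 1: "filter (\<lambda>t. t < i) (o1 @ sorted_list_of_set Z) = o1"
      proof -
        have "filter (\<lambda>t. t < i) o1 = o1" using o1(2) by (auto simp: filter_id_conv)
        moreover have "filter (\<lambda>t. t < i) (sorted_list_of_set Z) = []" using Z(1) fZ by (auto simp: filter_empty_conv)
        ultimately show ?thesis by simp
      qed
      have 2: "sorted_wrt (<) (o1 @ sorted_list_of_set Z)"
        using o1 Z(1) fZ by (fastforce simp: sorted_wrt_append)
      have 3: "s ` {..<j} \<subseteq> set (o1 @ sorted_list_of_set Z)"
      proof (rule image_subsetI)
        fix l assume "l \<in> {..<j}"
        then show "s l \<in> set (o1 @ sorted_list_of_set Z)"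
          using True Z(3) fZ sm[of l] by (cases "s l < i") auto
      qed
      have 4: "set (o1 @ sorted_list_of_set Z) \<subseteq> {..<m}" using o1(2) Z(1) fZ i by auto
      have 5: "length (o1 @ sorted_list_of_set Z) = n" using o1(3) Z(2) by simp
      show "o1 @ sorted_list_of_set Z \<in> ?Z"
        using 1 2 3 4 5 by (simp only: collision_free_def mem_Collect_eq)
    qed
    show "(\<lambda>z. set (filter (\<lambda>t. i \<le> t) z)) \<in> ?Z \<rightarrow>
      ?S"
    proof
      fix z assume "z \<in> ?Z"
      then have z: "length z = n" "sorted_wrt (<) z" "set z \<subseteq> {..<m}" "filter (\<lambda>t. t < i) z = o1" "s ` {..<j} \<subseteq> set z"
        by (auto simp: collision_free_def)
      have "length (filter (\<lambda>t. i \<le> t) z) = ?k"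
        using arg_cong[OF sorted_filter_append[OF z(2), of i], of length] z(1,4) by simp
      moreover have "distinct (filter (\<lambda>t. i \<le> t) z)" using z(2) strict_sorted_iff[of z] by simp
      ultimately have "card (set (filter (\<lambda>t. i \<le> t) z)) = ?k" by (metis distinct_card)
      then show "set (filter (\<lambda>t. i \<le> t) z) \<in> ?S"
        using z(3,5) by auto
    qed
  next
    fix Z assume "Z \<in> ?S"
    then have Z: "Z \<subseteq> {i..<m}" "finite Z" using finite_subset by auto
    then show "set (filter (\<lambda>t. i \<le> t) (o1 @ sorted_list_of_set Z)) = Z" using o1(2) by auto
  next
    fix z assume "z \<in> ?Z"
    then have z: "sorted_wrt (<) z" "filter (\<lambda>t. t < i) z = o1" by (auto simp: collision_free_def)
    have "sorted_wrt (<) (filter (\<lambda>t. i \<le> t) z)" using z(1) by (rule sorted_wrt_filter)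
    then have "sorted_list_of_set (set (filter (\<lambda>t. i \<le> t) z)) = filter (\<lambda>t. i \<le> t) z"
      by (intro sorted_list_of_set.idem_if_sorted_distinct) (auto simp: strict_sorted_iff)
    then show "o1 @ sorted_list_of_set (set (filter (\<lambda>t. i \<le> t) z)) = z"
      using sorted_filter_append[OF z(1), of i] z(2) by simp
  qed
  then have "card ?Z =
      card ?S" by (rule bij_betw_same_card[symmetric])
  also have "\<dots> = (if card ?T \<le> ?k then (m - i - card ?T) choose (?k - card ?T) else 0)"
    by (rule card_subsets_containing) auto
  finally have c: "real (card ?Z) =
      (if card ?T \<le> ?k then real ((m - i - card ?T) choose (?k - card ?T)) else 0)" by simp
  have T: "?T = s ` {l. l < j \<and> i \<le> s l}" using sm by auto
  have "inj_on s {l. l < j \<and> i \<le> s l}" using injectionsD(1)[OF s] by (rule inj_on_subset) auto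
  then have cT: "card ?T = card {l. l < j \<and> i \<le> s l}" unfolding T by (rule card_image)
  have "card ?T \<le> m - i" using card_mono[of "{i..<m}" ?T] by simp
  note binomial_prod[OF this, of ?k]
  then show ?thesis unfolding c prod_avail cT[symmetric] if_P[OF True] by (rule sym)
qed

definition clicks_weight :: "nat => nat => real => complex mat => nat => nat list => real" where
  "clicks_weight n m x U K z = (if length z = n then Re (estimate n m x U K z) else 0)"

definition node_weight :: "nat => nat => real => complex mat => nat => nat => nat list => real" where
  "node_weight n m x U K i o1 = weight (clicks_weight n m x U K) m i o1"

text \<open>Exchange the sum over outcomes with the expansion: a term depends on the outcome only
  through the requirement that \<open>s\<close> hits clicked modes, so it is multiplied by a number
  of completions.\<close>

lemma node_weight_eq:
  assumes "sorted_wrt (<) o1" "set o1 \<subseteq> {..<i}" "length o1 \<le> n" "i \<le> m"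
  shows "node_weight n m x U K i o1 = fact n * (1 / real m) ^ n * real ((m - i) choose (n - length o1)) * Re (node_sum n m x U K i o1)"
proof -
  let ?C = "{z \<in> collision_free n m. filter (\<lambda>t. t < i) z = o1}"
  let ?t = "\<lambda>j r s \<pi>. \<Prod>l<j. term_weight n m x U r s \<pi> l"
  let ?ok = "\<lambda>j s. \<forall>l<j. s l < i \<longrightarrow> s l \<in> set o1"
  let ?k = "n - length o1"
  have "weight (clicks_weight n m x U K) m i o1 = (\<Sum>z\<in>?C. Re (estimate n m x U K z))"
    unfolding weight_def[of "\<lambda>_ _. 0", simplified] clicks_weight_def
    by (rule sum.mono_neutral_cong_right[OF finite_leaves]) (auto simp: leaves_def collision_free_def)
  also have "\<dots> = Re (\<Sum>z\<in>?C. estimate n m x U K z)" by (simp add: Re_sum)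
  also have "(\<Sum>z\<in>?C. estimate n m x U K z) = of_real (fact n * (1 / real m) ^ n) *
      (\<Sum>j\<le>K. \<Sum>r\<in>injections j n. \<Sum>s\<in>injections j m. \<Sum>\<pi>\<in>perms j. \<Sum>z\<in>?C. if s ` {..<j} \<subseteq> set z then ?t j r s \<pi> else 0)"
    unfolding estimate_def sum_distrib_left[symmetric]
    by (subst sum.swap, intro arg_cong2[where f = "(*)"] sum.cong refl, subst sum.swap, intro sum.cong refl,
        subst sum.swap, intro sum.cong refl, subst sum.swap, intro sum.cong refl)
  also have "(\<Sum>j\<le>K. \<Sum>r\<in>injections j n. \<Sum>s\<in>injections j m. \<Sum>\<pi>\<in>perms j. \<Sum>z\<in>?C. if s ` {..<j} \<subseteq> set z then ?t j r s \<pi> else 0) =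
      of_real (real ((m - i) choose ?k)) * node_sum n m x U K i o1"
    unfolding node_sum_def sum_distrib_left
  proof (intro sum.cong refl)
    fix j r s \<pi> assume s: "s \<in> injections j m"
    have "(\<Sum>z\<in>?C. if s ` {..<j} \<subseteq> set z then ?t j r s \<pi> else 0) = (\<Sum>z\<in>{z \<in> ?C. s ` {..<j} \<subseteq> set z}. ?t j r s \<pi>)"
      by (rule sum.inter_filter[symmetric]) simp
    also have "{z \<in> ?C. s ` {..<j} \<subseteq> set z} = {z \<in> collision_free n m. filter (\<lambda>t. t < i) z = o1 \<and> s ` {..<j} \<subseteq> set z}" by auto
    also have "(\<Sum>z\<in>\<dots>. ?t j r s \<pi>) = of_real (real (card {z \<in> collision_free n m. filter (\<lambda>t. t < i) z = o1 \<and> s ` {..<j} \<subseteq> set z})) * ?t j r s \<pi>"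
      by simp
    also have "\<dots> = of_real (real ((m - i) choose ?k)) *
        (if ?ok j s then \<Prod>l<j. of_real (avail m i ?k s l) * term_weight n m x U r s \<pi> l else 0)"
    proof (cases "?ok j s")
      case True
      show ?thesis unfolding card_completions[OF assms(1-4) s] if_P[OF True] by (simp add: prod.distrib)
    next
      case False
      show ?thesis unfolding card_completions[OF assms(1-4) s] if_not_P[OF False] by simp
    qed
    finally show "(\<Sum>z\<in>?C. if s ` {..<j} \<subseteq> set z then ?t j r s \<pi> else 0) = of_real (real ((m - i) choose ?k)) *
        (if ?ok j s then \<Prod>l<j. of_real (avail m i ?k s l) * term_weight n m x U r s \<pi> l else 0)" .
  qed
  finally show ?thesis unfolding node_weight_def
    by simp
qed

text \<open>With \<open>d = m - i\<close>, the children have \<open>(d - 1) choose (k - 1)\<close>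
  and \<open>(d - 1) choose k\<close> completions, which are in the ratio \<open>k\<close> to
  \<open>d - k\<close>; all other prefactors are common and cancel. If both parts are cut off,
  \<open>0 / 0 = 0\<close> means no click.\<close>

definition click_prob :: "nat => nat => real => complex mat => nat => nat => nat list => real" where
  "click_prob n m x U K i o1 =
    (let k = n - length o1; a = real k * max 0 (Re (node_sum n m x U K (Suc i) (o1 @ [i])));
         b = real (m - i - k) * max 0 (Re (node_sum n m x U K (Suc i) o1)) in a / (a + b))"

lemma click_prob_01: "0 \<le> click_prob n m x U K i o1 \<and> click_prob n m x U K i o1 \<le> 1"
proof -
  have "0 \<le> a / (a + b) \<and> a / (a + b) \<le> 1" if "0 \<le> a" "0 \<le> b" for a b :: real
    using that by (cases "a + b = 0") (auto simp: field_simps)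
  then show ?thesis by (simp add: click_prob_def Let_def)
qed

lemma click_prob_weights:
  assumes i: "i < m" and o1: "sorted_wrt (<) o1" "set o1 \<subseteq> {..<i}"
  shows "click_prob n m x U K i o1 *
      (max 0 (node_weight n m x U K (Suc i) (o1 @ [i])) + max 0 (node_weight n m x U K (Suc i) o1)) =
    max 0 (node_weight n m x U K (Suc i) (o1 @ [i]))"
proof -
  let ?W = "node_weight n m x U K (Suc i)"
  \<comment> \<open>Below a node with more than \<open>n\<close> clicks there is no list of length
    \<open>n\<close>.\<close>
  have too_long: "?W o2 = 0" if "n < length o2" for o2
  proof -
    have "length o2 \<le> length z" if "z \<in> leaves m (Suc i) o2" for z
      using that length_filter_le[of "\<lambda>t. t < Suc i" z] by (auto simp: leaves_def)
    then show ?thesis using that unfolding node_weight_def weight_def[of "\<lambda>_ _. 0", simplified]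
      by (intro sum.neutral ballI) (fastforce simp: clicks_weight_def)
  qed
  show ?thesis
  proof (cases "length o1 < n")
    case False
    then have "click_prob n m x U K i o1 = 0" by (simp add: click_prob_def)
    moreover have "?W (o1 @ [i]) = 0" using False by (intro too_long) simp
    ultimately show ?thesis by simp
  next
    case True
    define k where "k = n - length o1"
    define d where "d = m - i"
    define a where "a = real k * max 0 (Re (node_sum n m x U K (Suc i) (o1 @ [i])))"
    define b where "b = real (d - k) * max 0 (Re (node_sum n m x U K (Suc i) o1))"
    define g where "g = fact n * (1 / real m) ^ n * real (d choose k) / real d"
    have k: "0 < k" "0 < d" using True i by (auto simp: k_def d_def)
    have c1: "real ((d - 1) choose (k - 1)) = real k * real (d choose k) / real d"
      using times_binomial_minus1_eq[OF k(1), of d] k by (simp add: field_simps flip: of_nat_mult)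
    have c0: "real ((d - 1) choose k) = real (d - k) * real (d choose k) / real d"
      using binomial_absorb_comp[of d k] k by (simp add: field_simps flip: of_nat_mult)
    have g: "0 \<le> g" by (simp add: g_def)
    have 1: "max 0 (?W (o1 @ [i])) = g * a"
    proof -
      have "m - Suc i = d - 1" "n - length (o1 @ [i]) = k - 1" by (auto simp: d_def k_def)
      then have "?W (o1 @ [i]) = g * (real k * Re (node_sum n m x U K (Suc i) (o1 @ [i])))"
        using True i o1 by (subst node_weight_eq) (auto simp: sorted_wrt_append less_Suc_eq c1[unfolded One_nat_def] g_def)
      then show ?thesis unfolding a_def using g by (auto simp: max_def mult_le_0_iff zero_le_mult_iff)
    qed
    have 0: "max 0 (?W o1) = g * b"
    proof -
      have "m - Suc i = d - 1" by (auto simp: d_def)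
      then have "?W o1 = g * (real (d - k) * Re (node_sum n m x U K (Suc i) o1))"
        using True i o1 by (subst node_weight_eq) (auto simp: less_Suc_eq c0[unfolded One_nat_def] g_def k_def[symmetric])
      then show ?thesis unfolding b_def using g by (auto simp: max_def mult_le_0_iff zero_le_mult_iff)
    qed
    have ab: "0 \<le> a" "0 \<le> b" by (simp_all add: a_def b_def)
    have "click_prob n m x U K i o1 = a / (a + b)"
      by (simp add: click_prob_def a_def b_def k_def d_def Let_def)
    then have "click_prob n m x U K i o1 * (a + b) = a" using ab by (cases "a + b = 0") auto
    then have "g * (click_prob n m x U K i o1 * (a + b)) = g * a" by (rule arg_cong)
    then show ?thesis unfolding 0 1 by (simp add: algebra_simps)
  qed
qed

text \<open>Factorial and binomial coefficient combine into a product of ratios, which the program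
  evaluates as a fold.\<close>

lemma root_weight:
  assumes "n \<le> m" "0 < m"
  shows "(\<Sum>z\<in>collision_free n m. clicks_weight n m x U K z) =
    (\<Prod>a<n. real (m - a) / real m) * Re (node_sum n m x U K 0 [])"
proof -
  have "(\<Sum>z\<in>collision_free n m. clicks_weight n m x U K z) = node_weight n m x U K 0 []"
    unfolding node_weight_def weight_def[of "\<lambda>_ _. 0", simplified]
    by (rule sum.mono_neutral_left[OF finite_leaves]) (auto simp: leaves_def collision_free_def clicks_weight_def)
  also have "\<dots> = fact n * (1 / real m) ^ n * real (m choose n) * Re (node_sum n m x U K 0 [])"
    by (subst node_weight_eq) auto
  also have "fact n * (1 / real m) ^ n * real (m choose n) = (\<Prod>a<n. real (m - a) / real m)"
  proof -
    have "(\<Prod>a<n. real (m - a)) * fact (m - n) = fact m" by (rule prod_falling[OF assms(1)])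
    moreover have "fact n * fact (m - n) * real (m choose n) = fact m"
      using arg_cong[OF binomial_fact_lemma[OF assms(1)], of real] by simp
    ultimately have "(fact n * real (m choose n)) * fact (m - n) = (\<Prod>a<n. real (m - a)) * fact (m - n)"
      by (simp add: mult_ac del: of_nat_diff)
    then have "fact n * real (m choose n) = (\<Prod>a<n. real (m - a))"
      unfolding mult_cancel_right using fact_nonzero[of "m - n", where ?'a = real] by blast
    then show ?thesis by (simp add: prod_dividef power_divide del: of_nat_diff)
  qed
  finally show ?thesis .
qed

section \<open>The sampling program\<close>

text \<open>Deterministic commands with a postcondition. Triples nest: the postcondition of one
  command is the triple of the next.\<close>

definition triple :: "complex mat => com => state => nat => (state => bool) => bool" where
  "triple U c s t Q \<longleftrightarrow> (\<exists>s'. exec U c s t s' \<and> Q s')"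

lemma triple_mono: "triple U c s t Q ==> t \<le> t' ==> (\<And>s. Q s ==> Q' s) ==> triple U c s t' Q'"
  unfolding triple_def using exec_mono by blast

lemma triple_time: "triple U c s t Q ==> t \<le> t' ==> triple U c s t' Q"
  by (rule triple_mono)

lemma triple_exec: "exec U c s t s' ==> Q s' ==> triple U c s t Q"
  unfolding triple_def by blast

lemma triple_Seq: "triple U c s t1 (\<lambda>s1. triple U d s1 t2 Q) ==> triple U (Seq c d) s (t1 + t2 + 1) Q"
  unfolding triple_def using exec_Seq by blast

lemma triple_Branch: "triple U (if holds b s then c else d) s t Q ==> triple U (Branch b c d) s (t + 1) Q"
  unfolding triple_def using exec_Branch by blast

lemmas triple_simple = exec_simple[THEN triple_exec]

lemma triple_While:
  assumes "\<And>s. I s ==> holds b s ==> triple U c s T (\<lambda>s'. I s' \<and> f s' < (f s :: nat))"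
  shows "I s ==> f s \<le> k ==> triple U (While b c) s (k * (T + 1) + 1) (\<lambda>s'. I s' \<and> \<not> holds b s')"
proof (induction k arbitrary: s)
  case 0
  have "\<not> holds b s" using assms[OF 0(1)] 0(2) unfolding triple_def by auto
  then show ?case using exec_While_stop 0 unfolding triple_def by fastforce
next
  case (Suc k)
  show ?case
  proof (cases "holds b s")
    case True
    obtain s1 where s1: "exec U c s T s1" "I s1" "f s1 < f s" using assms[OF Suc.prems(1) True] unfolding triple_def by blast
    obtain s2 where s2: "exec U (While b c) s1 (k * (T + 1) + 1) s2" "I s2 \<and> \<not> holds b s2"
      using Suc.IH[of s1] s1 Suc.prems(2) unfolding triple_def by auto
    have "exec U (While b c) s (T + (k * (T + 1) + 1) + 1) s2" by (rule exec_While_step[OF True s1(1) s2(1)])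
    then have "exec U (While b c) s (Suc k * (T + 1) + 1) s2" by (rule exec_mono) simp
    then show ?thesis using s2(2) by (rule triple_exec)
  next
    case False
    have "exec U (While b c) s (Suc k * (T + 1) + 1) s" by (rule exec_mono[OF exec_While_stop[OF False]]) simp
    then show ?thesis using Suc.prems(1) False by (intro triple_exec) auto
  qed
qed

definition gives :: "nat => complex mat => config => nat => outcome pmf => bool" where
  "gives n U k t q \<longleftrightarrow> (\<exists>D. reach U k t D \<and> q = map_pmf (read_output n) D)"

lemma gives_sampler: "gives n U ([P], initial_state n m x \<epsilon> \<delta>) t q ==> sampler P n m U x \<epsilon> \<delta> t q"
  unfolding gives_def sampler_def reach_def Let_def by (auto simp: map_pmf_comp)

lemma gives_mono: "gives n U k t q ==> t \<le> t' ==> gives n U k t' q"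
  unfolding gives_def using reach_mono by blast

lemma gives_nil: "gives n U ([], s) t (return_pmf (read_output n s))"
  unfolding gives_def using reach_nil[of U s t] by (intro exI[of _ "return_pmf s"]) simp

lemma gives_triple: "triple U c s t1 (\<lambda>s1. gives n U (cs, s1) t2 q) ==> gives n U (c # cs, s) (t1 + t2) q"
  unfolding gives_def triple_def using reach_exec by blast

lemma gives_Seq: "gives n U (c # d # cs, s) t q ==> gives n U (Seq c d # cs, s) (Suc t) q"
  unfolding gives_def using reach_Seq by blast

lemma gives_While:
  "gives n U (if holds b s then c # While b c # cs else cs, s) t q ==> gives n U (While b c # cs, s) (Suc t) q"
  unfolding gives_def using reach_While by blast

lemma gives_Sample:
  assumes "\<And>i. i \<in> set_pmf (draw (creg s) (nreg s a) (nreg s k)) ==> gives n U (cs, set_nreg r i s) t (Q i)"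
  shows "gives n U (Sample r a k # cs, s) (Suc t) (bind_pmf (draw (creg s) (nreg s a) (nreg s k)) Q)"
proof -
  let ?d = "draw (creg s) (nreg s a) (nreg s k)"
  from assms obtain D where D: "\<And>i. i \<in> set_pmf ?d ==> reach U (cs, set_nreg r i s) t (D i) \<and> Q i = map_pmf (read_output n) (D i)"
    unfolding gives_def using bchoice[of "set_pmf ?d" "\<lambda>i D. reach U (cs, set_nreg r i s) t D \<and> Q i = map_pmf (read_output n) D"] by blast
  have "bind_pmf ?d (\<lambda>i. run U t (cs, set_nreg r i s)) = bind_pmf ?d (\<lambda>i. map_pmf (\<lambda>s. ([], s)) (D i))"
    using D by (intro bind_pmf_cong) (auto simp: reach_def)
  then have "reach U (Sample r a k # cs, s) (Suc t) (bind_pmf ?d D)"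
    by (simp add: reach_def bind_map_pmf map_bind_pmf)
  moreover have "bind_pmf ?d Q = map_pmf (read_output n) (bind_pmf ?d D)"
    unfolding map_bind_pmf using D by (intro bind_pmf_cong) auto
  ultimately show ?thesis unfolding gives_def by blast
qed

text \<open>The weight of index 0 comes first, so register \<open>a\<close> holds the complement of
  \<open>p\<close>.\<close>

lemma draw_two:
  assumes "w a = complex_of_real (1 - p)" "w (a + 1) = complex_of_real p" "0 \<le> p" "p \<le> 1"
  shows "draw w a 2 = map_pmf (\<lambda>b. if b then 1 else 0) (bernoulli_pmf p)"
proof -
  have ws: "map (\<lambda>i. (i, Re (w (a + i)))) [0..<2] = [(0, 1 - p), (1, p)]"
  proof -
    have "[0..<2] = [0 :: nat, 1]" by (simp add: numeral_2_eq_2)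
    then show ?thesis using assms by simp
  qed
  have wf: "pmf_of_list_wf [(0 :: nat, 1 - p), (1, p)]" unfolding pmf_of_list_wf_def using assms(3,4) by simp
  show ?thesis unfolding draw_def ws Let_def if_P[OF wf]
  proof (rule pmf_eqI)
    fix i :: nat
    consider "i = 0" | "i = 1" | "1 < i" by linarith
    then show "pmf (pmf_of_list [(0, 1 - p), (1, p)]) i = pmf (map_pmf (\<lambda>b. if b then 1 else 0) (bernoulli_pmf p)) i"
    proof cases
      case 1
      have "(\<lambda>b. if b then 1 else (0 :: nat)) -` {i} = {False}" unfolding 1 by (auto split: if_split_asm)
      then show ?thesis unfolding pmf_pmf_of_list[OF wf] pmf_map using assms(3,4) 1 by (simp add: measure_pmf_single)
    next
      case 2
      have "(\<lambda>b. if b then 1 else (0 :: nat)) -` {i} = {True}" unfolding 2 by (auto split: if_split_asm)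
      then show ?thesis unfolding pmf_pmf_of_list[OF wf] pmf_map using assms(3,4) 2 by (simp add: measure_pmf_single)
    next
      case 3
      then have "(\<lambda>b. if b then 1 else (0 :: nat)) -` {i} = {}" by (auto split: if_split_asm)
      then show ?thesis unfolding pmf_pmf_of_list[OF wf] pmf_map using 3 by simp
    qed
  qed
qed

section \<open>Writing the output registers\<close>

primrec copy_low :: "nat => com" where
  "copy_low 0 = NConst 0 1"
| "copy_low (Suc p) = Seq (NConst (Suc p) p)
     (Seq (NOp NPlus (Suc p) (Suc p) 0) (Seq (NLoad (Suc p) (Suc p)) (copy_low p)))"

text \<open>The output registers overlap the working ones, so this is straight-line code from the
  highest target down. Each target first serves as its own address register, and register 0 keeps
  the base address until it is overwritten last.\<close>

lemma copy_low_correct: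
  "nreg s 0 = B ==> q < B ==> triple U (copy_low q) s (6 * q + 1)
    (\<lambda>s'. nreg s' 0 = 1 \<and> (\<forall>p<q. nreg s' (Suc p) = nreg s (B + p)) \<and> (\<forall>r>q. nreg s' r = nreg s r))"
proof (induction q arbitrary: s)
  case 0
  show ?case unfolding copy_low.simps by (rule triple_time, rule triple_simple) auto
next
  case (Suc q)
  let ?s = "set_nreg (Suc q) (nreg s (B + q)) s"
  have "triple U (copy_low q) ?s (6 * q + 1)
    (\<lambda>s'. nreg s' 0 = 1 \<and> (\<forall>p<q. nreg s' (Suc p) = nreg ?s (B + p)) \<and> (\<forall>r>q. nreg s' r = nreg ?s r))"
    using Suc.prems by (intro Suc.IH) auto
  then have IH: "triple U (copy_low q) ?s (6 * q + 1)
    (\<lambda>s'. nreg s' 0 = 1 \<and> (\<forall>p<Suc q. nreg s' (Suc p) = nreg s (B + p)) \<and> (\<forall>r>Suc q. nreg s' r = nreg s r))"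
  proof (rule triple_mono)
    fix s' assume s': "nreg s' 0 = 1 \<and> (\<forall>p<q. nreg s' (Suc p) = nreg ?s (B + p)) \<and> (\<forall>r>q. nreg s' r = nreg ?s r)"
    have "nreg ?s (B + p) = nreg s (B + p)" for p using Suc.prems by simp
    then show "nreg s' 0 = 1 \<and> (\<forall>p<Suc q. nreg s' (Suc p) = nreg s (B + p)) \<and> (\<forall>r>Suc q. nreg s' r = nreg s r)"
      using s' by (auto simp: less_Suc_eq)
  qed simp
  let ?Y = "set_nreg (Suc q) q s"
  let ?X = "set_nreg (Suc q) (apply_nat_op NPlus (nreg ?Y (Suc q)) (nreg ?Y 0)) ?Y"
  have eq: "set_nreg (Suc q) (nreg ?X (nreg ?X (Suc q))) ?X = ?s"
    using Suc.prems by (simp add: set_nreg_def add.commute)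
  show ?case unfolding copy_low.simps
    apply (rule triple_time)
     apply (rule triple_Seq triple_simple)+
     apply (subst eq, rule IH)
    apply simp
    done
qed

text \<open>The number of clicks is unbounded while the program is fixed, so a loop copies the
  clicks with index at least \<open>L\<close>, whose targets lie above its own registers. The
  remaining ones, at most \<open>L\<close>, are left to \<open>copy_low\<close>.\<close>

definition copy_out :: "nat => com" where
  "copy_out L = Seq (NConst 10 L) (Seq (While (NLess 10 0)
     (Seq (NOp NPlus 11 3 10) (Seq (NLoad 12 11) (Seq (NOp NPlus 11 10 2) (Seq (NStore 11 12) (NOp NPlus 10 10 2))))))
     (Seq (NConst 10 0) (Seq (NOp NPlus 0 10 3) (copy_low L))))"

lemma copy_out_correct:
  assumes s: "nreg s 0 = N" "nreg s 2 = 1" "nreg s 3 = B" and B: "L < B" "N < B" "12 < L"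
  shows "triple U (copy_out L) s (20 * N + 6 * L + 20)
    (\<lambda>s'. nreg s' 0 = 1 \<and> (\<forall>p<N. nreg s' (Suc p) = nreg s (B + p)))" (is "triple _ _ _ _ ?Q")
proof -
  define I where "I s' \<longleftrightarrow> nreg s' 0 = N \<and> nreg s' 2 = 1 \<and> nreg s' 3 = B \<and> L \<le> nreg s' 10 \<and>
    (\<forall>p. nreg s' (B + p) = nreg s (B + p)) \<and> (\<forall>p<min N (nreg s' 10). L \<le> p \<longrightarrow> nreg s' (Suc p) = nreg s (B + p))" for s' :: state
  let ?b = "Seq (NOp NPlus 11 3 10) (Seq (NLoad 12 11) (Seq (NOp NPlus 11 10 2) (Seq (NStore 11 12) (NOp NPlus 10 10 2))))"
  have step: "triple U ?b s' 9 (\<lambda>s''. I s'' \<and> N - nreg s'' 10 < N - nreg s' 10)" if "I s'" "holds (NLess 10 0) s'" for s'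
    apply (rule triple_time)
     apply (rule triple_Seq triple_simple)+
     apply (use that B in \<open>auto simp: I_def less_Suc_eq\<close>)
    done
  have loop: "triple U (While (NLess 10 0) ?b) s' (N * 10 + 1) (\<lambda>s''. I s'' \<and> \<not> holds (NLess 10 0) s'')" if "I s'" for s'
    using triple_While[of I "NLess 10 0" U ?b 9 "\<lambda>s'. N - nreg s' 10" s' N] step that by simp
  have I0: "I (set_nreg 10 L s)" unfolding I_def using s B by auto
  have rest: "triple U (Seq (NConst 10 0) (Seq (NOp NPlus 0 10 3) (copy_low L))) s' (6 * L + 6)
      ?Q"
    if s': "I s' \<and> \<not> holds (NLess 10 0) s'" for s'
  proof -
    let ?s = "set_nreg 0 B (set_nreg 10 0 s')"
    have 1: "triple U (copy_low L) ?s (6 * L + 1) ?Q"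
    proof (rule triple_mono[OF copy_low_correct[of ?s B L]])
      fix s2 assume s2: "nreg s2 0 = 1 \<and> (\<forall>p<L. nreg s2 (Suc p) = nreg ?s (B + p)) \<and> (\<forall>r>L. nreg s2 r = nreg ?s r)"
      have "nreg s2 (Suc p) = nreg s (B + p)" if "p < N" for p
      proof (cases "p < L")
        case True
        then show ?thesis using s2 s' B unfolding I_def by auto
      next
        case False
        then show ?thesis using s2 s' B that unfolding I_def by auto
      qed
      then show "nreg s2 0 = 1 \<and> (\<forall>p<N. nreg s2 (Suc p) = nreg s (B + p))" using s2 by blast
    qed (use B in auto)
    have "nreg s' 3 = B" using s' unfolding I_def by blast
    then show ?thesis
      apply -
      apply (rule triple_time)
       apply (rule triple_Seq triple_simple)+
       apply (use 1 in simp)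
      apply simp
      done
  qed
  show ?thesis unfolding copy_out_def
    apply (rule triple_time)
     apply (rule triple_Seq triple_simple)+
     apply (rule triple_mono[OF loop[OF I0] order_refl rest])
     apply assumption
    apply simp
    done
qed

text \<open>A wrong number of clicks, in either direction, is announced as a collision.\<close>

definition finish :: "nat => com" where
  "finish L = Branch (NLess 6 0) (NConst 0 0) (Branch (NLess 0 6) (NConst 0 0) (copy_out L))"

lemma finish_correct:
  assumes s: "nreg s 0 = N" "nreg s 2 = 1" "nreg s 3 = B" "nreg s 6 = length o1"
    "\<And>p. p < length o1 ==> nreg s (B + p) = o1 ! p" and B: "L < B" "N < B" "12 < L"
  shows "triple U (finish L) s (20 * N + 6 * L + 22) (\<lambda>s'. read_output N s' = to_outcome N o1)" (is "triple _ _ _ _ ?Q")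
proof (cases "length o1 = N")
  case False
  show ?thesis
  proof (cases "length o1 < N")
    case True
    have "triple U (NConst 0 0) s 1 ?Q"
      by (rule triple_simple) (use True in \<open>auto simp: read_output_def to_outcome_def\<close>)
    then show ?thesis unfolding finish_def
      by (intro triple_time[OF triple_Branch]) (use True s in auto)
  next
    case F: False
    have "triple U (NConst 0 0) s 1 ?Q"
      by (rule triple_simple) (use False in \<open>auto simp: read_output_def to_outcome_def\<close>)
    then have "triple U (Branch (NLess 0 6) (NConst 0 0) (copy_out L)) s (1 + 1) ?Q"
      by (intro triple_Branch) (use F False s in auto)
    then show ?thesis unfolding finish_def
      by (intro triple_time[OF triple_Branch]) (use F False s in auto)
  qed
next
  case True
  have "triple U (copy_out L) s (20 * N + 6 * L + 20) ?Q"
  proof (rule triple_mono[OF copy_out_correct[OF s(1-3) B] order_refl])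
    fix s' :: state assume s': "nreg s' 0 = 1 \<and> (\<forall>p<N. nreg s' (Suc p) = nreg s (B + p))"
    have "map (nreg s') [1..<N + 1] = o1"
      using s' True s(5) by (intro nth_equalityI) (auto simp del: upt_Suc)
    then show "?Q s'" using s' True by (simp add: read_output_def to_outcome_def)
  qed
  then have "triple U (Branch (NLess 0 6) (NConst 0 0) (copy_out L)) s (20 * N + 6 * L + 20 + 1) ?Q"
    by (intro triple_Branch) (use True s in auto)
  then show ?thesis unfolding finish_def
    by (intro triple_time[OF triple_Branch]) (use True s in auto)
qed

text \<open>Complex register 8 holds 0. There is no idle command, so the other branch writes a
  scratch register.\<close>

definition clamp :: "nat => com" where
  "clamp c = Branch (CReLess c 8) (COp CMinus c c c) (NConst 10 0)"

definition eval_pos :: "cexp => nat => com" where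
  "eval_pos e c = Seq (ccode (CUn CRe e) 40 c) (clamp c)"

text \<open>If both weights vanish, \<open>0 / 0 = 0\<close> yields the distribution concentrated on
  0, so \<open>draw\<close> always finds valid weights. Complex register 7 holds 1.\<close>

definition normalise :: com where
  "normalise = Seq (COp CPlus 11 10 11) (Seq (COp CDivide 11 10 11) (COp CMinus 10 7 11))"

text \<open>The candidate click \<open>i\<close> is stored and counted for the evaluation of
  \<open>e1\<close>, then uncounted for that of \<open>e0\<close>. The stored entry stays behind: a
  later draw of 1 accepts it by incrementing the count, a draw of 0 leaves it to be
  overwritten.\<close>

definition decide :: "cexp => cexp => com" where
  "decide e1 e0 = Seq (NOp NPlus 10 3 6) (Seq (NStore 10 4) (Seq (NOp NPlus 4 4 2) (Seq (NOp NPlus 6 6 2)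
     (Seq (eval_pos e1 10) (Seq (NOp NMonus 6 6 2) (Seq (eval_pos e0 11) normalise))))))"

text \<open>Natural register 5 counts the powers of \<open>(1 + x) / 2\<close> until
  \<open>D\<close> times the power is at most \<open>\<epsilon> * \<delta>\<close>. The two final
  truncated subtractions form \<open>K - (K - N)\<close>, the minimum with \<open>N\<close>.\<close>

definition setup_code :: "nat => nat => com" where
  "setup_code D L = Seq (NConst 2 1) (Seq (NConst 3 L) (Seq (NOp NPlus 3 3 0) (Seq (NConst 8 10) (Seq (NConst 9 2)
     (Seq (COfNat 7 2) (Seq (COp CTimes 3 1 2) (Seq (COp CPlus 6 7 0) (Seq (COp CPlus 5 7 7) (Seq (COp CDivide 5 6 5)
     (Seq (NConst 10 D) (Seq (COfNat 4 10)
     (Seq (While (CReLess 3 4) (Seq (NOp NPlus 5 5 2) (COp CTimes 4 4 5)))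
     (Seq (NOp NMonus 10 5 0) (NOp NMonus 5 5 10))))))))))))))"

definition decide_root :: "cexp => com" where
  "decide_root e = Seq (eval_pos e 10) (Seq (COp CMinus 11 7 10) (Seq (clamp 11) normalise))"

text \<open>Register 4 starts at \<open>(1 - r) * M\<close> for the drawn bit \<open>r\<close>:
  after the draw of a collision the loop is skipped, and \<open>finish\<close> sees no
  clicks.\<close>

definition sampling_program :: "nat => nat => cexp => cexp => cexp => com" where
  "sampling_program D L er e1 e0 = Seq (Seq (setup_code D L) (decide_root er))
     (Seq (Sample 7 8 9) (Seq (Seq (NOp NMonus 4 2 7) (NOp NTimes 4 4 1))
       (Seq (While (NLess 4 1) (Seq (decide e1 e0) (Seq (Sample 7 8 9) (NOp NPlus 6 6 7)))) (finish L))))"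

text \<open>Before step \<open>i\<close> the registers 4, 5 and 6 hold \<open>i\<close>, the truncation order and the number of
  earlier clicks, which are stored from \<open>B\<close> on.\<close>

definition working :: "nat => nat => nat => nat => real => nat => nat list => state => bool" where
  "working N M B K x i o1 s \<longleftrightarrow> nreg s 0 = N \<and> nreg s 1 = M \<and> nreg s 2 = 1 \<and> nreg s 3 = B \<and> nreg s 4 = i \<and>
     nreg s 5 = K \<and> nreg s 6 = length o1 \<and> nreg s 8 = 10 \<and> nreg s 9 = 2 \<and>
     (\<forall>p<length o1. nreg s (B + p) = o1 ! p) \<and>
     creg s 0 = complex_of_real x \<and> creg s 7 = 1 \<and> creg s 8 = 0"

text \<open>Demanded in every state satisfying \<open>working\<close>, because scratch registers and
  the rest of the array are arbitrary when the expression is reached.\<close>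

definition evaluates :: "complex mat => nat => nat => nat => nat => nat => real => nat => nat list => cexp => real => bool" where
  "evaluates U Z N M B K x i o1 e v \<longleftrightarrow> (\<forall>s. working N M B K x i o1 s \<longrightarrow>
     cok Z (\<lambda>t. nreg s (B + t)) (nreg s) e \<and> Re (ceval U (\<lambda>t. nreg s (B + t)) (creg s) (nreg s) e) = v)"

text \<open>The register plan: bound variables in 20 to 39, natural scratch from 40 to
  \<open>L - 1\<close>, complex scratch from 10 on. The state described by \<open>working\<close>
  lives below these and, for the clicks, from \<open>B\<close> on.\<close>

definition admissible :: "nat => nat => nat => cexp => bool" where
  "admissible Z L T e \<longleftrightarrow> cwf e \<and> cfv e \<subseteq> {..<40} \<and> cbv e \<subseteq> {20..<40} \<and> 40 + cwidth e \<le> L \<and> ccv e \<subseteq> {..<10} \<and> ctime Z e \<le> T"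

lemma clamp_correct:
  assumes "creg s 8 = 0" "creg s c = complex_of_real v" "c \<noteq> 8"
  shows "triple U (clamp c) s 2 (\<lambda>s'. creg s' c = complex_of_real (max 0 v) \<and> (\<forall>r. r \<noteq> c \<longrightarrow> creg s' r = creg s r) \<and>
     (\<forall>r. r \<noteq> 10 \<longrightarrow> nreg s' r = nreg s r))" (is "triple _ _ _ _ ?Q")
proof (cases "v < 0")
  case True
  have "triple U (COp CMinus c c c) s 1 ?Q"
    by (rule triple_simple) (use True in auto)
  then show ?thesis unfolding clamp_def by (intro triple_time[OF triple_Branch]) (use True assms in auto)
next
  case False
  have "triple U (NConst 10 0) s 1 ?Q"
    by (rule triple_simple) (use False assms in auto)
  then show ?thesis unfolding clamp_def by (intro triple_time[OF triple_Branch]) (use False assms in auto)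
qed

lemma working_cong:
  assumes "working N M B K x i o1 s" "\<And>r. r \<le> 6 \<or> r = 8 \<or> r = 9 \<or> B \<le> r ==> nreg s' r = nreg s r"
    "\<And>r. r < 10 ==> creg s' r = creg s r"
  shows "working N M B K x i o1 s'"
  using assms unfolding working_def by simp

lemma eval_pos_correct:
  assumes e: "admissible Z L T e" "evaluates U Z N M B K x i o1 e v" and s: "working N M B K x i o1 s"
    and c: "10 \<le> c" and B: "L \<le> B"
  shows "triple U (eval_pos e c) s (T + 5) (\<lambda>s'. creg s' c = complex_of_real (max 0 v) \<and> working N M B K x i o1 s' \<and>
     (\<forall>r<c. creg s' r = creg s r) \<and> (\<forall>r\<ge>B. nreg s' r = nreg s r))"
proof -
  let ?Q = "\<lambda>s'. creg s' c = complex_of_real (max 0 v) \<and> working N M B K x i o1 s' \<and> (\<forall>r<c. creg s' r = creg s r) \<and> (\<forall>r\<ge>B. nreg s' r = nreg s r)"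
  note e1 = e(1)[unfolded admissible_def]
  interpret array_machine U "\<lambda>t. nreg s (B + t)" B L Z using B e1 by unfold_locales auto
  have ok: "cok Z (\<lambda>t. nreg s (B + t)) (nreg s) e" "Re (ceval U (\<lambda>t. nreg s (B + t)) (creg s) (nreg s) e) = v"
    using e(2) s unfolding evaluates_def by auto
  have ready: "ready s" using s by (simp add: ready_def working_def)
  have "\<exists>s'. exec U (ccode (CUn CRe e) 40 c) s (ctime Z (CUn CRe e)) s' \<and>
      creg s' c = ceval U (\<lambda>t. nreg s (B + t)) (creg s) (nreg s) (CUn CRe e) \<and> frame (cbv (CUn CRe e)) 40 s s' \<and> (\<forall>r<c. creg s' r = creg s r)"
    by (rule ccode_correct) (use e1 ready ok c in \<open>auto simp: subset_eq\<close>)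
  then obtain s1 where s1: "exec U (ccode (CUn CRe e) 40 c) s (ctime Z (CUn CRe e)) s1"
      "creg s1 c = complex_of_real v" "frame (cbv e) 40 s s1" "\<And>r. r < c ==> creg s1 r = creg s r"
    using ok by auto
  have same: "nreg s1 r = nreg s r" if "r < 20 \<or> B \<le> r" for r
  proof -
    have "r \<notin> cbv e" "r < 40 \<or> L \<le> r" using e1 B that by auto
    then show ?thesis using s1(3) unfolding frame_def by blast
  qed
  have "triple U (clamp c) s1 2 (\<lambda>s'. creg s' c = complex_of_real (max 0 v) \<and> (\<forall>r. r \<noteq> c \<longrightarrow> creg s' r = creg s1 r) \<and>
     (\<forall>r. r \<noteq> 10 \<longrightarrow> nreg s' r = nreg s1 r))"
    using s1(2,4) c s by (intro clamp_correct) (auto simp: working_def)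
  then have "triple U (clamp c) s1 2 ?Q"
  proof (rule triple_mono)
    fix s' :: state assume s': "creg s' c = complex_of_real (max 0 v) \<and> (\<forall>r. r \<noteq> c \<longrightarrow> creg s' r = creg s1 r) \<and>
     (\<forall>r. r \<noteq> 10 \<longrightarrow> nreg s' r = nreg s1 r)"
    have "B > 10" using B e1 by auto
    then have n: "nreg s' r = nreg s r" if "r \<noteq> 10" "r < 20 \<or> B \<le> r" for r using s' same[of r] that by simp
    have cc: "creg s' r = creg s r" if "r < c" for r using s' s1(4)[of r] that by simp
    have "working N M B K x i o1 s'"
      by (rule working_cong[OF s]) (use n cc c \<open>B > 10\<close> in auto)
    then show "?Q s'" using s' n cc \<open>B > 10\<close> by auto
  qed simp
  then have "triple U (eval_pos e c) s (ctime Z (CUn CRe e) + 2 + 1) ?Q"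
    unfolding eval_pos_def by (intro triple_Seq triple_exec[OF s1(1)])
  then show ?thesis by (rule triple_time) (use e1 in simp)
qed

lemma normalise_correct:
  assumes s: "working N M B K x i o1 s" and c: "creg s 10 = complex_of_real a" "creg s 11 = complex_of_real b"
  shows "triple U normalise s 5 (\<lambda>s'. creg s' 10 = complex_of_real (1 - a / (a + b)) \<and>
     creg s' 11 = complex_of_real (a / (a + b)) \<and> working N M B K x i o1 s' \<and> (\<forall>r\<ge>B. nreg s' r = nreg s r))"
  unfolding normalise_def
  apply (rule triple_time)
   apply (rule triple_Seq triple_simple)+
   apply (use s c in \<open>simp add: working_def\<close>)
  apply simp
  done

lemma decide_correct:
  assumes e1: "admissible Z L T e1" "evaluates U Z N M B K x (Suc i) (o1 @ [i]) e1 a"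
    and e0: "admissible Z L T e0" "evaluates U Z N M B K x (Suc i) o1 e0 b"
    and s: "working N M B K x i o1 s" and B: "L \<le> B"
  defines "p \<equiv> max 0 a / (max 0 a + max 0 b)"
  shows "triple U (decide e1 e0) s (2 * T + 40) (\<lambda>s'. creg s' 10 = complex_of_real (1 - p) \<and>
     creg s' 11 = complex_of_real p \<and> working N M B K x (Suc i) o1 s' \<and> nreg s' (B + length o1) = i)"
proof -
  have B40: "40 < B" using e1(1) B nwidth_pos unfolding admissible_def
  proof -
    have "0 < cwidth e1" using nwidth_pos by (induction e1) (auto simp: less_max_iff_disj)
    then show ?thesis using e1(1) B unfolding admissible_def by simp
  qed
  let ?s1 = "set_nreg 10 (B + length o1) s"
  let ?s2 = "set_nreg (B + length o1) i ?s1"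
  let ?s3 = "set_nreg 4 (Suc i) ?s2"
  let ?s4 = "set_nreg 6 (Suc (length o1)) ?s3"
  have w4: "working N M B K x (Suc i) (o1 @ [i]) ?s4"
    using s B40 unfolding working_def by (auto simp: nth_append less_Suc_eq)
  let ?Q = "\<lambda>s'. creg s' 10 = complex_of_real (1 - p) \<and>
     creg s' 11 = complex_of_real p \<and> working N M B K x (Suc i) o1 s' \<and> nreg s' (B + length o1) = i"
  have tail: "triple U (Seq (NOp NMonus 6 6 2) (Seq (eval_pos e0 11) normalise)) s5 (T + 13) ?Q"
    if s5: "creg s5 10 = complex_of_real (max 0 a) \<and> working N M B K x (Suc i) (o1 @ [i]) s5 \<and>
     (\<forall>r<10. creg s5 r = creg ?s4 r) \<and> (\<forall>r\<ge>B. nreg s5 r = nreg ?s4 r)" for s5 :: state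
  proof -
    let ?s6 = "set_nreg 6 (nreg s5 6 - nreg s5 2) s5"
    have at: "nreg ?s6 (B + length o1) = i" using s5 B40 by simp
    have w6: "working N M B K x (Suc i) o1 ?s6"
    proof -
      have w5: "working N M B K x (Suc i) (o1 @ [i]) s5" using s5 by blast
      have "nreg s5 (B + p) = o1 ! p" if "p < length o1" for p
      proof -
        have "nreg s5 (B + p) = (o1 @ [i]) ! p" using w5 that unfolding working_def length_append by simp
        then show ?thesis using that by (simp add: nth_append)
      qed
      then show ?thesis using w5 B40 unfolding working_def by simp
    qed
    have "triple U (eval_pos e0 11) ?s6 (T + 5) (\<lambda>s7. triple U normalise s7 5 ?Q)"
    proof (rule triple_mono[OF eval_pos_correct[OF e0 w6 _ B] order_refl])
      fix s7 :: state assume s7: "creg s7 11 = complex_of_real (max 0 b) \<and> working N M B K x (Suc i) o1 s7 \<and>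
        (\<forall>r<11. creg s7 r = creg ?s6 r) \<and> (\<forall>r\<ge>B. nreg s7 r = nreg ?s6 r)"
      then have "creg s7 10 = complex_of_real (max 0 a)" using s5 by simp
      then have "triple U normalise s7 5 (\<lambda>s'. creg s' 10 = complex_of_real (1 - p) \<and>
         creg s' 11 = complex_of_real p \<and> working N M B K x (Suc i) o1 s' \<and> (\<forall>r\<ge>B. nreg s' r = nreg s7 r))"
        unfolding p_def using s7 by (intro normalise_correct) auto
      then show "triple U normalise s7 5 ?Q" by (rule triple_mono) (use s7 at in auto)
    qed simp
    note 1 = triple_Seq[OF this]
    have "triple U (NOp NMonus 6 6 2) s5 1 (\<lambda>s6. triple U (Seq (eval_pos e0 11) normalise) s6 (T + 5 + 5 + 1) ?Q)"
      by (rule triple_simple) (use 1 in simp)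
    from triple_Seq[OF this] show ?thesis by (rule triple_time) simp
  qed
  have "triple U (eval_pos e1 10) ?s4 (T + 5) (\<lambda>s5. triple U (Seq (NOp NMonus 6 6 2) (Seq (eval_pos e0 11) normalise)) s5 (T + 13) ?Q)"
    by (rule triple_mono[OF eval_pos_correct[OF e1 w4 _ B] order_refl tail]) auto
  note 2 = triple_Seq[OF this]
  have r: "nreg s 3 = B" "nreg s 6 = length o1" "nreg s 4 = i" "nreg s 2 = 1" using s by (auto simp: working_def)
  have eq: "set_nreg 6 (apply_nat_op NPlus (nreg ?s3 6) (nreg ?s3 2)) ?s3 = ?s4"
    "set_nreg 4 (apply_nat_op NPlus (nreg ?s2 4) (nreg ?s2 2)) ?s2 = ?s3"
    "set_nreg (nreg ?s1 10) (nreg ?s1 4) ?s1 = ?s2"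
    "set_nreg 10 (apply_nat_op NPlus (nreg s 3) (nreg s 6)) s = ?s1"
    using r B40 by simp_all
  show ?thesis unfolding decide_def
    apply (rule triple_time)
     apply (rule triple_Seq, rule triple_simple, subst eq)+
     apply (rule 2)
    apply simp
    done
qed

lemma max_ratio_01: "0 \<le> max 0 a / (max 0 a + max 0 b)" "max 0 a / (max 0 a + max 0 b) \<le> (1 :: real)"
  by (cases "max 0 a + max 0 b = 0"; auto simp: divide_le_eq_1)+

text \<open>Induction on the number of modes left, in step with the recursion of
  \<open>walk\<close>; the fixed cost at the end is that of \<open>finish\<close>.\<close>

lemma loop_gives:
  assumes e1: "admissible Z L T e1" "\<And>i o1. i < M ==> length o1 \<le> i ==> evaluates U Z N M B K x (Suc i) (o1 @ [i]) e1 (w1 i o1)"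
    and e0: "admissible Z L T e0" "\<And>i o1. i < M ==> length o1 \<le> i ==> evaluates U Z N M B K x (Suc i) o1 e0 (w0 i o1)"
    and p: "\<And>i o1. p i o1 = max 0 (w1 i o1) / (max 0 (w1 i o1) + max 0 (w0 i o1))"
    and B: "L < B" "N < B" "12 < L"
  shows "working N M B K x i o1 s ==> length o1 \<le> i ==> i + d = M ==>
    gives N U ([While (NLess 4 1) (Seq (decide e1 e0) (Seq (Sample 7 8 9) (NOp NPlus 6 6 7))), finish L], s)
      (d * (2 * T + 50) + (20 * N + 6 * L + 30)) (map_pmf (to_outcome N) (walk p d i o1))"
proof (induction d arbitrary: i o1 s)
  case 0
  have "triple U (finish L) s (20 * N + 6 * L + 22) (\<lambda>s'. read_output N s' = to_outcome N o1)"
    by (rule finish_correct[OF _ _ _ _ _ B]) (use 0(1) in \<open>auto simp: working_def\<close>)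
  then have "triple U (finish L) s (20 * N + 6 * L + 22) (\<lambda>s'. gives N U ([], s') 0 (return_pmf (to_outcome N o1)))"
  proof (rule triple_mono)
    fix s' assume "read_output N s' = to_outcome N o1"
    then show "gives N U ([], s') 0 (return_pmf (to_outcome N o1))" using gives_nil[of N U s' 0] by simp
  qed simp
  from gives_triple[OF this] have g: "gives N U ([finish L], s) (20 * N + 6 * L + 22) (return_pmf (to_outcome N o1))" by simp
  have "\<not> holds (NLess 4 1) s" using 0 by (simp add: working_def)
  then show ?case using gives_mono[OF gives_While[of N U "NLess 4 1" s _ "[finish L]"]] g by simp
next
  case (Suc d)
  let ?p = "p i o1"
  let ?W = "While (NLess 4 1) (Seq (decide e1 e0) (Seq (Sample 7 8 9) (NOp NPlus 6 6 7)))"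
  let ?q = "map_pmf (to_outcome N) (walk p (Suc d) i o1)"
  let ?t = "d * (2 * T + 50) + (20 * N + 6 * L + 30)"
  have i: "i < M" using Suc.prems(3) by simp
  have p01: "0 \<le> ?p" "?p \<le> 1" unfolding p by (rule max_ratio_01)+
  have rest: "gives N U (Seq (Sample 7 8 9) (NOp NPlus 6 6 7) # [?W, finish L], s1) (?t + 3) ?q"
    if s1: "creg s1 10 = complex_of_real (1 - ?p) \<and>
     creg s1 11 = complex_of_real ?p \<and> working N M B K x (Suc i) o1 s1 \<and> nreg s1 (B + length o1) = i" for s1 :: state
  proof -
    define Q where "Q r = map_pmf (to_outcome N) (walk p d (Suc i) (if r = 1 then o1 @ [i] else o1))" for r :: nat
    have n: "nreg s1 8 = 10" "nreg s1 9 = 2" using s1 by (auto simp: working_def)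
    have dr: "draw (creg s1) (nreg s1 8) (nreg s1 9) = map_pmf (\<lambda>b. if b then 1 else 0) (bernoulli_pmf ?p)"
      unfolding n by (rule draw_two) (use s1 p01 in auto)
    have g: "gives N U (Sample 7 8 9 # NOp NPlus 6 6 7 # [?W, finish L], s1) (Suc (1 + ?t))
        (bind_pmf (draw (creg s1) (nreg s1 8) (nreg s1 9)) Q)"
    proof (rule gives_Sample)
      fix r assume "r \<in> set_pmf (draw (creg s1) (nreg s1 8) (nreg s1 9))"
      then have r: "r = 0 \<or> r = 1" unfolding dr by auto
      have "triple U (NOp NPlus 6 6 7) (set_nreg 7 r s1) 1 (\<lambda>s2. gives N U ([?W, finish L], s2) ?t (Q r))"
      proof (rule triple_simple)
        let ?s2 = "set_nreg 6 (apply_nat_op NPlus (nreg (set_nreg 7 r s1) 6) (nreg (set_nreg 7 r s1) 7)) (set_nreg 7 r s1)"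
        have "working N M B K x (Suc i) (if r = 1 then o1 @ [i] else o1) ?s2"
        proof (cases "r = 1")
          case True
          have "nreg s1 (B + p) = (o1 @ [i]) ! p" if "p < Suc (length o1)" for p
          proof (cases "p = length o1")
            case False
            then have "nreg s1 (B + p) = o1 ! p" using that s1 unfolding working_def by simp
            then show ?thesis using that False by (simp add: nth_append)
          qed (use s1 in simp)
          then show ?thesis using s1 B True unfolding working_def by simp
        next
          case False
          then have "r = 0" using r by simp
          then show ?thesis using s1 B unfolding working_def by simp
        qed
        then show "gives N U ([?W, finish L], ?s2) ?t (Q r)"
          unfolding Q_def using Suc.prems r by (intro Suc.IH) auto
      qed
      then show "gives N U (NOp NPlus 6 6 7 # [?W, finish L], set_nreg 7 r s1) (1 + ?t) (Q r)" by (rule gives_triple)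
    qed
    have "bind_pmf (draw (creg s1) (nreg s1 8) (nreg s1 9)) Q = ?q"
      unfolding dr bind_map_pmf walk.simps map_bind_pmf Q_def by (intro bind_pmf_cong refl) simp
    then show ?thesis using gives_mono[OF gives_Seq[OF g]] by simp
  qed
  have "triple U (decide e1 e0) s (2 * T + 40) (\<lambda>s1. gives N U (Seq (Sample 7 8 9) (NOp NPlus 6 6 7) # [?W, finish L], s1) (?t + 3) ?q)"
    by (rule triple_mono[OF decide_correct[OF e1(1) e1(2)[OF i Suc.prems(2)] e0(1) e0(2)[OF i Suc.prems(2)] Suc.prems(1)] order_refl])
      (use B rest p in auto)
  from gives_Seq[OF gives_triple[OF this]]
  have "gives N U (Seq (decide e1 e0) (Seq (Sample 7 8 9) (NOp NPlus 6 6 7)) # [?W, finish L], s) (Suc (2 * T + 40 + (?t + 3))) ?q" .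
  moreover have "holds (NLess 4 1) s" using Suc.prems by (simp add: working_def)
  ultimately have "gives N U ([?W, finish L], s) (Suc (Suc (2 * T + 40 + (?t + 3)))) ?q"
    by (intro gives_While) simp
  then show ?case by (rule gives_mono) (simp add: algebra_simps)
qed


text \<open>Invariant: complex register 4 holds \<open>D * \<rho> ^ k\<close> for the counter
  \<open>k\<close>, which cannot pass the least admissible order.\<close>

lemma order_loop:
  fixes D :: nat
  assumes \<rho>: "0 \<le> \<rho>" and ex: "\<exists>k. real D * \<rho> ^ k \<le> \<eta>"
    and s: "nreg s 5 = 0" "nreg s 2 = 1" "creg s 3 = complex_of_real \<eta>" "creg s 4 = complex_of_real (real D)" "creg s 5 = complex_of_real \<rho>"
  defines "K \<equiv> LEAST k. real D * \<rho> ^ k \<le> \<eta>"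
  shows "triple U (While (CReLess 3 4) (Seq (NOp NPlus 5 5 2) (COp CTimes 4 4 5))) s (K * 4 + 1)
    (\<lambda>s'. nreg s' 5 = K \<and> (\<forall>r. r \<noteq> 5 \<longrightarrow> nreg s' r = nreg s r) \<and> (\<forall>r. r \<noteq> 4 \<longrightarrow> creg s' r = creg s r))" (is "triple _ _ _ _ ?Q")
proof -
  define I where "I s' \<longleftrightarrow> nreg s' 5 \<le> K \<and> creg s' 4 = complex_of_real (real D * \<rho> ^ nreg s' 5) \<and>
    (\<forall>r. r \<noteq> 5 \<longrightarrow> nreg s' r = nreg s r) \<and> (\<forall>r. r \<noteq> 4 \<longrightarrow> creg s' r = creg s r)" for s' :: state
  have K: "real D * \<rho> ^ K \<le> \<eta>" unfolding K_def using ex by (rule LeastI_ex)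
  let ?b = "Seq (NOp NPlus 5 5 2) (COp CTimes 4 4 5)"
  have step: "triple U ?b s' 3 (\<lambda>s''. I s'' \<and> K - nreg s'' 5 < K - nreg s' 5)" if "I s'" "holds (CReLess 3 4) s'" for s'
  proof -
    have "nreg s' 5 \<noteq> K" using that K s unfolding I_def by auto
    then have lt: "nreg s' 5 < K" using that unfolding I_def by simp
    let ?s1 = "set_nreg 5 (Suc (nreg s' 5)) s'"
    let ?s2 = "set_creg 4 (complex_of_real (real D * \<rho> ^ Suc (nreg s' 5))) ?s1"
    have r: "nreg s' 2 = 1" "creg s' 5 = complex_of_real \<rho>" "creg s' 4 = complex_of_real (real D * \<rho> ^ nreg s' 5)"
      using that s unfolding I_def by auto
    have eq: "set_nreg 5 (apply_nat_op NPlus (nreg s' 5) (nreg s' 2)) s' = ?s1"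
      "set_creg 4 (apply_cpx_op CTimes (creg ?s1 4) (creg ?s1 5)) ?s1 = ?s2"
      using r by (simp_all add: mult_ac)
    have "I ?s2 \<and> K - nreg ?s2 5 < K - nreg s' 5" using that lt unfolding I_def by simp
    then have "triple U (COp CTimes 4 4 5) ?s1 1 (\<lambda>s''. I s'' \<and> K - nreg s'' 5 < K - nreg s' 5)"
      by - (rule triple_simple, simp only: eq)
    then have "triple U (NOp NPlus 5 5 2) s' 1 (\<lambda>s1. triple U (COp CTimes 4 4 5) s1 1 (\<lambda>s''. I s'' \<and> K - nreg s'' 5 < K - nreg s' 5))"
      by - (rule triple_simple, simp only: eq)
    from triple_Seq[OF this] show ?thesis by (rule triple_time) simp
  qed
  have I0: "I s" unfolding I_def using s by simp
  have "triple U (While (CReLess 3 4) ?b) s (K * (3 + 1) + 1) (\<lambda>s'. I s' \<and> \<not> holds (CReLess 3 4) s')"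
    by (rule triple_While[of I "CReLess 3 4" U ?b 3 "\<lambda>s'. K - nreg s' 5" s K, OF step I0]) auto
  then show ?thesis
  proof (rule triple_mono)
    fix s' assume s': "I s' \<and> \<not> holds (CReLess 3 4) s'"
    then have "real D * \<rho> ^ nreg s' 5 \<le> \<eta>" using s unfolding I_def by auto
    then have "K \<le> nreg s' 5" unfolding K_def by (rule Least_le)
    then show "?Q s'"
      using s' unfolding I_def by auto
  qed simp
qed

lemma setup_correct:
  fixes D L N M :: nat
  assumes x: "0 \<le> x" "x < 1" and \<eta>: "0 < \<epsilon> * \<delta>"
  defines "K \<equiv> LEAST k. real D * ((1 + x) / 2) ^ k \<le> \<epsilon> * \<delta>"
  shows "triple U (setup_code D L) (initial_state N M x \<epsilon> \<delta>) (K * 4 + 60) (working N M (L + N) (min K N) x 0 [])"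
proof -
  define \<rho> where "\<rho> = (1 + x) / 2"
  have \<rho>: "0 \<le> \<rho>" "\<rho> < 1" using x by (auto simp: \<rho>_def)
  have ex: "\<exists>k. real D * \<rho> ^ k \<le> \<epsilon> * \<delta>"
  proof (cases "D = 0")
    case False
    have "\<exists>k. \<rho> ^ k < \<epsilon> * \<delta> / real D"
      using \<rho> \<eta> False by (intro real_arch_pow_inv) auto
    then show ?thesis using False by (auto simp: field_simps intro: less_imp_le)
  qed (use \<eta> in auto)
  let ?s0 = "initial_state N M x \<epsilon> \<delta>"
  let ?s1 = "set_nreg 2 1 ?s0"
  let ?s2 = "set_nreg 3 L ?s1"
  let ?s3 = "set_nreg 3 (apply_nat_op NPlus (nreg ?s2 3) (nreg ?s2 0)) ?s2"
  let ?s4 = "set_nreg 8 10 ?s3"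
  let ?s5 = "set_nreg 9 2 ?s4"
  let ?s6 = "set_creg 7 (of_nat (nreg ?s5 2)) ?s5"
  let ?s7 = "set_creg 3 (apply_cpx_op CTimes (creg ?s6 1) (creg ?s6 2)) ?s6"
  let ?s8 = "set_creg 6 (apply_cpx_op CPlus (creg ?s7 7) (creg ?s7 0)) ?s7"
  let ?s9 = "set_creg 5 (apply_cpx_op CPlus (creg ?s8 7) (creg ?s8 7)) ?s8"
  let ?s10 = "set_creg 5 (apply_cpx_op CDivide (creg ?s9 6) (creg ?s9 5)) ?s9"
  let ?s11 = "set_nreg 10 D ?s10"
  define s12 where "s12 = set_creg 4 (of_nat (nreg ?s11 10)) ?s11"
  have n: "nreg s12 0 = N" "nreg s12 1 = M" "nreg s12 2 = 1" "nreg s12 3 = L + N" "nreg s12 4 = 0" "nreg s12 5 = 0"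
    "nreg s12 6 = 0" "nreg s12 8 = 10" "nreg s12 9 = 2"
    by (simp_all add: s12_def initial_state_def)
  have c: "creg s12 0 = complex_of_real x" "creg s12 7 = 1" "creg s12 8 = 0" "creg s12 3 = complex_of_real (\<epsilon> * \<delta>)"
    "creg s12 4 = complex_of_real (real D)" "creg s12 5 = complex_of_real \<rho>"
    by (simp_all add: s12_def initial_state_def \<rho>_def)
  have tail: "triple U (Seq (NOp NMonus 10 5 0) (NOp NMonus 5 5 10)) s' 3 (working N M (L + N) (min K N) x 0 [])"
    if s': "nreg s' 5 = K \<and> (\<forall>r. r \<noteq> 5 \<longrightarrow> nreg s' r = nreg s12 r) \<and> (\<forall>r. r \<noteq> 4 \<longrightarrow> creg s' r = creg s12 r)" for s' :: state
  proof -
    let ?t1 = "set_nreg 10 (apply_nat_op NMonus (nreg s' 5) (nreg s' 0)) s'"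
    let ?t2 = "set_nreg 5 (apply_nat_op NMonus (nreg ?t1 5) (nreg ?t1 10)) ?t1"
    have "nreg s' 0 = N" "nreg s' 5 = K" using s' n by auto
    then have "nreg ?t2 5 = min K N" by (simp add: min_def)
    moreover have "nreg ?t2 r = nreg s12 r" if "r \<noteq> 5" "r \<noteq> 10" for r using s' that by simp
    moreover have "creg ?t2 r = creg s12 r" if "r \<noteq> 4" for r using s' that by simp
    ultimately have "working N M (L + N) (min K N) x 0 [] ?t2" using n c unfolding working_def by simp
    then have "triple U (NOp NMonus 5 5 10) ?t1 1 (working N M (L + N) (min K N) x 0 [])" by (rule triple_simple)
    then have "triple U (NOp NMonus 10 5 0) s' 1 (\<lambda>t1. triple U (NOp NMonus 5 5 10) t1 1 (working N M (L + N) (min K N) x 0 []))"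
      by (rule triple_simple)
    from triple_Seq[OF this] show ?thesis by (rule triple_time) simp
  qed
  have loop: "triple U (While (CReLess 3 4) (Seq (NOp NPlus 5 5 2) (COp CTimes 4 4 5))) s12 (K * 4 + 1)
    (\<lambda>s'. triple U (Seq (NOp NMonus 10 5 0) (NOp NMonus 5 5 10)) s' 3 (working N M (L + N) (min K N) x 0 []))"
    by (rule triple_mono[OF order_loop[OF \<rho>(1) ex n(6,3) c(4-6), of U, folded K_def[folded \<rho>_def]] order_refl tail]) assumption
  note 1 = triple_Seq[OF loop, unfolded s12_def]
  show ?thesis unfolding setup_code_def
    apply (rule triple_time)
     apply (rule triple_Seq, rule triple_simple)+
     apply (rule 1)
    apply simp
    done
qed

lemma decide_root_correct:
  assumes e: "admissible Z L T e" "evaluates U Z N M B K x 0 [] e v"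
    and s: "working N M B K x 0 [] s" and B: "L \<le> B"
  defines "p \<equiv> max 0 v / (max 0 v + max 0 (1 - v))"
  shows "triple U (decide_root e) s (T + 20) (\<lambda>s'. creg s' 10 = complex_of_real (1 - p) \<and>
     creg s' 11 = complex_of_real p \<and> working N M B K x 0 [] s')"
proof -
  \<comment> \<open>The program subtracts the clamped value from 1. For negative \<open>v\<close>
    the numerator vanishes, so the ratio is the same.\<close>
  have p: "p = max 0 v / (max 0 v + max 0 (1 - max 0 v))" unfolding p_def by (auto simp: max_def)
  let ?Q = "\<lambda>s'. creg s' 10 = complex_of_real (1 - p) \<and> creg s' 11 = complex_of_real p \<and> working N M B K x 0 [] s'"
  have tail: "triple U (Seq (COp CMinus 11 7 10) (Seq (clamp 11) normalise)) s1 12 ?Q"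
    if s1: "creg s1 10 = complex_of_real (max 0 v) \<and> working N M B K x 0 [] s1 \<and>
      (\<forall>r<10. creg s1 r = creg s r) \<and> (\<forall>r\<ge>B. nreg s1 r = nreg s r)" for s1 :: state
  proof -
    have 7: "creg s1 7 = 1" using s1 by (simp add: working_def)
    let ?s2 = "set_creg 11 (apply_cpx_op CMinus (creg s1 7) (creg s1 10)) s1"
    have w2: "working N M B K x 0 [] ?s2" by (rule working_cong[of _ _ _ _ _ _ _ s1]) (use s1 in auto)
    have B10: "10 < B" using e(1) B unfolding admissible_def by simp
    have "triple U (clamp 11) ?s2 2 (\<lambda>s3. triple U normalise s3 5 ?Q)"
    proof (rule triple_mono[OF clamp_correct order_refl])
      show "creg ?s2 8 = 0" using s1 by (simp add: working_def)
      show "creg ?s2 11 = complex_of_real (1 - max 0 v)" using s1 7 by simp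
      fix s3 :: state assume s3: "creg s3 11 = complex_of_real (max 0 (1 - max 0 v)) \<and>
        (\<forall>r. r \<noteq> 11 \<longrightarrow> creg s3 r = creg ?s2 r) \<and> (\<forall>r. r \<noteq> 10 \<longrightarrow> nreg s3 r = nreg ?s2 r)"
      have w3: "working N M B K x 0 [] s3" by (rule working_cong[OF w2]) (use s3 B10 in auto)
      have "creg s3 10 = complex_of_real (max 0 v)" using s3 s1 by simp
      then have "triple U normalise s3 5 (\<lambda>s'. creg s' 10 = complex_of_real (1 - p) \<and>
         creg s' 11 = complex_of_real p \<and> working N M B K x 0 [] s' \<and> (\<forall>r\<ge>B. nreg s' r = nreg s3 r))"
        unfolding p using s3 w3 by (intro normalise_correct) auto
      then show "triple U normalise s3 5 ?Q" by (rule triple_mono) auto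
    qed simp
    from triple_Seq[OF this]
    have "triple U (COp CMinus 11 7 10) s1 1 (\<lambda>s2. triple U (Seq (clamp 11) normalise) s2 (2 + 5 + 1) ?Q)"
      by (rule triple_simple)
    from triple_Seq[OF this] show ?thesis by (rule triple_time) simp
  qed
  have "triple U (eval_pos e 10) s (T + 5) (\<lambda>s1. triple U (Seq (COp CMinus 11 7 10) (Seq (clamp 11) normalise)) s1 12 ?Q)"
    by (rule triple_mono[OF eval_pos_correct[OF e s _ B] order_refl tail]) auto
  from triple_Seq[OF this] show ?thesis unfolding decide_root_def by (rule triple_time) simp
qed

lemma sampling_program_gives:
  fixes D L N M :: nat
  assumes x: "0 \<le> x" "x < 1" and \<eta>: "0 < \<epsilon> * \<delta>" and N: "0 < N"
  defines "K' \<equiv> LEAST k. real D * ((1 + x) / 2) ^ k \<le> \<epsilon> * \<delta>"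
  defines "K \<equiv> min K' N" and "B \<equiv> L + N"
  assumes er: "admissible Z L T er" "evaluates U Z N M B K x 0 [] er v"
    and e1: "admissible Z L T e1" "\<And>i o1. i < M ==> length o1 \<le> i ==> evaluates U Z N M B K x (Suc i) (o1 @ [i]) e1 (w1 i o1)"
    and e0: "admissible Z L T e0" "\<And>i o1. i < M ==> length o1 \<le> i ==> evaluates U Z N M B K x (Suc i) o1 e0 (w0 i o1)"
    and p: "\<And>i o1. p i o1 = max 0 (w1 i o1) / (max 0 (w1 i o1) + max 0 (w0 i o1))"
    and p0: "p0 = max 0 v / (max 0 v + max 0 (1 - v))"
  shows "gives N U ([sampling_program D L er e1 e0], initial_state N M x \<epsilon> \<delta>)
    (K' * 4 + T + M * (2 * T + 50) + 20 * N + 6 * L + 150) (tree_sampler N M p0 p)"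
proof -
  let ?W = "While (NLess 4 1) (Seq (decide e1 e0) (Seq (Sample 7 8 9) (NOp NPlus 6 6 7)))"
  let ?t = "M * (2 * T + 50) + (20 * N + 6 * L + 30)"
  have L: "12 < L" using er(1) unfolding admissible_def by simp
  have B: "L < B" "N < B" using N L by (auto simp: B_def)
  have lg: "gives N U ([?W, finish L], s) (d * (2 * T + 50) + (20 * N + 6 * L + 30)) (map_pmf (to_outcome N) (walk p d i o1))"
    if "working N M B K x i o1 s" "length o1 \<le> i" "i + d = M" for i o1 s d
    by (rule loop_gives[OF e1(1) e1(2) e0(1) e0(2) p B L that])
  have p01: "0 \<le> p0" "p0 \<le> 1" unfolding p0 by (rule max_ratio_01)+
  have rest: "gives N U (Seq (Sample 7 8 9) (Seq (Seq (NOp NMonus 4 2 7) (NOp NTimes 4 4 1)) (Seq ?W (finish L))) # [], s1)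
      (?t + 10) (tree_sampler N M p0 p)"
    if s1: "creg s1 10 = complex_of_real (1 - p0) \<and> creg s1 11 = complex_of_real p0 \<and> working N M B K x 0 [] s1" for s1 :: state
  proof -
    define Q where "Q r = (if r = 1 then map_pmf (to_outcome N) (walk p M 0 []) else return_pmf Collision)" for r :: nat
    have n: "nreg s1 8 = 10" "nreg s1 9 = 2" using s1 by (auto simp: working_def)
    have dr: "draw (creg s1) (nreg s1 8) (nreg s1 9) = map_pmf (\<lambda>b. if b then 1 else 0) (bernoulli_pmf p0)"
      unfolding n by (rule draw_two) (use s1 p01 in auto)
    have g: "gives N U (Sample 7 8 9 # [Seq (Seq (NOp NMonus 4 2 7) (NOp NTimes 4 4 1)) (Seq ?W (finish L))], s1) (Suc (?t + 6))
        (bind_pmf (draw (creg s1) (nreg s1 8) (nreg s1 9)) Q)"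
    proof (rule gives_Sample)
      fix r assume "r \<in> set_pmf (draw (creg s1) (nreg s1 8) (nreg s1 9))"
      then have r: "r = 0 \<or> r = 1" unfolding dr by auto
      let ?s2 = "set_nreg 7 r s1"
      let ?s3 = "set_nreg 4 (apply_nat_op NMonus (nreg ?s2 2) (nreg ?s2 7)) ?s2"
      let ?s4 = "set_nreg 4 (apply_nat_op NTimes (nreg ?s3 4) (nreg ?s3 1)) ?s3"
      have w4: "working N M B K x (if r = 1 then 0 else M) [] ?s4"
        using s1 r B unfolding working_def by auto
      have "gives N U ([?W, finish L], ?s4) ?t (Q r)"
      proof (cases "r = 1")
        case True
        then show ?thesis using lg[of 0 "[]" ?s4 M] w4 by (simp add: Q_def)
      next
        case False
        then have w: "working N M B K x M [] ?s4" using w4 by simp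
        \<comment> \<open>The walk that starts at mode \<open>M\<close> ends at once without clicks,
          and \<open>0 < N\<close> makes that a collision.\<close>
        have "Q r = map_pmf (to_outcome N) (walk p 0 M [])"
          unfolding Q_def if_not_P[OF False] walk.simps map_return_pmf to_outcome_def using N by simp
        then show ?thesis using gives_mono[OF lg[OF w, of 0], of ?t] by simp
      qed
      note 1 = gives_Seq[OF this]
      have "triple U (NOp NTimes 4 4 1) ?s3 1 (\<lambda>s4. gives N U ([Seq ?W (finish L)], s4) (Suc ?t) (Q r))"
        by (rule triple_simple) (rule 1)
      then have "triple U (NOp NMonus 4 2 7) ?s2 1 (\<lambda>s3. triple U (NOp NTimes 4 4 1) s3 1 (\<lambda>s4. gives N U ([Seq ?W (finish L)], s4) (Suc ?t) (Q r)))"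
        by (rule triple_simple)
      from gives_Seq[OF gives_triple[OF triple_Seq[OF this]]]
      show "gives N U ([Seq (Seq (NOp NMonus 4 2 7) (NOp NTimes 4 4 1)) (Seq ?W (finish L))], ?s2) (?t + 6) (Q r)"
        by (rule gives_mono) simp
    qed
    have "bind_pmf (draw (creg s1) (nreg s1 8) (nreg s1 9)) Q = tree_sampler N M p0 p"
      unfolding dr bind_map_pmf tree_sampler_def Q_def by (intro bind_pmf_cong refl) simp
    then show ?thesis using gives_mono[OF gives_Seq[OF g]] by simp
  qed
  have root: "triple U (decide_root er) s (T + 20) (\<lambda>s1. gives N U (Seq (Sample 7 8 9) (Seq (Seq (NOp NMonus 4 2 7) (NOp NTimes 4 4 1)) (Seq ?W (finish L))) # [], s1)
      (?t + 10) (tree_sampler N M p0 p))" if "working N M B K x 0 [] s" for s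
    by (rule triple_mono[OF decide_root_correct[OF er that] order_refl]) (use B rest p0 in auto)
  have "triple U (setup_code D L) (initial_state N M x \<epsilon> \<delta>) (K' * 4 + 60) (\<lambda>s. triple U (decide_root er) s (T + 20)
     (\<lambda>s1. gives N U (Seq (Sample 7 8 9) (Seq (Seq (NOp NMonus 4 2 7) (NOp NTimes 4 4 1)) (Seq ?W (finish L))) # [], s1)
      (?t + 10) (tree_sampler N M p0 p)))"
    by (rule triple_mono[OF setup_correct[OF x \<eta>, of U D L N M, folded K'_def, folded K_def B_def] order_refl root])
  from gives_Seq[OF gives_triple[OF triple_Seq[OF this]]] show ?thesis unfolding sampling_program_def
    by (rule gives_mono) simp
qed

section \<open>Evaluating the expansion\<close>

definition digit :: "nat => nat => nat => nat" where
  "digit b e l = e div b ^ l mod b"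

lemma digit_less: "0 < b ==> digit b e l < b"
  by (simp add: digit_def)

text \<open>Functions from \<open>{..<j}\<close> to \<open>{..<b}\<close> are coded by numbers below
  \<open>b ^ j\<close>, so a sum over functions becomes a fold over a range. Digits from
  \<open>j\<close> on are 0 while functions in \<open>PiE\<close> are undefined there, hence the
  condition on \<open>F\<close>. For \<open>j = 0\<close> the base may be 0, which occurs when
  \<open>b = j\<close>.\<close>

lemma sum_digits:
  fixes F :: "(nat => nat) => 'a :: comm_monoid_add"
  shows "(0 < j ==> 0 < b) ==> (\<And>f g. (\<And>l. l < j ==> f l = g l) ==> F f = F g) ==>
    (\<Sum>e<b ^ j. F (digit b e)) = (\<Sum>f\<in>PiE {..<j} (\<lambda>_. {..<b}). F f)"
proof (induction j arbitrary: F)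
  case 0
  have "F (digit b 0) = F (\<lambda>_. undefined)" by (rule 0(2)) simp
  then show ?case by simp
next
  case (Suc j)
  have b: "0 < b" using Suc.prems(1) by simp
  have low: "digit b (a * b ^ j + e) l = digit b e l" if "l < j" for a e l
  proof -
    have "a * b ^ j = a * b ^ (j - Suc l) * b * b ^ l"
    proof -
      have "b ^ j = b ^ (j - Suc l) * b ^ Suc l" using that by (metis Suc_leI le_add_diff_inverse2 power_add)
      then show ?thesis by (simp add: mult_ac)
    qed
    then have "(a * b ^ j + e) div b ^ l = (e + a * b ^ (j - Suc l) * b * b ^ l) div b ^ l" by (simp only: add.commute)
    also have "\<dots> = a * b ^ (j - Suc l) * b + e div b ^ l" using b by (intro div_mult_self1) simp
    finally show ?thesis unfolding digit_def by simp
  qed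
  have top: "digit b (a * b ^ j + e) j = a" if "a < b" "e < b ^ j" for a e
    using that b by (simp add: digit_def)
  have "(\<Sum>e<b ^ Suc j. F (digit b e)) = (\<Sum>a<b. \<Sum>e\<in>{a * b ^ j..<a * b ^ j + b ^ j}. F (digit b e))"
    by (simp add: sum.nat_group)
  also have "\<dots> = (\<Sum>a<b. \<Sum>e<b ^ j. F ((digit b e)(j := a)))"
  proof (rule sum.cong[OF refl])
    fix a assume a: "a \<in> {..<b}"
    have "(\<Sum>e\<in>{a * b ^ j..<a * b ^ j + b ^ j}. F (digit b e)) = (\<Sum>e<b ^ j. F (digit b (a * b ^ j + e)))"
      by (rule sum.reindex_bij_witness[of _ "\<lambda>e. a * b ^ j + e" "\<lambda>e. e - a * b ^ j"]) auto
    also have "\<dots> = (\<Sum>e<b ^ j. F ((digit b e)(j := a)))"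
      using a low top by (intro sum.cong refl Suc.prems(2)) (auto simp: less_Suc_eq)
    finally show "(\<Sum>e\<in>{a * b ^ j..<a * b ^ j + b ^ j}. F (digit b e)) = (\<Sum>e<b ^ j. F ((digit b e)(j := a)))" .
  qed
  also have "\<dots> = (\<Sum>a<b. \<Sum>f\<in>PiE {..<j} (\<lambda>_. {..<b}). F (f(j := a)))"
  proof (rule sum.cong[OF refl])
    fix a
    show "(\<Sum>e<b ^ j. F ((digit b e)(j := a))) = (\<Sum>f\<in>PiE {..<j} (\<lambda>_. {..<b}). F (f(j := a)))"
      by (rule Suc.IH[of "\<lambda>f. F (f(j := a))"]) (use b in simp, rule Suc.prems(2), auto simp: less_Suc_eq)
  qed
  also have "\<dots> = (\<Sum>f\<in>PiE {..<Suc j} (\<lambda>_. {..<b}). F f)"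
    unfolding lessThan_Suc by (subst sum_PiE_insert) auto
  finally show ?case .
qed

lemma sum_injective_functions:
  "(\<Sum>f\<in>PiE {..<j} (\<lambda>_. {..<b}). if inj_on f {..<j} then G f else 0) = (\<Sum>f\<in>injections j b. G f)"
  unfolding injections_def by (subst sum.inter_filter[symmetric]) (auto intro!: finite_PiE)

text \<open>An injective map of a finite set to itself is a bijection; extended by the identity it
  becomes a permutation.\<close>

lemma sum_injective_endofunctions:
  fixes G :: "(nat => nat) => 'a :: comm_monoid_add"
  assumes G: "\<And>f g. (\<And>l. l < j ==> f l = g l) ==> G f = G g"
  shows "(\<Sum>f\<in>PiE {..<j} (\<lambda>_. {..<j}). if inj_on f {..<j} then G f else 0) = (\<Sum>\<pi>\<in>perms j. G \<pi>)"
proof -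
  have "(\<Sum>\<pi>\<in>perms j. G \<pi>) = (\<Sum>f\<in>injections j j. G f)"
  proof (rule sum.reindex_bij_witness[of _ "\<lambda>f l. if l < j then f l else l" "\<lambda>\<pi>. restrict \<pi> {..<j}"])
    fix \<pi> assume "\<pi> \<in> perms j"
    then have p: "\<pi> permutes {..<j}" by (simp add: perms_def)
    then show "(\<lambda>l. if l < j then restrict \<pi> {..<j} l else l) = \<pi>" by (auto simp: fun_eq_iff permutes_not_in)
    have "inj_on \<pi> {..<j}" using permutes_inj[OF p] by (rule inj_on_subset) simp
    then show "restrict \<pi> {..<j} \<in> injections j j"
      using permutes_in_image[OF p] by (auto simp: injections_def)
    show "G (restrict \<pi> {..<j}) = G \<pi>" by (rule G) simp
  next
    fix f assume f: "f \<in> injections j j"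
    then show "restrict (\<lambda>l. if l < j then f l else l) {..<j} = f"
      by (auto simp: injections_def fun_eq_iff PiE_def extensional_def)
    have "inj_on f {..<j}" "f ` {..<j} \<subseteq> {..<j}" using f by (auto simp: injections_def)
    then have "f ` {..<j} = {..<j}" by (intro endo_inj_surj) auto
    then have "bij_betw f {..<j} {..<j}" using \<open>inj_on f {..<j}\<close> by (simp add: bij_betw_def)
    then have "bij_betw (\<lambda>l. if l < j then f l else l) {..<j} {..<j}"
      by (subst bij_betw_cong[of _ _ f]) auto
    then show "(\<lambda>l. if l < j then f l else l) \<in> perms j"
      unfolding perms_def mem_Collect_eq by (rule bij_imp_permutes) simp
  qed
  then show ?thesis by (simp only: sum_injective_functions)
qed

lemma neval_folds [simp]:
  "neval A \<rho> (NFold NPlus v n b) = (\<Sum>i<neval A \<rho> n. neval A (\<rho>(v := i)) b)"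
  "neval A \<rho> (NFold NTimes v n b) = (\<Prod>i<neval A \<rho> n. neval A (\<rho>(v := i)) b)"
  using iter_op_sum_nat iter_op_prod_nat by auto

lemma ceval_folds [simp]:
  "ceval U A \<gamma> \<rho> (CFold CPlus v n b) = (\<Sum>i<neval A \<rho> n. ceval U A \<gamma> (\<rho>(v := i)) b)"
  "ceval U A \<gamma> \<rho> (CFold CTimes v n b) = (\<Prod>i<neval A \<rho> n. ceval U A \<gamma> (\<rho>(v := i)) b)"
  using iter_op_sum_cpx iter_op_prod_cpx by auto

declare neval.simps(5) [simp del] ceval.simps(6) [simp del]

section \<open>Expressions for comparisons, digits and the expansion\<close>

definition nle :: "nexp => nexp => nexp" where
  "nle a b = NBin NMonus (NLit 1) (NBin NMonus a b)"

definition ndist :: "nexp => nexp => nexp" where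
  "ndist a b = NBin NPlus (NBin NMonus a b) (NBin NMonus b a)"

definition neq :: "nexp => nexp => nexp" where
  "neq a b = NBin NMonus (NLit 1) (ndist a b)"

text \<open>Without a division instruction the quotient is found by counting the \<open>t\<close>
  with \<open>b ^ l * (t + 1) \<le> e\<close>. The comparison is a 0-1 value obtained from truncated
  subtraction.\<close>

definition ndiv_pow :: "nat => nat => nat => nexp => nat => nexp" where
  "ndiv_pow v u b l e = NFold NPlus v (NVar e)
     (nle (NBin NTimes (NFold NTimes u l (NVar b)) (NBin NPlus (NVar v) (NLit 1))) (NVar e))"

definition ndigit :: "nat => nat => nat => nexp => nat => nexp" where
  "ndigit v u b l e = NBin NMonus (ndiv_pow v u b l e)
     (NBin NTimes (NVar b) (ndiv_pow v u b (NBin NPlus l (NLit 1)) e))"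

lemma neval_nle [simp]: "neval A \<rho> (nle a b) = of_bool (neval A \<rho> a \<le> neval A \<rho> b)"
  by (auto simp: nle_def)

lemma neval_ndist_pos [simp]: "0 < neval A \<rho> (ndist a b) \<longleftrightarrow> neval A \<rho> a \<noteq> neval A \<rho> b"
  by (auto simp: ndist_def)

lemma neval_neq [simp]: "neval A \<rho> (neq a b) = of_bool (neval A \<rho> a = neval A \<rho> b)"
  by (auto simp: neq_def ndist_def)

lemma sum_div_count: "0 < q ==> (\<Sum>t<e. of_bool (q * (t + 1) \<le> e)) = e div (q :: nat)"
proof -
  assume q: "0 < q"
  have "q * (t + 1) \<le> e \<longleftrightarrow> t < e div q" for t
    using less_eq_div_iff_mult_less_eq[OF q, of "t + 1" e] by (simp add: mult.commute Suc_le_eq)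
  then have "(\<Sum>t<e. of_bool (q * (t + 1) \<le> e)) = (\<Sum>t<e. of_bool (t < e div q) :: nat)" by simp
  also have "\<dots> = card {t \<in> {..<e}. t < e div q}" by (simp add: of_bool_def sum.If_cases Int_def)
  also have "{t \<in> {..<e}. t < e div q} = {..<e div q}"
    using div_le_dividend[of e q] by (auto intro: order_less_le_trans)
  finally show ?thesis by simp
qed

lemma neval_ndiv_pow:
  assumes "v \<noteq> e" "v \<noteq> b" "u \<noteq> b" "v \<notin> nfv l" "0 < \<rho> b"
  shows "neval A \<rho> (ndiv_pow v u b l e) = \<rho> e div \<rho> b ^ neval A \<rho> l"
proof -
  have "neval A (\<rho>(v := t)) l = neval A \<rho> l" for t by (rule neval_cong) (use assms(4) in auto)
  then show ?thesis using assms sum_div_count[of "\<rho> b ^ neval A \<rho> l" "\<rho> e"] by (simp add: ndiv_pow_def)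
qed

lemma neval_ndigit [simp]:
  assumes "v \<noteq> e" "v \<noteq> b" "u \<noteq> b" "v \<notin> nfv l" "0 < \<rho> b"
  shows "neval A \<rho> (ndigit v u b l e) = digit (\<rho> b) (\<rho> e) (neval A \<rho> l)"
proof -
  have "neval A \<rho> (ndigit v u b l e) = \<rho> e div \<rho> b ^ neval A \<rho> l - \<rho> b * (\<rho> e div \<rho> b ^ (neval A \<rho> l + 1))"
    using assms by (simp add: ndigit_def neval_ndiv_pow)
  also have "\<rho> e div \<rho> b ^ (neval A \<rho> l + 1) = \<rho> e div \<rho> b ^ neval A \<rho> l div \<rho> b"
    unfolding power_add power_one_right by (rule div_mult2_eq)
  finally show ?thesis by (simp add: digit_def minus_mult_div_eq_mod)
qed

text \<open>The counting fold makes as many rounds as the code is large, and the power takes up to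
  \<open>l + 1\<close> rounds.\<close>

lemma nok_ndigit:
  assumes "v \<noteq> e" "v \<noteq> b" "u \<noteq> b" "v \<notin> nfv l" "nok Z A \<rho> l" "\<rho> e \<le> Z" "neval A \<rho> l < Z"
  shows "nok Z A \<rho> (ndigit v u b l e)"
proof -
  have 1: "neval A (\<rho>(v := t)) l = neval A \<rho> l" for t by (rule neval_cong) (use assms(4) in auto)
  have 2: "nok Z A (\<rho>(v := t)) l = nok Z A \<rho> l" for t by (rule nok_cong) (use assms(4) in auto)
  show ?thesis using assms 1 2 by (simp add: ndigit_def ndiv_pow_def nle_def)
qed

lemma nfv_expr [simp]:
  "nfv (nle a b) = nfv a \<union> nfv b" "nfv (ndist a b) = nfv a \<union> nfv b" "nfv (neq a b) = nfv a \<union> nfv b"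
  "nfv (ndigit v u q l e) = {e, q} \<union> (nfv l - {v})"
  "nbv (nle a b) = nbv a \<union> nbv b" "nbv (ndist a b) = nbv a \<union> nbv b" "nbv (neq a b) = nbv a \<union> nbv b"
  "nbv (ndigit v u q l e) = {v, u} \<union> nbv l"
  by (auto simp: nle_def ndist_def neq_def ndigit_def ndiv_pow_def)

lemma nwf_expr [simp]:
  "nwf (nle a b) \<longleftrightarrow> nwf a \<and> nwf b \<and> nbv a \<inter> nfv b = {}"
  "nwf (ndist a b) \<longleftrightarrow> nwf a \<and> nwf b \<and> nbv a \<inter> nfv b = {} \<and> nbv b \<inter> nfv a = {} \<and> nbv a \<inter> nfv a = {} \<and> nbv b \<inter> nfv b = {}"
  "nwf (neq a b) \<longleftrightarrow> nwf (ndist a b)"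
  by (auto simp: nle_def ndist_def neq_def)

lemma nwf_ndigit [simp]:
  "nwf l ==> nbv l \<inter> nfv l = {} ==> {u, v} \<inter> (nfv l \<union> nbv l) = {} ==> b \<notin> {u, v} ==> e \<notin> {u, v} ==> u \<noteq> v ==>
   {b, e} \<inter> nbv l = {} ==> {u, v} \<inter> {2, 3} = {} ==> nwf (ndigit v u b l e)"
  by (auto simp: ndigit_def ndiv_pow_def)

lemma nok_expr [simp]:
  "nok Z A \<rho> (nle a b) \<longleftrightarrow> nok Z A \<rho> a \<and> nok Z A \<rho> b"
  "nok Z A \<rho> (ndist a b) \<longleftrightarrow> nok Z A \<rho> a \<and> nok Z A \<rho> b"
  "nok Z A \<rho> (neq a b) \<longleftrightarrow> nok Z A \<rho> a \<and> nok Z A \<rho> b"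
  by (auto simp: nle_def ndist_def neq_def)

text \<open>The variables 20 to 24 hold \<open>j\<close>, the numbers whose digits are \<open>r\<close>, \<open>s\<close> and \<open>\<pi>\<close>, and \<open>l\<close>.\<close>

definition row_exp :: "nat => nexp" where "row_exp y = ndigit 27 28 0 (NVar y) 21"
definition col_exp :: "nat => nexp" where "col_exp y = ndigit 27 28 1 (NVar y) 22"
definition perm_exp :: "nat => nexp" where "perm_exp y = ndigit 27 28 20 (NVar y) 23"
definition perm_col_exp :: nexp where "perm_col_exp = ndigit 30 31 1 (perm_exp 24) 22"

text \<open>A test per factor instead of one per term: the column must be at or after the current
  mode or among the clicks, and none of the three codes may repeat an earlier digit. The product
  over all factors then vanishes unless all three functions are injective and every column is
  allowed.\<close>

definition valid_exp :: nexp where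
  "valid_exp = nle (NLit 1) (NBin NTimes
     (NBin NPlus (NBin NTimes (nle (NBin NPlus (col_exp 24) (NLit 1)) (NVar 4)) (NFold NPlus 26 (NVar 6) (neq (NArr (NVar 26)) (col_exp 24))))
       (nle (NVar 4) (col_exp 24)))
     (NFold NTimes 25 (NVar 24) (NBin NTimes (ndist (row_exp 24) (row_exp 25))
       (NBin NTimes (ndist (col_exp 24) (col_exp 25)) (ndist (perm_exp 24) (perm_exp 25))))))"

definition scale_exp :: cexp where
  "scale_exp = CBin CDivide (CBin CTimes (CVar 0) (COf (NVar 1)))
     (COf (NBin NTimes (NBin NPlus (NVar 24) (NLit 1)) (NBin NMonus (NVar 0) (NVar 24))))"

text \<open>Conjugation is not an instruction; it is computed as
  \<open>2 * Re w - w\<close>.\<close>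

definition wick_exp :: cexp where
  "wick_exp = CBin CMinus (CBin CTimes (CEntry (row_exp 24) (col_exp 24))
       (CBin CMinus (CBin CTimes (COf (NLit 2)) (CUn CRe (CEntry (row_exp 24) perm_col_exp))) (CEntry (row_exp 24) perm_col_exp)))
     (CBin CDivide (COf (neq (col_exp 24) perm_col_exp)) (COf (NVar 1)))"

definition later_exp :: nexp where
  "later_exp = NFold NPlus 25 (NVar 24) (nle (NVar 4) (col_exp 25))"

definition avail_exp :: cexp where
  "avail_exp = CBin CPlus (COf (nle (NBin NPlus (col_exp 24) (NLit 1)) (NVar 4)))
     (CBin CTimes (COf (nle (NVar 4) (col_exp 24)))
       (CBin CDivide (COf (NBin NMonus (NBin NMonus (NVar 0) (NVar 6)) later_exp))
         (COf (NBin NMonus (NBin NMonus (NVar 1) (NVar 4)) later_exp))))"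

definition factor_exp :: cexp where
  "factor_exp = CBin CTimes (COf valid_exp) (CBin CTimes avail_exp (CBin CTimes scale_exp wick_exp))"

definition node_exp :: cexp where
  "node_exp = CFold CPlus 20 (NBin NPlus (NVar 5) (NLit 1)) (CFold CPlus 21 (NFold NTimes 28 (NVar 20) (NVar 0))
     (CFold CPlus 22 (NFold NTimes 28 (NVar 20) (NVar 1)) (CFold CPlus 23 (NFold NTimes 28 (NVar 20) (NVar 20))
       (CFold CTimes 24 (NVar 20) factor_exp))))"

definition root_exp :: cexp where
  "root_exp = CBin CTimes (CFold CTimes 32 (NVar 0) (CBin CDivide (COf (NBin NMonus (NVar 1) (NVar 32))) (COf (NVar 1)))) node_exp"

text \<open>Evaluated when register 6 already counts the candidate click, hence the correction by 1.
  In \<open>no_click_exp\<close> the same is done for register 4, which already holds the next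
  mode.\<close>

definition click_exp :: cexp where
  "click_exp = CBin CTimes (COf (NBin NMonus (NVar 0) (NBin NMonus (NVar 6) (NLit 1)))) node_exp"

definition no_click_exp :: cexp where
  "no_click_exp = CBin CTimes (COf (NBin NMonus (NBin NMonus (NVar 1) (NBin NMonus (NVar 4) (NLit 1))) (NBin NMonus (NVar 0) (NVar 6)))) node_exp"

lemmas digit_exps = row_exp_def col_exp_def perm_exp_def perm_col_exp_def

lemma digit_exps_wf [simp]:
  "y \<in> {24, 25} ==> nwf (row_exp y)" "y \<in> {24, 25} ==> nwf (col_exp y)" "y \<in> {24, 25} ==> nwf (perm_exp y)" "nwf perm_col_exp"
  "y \<in> {24, 25} ==> nfv (row_exp y) = {0, 21, y}" "y \<in> {24, 25} ==> nfv (col_exp y) = {1, 22, y}"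
  "y \<in> {24, 25} ==> nfv (perm_exp y) = {20, 23, y}" "nfv perm_col_exp = {1, 20, 22, 23, 24}"
  "nbv (row_exp y) = {27, 28}" "nbv (col_exp y) = {27, 28}" "nbv (perm_exp y) = {27, 28}" "nbv perm_col_exp = {27, 28, 30, 31}"
  unfolding digit_exps by (auto)

lemma valid_exp_wf [simp]:
  "nwf valid_exp" "nfv valid_exp = {0, 1, 4, 6, 20, 21, 22, 23, 24}" "nbv valid_exp = {25, 26, 27, 28}"
  by (simp_all add: valid_exp_def, auto)

lemma avail_exp_wf [simp]:
  "cwf avail_exp" "cfv avail_exp = {0, 1, 4, 6, 22, 24}" "cbv avail_exp = {25, 27, 28}" "ccv avail_exp = {}"
  by (simp_all add: avail_exp_def later_exp_def, auto)

lemma scale_exp_wf [simp]: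
  "cwf scale_exp" "cfv scale_exp = {0, 1, 24}" "cbv scale_exp = {}" "ccv scale_exp = {0}"
  by (simp_all add: scale_exp_def, auto)

lemma wick_exp_wf [simp]:
  "cwf wick_exp" "cfv wick_exp = {0, 1, 20, 21, 22, 23, 24}" "cbv wick_exp = {27, 28, 30, 31}" "ccv wick_exp = {}"
  by (simp_all add: wick_exp_def, auto)

lemma factor_exp_wf [simp]:
  "cwf factor_exp" "cfv factor_exp = {0, 1, 4, 6, 20, 21, 22, 23, 24}" "cbv factor_exp = {25, 26, 27, 28, 30, 31}" "ccv factor_exp = {0}"
  by (simp_all add: factor_exp_def, auto)

lemma node_exp_wf:
  "cwf node_exp" "cfv node_exp = {0, 1, 4, 5, 6}" "cbv node_exp = {20, 21, 22, 23, 24, 25, 26, 27, 28, 30, 31}" "ccv node_exp = {0}"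
  by (simp_all add: node_exp_def, auto)

lemma exps_wf:
  "e \<in> {root_exp, click_exp, no_click_exp} ==> cwf e \<and> cfv e \<subseteq> {..<40} \<and> cbv e \<subseteq> {20..<40} \<and> ccv e \<subseteq> {..<10}"
  using node_exp_wf by (auto simp: root_exp_def click_exp_def no_click_exp_def subset_eq disjoint_iff)

lemma sum_of_bool_card: "(\<Sum>l'<(l :: nat). of_bool (P l')) = card {l'. l' < l \<and> P l'}"
  by (induction l) (simp_all add: card_less_Suc_if)

lemma factor_eval:
  assumes \<rho>: "\<rho> 0 = n" "\<rho> 1 = m" "\<rho> 4 = i" "\<rho> 6 = length o1" "\<rho> 20 = j" "\<rho> 24 = l" and l: "l < j"
    and n: "0 < n" "n \<le> m" and U: "U \<in> carrier_mat m m" and A: "\<And>p. p < length o1 ==> A p = o1 ! p" and \<gamma>: "\<gamma> 0 = complex_of_real x"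
  defines "r \<equiv> digit n (\<rho> 21)" and "s \<equiv> digit m (\<rho> 22)" and "\<pi> \<equiv> digit j (\<rho> 23)"
  shows "ceval U A \<gamma> \<rho> factor_exp = (if (s l < i \<longrightarrow> s l \<in> set o1) \<and> (\<forall>l'<l. r l \<noteq> r l' \<and> s l \<noteq> s l' \<and> \<pi> l \<noteq> \<pi> l')
    then of_real (avail m i (n - length o1) s l) * term_weight n m x U r s \<pi> l else 0)"
proof -
  have pos: "0 < \<rho> 0" "0 < \<rho> 1" "0 < \<rho> (Suc 0)" "0 < \<rho> 20" using \<rho> n l by auto
  have dig: "neval A \<rho> (row_exp 24) = r l" "neval A \<rho> (col_exp 24) = s l" "neval A \<rho> (perm_exp 24) = \<pi> l"
      "neval A \<rho> perm_col_exp = s (\<pi> l)"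
    using pos \<rho> by (simp_all add: digit_exps r_def s_def \<pi>_def)
  have dig25: "neval A (\<rho>(25 := l')) (row_exp 24) = r l" "neval A (\<rho>(25 := l')) (col_exp 24) = s l" "neval A (\<rho>(25 := l')) (perm_exp 24) = \<pi> l"
      "neval A (\<rho>(25 := l')) (row_exp 25) = r l'" "neval A (\<rho>(25 := l')) (col_exp 25) = s l'" "neval A (\<rho>(25 := l')) (perm_exp 25) = \<pi> l'"
      "neval A (\<rho>(26 := l')) (col_exp 24) = s l" for l'
    using pos \<rho> by (simp_all add: digit_exps r_def s_def \<pi>_def)
  \<comment> \<open>Membership among the clicks is decided by counting the array entries equal to
    the column.\<close>
  have mem: "(0 < (\<Sum>p<length o1. of_bool (A p = s l) :: nat)) \<longleftrightarrow> s l \<in> set o1"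
    using A by (auto simp: in_set_conv_nth sum_eq_0_iff[symmetric] simp flip: neq0_conv)
  have valid: "neval A \<rho> valid_exp = of_bool ((s l < i \<longrightarrow> s l \<in> set o1) \<and> (\<forall>l'<l. r l \<noteq> r l' \<and> s l \<noteq> s l' \<and> \<pi> l \<noteq> \<pi> l'))"
  proof -
    have "neval A \<rho> valid_exp = of_bool (0 < (of_bool (s l < i) * (\<Sum>p<length o1. of_bool (A p = s l)) + of_bool (i \<le> s l)) *
        (\<Prod>l'<l. neval A (\<rho>(25 := l')) (ndist (row_exp 24) (row_exp 25)) * (neval A (\<rho>(25 := l')) (ndist (col_exp 24) (col_exp 25)) *
           neval A (\<rho>(25 := l')) (ndist (perm_exp 24) (perm_exp 25)))))"
      unfolding valid_exp_def neval_nle neval.simps(1-4) neval_folds neval_neq apply_nat_op.simps dig dig25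
      using \<rho> by (simp add: Suc_le_eq)
    also have "\<dots> = of_bool ((s l < i \<longrightarrow> s l \<in> set o1) \<and> (\<forall>l'<l. r l \<noteq> r l' \<and> s l \<noteq> s l' \<and> \<pi> l \<noteq> \<pi> l'))"
    proof -
      have "0 < (of_bool (s l < i) * (\<Sum>p<length o1. of_bool (A p = s l)) + of_bool (i \<le> s l) :: nat) \<longleftrightarrow> (s l < i \<longrightarrow> s l \<in> set o1)"
      proof -
        have "0 < of_bool a * T + of_bool (\<not> a) \<longleftrightarrow> (a \<longrightarrow> 0 < T)" for a and T :: nat by (cases a) auto
        then show ?thesis unfolding mem[symmetric] not_less[symmetric] .
      qed
      moreover have "0 < (\<Prod>l'<l. neval A (\<rho>(25 := l')) (ndist (row_exp 24) (row_exp 25)) * (neval A (\<rho>(25 := l')) (ndist (col_exp 24) (col_exp 25)) *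
           neval A (\<rho>(25 := l')) (ndist (perm_exp 24) (perm_exp 25)))) \<longleftrightarrow> (\<forall>l'<l. r l \<noteq> r l' \<and> s l \<noteq> s l' \<and> \<pi> l \<noteq> \<pi> l')"
        by (simp only: prod_pos_nat_iff finite_lessThan nat_0_less_mult_iff neval_ndist_pos dig25) auto
      ultimately show ?thesis by (simp only: nat_0_less_mult_iff)
    qed
    finally show ?thesis .
  qed
  have sl: "r l < n" "s l < m" "s (\<pi> l) < m" "r l < m"
    using n by (auto simp: r_def s_def intro: digit_less order_less_le_trans)
  have wick: "ceval U A \<gamma> \<rho> wick_exp = fac (1 / real m) True (\<lambda>t. U $$ (r l, t)) (s l) (s (\<pi> l))"
  proof -
    have cnj2: "2 * complex_of_real (Re w) - w = cnj w" for w by (simp add: complex_eq_iff)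
    show ?thesis unfolding wick_exp_def ceval.simps(1-5) neval_neq apply_cpx_op.simps apply_cpx_unop.simps dig neval.simps(1,2)
      using U sl \<rho> by (simp add: fac_def entry_def cnj2)
  qed
  have scale: "ceval U A \<gamma> \<rho> scale_exp = of_real (x * real m / (real (l + 1) * real (n - l)))"
    using \<rho> \<gamma> by (simp add: scale_exp_def distrib_right del: of_nat_diff)
  have later: "neval A \<rho> later_exp = card {l'. l' < l \<and> i \<le> s l'}"
    unfolding later_exp_def neval_folds neval_nle dig25 neval.simps(1) sum_of_bool_card[symmetric] using \<rho> by simp
  have av: "ceval U A \<gamma> \<rho> avail_exp = of_real (avail m i (n - length o1) s l)"
    unfolding avail_exp_def ceval.simps(1-5) neval_nle apply_cpx_op.simps neval.simps(1-3) apply_nat_op.simps dig later avail_def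
    using \<rho> by (auto simp: Suc_le_eq simp del: of_nat_diff)
  show ?thesis unfolding factor_exp_def ceval.simps(1-5) apply_cpx_op.simps valid av scale wick term_weight_def
    by (simp add: mult_ac)
qed

lemma prod_if_all: "(\<Prod>l<(j :: nat). if P l then g l else 0) = (if \<forall>l<j. P l then \<Prod>l<j. g l else (0 :: 'a :: comm_semiring_1))"
  by (induction j) (auto simp: less_Suc_eq)

lemma inj_on_lessThan_iff: "inj_on f {..<j :: nat} \<longleftrightarrow> (\<forall>l<j. \<forall>l'<l. f l \<noteq> f l')"
proof
  assume f: "\<forall>l<j. \<forall>l'<l. f l \<noteq> f l'"
  show "inj_on f {..<j}"
  proof (rule inj_onI)
    fix a b assume "a \<in> {..<j}" "b \<in> {..<j}" "f a = f b"
    then show "a = b" using f by (metis lessThan_iff linorder_neqE_nat)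
  qed
next
  assume f: "inj_on f {..<j}"
  show "\<forall>l<j. \<forall>l'<l. f l \<noteq> f l'"
  proof (intro allI impI notI)
    fix l l' assume "l < j" "l' < l" "f l = f l'"
    then show False using inj_onD[OF f, of l l'] by simp
  qed
qed

lemma term_weight_cong:
  "r l = r' l ==> s l = s' l ==> s (\<pi> l) = s' (\<pi>' l) ==> term_weight n m x U r s \<pi> l = term_weight n m x U r' s' \<pi>' l"
  by (simp add: term_weight_def)

lemma avail_cong: "(\<And>l'. l' \<le> l ==> s l' = s' l') ==> avail m i k s l = avail m i k s' l"
proof -
  assume s: "\<And>l'. l' \<le> l ==> s l' = s' l'"
  then have "{l'. l' < l \<and> i \<le> s l'} = {l'. l' < l \<and> i \<le> s' l'}" by auto
  then show ?thesis using s[of l] by (simp add: avail_def)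
qed

text \<open>Multiplied together, the tests in the factors express injectivity of all three digit
  functions and the condition on the clicks. The sums over codes are then turned into sums over
  functions from the inside out.\<close>

lemma node_eval:
  assumes \<rho>: "\<rho> 0 = n" "\<rho> 1 = m" "\<rho> 4 = i" "\<rho> 5 = K" "\<rho> 6 = length o1"
    and n: "0 < n" "n \<le> m" and U: "U \<in> carrier_mat m m" and A: "\<And>p. p < length o1 ==> A p = o1 ! p" and \<gamma>: "\<gamma> 0 = complex_of_real x"
  shows "ceval U A \<gamma> \<rho> node_exp = node_sum n m x U K i o1"
proof -
  define C where "C j s \<longleftrightarrow> (\<forall>l<j. s l < i \<longrightarrow> s l \<in> set o1)" for j :: nat and s :: "nat => nat"
  define g where "g r s \<pi> l = of_real (avail m i (n - length o1) s l) * term_weight n m x U r s \<pi> l" for r s \<pi> l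
  let ?\<rho> = "\<lambda>j e1 e2 e3. \<rho>(20 := j, 21 := e1, 22 := e2, 23 := e3)"
  have body: "(\<Prod>l<j. ceval U A \<gamma> ((?\<rho> j e1 e2 e3)(24 := l)) factor_exp) =
      (if inj_on (digit n e1) {..<j} \<and> inj_on (digit m e2) {..<j} \<and> inj_on (digit j e3) {..<j} \<and> C j (digit m e2)
       then \<Prod>l<j. g (digit n e1) (digit m e2) (digit j e3) l else 0)" for j e1 e2 e3
  proof -
    have "(\<Prod>l<j. ceval U A \<gamma> ((?\<rho> j e1 e2 e3)(24 := l)) factor_exp) = (\<Prod>l<j. if (digit m e2 l < i \<longrightarrow> digit m e2 l \<in> set o1) \<and>
        (\<forall>l'<l. digit n e1 l \<noteq> digit n e1 l' \<and> digit m e2 l \<noteq> digit m e2 l' \<and> digit j e3 l \<noteq> digit j e3 l')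
       then g (digit n e1) (digit m e2) (digit j e3) l else 0)"
    proof (rule prod.cong[OF refl])
      fix l assume "l \<in> {..<j}"
      then show "ceval U A \<gamma> ((?\<rho> j e1 e2 e3)(24 := l)) factor_exp = (if (digit m e2 l < i \<longrightarrow> digit m e2 l \<in> set o1) \<and>
        (\<forall>l'<l. digit n e1 l \<noteq> digit n e1 l' \<and> digit m e2 l \<noteq> digit m e2 l' \<and> digit j e3 l \<noteq> digit j e3 l')
         then g (digit n e1) (digit m e2) (digit j e3) l else 0)"
        using \<rho> n U A \<gamma>
        by (subst factor_eval[where n = n and m = m and i = i and ?o1.0 = o1 and j = j and l = l and x = x]) (simp_all add: g_def split del: if_split cong: if_cong)
    qed
    also have "\<dots> = (if inj_on (digit n e1) {..<j} \<and> inj_on (digit m e2) {..<j} \<and> inj_on (digit j e3) {..<j} \<and> C j (digit m e2)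
       then \<Prod>l<j. g (digit n e1) (digit m e2) (digit j e3) l else 0)"
      unfolding prod_if_all inj_on_lessThan_iff C_def by (rule if_cong) auto
    finally show ?thesis .
  qed
  have "ceval U A \<gamma> \<rho> node_exp = (\<Sum>j\<le>K. \<Sum>e1<n ^ j. \<Sum>e2<m ^ j. \<Sum>e3<j ^ j. \<Prod>l<j. ceval U A \<gamma> ((?\<rho> j e1 e2 e3)(24 := l)) factor_exp)"
    using \<rho> by (simp add: node_exp_def lessThan_Suc_atMost)
  also have "\<dots> = (\<Sum>j\<le>K. \<Sum>r\<in>injections j n. \<Sum>s\<in>injections j m. \<Sum>\<pi>\<in>perms j. if C j s then \<Prod>l<j. g r s \<pi> l else 0)"
  proof (rule sum.cong[OF refl])
    fix j
    \<comment> \<open>Digit functions agree with functions in \<open>PiE\<close> and with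
      permutations only below \<open>j\<close>, so each summand must be seen to depend on those
      values alone.\<close>
    have g1: "g r s \<pi> l = g r s \<pi>' l" if "\<pi> l = \<pi>' l" for r s \<pi> \<pi>' l
      unfolding g_def using term_weight_cong[of r l r s s \<pi> \<pi>'] that by simp
    have g2: "g r s \<pi> l = g r s' \<pi> l" if "\<And>l. l < j ==> s l = s' l" "\<pi> \<in> perms j" "l < j" for r s s' \<pi> l
      unfolding g_def using term_weight_cong[of r l r s s' \<pi> \<pi>] avail_cong[of l s s'] that perms_less[OF that(2,3)] by simp
    have g3: "g r s \<pi> l = g r' s \<pi> l" if "r l = r' l" for r r' s \<pi> l
      unfolding g_def using term_weight_cong[of r l r' s s \<pi> \<pi>] that by simp
    have C2: "C j s = C j s'" if "\<And>l. l < j ==> s l = s' l" for s s' unfolding C_def using that by auto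
    have inj2: "inj_on f {..<j} = inj_on f' {..<j}" if "\<And>l. l < j ==> f l = f' l" for f f' :: "nat => nat"
      by (rule inj_on_cong) (use that in simp)
    have p: "(\<Sum>e3<j ^ j. if inj_on r {..<j} \<and> inj_on s {..<j} \<and> inj_on (digit j e3) {..<j} \<and> C j s then \<Prod>l<j. g r s (digit j e3) l else 0) =
        (if inj_on r {..<j} \<and> inj_on s {..<j} then \<Sum>\<pi>\<in>perms j. if C j s then \<Prod>l<j. g r s \<pi> l else 0 else 0)" for r s
    proof -
      let ?G = "\<lambda>\<pi>. if inj_on r {..<j} \<and> inj_on s {..<j} \<and> C j s then \<Prod>l<j. g r s \<pi> l else 0"
      have G: "?G \<pi> = ?G \<pi>'" if "\<And>l. l < j ==> \<pi> l = \<pi>' l" for \<pi> \<pi>'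
      proof -
        have "(\<Prod>l<j. g r s \<pi> l) = (\<Prod>l<j. g r s \<pi>' l)"
          by (rule prod.cong[OF refl], rule g1, rule that) simp
        then show ?thesis by simp
      qed
      have "(\<Sum>e3<j ^ j. if inj_on r {..<j} \<and> inj_on s {..<j} \<and> inj_on (digit j e3) {..<j} \<and> C j s then \<Prod>l<j. g r s (digit j e3) l else 0) =
          (\<Sum>e3<j ^ j. if inj_on (digit j e3) {..<j} then ?G (digit j e3) else 0)" by (intro sum.cong refl) auto
      also have "\<dots> = (\<Sum>\<pi>\<in>PiE {..<j} (\<lambda>_. {..<j}). if inj_on \<pi> {..<j} then ?G \<pi> else 0)"
      proof (rule sum_digits)
        fix f f' :: "nat => nat" assume ff: "\<And>l. l < j ==> f l = f' l"
        show "(if inj_on f {..<j} then ?G f else 0) = (if inj_on f' {..<j} then ?G f' else 0)"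
          by (rule arg_cong2[where f = "\<lambda>c y. if c then y else 0", OF inj2[OF ff] G[OF ff]])
      qed
      also have "\<dots> = (\<Sum>\<pi>\<in>perms j. ?G \<pi>)" by (rule sum_injective_endofunctions) (rule G)
      finally have e: "(\<Sum>e3<j ^ j. if inj_on r {..<j} \<and> inj_on s {..<j} \<and> inj_on (digit j e3) {..<j} \<and> C j s then \<Prod>l<j. g r s (digit j e3) l else 0) =
        (\<Sum>\<pi>\<in>perms j. ?G \<pi>)" .
      show ?thesis
      proof (cases "inj_on r {..<j} \<and> inj_on s {..<j}")
        case True
        then show ?thesis unfolding e by simp
      next
        case False
        show ?thesis unfolding e if_not_P[OF False] by (rule sum.neutral) (use False in auto)
      qed
    qed
    have s: "(\<Sum>e2<m ^ j. if inj_on r {..<j} \<and> inj_on (digit m e2) {..<j} then \<Sum>\<pi>\<in>perms j. if C j (digit m e2) then \<Prod>l<j. g r (digit m e2) \<pi> l else 0 else 0) =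
        (if inj_on r {..<j} then \<Sum>s\<in>injections j m. \<Sum>\<pi>\<in>perms j. if C j s then \<Prod>l<j. g r s \<pi> l else 0 else 0)" for r
    proof -
      let ?G = "\<lambda>s. if inj_on r {..<j} then \<Sum>\<pi>\<in>perms j. if C j s then \<Prod>l<j. g r s \<pi> l else 0 else 0"
      have G: "?G s = ?G s'" if ss: "\<And>l. l < j ==> s l = s' l" for s s'
      proof -
        have "(\<Sum>\<pi>\<in>perms j. if C j s then \<Prod>l<j. g r s \<pi> l else 0) = (\<Sum>\<pi>\<in>perms j. if C j s' then \<Prod>l<j. g r s' \<pi> l else 0)"
          by (intro sum.cong refl if_cong prod.cong C2[OF ss] g2[OF ss]) auto
        then show ?thesis by simp
      qed
      have "(\<Sum>e2<m ^ j. if inj_on r {..<j} \<and> inj_on (digit m e2) {..<j} then \<Sum>\<pi>\<in>perms j. if C j (digit m e2) then \<Prod>l<j. g r (digit m e2) \<pi> l else 0 else 0) =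
          (\<Sum>e2<m ^ j. if inj_on (digit m e2) {..<j} then ?G (digit m e2) else 0)" by (intro sum.cong refl) auto
      also have "\<dots> = (\<Sum>s\<in>PiE {..<j} (\<lambda>_. {..<m}). if inj_on s {..<j} then ?G s else 0)"
      proof (rule sum_digits)
        show "0 < m" using n by simp
        fix f f' :: "nat => nat" assume ff: "\<And>l. l < j ==> f l = f' l"
        show "(if inj_on f {..<j} then ?G f else 0) = (if inj_on f' {..<j} then ?G f' else 0)"
          by (rule arg_cong2[where f = "\<lambda>c y. if c then y else 0", OF inj2[OF ff] G[OF ff]])
      qed
      also have "\<dots> = (\<Sum>s\<in>injections j m. ?G s)" by (rule sum_injective_functions)
      finally show ?thesis by simp
    qed
    let ?G = "\<lambda>r. \<Sum>s\<in>injections j m. \<Sum>\<pi>\<in>perms j. if C j s then \<Prod>l<j. g r s \<pi> l else 0"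
    have "(\<Sum>e1<n ^ j. \<Sum>e2<m ^ j. \<Sum>e3<j ^ j. \<Prod>l<j. ceval U A \<gamma> ((?\<rho> j e1 e2 e3)(24 := l)) factor_exp) =
        (\<Sum>e1<n ^ j. if inj_on (digit n e1) {..<j} then ?G (digit n e1) else 0)"
      unfolding body p s ..
    also have "\<dots> = (\<Sum>r\<in>PiE {..<j} (\<lambda>_. {..<n}). if inj_on r {..<j} then ?G r else 0)"
    proof (rule sum_digits)
      fix f f' :: "nat => nat" assume ff: "\<And>l. l < j ==> f l = f' l"
      have G: "?G f = ?G f'" by (intro sum.cong refl if_cong prod.cong) (rule g3, rule ff, simp)
      show "(if inj_on f {..<j} then ?G f else 0) = (if inj_on f' {..<j} then ?G f' else 0)"
        by (rule arg_cong2[where f = "\<lambda>c y. if c then y else 0", OF inj2[OF ff] G])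
    qed (use n in simp)
    also have "\<dots> = (\<Sum>r\<in>injections j n. ?G r)" by (rule sum_injective_functions)
    finally show "(\<Sum>e1<n ^ j. \<Sum>e2<m ^ j. \<Sum>e3<j ^ j. \<Prod>l<j. ceval U A \<gamma> ((?\<rho> j e1 e2 e3)(24 := l)) factor_exp) = (\<Sum>r\<in>injections j n. ?G r)" .
  qed
  finally show ?thesis unfolding node_sum_def C_def g_def .
qed

lemma factor_ok:
  assumes "0 < \<rho> 0" "0 < \<rho> 1" "\<rho> 24 < \<rho> 20" "\<rho> 20 < Z" "\<rho> 21 \<le> Z" "\<rho> 22 \<le> Z" "\<rho> 23 \<le> Z" "\<rho> 6 \<le> Z"
  shows "cok Z A \<rho> factor_exp"
proof -
  have pos: "0 < \<rho> (Suc 0)" "0 < \<rho> 20" using assms by auto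
  have lt: "digit (\<rho> 20) e l < Z" for e l using digit_less[of "\<rho> 20" e l] assms by simp
  show ?thesis using assms pos lt
    by (auto simp: factor_exp_def valid_exp_def avail_exp_def scale_exp_def wick_exp_def later_exp_def digit_exps
        intro!: nok_ndigit)
qed

text \<open>All ranges are at most \<open>m ^ (K + 1)\<close>: the codes run below
  \<open>n ^ j\<close>, \<open>m ^ j\<close> and \<open>j ^ j\<close> with
  \<open>j \<le> K \<le> n \<le> m\<close>, and digit extraction counts up to the code
  itself.\<close>

lemma node_ok:
  assumes \<rho>: "\<rho> 0 = n" "\<rho> 1 = m" "\<rho> 5 = K" "\<rho> 6 \<le> m" and n: "0 < n" "n \<le> m" "2 \<le> m" "K \<le> n" and Z: "m ^ (K + 1) \<le> Z"
  shows "cok Z A \<rho> node_exp"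
proof -
  have pw: "m ^ j \<le> Z" if "j \<le> K" for j
    using that n Z by (intro order_trans[OF power_increasing[of j "K + 1" m]]) auto
  have "K + 2 \<le> 2 ^ (K + 1)" by (induction K) auto
  also have "\<dots> \<le> m ^ (K + 1)" using n(3) by (intro power_mono) auto
  finally have K: "K + 2 \<le> Z" using Z by simp
  have m: "m \<le> Z" using order_trans[OF power_increasing[of 1 "K + 1" m] Z] n by simp
  have pn: "n ^ j \<le> Z" "j ^ j \<le> Z" if "j \<le> K" for j
    using order_trans[OF power_mono[of n m j] pw[OF that]] order_trans[OF power_mono[of j m j] pw[OF that]] that n by auto
  have F: "cok Z A (\<rho>(20 := j, 21 := e1, 22 := e2, 23 := e3, 24 := l)) factor_exp"
    if "j \<le> K" "e1 < n ^ j" "e2 < m ^ j" "e3 < j ^ j" "l < j" for j e1 e2 e3 l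
    using that \<rho> n K m pn[OF that(1)] pw[OF that(1)] by (intro factor_ok) auto
  show ?thesis unfolding node_exp_def cok.simps nok.simps neval_folds neval.simps(1-3) apply_nat_op.simps
    using \<rho> K pn pw F by (auto simp: less_Suc_eq_le)
qed


section \<open>The program for a given truncation constant\<close>

definition workspace :: nat where
  "workspace = 40 + (cwidth root_exp + cwidth click_exp + cwidth no_click_exp)"

definition eval_time :: "nat => nat" where
  "eval_time Z = ctime Z root_exp + ctime Z click_exp + ctime Z no_click_exp"

definition boson_program :: "nat => com" where
  "boson_program D = sampling_program D workspace root_exp click_exp no_click_exp"

lemma exps_admissible:
  "e \<in> {root_exp, click_exp, no_click_exp} ==> admissible Z workspace (eval_time Z) e"
  using exps_wf[of e] unfolding admissible_def by (auto simp: workspace_def eval_time_def)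

text \<open>Adding the three expressions to form one lets a single polynomial bound serve for
  all.\<close>

lemma eval_time_poly: "\<exists>a k. \<forall>Z\<ge>1. eval_time Z \<le> a * Z ^ k"
proof -
  have "\<exists>a k. \<forall>Z\<ge>1. ctime Z (CBin CPlus (CBin CPlus root_exp click_exp) no_click_exp) \<le> a * Z ^ k" by (rule ctime_poly)
  then obtain a k where ak: "\<And>Z. 1 \<le> Z ==> ctime Z (CBin CPlus (CBin CPlus root_exp click_exp) no_click_exp) \<le> a * Z ^ k" by blast
  have "eval_time Z \<le> a * Z ^ k" if "1 \<le> Z" for Z
    using ak[OF that] by (simp add: eval_time_def)
  then show ?thesis by blast
qed

lemma node_evaluates:
  assumes n: "0 < n" "n \<le> m" "2 \<le> m" "K \<le> n" and Z: "m ^ (K + 1) \<le> Z" and U: "U \<in> carrier_mat m m"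
    and s: "working n m B K x i o1 s" and o1: "length o1 \<le> m"
  shows "cok Z (\<lambda>t. nreg s (B + t)) (nreg s) node_exp"
    "ceval U (\<lambda>t. nreg s (B + t)) (creg s) (nreg s) node_exp = node_sum n m x U K i o1"
proof -
  have r: "nreg s 0 = n" "nreg s 1 = m" "nreg s 4 = i" "nreg s 5 = K" "nreg s 6 = length o1" "creg s 0 = complex_of_real x"
    "\<And>p. p < length o1 ==> nreg s (B + p) = o1 ! p" using s unfolding working_def by auto
  show "cok Z (\<lambda>t. nreg s (B + t)) (nreg s) node_exp"
    by (rule node_ok[OF r(1,2,4) _ n Z]) (use r o1 in simp)
  show "ceval U (\<lambda>t. nreg s (B + t)) (creg s) (nreg s) node_exp = node_sum n m x U K i o1"
    by (rule node_eval) (use r n U in simp_all)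
qed

lemma Re_of_real_times: "Re (of_real a * z) = a * Re z"
  by simp

lemma click_evaluates:
  assumes n: "0 < n" "n \<le> m" "2 \<le> m" "K \<le> n" and Z: "m ^ (K + 1) \<le> Z" and U: "U \<in> carrier_mat m m"
    and o1: "length o1 \<le> i" "i < m"
  shows "evaluates U Z n m B K x (Suc i) (o1 @ [i]) click_exp (real (n - length o1) * Re (node_sum n m x U K (Suc i) (o1 @ [i])))"
    "evaluates U Z n m B K x (Suc i) o1 no_click_exp (real (m - i - (n - length o1)) * Re (node_sum n m x U K (Suc i) o1))"
proof -
  show "evaluates U Z n m B K x (Suc i) (o1 @ [i]) click_exp (real (n - length o1) * Re (node_sum n m x U K (Suc i) (o1 @ [i])))"
    unfolding evaluates_def
  proof (intro allI impI)
    fix s assume s: "working n m B K x (Suc i) (o1 @ [i]) s"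
    have l: "length (o1 @ [i]) \<le> m" using o1 by simp
    have r: "nreg s 0 = n" "nreg s 6 = Suc (length o1)" using s unfolding working_def by auto
    show "cok Z (\<lambda>t. nreg s (B + t)) (nreg s) click_exp \<and> Re (ceval U (\<lambda>t. nreg s (B + t)) (creg s) (nreg s) click_exp) =
        real (n - length o1) * Re (node_sum n m x U K (Suc i) (o1 @ [i]))"
      using node_evaluates[OF n Z U s l] r by (simp add: click_exp_def del: of_nat_diff)
  qed
  show "evaluates U Z n m B K x (Suc i) o1 no_click_exp (real (m - i - (n - length o1)) * Re (node_sum n m x U K (Suc i) o1))"
    unfolding evaluates_def
  proof (intro allI impI)
    fix s assume s: "working n m B K x (Suc i) o1 s"
    have l: "length o1 \<le> m" using o1 by simp
    have r: "nreg s 0 = n" "nreg s 6 = length o1" "nreg s 1 = m" "nreg s 4 = Suc i" using s unfolding working_def by auto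
    show "cok Z (\<lambda>t. nreg s (B + t)) (nreg s) no_click_exp \<and> Re (ceval U (\<lambda>t. nreg s (B + t)) (creg s) (nreg s) no_click_exp) =
        real (m - i - (n - length o1)) * Re (node_sum n m x U K (Suc i) o1)"
      using node_evaluates[OF n Z U s l] r by (simp add: no_click_exp_def del: of_nat_diff)
  qed
qed

lemma root_evaluates:
  assumes n: "0 < n" "n \<le> m" "2 \<le> m" "K \<le> n" and Z: "m ^ (K + 1) \<le> Z" and U: "U \<in> carrier_mat m m"
  shows "evaluates U Z n m B K x 0 [] root_exp (\<Sum>z\<in>collision_free n m. clicks_weight n m x U K z)"
  unfolding evaluates_def
proof (intro allI impI)
  fix s assume s: "working n m B K x 0 [] s"
  have r: "nreg s 0 = n" "nreg s 1 = m" "nreg s (Suc 0) = m" using s unfolding working_def by auto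
  have m: "n \<le> Z" using order_trans[OF power_increasing[of 1 "K + 1" m] Z] n by simp
  let ?A = "\<lambda>t. nreg s (B + t)"
  note node = node_evaluates[OF n Z U s, simplified]
  have "ceval U ?A (creg s) (nreg s) root_exp =
      complex_of_real (\<Prod>a<n. real (m - a) / real m) * node_sum n m x U K 0 []"
    unfolding root_exp_def ceval.simps(3) apply_cpx_op.simps node(2)
    using r by (simp add: prod_dividef del: of_nat_diff)
  then have "Re (ceval U ?A (creg s) (nreg s) root_exp) = (\<Prod>a<n. real (m - a) / real m) * Re (node_sum n m x U K 0 [])"
    by (simp only: Re_of_real_times)
  moreover have "cok Z ?A (nreg s) root_exp" unfolding root_exp_def using r m node(1) by simp
  ultimately show "cok Z ?A (nreg s) root_exp \<and> Re (ceval U ?A (creg s) (nreg s) root_exp) = (\<Sum>z\<in>collision_free n m. clicks_weight n m x U K z)"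
    using root_weight[of n m x U K] n by simp
qed

lemma boson_program_gives:
  fixes D n m :: nat
  assumes x: "0 \<le> x" "x < 1" and \<eta>: "0 < \<epsilon> * \<delta>" and n: "0 < n" "n \<le> m" "2 \<le> m" and U: "U \<in> carrier_mat m m"
  defines "K' \<equiv> LEAST k. real D * ((1 + x) / 2) ^ k \<le> \<epsilon> * \<delta>"
  defines "K \<equiv> min K' n"
  defines "s \<equiv> \<Sum>z\<in>collision_free n m. clicks_weight n m x U K z"
  defines "T \<equiv> eval_time (m ^ (K + 1))"
  shows "sampler (boson_program D) n m U x \<epsilon> \<delta> (K' * 4 + T + m * (2 * T + 50) + 20 * n + 6 * workspace + 150)
    (tree_sampler n m (max 0 s / (max 0 s + max 0 (1 - s))) (click_prob n m x U K))"
proof (rule gives_sampler)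
  have K: "K \<le> n" by (simp add: K_def)
  have Kmin: "min (LEAST k. real D * ((1 + x) / 2) ^ k \<le> \<epsilon> * \<delta>) n = K" by (simp add: K_def K'_def)
  show "gives n U ([boson_program D], initial_state n m x \<epsilon> \<delta>) (K' * 4 + T + m * (2 * T + 50) + 20 * n + 6 * workspace + 150)
    (tree_sampler n m (max 0 s / (max 0 s + max 0 (1 - s))) (click_prob n m x U K))"
    unfolding boson_program_def K'_def
  proof (rule sampling_program_gives[where D = D and Z = "m ^ (K + 1)" and v = s and
        ?w1.0 = "\<lambda>i o1. real (n - length o1) * Re (node_sum n m x U K (Suc i) (o1 @ [i]))" and
        ?w0.0 = "\<lambda>i o1. real (m - i - (n - length o1)) * Re (node_sum n m x U K (Suc i) o1)", OF x \<eta> n(1), unfolded Kmin])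
    show "admissible (m ^ (K + 1)) workspace T root_exp" "admissible (m ^ (K + 1)) workspace T click_exp"
      "admissible (m ^ (K + 1)) workspace T no_click_exp" unfolding T_def by (rule exps_admissible, simp)+
    show "evaluates U (m ^ (K + 1)) n m (workspace + n) K x 0 [] root_exp s"
      unfolding s_def by (rule root_evaluates[OF n K order_refl U])
    fix i o1
    show "evaluates U (m ^ (K + 1)) n m (workspace + n) K x (Suc i) (o1 @ [i]) click_exp (real (n - length o1) * Re (node_sum n m x U K (Suc i) (o1 @ [i])))"
      "evaluates U (m ^ (K + 1)) n m (workspace + n) K x (Suc i) o1 no_click_exp (real (m - i - (n - length o1)) * Re (node_sum n m x U K (Suc i) o1))"
      if "i < m" "length o1 \<le> i"
      by (rule click_evaluates[OF n K order_refl U that(2,1)])+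
    \<comment> \<open>The program cuts off after multiplying, \<open>click_prob\<close> before; a
      nonnegative factor commutes with \<open>max 0\<close>.\<close>
    have mx: "max 0 (real a * b) = real a * max 0 b" for a b
      by (cases "0 \<le> b") (auto simp: max_def mult_nonneg_nonneg zero_le_mult_iff)
    show "click_prob n m x U K i o1 = max 0 (real (n - length o1) * Re (node_sum n m x U K (Suc i) (o1 @ [i]))) /
       (max 0 (real (n - length o1) * Re (node_sum n m x U K (Suc i) (o1 @ [i]))) +
        max 0 (real (m - i - (n - length o1)) * Re (node_sum n m x U K (Suc i) o1)))"
      unfolding click_prob_def Let_def mx ..
  qed simp
qed

section \<open>The truncation error\<close>

definition tail :: "nat => nat => real => nat => complex mat => real" where
  "tail n m x K U = (\<Sum>z\<in>collision_free n m. \<Sum>j\<in>{K<..n}. x ^ j * cmod (chaos n (1 / real m) j (\<lambda>i p. U $$ (i, z ! p))))"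

lemma tail_nonneg: "0 \<le> x ==> 0 \<le> tail n m x K U"
  unfolding tail_def by (intro sum_nonneg) auto

lemma clicks_weight_error:
  assumes z: "z \<in> collision_free n m" and n: "0 < n" "n \<le> m" "K \<le> n" and x: "0 \<le> x" "x \<le> 1" and U: "U \<in> carrier_mat m m"
  shows "\<bar>noisy_click_prob n m x U z - clicks_weight n m x U K z\<bar> \<le>
    (\<Sum>j\<in>{K<..n}. x ^ j * cmod (chaos n (1 / real m) j (\<lambda>i p. U $$ (i, z ! p))))"
proof -
  let ?c = "\<lambda>j. chaos n (1 / real m) j (\<lambda>i p. U $$ (i, z ! p))"
  have "complex_of_real (noisy_click_prob n m x U z) = (\<Sum>j\<le>n. of_real x ^ j * ?c j)"
    unfolding noisy_click_prob_eq[OF U z n(1,2) x] noisy_sum_def by (rule noisy_sum_eq_chaos)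
  moreover have "estimate n m x U K z = (\<Sum>j\<le>K. of_real x ^ j * ?c j)" by (rule estimate_eq_chaos[OF z n])
  moreover have "(\<Sum>j\<le>n. of_real x ^ j * ?c j) = (\<Sum>j\<le>K. of_real x ^ j * ?c j) + (\<Sum>j\<in>{K<..n}. of_real x ^ j * ?c j)"
    using n(3) by (subst sum.union_disjoint[symmetric]) (auto intro!: sum.cong)
  ultimately have "complex_of_real (noisy_click_prob n m x U z) - estimate n m x U K z = (\<Sum>j\<in>{K<..n}. of_real x ^ j * ?c j)" by simp
  moreover have "noisy_click_prob n m x U z - clicks_weight n m x U K z = Re (complex_of_real (noisy_click_prob n m x U z) - estimate n m x U K z)"
    using z by (simp add: clicks_weight_def collision_free_def)
  ultimately have "noisy_click_prob n m x U z - clicks_weight n m x U K z = Re (\<Sum>j\<in>{K<..n}. of_real x ^ j * ?c j)"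
    by (simp only:)
  then have "\<bar>noisy_click_prob n m x U z - clicks_weight n m x U K z\<bar> \<le> cmod (\<Sum>j\<in>{K<..n}. of_real x ^ j * ?c j)"
    using abs_Re_le_cmod[of "\<Sum>j\<in>{K<..n}. of_real x ^ j * ?c j"] by (simp only:)
  also have "\<dots> \<le> (\<Sum>j\<in>{K<..n}. cmod (of_real x ^ j * ?c j))" by (rule norm_sum)
  also have "\<dots> = (\<Sum>j\<in>{K<..n}. x ^ j * cmod (?c j))" using x by (simp add: norm_mult norm_power)
  finally show ?thesis .
qed

lemma sampler_error:
  assumes n: "0 < n" "n \<le> m" "K \<le> n" and x: "0 \<le> x" "x \<le> 1" and U: "U \<in> unitary_group m"
  defines "s \<equiv> \<Sum>z\<in>collision_free n m. clicks_weight n m x U K z"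
  shows "total_variation (outcomes n m) (noisy_prob n m x U)
    (pmf (tree_sampler n m (max 0 s / (max 0 s + max 0 (1 - s))) (click_prob n m x U K))) \<le> 6 * tail n m x K U"
proof -
  have "total_variation (outcomes n m) (noisy_prob n m x U)
    (pmf (tree_sampler n m (max 0 s / (max 0 s + max 0 (1 - s))) (click_prob n m x U K)))
    \<le> 6 * (\<Sum>z\<in>collision_free n m. \<bar>noisy_prob n m x U (Clicks z) - clicks_weight n m x U K z\<bar>)"
  proof (rule tree_sampler_error)
    show "0 \<le> click_prob n m x U K i o1 \<and> click_prob n m x U K i o1 \<le> 1" for i o1 by (rule click_prob_01)
    show "click_prob n m x U K i o1 * (max 0 (weight (clicks_weight n m x U K) m (Suc i) (o1 @ [i])) +
        max 0 (weight (clicks_weight n m x U K) m (Suc i) o1)) = max 0 (weight (clicks_weight n m x U K) m (Suc i) (o1 @ [i]))"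
      if "i < m" "sorted_wrt (<) o1" "set o1 \<subseteq> {..<i}" for i o1
      using click_prob_weights[OF that] unfolding node_weight_def .
    show "clicks_weight n m x U K z = 0" if "length z \<noteq> n" for z using that by (simp add: clicks_weight_def)
    show "0 \<le> noisy_prob n m x U Collision" using sum_noisy_click_prob_le_1[OF U n(1,2) x] by simp
  qed (simp_all add: s_def noisy_click_prob_nonneg)
  also have "\<dots> \<le> 6 * tail n m x K U"
  proof -
    have "U \<in> carrier_mat m m" using U by (simp add: unitary_group_def)
    then show ?thesis unfolding tail_def
      using clicks_weight_error[OF _ n x] by (intro mult_left_mono sum_mono) auto
  qed
  finally show ?thesis .
qed

lemma power_tail_le:
  assumes "0 \<le> x" "x < (1 :: real)"
  shows "(\<Sum>j\<in>{K<..n}. x ^ j) \<le> x ^ K / (1 - x)"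
proof -
  have "(\<Sum>j\<in>{K<..n}. x ^ j) \<le> (\<Sum>j\<in>{K..<K + (n + 1)}. x ^ j)"
    using assms by (intro sum_mono2) auto
  also have "\<dots> = x ^ K * (\<Sum>j<n + 1. x ^ j)"
    by (simp only: sum.atLeastLessThan_shift_0[of _ K] sum_distrib_left) (simp add: power_add lessThan_atLeast0)
  also have "\<dots> \<le> x ^ K * (1 / (1 - x))"
  proof (rule mult_left_mono)
    have "(\<Sum>j<n + 1. x ^ j) = (1 - x ^ (n + 1)) / (1 - x)" using assms sum_gp_strict[of x "n + 1"] by simp
    also have "\<dots> \<le> 1 / (1 - x)" using assms by (intro divide_right_mono) auto
    finally show "(\<Sum>j<n + 1. x ^ j) \<le> 1 / (1 - x)" .
  qed (use assms in simp)
  finally show ?thesis by simp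
qed

lemma chaos_columns_measurable:
  assumes "haar m \<mu>" "n \<le> m" "z \<in> collision_free n m"
  shows "(\<lambda>U. chaos n (1 / real m) j (\<lambda>i p. U $$ (i, z ! p))) \<in> borel_measurable \<mu>"
proof -
  interpret haar m \<mu> by fact
  have z: "z ! p < m" if "p < n" for p
    using assms(3) that subsetD[OF _ nth_mem[of p z], of "{..<m}"] by (auto simp: collision_free_def)
  have "(\<lambda>U. chaos n (1 / real m) j (\<lambda>i p. if i < n \<and> p < n then U $$ (i, z ! p) else 0)) \<in> borel_measurable \<mu>"
  proof (rule chaos_measurable)
    fix i p
    show "(\<lambda>U. if i < n \<and> p < n then U $$ (i, z ! p) else 0) \<in> borel_measurable \<mu>"
    proof (cases "i < n \<and> p < n")
      case True
      then show ?thesis using assms(2) z measurable_entry[of i "z ! p"] by simp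
    next
      case False
      show ?thesis unfolding if_not_P[OF False] by simp
    qed
  qed
  moreover have "chaos n (1 / real m) j (\<lambda>i p. if i < n \<and> p < n then U $$ (i, z ! p) else 0) = chaos n (1 / real m) j (\<lambda>i p. U $$ (i, z ! p))" for U
    by (rule chaos_depends) simp
  ultimately show ?thesis by simp
qed

lemma tail_measurable:
  assumes "haar m \<mu>" "n \<le> m"
  shows "tail n m x K \<in> borel_measurable \<mu>"
proof -
  interpret haar m \<mu> by fact
  note [measurable] = chaos_columns_measurable[OF assms]
  show ?thesis unfolding tail_def by measurable
qed

text \<open>With \<open>w = fact n / m ^ n\<close>, the second moment
  \<open>exp 15 * w\<^sup>2\<close> gives a first moment of order \<open>w\<close>. There are at
  most \<open>1 / w\<close> collision-free outcomes, and the powers of \<open>x\<close> form a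
  geometric series.\<close>

lemma tail_expectation:
  assumes "haar m \<mu>" and n: "0 < n" "n ^ 3 + n \<le> m" and x: "0 \<le> x" "x < 1"
  shows "(\<integral>\<^sup>+U. indicator {U. flat_rows n m n U} U * ennreal (tail n m x K U) \<partial>\<mu>)
    \<le> ennreal ((exp 15 + 1) / (2 * (1 - x)) * x ^ K)"
proof -
  interpret haar m \<mu> by fact
  have nm: "n \<le> m" "0 < m" using n by auto
  define w where "w = fact n * (1 / real m) ^ n"
  have w: "0 < w" using nm by (simp add: w_def)
  let ?c = "\<lambda>z j U. cmod (chaos n (1 / real m) j (\<lambda>i p. U $$ (i, z ! p)))"
  let ?I = "indicator {U. flat_rows n m n U} :: complex mat => ennreal"
  have [measurable]: "Measurable.pred \<mu> (flat_rows n m n)" by (rule flat_rows_measurable[OF assms(1) nm(1)])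
  have I_meas [measurable]: "?I \<in> borel_measurable \<mu>" by measurable
  have c_meas [measurable]: "?c z j \<in> borel_measurable \<mu>" if "z \<in> collision_free n m" for z j
    using chaos_columns_measurable[OF assms(1) nm(1) that] by simp
  have one: "(\<integral>\<^sup>+U. ?I U * ennreal (?c z j U) \<partial>\<mu>) \<le> ennreal ((exp 15 + 1) / 2 * w)" if z: "z \<in> collision_free n m" for z j
  proof -
    have zp: "length z = n" "sorted_wrt (<) z" "set z \<subseteq> {..<m}" using z by (auto simp: collision_free_def)
    \<comment> \<open>Takes the place of Cauchy-Schwarz: a pointwise bound of \<open>c\<close> by
      its square, balanced at \<open>c = w\<close>.\<close>
    have amgm: "c \<le> c\<^sup>2 / (2 * w) + w / 2" for c :: real
    proof -
      have "0 \<le> (c - w)\<^sup>2 / (2 * w)" using w by simp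
      also have "\<dots> = c\<^sup>2 / (2 * w) + w / 2 - c" using w by (simp add: power2_eq_square field_simps)
      finally show ?thesis by simp
    qed
    have "(\<integral>\<^sup>+U. ?I U * ennreal (?c z j U) \<partial>\<mu>) \<le> (\<integral>\<^sup>+U. ennreal (1 / (2 * w)) * (?I U * ennreal ((?c z j U)\<^sup>2)) + ennreal (w / 2) \<partial>\<mu>)"
    proof (rule nn_integral_mono)
      fix U
      have "ennreal (?c z j U) \<le> ennreal ((?c z j U)\<^sup>2 / (2 * w) + w / 2)" by (intro ennreal_leI amgm)
      also have "\<dots> = ennreal (1 / (2 * w)) * ennreal ((?c z j U)\<^sup>2) + ennreal (w / 2)"
        using w by (simp add: ennreal_mult[symmetric] ennreal_plus[symmetric] del: ennreal_plus)
      finally show "?I U * ennreal (?c z j U) \<le> ennreal (1 / (2 * w)) * (?I U * ennreal ((?c z j U)\<^sup>2)) + ennreal (w / 2)"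
        by (auto simp: indicator_def)
    qed
    also have "\<dots> = ennreal (1 / (2 * w)) * (\<integral>\<^sup>+U. ?I U * ennreal ((?c z j U)\<^sup>2) \<partial>\<mu>) + ennreal (w / 2)"
      using z by (subst nn_integral_add) (auto simp: nn_integral_cmult emeasure_space_1)
    also have "\<dots> \<le> ennreal (1 / (2 * w)) * ennreal (exp 15 * w\<^sup>2) + ennreal (w / 2)"
    proof (intro add_right_mono mult_left_mono)
      have inj: "inj_on (\<lambda>p. z ! p) {..<n}" using zp by (intro inj_on_nth) (auto simp: strict_sorted_iff)
      have img: "(\<lambda>p. z ! p) ` {..<n} \<subseteq> {..<m}" using zp by (auto simp: set_conv_nth)
      show "(\<integral>\<^sup>+U. ?I U * ennreal ((?c z j U)\<^sup>2) \<partial>\<mu>) \<le> ennreal (exp 15 * w\<^sup>2)"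
        unfolding w_def by (rule haar_chaos_second_moment[OF assms(1) n inj img])
    qed simp
    also have "\<dots> = ennreal (1 / (2 * w) * (exp 15 * w\<^sup>2) + w / 2)"
      using w by (simp add: ennreal_mult[symmetric] ennreal_plus[symmetric] del: ennreal_plus)
    also have "1 / (2 * w) * (exp 15 * w\<^sup>2) + w / 2 = (exp 15 + 1) / 2 * w"
      using w by (simp add: power2_eq_square field_simps)
    finally show ?thesis .
  qed
  have "(\<integral>\<^sup>+U. ?I U * ennreal (tail n m x K U) \<partial>\<mu>) =
      (\<integral>\<^sup>+U. (\<Sum>z\<in>collision_free n m. \<Sum>j\<in>{K<..n}. ennreal (x ^ j) * (?I U * ennreal (?c z j U))) \<partial>\<mu>)"
  proof (rule nn_integral_cong)
    fix U
    have "ennreal (tail n m x K U) = (\<Sum>z\<in>collision_free n m. \<Sum>j\<in>{K<..n}. ennreal (x ^ j) * ennreal (?c z j U))"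
      unfolding tail_def using x by (subst sum_ennreal[symmetric], simp add: sum_nonneg, subst sum_ennreal[symmetric]) (auto simp: ennreal_mult)
    then show "?I U * ennreal (tail n m x K U) = (\<Sum>z\<in>collision_free n m. \<Sum>j\<in>{K<..n}. ennreal (x ^ j) * (?I U * ennreal (?c z j U)))"
      by (simp add: sum_distrib_left mult_ac)
  qed
  also have "\<dots> = (\<Sum>z\<in>collision_free n m. \<Sum>j\<in>{K<..n}. ennreal (x ^ j) * (\<integral>\<^sup>+U. ?I U * ennreal (?c z j U) \<partial>\<mu>))"
    by (subst nn_integral_sum, measurable, intro sum.cong refl, subst nn_integral_sum, measurable, intro sum.cong refl, rule nn_integral_cmult, measurable)
  also have "\<dots> \<le> (\<Sum>z\<in>collision_free n m. \<Sum>j\<in>{K<..n}. ennreal (x ^ j) * ennreal ((exp 15 + 1) / 2 * w))"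
    by (intro sum_mono mult_left_mono one) auto
  also have "\<dots> = ennreal (\<Sum>z\<in>collision_free n m. \<Sum>j\<in>{K<..n}. x ^ j * ((exp 15 + 1) / 2 * w))"
  proof -
    have nn: "0 \<le> x ^ j * ((exp 15 + 1) / 2 * w)" for j using x w by simp
    have "ennreal (x ^ j) * ennreal ((exp 15 + 1) / 2 * w) = ennreal (x ^ j * ((exp 15 + 1) / 2 * w))" for j
      using x w by (intro ennreal_mult[symmetric]) auto
    then show ?thesis using nn by (simp only: sum_ennreal sum_nonneg)
  qed
  also have "\<dots> \<le> ennreal ((exp 15 + 1) / (2 * (1 - x)) * x ^ K)"
  proof (rule ennreal_leI)
    have "(\<Sum>z\<in>collision_free n m. \<Sum>j\<in>{K<..n}. x ^ j * ((exp 15 + 1) / 2 * w)) =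
        (exp 15 + 1) / 2 * (real (card (collision_free n m)) * w) * (\<Sum>j\<in>{K<..n}. x ^ j)"
      by (simp add: sum_distrib_left sum_distrib_right mult_ac)
    also have "\<dots> \<le> (exp 15 + 1) / 2 * 1 * (x ^ K / (1 - x))"
    proof (intro mult_mono mult_nonneg_nonneg power_tail_le x)
      have "real (card (collision_free n m)) * w = (fact n * real (card (collision_free n m))) / real m ^ n"
        by (simp add: w_def power_divide)
      also have "\<dots> \<le> 1" using card_collision_free_le[of n m] nm by (simp add: divide_le_eq)
      finally show "real (card (collision_free n m)) * w \<le> 1" .
    qed (use x w in \<open>auto intro: sum_nonneg\<close>)
    finally show "(\<Sum>z\<in>collision_free n m. \<Sum>j\<in>{K<..n}. x ^ j * ((exp 15 + 1) / 2 * w)) \<le> (exp 15 + 1) / (2 * (1 - x)) * x ^ K"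
      by simp
  qed
  finally show ?thesis .
qed

text \<open>Markov's inequality on the flat event, plus the probability that some row is not flat;
  each may use \<open>\<delta> / 2\<close>. The constant 12 is the 6 of the sampler error times this
  2.\<close>

lemma tail_small:
  assumes "haar m \<mu>" and n: "0 < n" "n ^ 3 + n \<le> m" and x: "0 \<le> x" "x < 1" and \<eta>: "0 < \<epsilon>" "0 < \<delta>"
    and K: "12 * ((exp 15 + 1) / (2 * (1 - x))) * x ^ K \<le> \<epsilon> * \<delta>"
    and flat: "4 * real n * real m * exp (- real m / (4 * real n ^ 3)) \<le> \<delta> / 2"
  shows "\<exists>G\<in>sets \<mu>. 1 - \<delta> \<le> measure \<mu> G \<and> (\<forall>U\<in>G. 6 * tail n m x K U \<le> \<epsilon>)"
proof -
  interpret haar m \<mu> by fact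
  have nm: "n \<le> m" using n by simp
  have [measurable]: "Measurable.pred \<mu> (flat_rows n m n)" by (rule flat_rows_measurable[OF assms(1) nm])
  have [measurable]: "tail n m x K \<in> borel_measurable \<mu>" by (rule tail_measurable[OF assms(1) nm])
  let ?I = "indicator {U. flat_rows n m n U} :: complex mat => ennreal"
  define G where "G = {U \<in> space \<mu>. flat_rows n m n U \<and> 6 * tail n m x K U \<le> \<epsilon>}"
  define B1 where "B1 = {U \<in> space \<mu>. \<not> flat_rows n m n U}"
  define B2 where "B2 = {U \<in> space \<mu>. flat_rows n m n U \<and> \<epsilon> < 6 * tail n m x K U}"
  have sets: "G \<in> sets \<mu>" "B1 \<in> sets \<mu>" "B2 \<in> sets \<mu>" unfolding G_def B1_def B2_def by measurable
  have "ennreal \<epsilon> * emeasure \<mu> B2 = (\<integral>\<^sup>+U. ennreal \<epsilon> * indicator B2 U \<partial>\<mu>)" using sets by (simp add: nn_integral_cmult_indicator)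
  also have "\<dots> \<le> (\<integral>\<^sup>+U. ennreal 6 * (?I U * ennreal (tail n m x K U)) \<partial>\<mu>)"
  proof (rule nn_integral_mono)
    fix U assume "U \<in> space \<mu>"
    show "ennreal \<epsilon> * indicator B2 U \<le> ennreal 6 * (?I U * ennreal (tail n m x K U))"
    proof (cases "U \<in> B2")
      case True
      then have "ennreal \<epsilon> \<le> ennreal (6 * tail n m x K U)" by (intro ennreal_leI) (simp add: B2_def)
      also have "\<dots> = ennreal 6 * ennreal (tail n m x K U)" using x by (intro ennreal_mult) (auto intro: tail_nonneg)
      finally show ?thesis using True by (simp add: B2_def)
    qed simp
  qed
  also have "\<dots> = ennreal 6 * (\<integral>\<^sup>+U. ?I U * ennreal (tail n m x K U) \<partial>\<mu>)"
    by (rule nn_integral_cmult) measurable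
  also have "\<dots> \<le> ennreal 6 * ennreal ((exp 15 + 1) / (2 * (1 - x)) * x ^ K)"
    by (intro mult_left_mono tail_expectation[OF assms(1) n x]) simp
  also have "\<dots> = ennreal (6 * ((exp 15 + 1) / (2 * (1 - x)) * x ^ K))"
    using x by (intro ennreal_mult[symmetric]) auto
  also have "\<dots> \<le> ennreal (\<epsilon> * \<delta> / 2)"   proof (rule ennreal_leI)
    have "6 * (c * y) \<le> e / 2" if "12 * c * y \<le> e" for c y e :: real using that by simp
    from this[OF K] show "6 * ((exp 15 + 1) / (2 * (1 - x)) * x ^ K) \<le> \<epsilon> * \<delta> / 2" .
  qed
  finally have "ennreal (\<epsilon> * measure \<mu> B2) \<le> ennreal (\<epsilon> * \<delta> / 2)"
    using \<eta> by (simp add: emeasure_eq_measure ennreal_mult)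
  then have B2: "measure \<mu> B2 \<le> \<delta> / 2" using \<eta> by (simp add: ennreal_le_iff)
  have B1: "measure \<mu> B1 \<le> \<delta> / 2" using not_flat_rows[OF n(1) nm] flat unfolding B1_def by linarith
  have "space \<mu> = G \<union> (B1 \<union> B2)" by (auto simp: G_def B1_def B2_def)
  then have "1 \<le> measure \<mu> G + measure \<mu> (B1 \<union> B2)"
    using measure_Un_le[of G \<mu> "B1 \<union> B2"] sets prob_space by simp
  also have "measure \<mu> (B1 \<union> B2) \<le> \<delta> / 2 + \<delta> / 2"
    using measure_Un_le[of B1 \<mu> B2] sets B1 B2 by simp
  finally have "1 - \<delta> \<le> measure \<mu> G" by simp
  then show ?thesis using sets(1) by (intro bexI[of _ G]) (auto simp: G_def)
qed


section \<open>Running time\<close>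

text \<open>The order is logarithmic in \<open>D / \<eta>\<close>; this is the source of the
  logarithms of \<open>\<epsilon>\<close> and \<open>\<delta>\<close> in the running time.\<close>

lemma order_bound:
  fixes D :: nat
  assumes \<rho>: "0 < \<rho>" "\<rho> < 1" and D: "1 \<le> D" and \<eta>: "0 < \<eta>" "\<eta> \<le> 1"
  defines "K \<equiv> LEAST k. real D * \<rho> ^ k \<le> \<eta>"
  shows "real D * \<rho> ^ K \<le> \<eta>" "real K \<le> 1 + (ln (real D) + ln (1 / \<eta>)) / ln (1 / \<rho>)"
proof -
  define y where "y = (ln (real D) + ln (1 / \<eta>)) / ln (1 / \<rho>)"
  define k where "k = nat \<lceil>y\<rceil>"
  have l: "0 < ln (1 / \<rho>)" using \<rho> by simp
  have y: "0 \<le> y" unfolding y_def using l D \<eta> by (intro divide_nonneg_pos add_nonneg_nonneg) auto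
  have k: "y \<le> real k" "real k \<le> y + 1" unfolding k_def using y by linarith+
  have "ln (real D) + ln (1 / \<eta>) = y * ln (1 / \<rho>)" using l by (simp add: y_def)
  also have "\<dots> \<le> real k * ln (1 / \<rho>)" using k l by (intro mult_right_mono) auto
  finally have "ln (real D * \<rho> ^ k) \<le> ln \<eta>"
    using D \<rho> \<eta> by (simp add: ln_mult ln_realpow ln_div)
  then have "real D * \<rho> ^ k \<le> \<eta>" using D \<rho> \<eta> by (subst (asm) ln_le_cancel_iff) auto
  then have "K \<le> k" "real D * \<rho> ^ K \<le> \<eta>" unfolding K_def by (auto intro: Least_le LeastI)
  then show "real D * \<rho> ^ K \<le> \<eta>" "real K \<le> 1 + (ln (real D) + ln (1 / \<eta>)) / ln (1 / \<rho>)"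
    using k unfolding y_def by auto
qed

text \<open>With \<open>M = 8 * N ^ 3 * y\<close> the exponent is \<open>2 * y\<close>. One half
  absorbs the factor \<open>M\<close>, as \<open>y * exp (- y) \<le> 1\<close>; the other gives
  \<open>exp (- (N ^ 2))\<close>, because \<open>y\<close> is at least \<open>N ^ 2\<close>.\<close>

lemma flat_bound:
  fixes N M :: real
  assumes "1 \<le> N" "8 * N ^ 5 \<le> M"
  shows "4 * N * M * exp (- M / (4 * N ^ 3)) \<le> 32 * N ^ 4 * exp (- (N ^ 2))"
proof -
  define y where "y = M / (8 * N ^ 3)"
  have N: "0 < N ^ 3" using assms by simp
  have M: "M = 8 * N ^ 3 * y" using N by (simp add: y_def)
  have 5: "N ^ 5 = N ^ 3 * N ^ 2" by (simp add: power_add[symmetric])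
  have "(8 * N ^ 3) * N ^ 2 \<le> (8 * N ^ 3) * y" using assms(2) unfolding M 5 by (simp only: mult.assoc)
  then have y: "N ^ 2 \<le> y" by (rule mult_left_le_imp_le) (use N in simp)
  have e: "- M / (4 * N ^ 3) = - y + - y" using N unfolding M by (simp add: field_simps)
  have y0: "0 \<le> y" using y by (rule order_trans[rotated]) simp
  have "y \<le> exp y" using exp_ge_add_one_self[of y] by linarith
  then have "y * exp (- y) \<le> 1" by (simp add: exp_minus field_simps)
  then have "32 * N ^ 4 * (y * exp (- y)) * exp (- y) \<le> 32 * N ^ 4 * 1 * exp (- (N ^ 2))"
    using y y0 assms(1) by (intro mult_mono) auto
  moreover have "4 * N * M * exp (- M / (4 * N ^ 3)) = 32 * N ^ 4 * (y * exp (- y)) * exp (- y)"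
  proof -
    have E: "exp (- M / (4 * N ^ 3)) = exp (- y) * exp (- y)" unfolding e by (rule exp_add)
    show ?thesis unfolding E by (simp add: M power_add[symmetric] numeral_eq_Suc)
  qed
  ultimately show ?thesis by (simp only:)
qed

text \<open>The count is at most a constant times the product of \<open>K' + 1\<close>,
  \<open>T + 1\<close>, \<open>M + 1\<close> and \<open>N + 1\<close>, and each of these is bounded
  by a power of \<open>N\<close>. For \<open>T\<close>, the power \<open>M ^ ((K + 1) * k)\<close>
  is at most \<open>N\<close> to a multiple of \<open>K' + 1 \<le> c * S\<close>. Additive constants
  in the exponent are absorbed through \<open>1 \<le> S\<close>.\<close>

lemma time_bound:
  fixes N M K K' t a k c0 W d :: nat and S c :: real
  assumes T: "T \<le> a * (M ^ (K + 1)) ^ k" and K: "K \<le> K'" "real (K' + 1) \<le> c * S" and c: "0 \<le> c" and S: "1 \<le> S"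
    and M: "1 \<le> M" "M \<le> N ^ d" and N: "3 \<le> N" "a + 1 \<le> N" "233 + 6 * W \<le> N"
  shows "real (K' * 4 + T + M * (2 * T + 50) + 20 * N + 6 * W + 150) \<le> real N powr ((c + d * k * c + d + 5) * S)"
proof -
  have N1: "1 \<le> real N" "0 < real N" using N by auto
  have "exp 1 \<le> (3 :: real)" by (rule exp_le)
  also have "\<dots> \<le> real N" using N by simp
  finally have lnN: "1 \<le> ln (real N)" using N1 by (subst ln_ge_iff) auto
  have A: "real (K' + 1) \<le> real N powr (c * S)"
  proof -
    have "real (K' + 1) \<le> exp (c * S)" using K(2) exp_ge_add_one_self[of "c * S"] by linarith
    also have "\<dots> \<le> exp (c * S * ln (real N))" using lnN c S mult_left_mono[OF lnN, of "c * S"] by simp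
    finally show ?thesis using N1 by (simp add: powr_def)
  qed
  have B: "real (T + 1) \<le> real N powr (1 + d * k * c * S)"
  proof -
    have 1: "1 \<le> M ^ ((K + 1) * k)" using M by simp
    have "T \<le> a * M ^ ((K + 1) * k)" using T unfolding power_mult .
    then have "T + 1 \<le> (a + 1) * M ^ ((K + 1) * k)" unfolding distrib_right[of a 1] mult_1 using 1 by (rule add_mono)
    also have "\<dots> \<le> N * (N ^ d) ^ ((K' + 1) * k)"
    proof (rule mult_le_mono[OF N(2)])
      have "M ^ ((K + 1) * k) \<le> M ^ ((K' + 1) * k)" using M K by (intro power_increasing mult_le_mono) auto
      also have "\<dots> \<le> (N ^ d) ^ ((K' + 1) * k)" using M by (intro power_mono) auto
      finally show "M ^ ((K + 1) * k) \<le> (N ^ d) ^ ((K' + 1) * k)" .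
    qed
    also have "\<dots> = N ^ (1 + d * k * (K' + 1))" 
    proof -
      have "d * ((K' + 1) * k) = d * k * (K' + 1)" by (simp only: mult_ac)
      then show ?thesis by (simp only: power_mult[symmetric] power_add power_one_right)
    qed
    finally have "real (T + 1) \<le> real (N ^ (1 + d * k * (K' + 1)))" by (simp only: of_nat_le_iff)
    also have "\<dots> = real N powr (1 + d * k * real (K' + 1))"
      using N1(2) by (simp only: of_nat_power powr_realpow[symmetric] of_nat_add of_nat_mult of_nat_1)
    also have "\<dots> \<le> real N powr (1 + d * k * c * S)"
    proof (rule powr_mono[OF _ N1(1)])
      have "real (d * k) * real (K' + 1) \<le> real (d * k) * (c * S)" using K(2) by (rule mult_left_mono) simp
      then show "1 + d * k * real (K' + 1) \<le> 1 + d * k * c * S" by (simp add: mult_ac)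
    qed
    finally show ?thesis .
  qed
  have C: "real (M + 1) \<le> real N powr (1 + d)"
  proof -
    have "M + 1 \<le> N ^ d * 2" using M by linarith
    also have "\<dots> \<le> N ^ d * N" using N(1) by (intro mult_le_mono2) simp
    finally have "real (M + 1) \<le> real (N ^ (d + 1))" by (simp only: of_nat_le_iff power_add power_one_right)
    then show ?thesis using N1 by (simp add: powr_realpow[symmetric] powr_add)
  qed
  have D: "real (N + 1) \<le> real N powr 2"
  proof -
    have "N + 1 \<le> N * 2" using N(1) by linarith
    also have "\<dots> \<le> N * N" using N(1) by (intro mult_le_mono2) simp
    finally have "real (N + 1) \<le> real (N * N)" by (simp only: of_nat_le_iff)
    then show ?thesis using N1 by (simp add: powr_numeral power2_eq_square)
  qed
  have E: "real (233 + 6 * W) \<le> real N powr 1" using N(3) N1 by (simp add: of_nat_le_iff[symmetric] del: of_nat_le_iff)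
  define X where "X = (K' + 1) * (T + 1) * (M + 1) * (N + 1)"
  have X: "K' \<le> X" "T \<le> X" "M * T \<le> X" "M \<le> X" "N \<le> X" "1 \<le> X" by (auto simp: X_def algebra_simps)
  have "K' * 4 + T + M * (2 * T + 50) + 20 * N + 6 * W + 150 = 4 * K' + T + 2 * (M * T) + 50 * M + 20 * N + (6 * W + 150) * 1"
    by (simp add: algebra_simps)
  also have "\<dots> \<le> 4 * X + X + 2 * X + 50 * X + 20 * X + (6 * W + 150) * X"
    using X by (intro add_mono mult_le_mono le_refl)
  also have "\<dots> \<le> (233 + 6 * W) * X" by (simp add: algebra_simps)
  finally have "real (K' * 4 + T + M * (2 * T + 50) + 20 * N + 6 * W + 150) \<le> real ((233 + 6 * W) * X)" by (simp only: of_nat_le_iff)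
  also have "\<dots> = real (233 + 6 * W) * (real (K' + 1) * real (T + 1) * real (M + 1) * real (N + 1))" by (simp only: X_def of_nat_mult)
  also have "\<dots> \<le> real N powr 1 * (real N powr (c * S) * real N powr (1 + d * k * c * S) * real N powr (1 + d) * real N powr 2)"
    by (intro mult_mono A B C D E) auto
  also have "\<dots> = real N powr (5 + d + (c + d * k * c) * S)"
    unfolding powr_add[symmetric] by (simp add: algebra_simps)
  also have "\<dots> \<le> real N powr ((c + d * k * c + d + 5) * S)"
  proof (rule powr_mono[OF _ N1(1)])
    have "(5 + real d) * 1 \<le> (5 + real d) * S" using S by (intro mult_left_mono) auto
    then show "5 + d + (c + d * k * c) * S \<le> (c + d * k * c + d + 5) * S" by (simp add: algebra_simps)
  qed
  finally show ?thesis .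
qed

theorem theorem1:
  fixes M :: "nat \<Rightarrow> nat" and x :: real
  assumes M_poly: "\<exists>d :: nat. (\<lambda>N. real (M N)) \<in> O(\<lambda>N. real N ^ d)"
    and M_large: "filterlim (\<lambda>N. real (M N) / real N ^ 5) at_top sequentially"
    and x: "0 \<le> x" "x < 1"
  shows "\<exists>P :: com. \<exists>C :: real. \<forall>\<^sub>F N in sequentially.
    \<forall>\<epsilon> \<delta>. 0 < \<epsilon> \<and> \<epsilon> < 1 \<and> 0 < \<delta> \<and> \<delta> < 1 \<longrightarrow>
      (\<exists>(t :: nat) (q :: complex mat \<Rightarrow> outcome pmf).
        real t \<le> real N powr (C * (ln (real N) + ln (1 / \<epsilon>) + ln (1 / \<delta>))) \<and>
        (\<forall>U\<in>unitary_group (M N). sampler P N (M N) U x \<epsilon> \<delta> t (q U)) \<and>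
        (\<forall>\<mu>. haar_measure (M N) \<mu> \<longrightarrow>
          (\<exists>G\<in>sets \<mu>. measure \<mu> G \<ge> 1 - \<delta> \<and>
            (\<forall>U\<in>G. set_pmf (q U) \<subseteq> outcomes N (M N) \<and>
              total_variation (outcomes N (M N))
                (noisy_prob N (M N) x U) (pmf (q U)) \<le> \<epsilon>))))"
proof -
  \<comment> \<open>Replaces \<open>x\<close>: still below 1, but positive even for
    \<open>x = 0\<close>, so that \<open>ln (1 / \<rho>)\<close> can be used.\<close>
  define \<rho> where "\<rho> = (1 + x) / 2"
  have \<rho>: "0 < \<rho>" "\<rho> < 1" "x \<le> \<rho>" using x by (auto simp: \<rho>_def)
  \<comment> \<open>The constant demanded by \<open>tail_small\<close>; it is rounded up to
    \<open>D\<close> because programs contain only natural literals.\<close>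
  define C0 where "C0 = 12 * ((exp 15 + 1) / (2 * (1 - x)))"
  define D where "D = nat \<lceil>C0\<rceil> + 1"
  have D: "C0 \<le> real D" "1 \<le> D" unfolding D_def by linarith+
  obtain a k where ak: "\<And>Z. 1 \<le> Z ==> eval_time Z \<le> a * Z ^ k" using eval_time_poly by blast
  obtain d0 where d0: "(\<lambda>N. real (M N)) \<in> O(\<lambda>N. real N ^ d0)" using M_poly by blast
  then obtain b where b: "\<forall>\<^sub>F N in sequentially. norm (real (M N)) \<le> b * norm (real N ^ d0)" by (elim landau_o.bigE)
  \<comment> \<open>The extra power absorbs the constant \<open>b\<close> once
    \<open>b \<le> N\<close>.\<close>
  define d where "d = d0 + 1"
  define c where "c = 2 + ln (real D) / ln (1 / \<rho>) + 1 / ln (1 / \<rho>)"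
  have l: "0 < ln (1 / \<rho>)" using \<rho> by simp
  have lD: "0 \<le> ln (real D)" using D by simp
  have c: "0 \<le> c" unfolding c_def using l lD by (intro add_nonneg_nonneg divide_nonneg_pos) auto
  define C where "C = c + d * k * c + d + 5"
  have "\<forall>\<^sub>F N in sequentially. 8 \<le> real (M N) / real N ^ 5" using M_large by (auto simp: filterlim_at_top)
  \<comment> \<open>The probability of rows that are not flat must undercut every
    \<open>\<delta>\<close> for which truncation takes place; such \<open>\<delta>\<close> are at
    least \<open>\<rho> ^ N\<close>.\<close>
  moreover have "\<forall>\<^sub>F N in sequentially. 32 * real N ^ 4 * exp (- (real N ^ 2)) \<le> exp (- (ln (1 / \<rho>) * real N)) / 2"
    using l by real_asymp
  moreover have "\<forall>\<^sub>F N :: nat in sequentially. max 3 (max (nat \<lceil>b\<rceil>) (max (a + 1) (233 + 6 * workspace))) \<le> N"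
    by (rule eventually_ge_at_top)
  ultimately have "\<forall>\<^sub>F N in sequentially. \<forall>\<epsilon> \<delta>. 0 < \<epsilon> \<and> \<epsilon> < 1 \<and> 0 < \<delta> \<and> \<delta> < 1 \<longrightarrow>
      (\<exists>(t :: nat) (q :: complex mat => outcome pmf).
        real t \<le> real N powr (C * (ln (real N) + ln (1 / \<epsilon>) + ln (1 / \<delta>))) \<and>
        (\<forall>U\<in>unitary_group (M N). sampler (boson_program D) N (M N) U x \<epsilon> \<delta> t (q U)) \<and>
        (\<forall>\<mu>. haar_measure (M N) \<mu> \<longrightarrow>
          (\<exists>G\<in>sets \<mu>. measure \<mu> G \<ge> 1 - \<delta> \<and>
            (\<forall>U\<in>G. set_pmf (q U) \<subseteq> outcomes N (M N) \<and>
              total_variation (outcomes N (M N))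
                (noisy_prob N (M N) x U) (pmf (q U)) \<le> \<epsilon>))))"
    using b
  proof eventually_elim
    case (elim N)
    let ?m = "M N"
    have N: "3 \<le> N" "b \<le> real N" "a + 1 \<le> N" "233 + 6 * workspace \<le> N" using elim(3) by linarith+
    have N1: "1 \<le> real N" "0 < N" using N by auto
    have m8: "8 * real N ^ 5 \<le> real ?m" using elim(1) N1 by (simp add: field_simps)
    have m: "N ^ 3 + N \<le> ?m"
    proof -
      have "real N ^ 3 \<le> real N ^ 5" "real N ^ 1 \<le> real N ^ 5" using N1 by (intro power_increasing; simp)+
      then have "real (N ^ 3 + N) \<le> real ?m" using m8 N1 unfolding of_nat_add of_nat_power power_one_right by linarith
      then show ?thesis by (simp only: of_nat_le_iff)
    qed
    have mN: "N \<le> ?m" "2 \<le> ?m" "1 \<le> ?m" using m N by auto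
    have md: "?m \<le> N ^ d"
    proof -
      have "real ?m \<le> b * real N ^ d0" using elim(4) by simp
      also have "\<dots> \<le> real N * real N ^ d0" using N(2) by (intro mult_right_mono) auto
      finally have "real ?m \<le> real (N ^ d)" by (simp add: d_def)
      then show ?thesis by (simp only: of_nat_le_iff)
    qed
    have flat: "4 * real N * real ?m * exp (- real ?m / (4 * real N ^ 3)) \<le> \<rho> ^ N / 2"
    proof -
      have "exp (- (ln (1 / \<rho>) * real N)) = \<rho> ^ N"
        using \<rho> by (simp add: ln_div exp_of_nat2_mult)
      then show ?thesis using flat_bound[OF N1(1) m8] elim(2) by linarith
    qed
    show ?case
    proof (intro allI impI)
      fix \<epsilon> \<delta> :: real
      assume ed: "0 < \<epsilon> \<and> \<epsilon> < 1 \<and> 0 < \<delta> \<and> \<delta> < 1"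
      have \<eta>: "0 < \<epsilon> * \<delta>" "\<epsilon> * \<delta> \<le> 1" "\<epsilon> * \<delta> \<le> \<delta>"
        using ed mult_mono[of \<epsilon> 1 \<delta> 1] mult_right_mono[of \<epsilon> 1 \<delta>] by auto
      define K' where "K' = (LEAST k. real D * ((1 + x) / 2) ^ k \<le> \<epsilon> * \<delta>)"
      define K where "K = min K' N"
      note ob = order_bound[OF \<rho>(1,2) D(2) \<eta>(1,2), unfolded \<rho>_def, folded K'_def, folded \<rho>_def]
      define T where "T = eval_time (?m ^ (K + 1))"
      define t where "t = K' * 4 + T + ?m * (2 * T + 50) + 20 * N + 6 * workspace + 150"
      define s where "s U = (\<Sum>z\<in>collision_free N ?m. clicks_weight N ?m x U K z)" for U
      define q where "q U = tree_sampler N ?m (max 0 (s U) / (max 0 (s U) + max 0 (1 - s U))) (click_prob N ?m x U K)" for U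
      define S where "S = ln (real N) + ln (1 / \<epsilon>) + ln (1 / \<delta>)"
      have le: "0 \<le> ln (1 / \<epsilon>)" "0 \<le> ln (1 / \<delta>)" using ed by auto
      have lnN: "1 \<le> ln (real N)"
      proof -
        have "exp 1 \<le> (3 :: real)" by (rule exp_le)
        also have "\<dots> \<le> real N" using N by simp
        finally show ?thesis using N1 by (subst ln_ge_iff) auto
      qed
      have S: "1 \<le> S" unfolding S_def using le lnN by simp
      have KS: "real (K' + 1) \<le> c * S"
      proof -
        have e: "ln (1 / (\<epsilon> * \<delta>)) \<le> S" unfolding S_def using ed lnN by (simp add: ln_mult ln_div)
        have "real K' \<le> 1 + ln (real D) / ln (1 / \<rho>) + ln (1 / (\<epsilon> * \<delta>)) / ln (1 / \<rho>)"
          using ob(2) by (simp add: add_divide_distrib)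
        also have "\<dots> \<le> 1 + ln (real D) / ln (1 / \<rho>) + S / ln (1 / \<rho>)"
          using e l by (intro add_left_mono divide_right_mono) auto
        finally have 1: "real (K' + 1) \<le> (2 + ln (real D) / ln (1 / \<rho>)) * 1 + 1 / ln (1 / \<rho>) * S" by simp
        have "(2 + ln (real D) / ln (1 / \<rho>)) * 1 \<le> (2 + ln (real D) / ln (1 / \<rho>)) * S"
          using S l lD by (intro mult_left_mono add_nonneg_nonneg divide_nonneg_pos) auto
        then show ?thesis using 1 unfolding c_def distrib_right by linarith
      qed
      have "T \<le> a * (?m ^ (K + 1)) ^ k" unfolding T_def using mN by (intro ak) simp
      then have "real t \<le> real N powr (C * S)"
        unfolding t_def C_def using KS c S mN md N by (intro time_bound) (auto simp: K_def)
      moreover have "sampler (boson_program D) N ?m U x \<epsilon> \<delta> t (q U)" if "U \<in> unitary_group ?m" for U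
      proof -
        have "U \<in> carrier_mat ?m ?m" using that by (simp add: unitary_group_def)
        from boson_program_gives[OF x \<eta>(1) N1(2) mN(1,2) this, of D]
        show ?thesis unfolding t_def q_def s_def T_def K_def K'_def .
      qed
      moreover have "\<exists>G\<in>sets \<mu>. 1 - \<delta> \<le> measure \<mu> G \<and> (\<forall>U\<in>G. set_pmf (q U) \<subseteq> outcomes N ?m \<and>
          total_variation (outcomes N ?m) (noisy_prob N ?m x U) (pmf (q U)) \<le> \<epsilon>)" if "haar_measure ?m \<mu>" for \<mu>
      proof -
        have h: "haar ?m \<mu>" using that by (rule haar.intro)
        interpret haar ?m \<mu> by (rule h)
        have "\<exists>G\<in>sets \<mu>. 1 - \<delta> \<le> measure \<mu> G \<and> (\<forall>U\<in>G. 6 * tail N ?m x K U \<le> \<epsilon>)"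
        \<comment> \<open>If the order reaches \<open>N\<close>, nothing is truncated and every
          \<open>U\<close> is good, however small \<open>\<delta>\<close> is. Otherwise
          \<open>\<rho> ^ N \<le> D * \<rho> ^ K' \<le> \<delta>\<close>, and the flatness estimate
          suffices.\<close>
        proof (cases "K' < N")
          case False
          then have "tail N ?m x K U = 0" for U by (simp add: tail_def K_def)
          then show ?thesis using ed by (intro bexI[of _ "space \<mu>"]) (auto simp: prob_space)
        next
          case True
          then have K: "K = K'" by (simp add: K_def)
          show ?thesis
          proof (rule tail_small[OF h N1(2) m x])
            have "C0 * x ^ K \<le> real D * \<rho> ^ K"
              using D(1) \<rho> x by (intro mult_mono power_mono) auto
            then show "12 * ((exp 15 + 1) / (2 * (1 - x))) * x ^ K \<le> \<epsilon> * \<delta>"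
              using ob(1) unfolding K C0_def by linarith
            have "1 * \<rho> ^ N \<le> real D * \<rho> ^ K'"
              using True \<rho> D by (intro mult_mono power_decreasing) auto
            then show "4 * real N * real ?m * exp (- real ?m / (4 * real N ^ 3)) \<le> \<delta> / 2"
              using flat ob(1) \<eta>(3) by linarith
          qed (use ed in auto)
        qed
        then obtain G where G: "G \<in> sets \<mu>" "1 - \<delta> \<le> measure \<mu> G" "\<And>U. U \<in> G ==> 6 * tail N ?m x K U \<le> \<epsilon>" by blast
        have "set_pmf (q U) \<subseteq> outcomes N ?m \<and> total_variation (outcomes N ?m) (noisy_prob N ?m x U) (pmf (q U)) \<le> \<epsilon>" if "U \<in> G" for U
        proof -
          have U: "U \<in> unitary_group ?m" using sets.sets_into_space[OF G(1)] that space_haar by auto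
          have "K \<le> N" "x \<le> 1" using x by (auto simp: K_def)
          from sampler_error[OF N1(2) mN(1) this(1) x(1) this(2) U]
          show ?thesis using G(3)[OF that] set_tree_sampler unfolding q_def s_def by (meson order_trans)
        qed
        then show ?thesis using G by blast
      qed
      ultimately show "\<exists>(t :: nat) (q :: complex mat => outcome pmf).
        real t \<le> real N powr (C * (ln (real N) + ln (1 / \<epsilon>) + ln (1 / \<delta>))) \<and>
        (\<forall>U\<in>unitary_group ?m. sampler (boson_program D) N ?m U x \<epsilon> \<delta> t (q U)) \<and>
        (\<forall>\<mu>. haar_measure ?m \<mu> \<longrightarrow>
          (\<exists>G\<in>sets \<mu>. measure \<mu> G \<ge> 1 - \<delta> \<and>
            (\<forall>U\<in>G. set_pmf (q U) \<subseteq> outcomes N ?m \<and>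
              total_variation (outcomes N ?m) (noisy_prob N ?m x U) (pmf (q U)) \<le> \<epsilon>)))"
        unfolding S_def by blast
    qed
  qed
  then show ?thesis by blast
qed

end
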